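(* Let $K$ be a perfect field and $F|K$ an algebraic function field. Then the $K$-uniformizable places of $F|K$ lie dense in the Zariski space of $F|K$ (the space of all $K$-trivial places of $F|K$) with respect to the Zariski patch topology.
   Context: A place of $F|K$ is $K$-trivial if it induces the identity (or an isomorphism) on $K$. The residue of $a\in F$ under a place $P$ is written $aP$ (with $aP=\infty$ if $a$ is not in the valuation ring $\mathcal O_P$). The Zariski patch topology on the Zariski space of $F|K$ has as basic open sets the sets $$\{P\mid P \text{ a place of } F|K \text{ such that } a_1P\ne0,\ldots,a_kP\ne0;\ b_1P=0,\ldots,b_\ell P=0\}$$ with $a_1,\ldots,a_k,b_1,\ldots,b_\ell\in F\setminus\{0\}$. A $K$-trivial place $P$ of $F|K$ is $K$-uniformizable if there is an integral separated $K$-scheme $X$ of finite type with field of rational functions $F$ such that $P$ is centered in a regular point $x\in X$ (i.e. $\mathcal O_P$ dominates $\mathcal O_{X,x}$). *)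

theory Defs
  imports "HOL-Algebra.Generated_Fields" "HOL-Algebra.Generated_Rings" "HOL-Algebra.QuotRing"
    "HOL-Algebra.Ring_Divisibility" "HOL-Computational_Algebra.Primes" "HOL-Analysis.Function_Topology"
begin

text \<open>
  Everything is relative to carriers of \<open>HOL-Algebra\<close> rings. Schemes are locally ringed spaces
  that are locally isomorphic to a spectrum; the spectrum carries the sheaf of functions
  into the localisations that are locally fractions.
\<close>

section \<open>Local rings and regularity\<close>

definition local_ring :: "'a ring \<Rightarrow> bool" where
  "local_ring R \<longleftrightarrow> cring R \<and> (\<exists>!m. maximalideal m R)"

definition max_ideal :: "'a ring \<Rightarrow> 'a set" where
  "max_ideal R = (THE m. maximalideal m R)"

definition prime_chain :: "'a ring \<Rightarrow> nat \<Rightarrow> (nat \<Rightarrow> 'a set) \<Rightarrow> bool" where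
  "prime_chain R n c \<longleftrightarrow> (\<forall>i\<le>n. primeideal (c i) R) \<and> (\<forall>i<n. c i \<subset> c (Suc i))"

definition has_krull_dim :: "'a ring \<Rightarrow> nat \<Rightarrow> bool" where
  "has_krull_dim R n \<longleftrightarrow> (\<exists>c. prime_chain R n c) \<and> \<not> (\<exists>c. prime_chain R (Suc n) c)"

definition regular_local_ring :: "'a ring \<Rightarrow> bool" where
  "regular_local_ring R \<longleftrightarrow> local_ring R \<and> noetherian_ring R \<and>
     (\<exists>S \<subseteq> carrier R. finite S \<and> genideal R S = max_ideal R \<and> has_krull_dim R (card S))"


section \<open>Localisation\<close>

text \<open>A fraction is the equivalence class of its representing pairs. Operations on classes are
  unions over all representatives, which is a union of equal classes.\<close>

definition fraction :: "'a ring \<Rightarrow> 'a set \<Rightarrow> 'a \<Rightarrow> 'a \<Rightarrow> ('a \<times> 'a) set" where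
  "fraction R S a s =
     {(b, t). b \<in> carrier R \<and> t \<in> S \<and>
        (\<exists>u\<in>S. u \<otimes>\<^bsub>R\<^esub> ((t \<otimes>\<^bsub>R\<^esub> a) \<ominus>\<^bsub>R\<^esub> (s \<otimes>\<^bsub>R\<^esub> b)) = \<zero>\<^bsub>R\<^esub>)}"

definition localization :: "'a ring \<Rightarrow> 'a set \<Rightarrow> ('a \<times> 'a) set ring" where
  "localization R S =
     \<lparr> carrier = {fraction R S a s | a s. a \<in> carrier R \<and> s \<in> S},
       monoid.mult = (\<lambda>\<alpha> \<beta>. \<Union>(a, s)\<in>\<alpha>. \<Union>(b, t)\<in>\<beta>. fraction R S (a \<otimes>\<^bsub>R\<^esub> b) (s \<otimes>\<^bsub>R\<^esub> t)),
       one = fraction R S \<one>\<^bsub>R\<^esub> \<one>\<^bsub>R\<^esub>,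
       ring.zero = fraction R S \<zero>\<^bsub>R\<^esub> \<one>\<^bsub>R\<^esub>,
       ring.add = (\<lambda>\<alpha> \<beta>. \<Union>(a, s)\<in>\<alpha>. \<Union>(b, t)\<in>\<beta>.
                fraction R S ((a \<otimes>\<^bsub>R\<^esub> t) \<oplus>\<^bsub>R\<^esub> (b \<otimes>\<^bsub>R\<^esub> s)) (s \<otimes>\<^bsub>R\<^esub> t)) \<rparr>"


section \<open>Ringed spaces\<close>

record ('p, 'a) ringed_space =
  topo :: "'p topology"
  sections :: "'p set \<Rightarrow> 'a ring"
  restr :: "'p set \<Rightarrow> 'p set \<Rightarrow> 'a \<Rightarrow> 'a"

text \<open>The values of \<open>sections\<close> and \<open>restr\<close> matter only on open sets.\<close>

abbreviation pts :: "('p, 'a) ringed_space \<Rightarrow> 'p set" where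
  "pts X \<equiv> topspace (topo X)"

definition is_presheaf :: "('p, 'a) ringed_space \<Rightarrow> bool" where
  "is_presheaf X \<longleftrightarrow>
     (\<forall>U. openin (topo X) U \<longrightarrow> cring (sections X U)) \<and>
     (\<forall>U V. openin (topo X) U \<and> openin (topo X) V \<and> V \<subseteq> U \<longrightarrow>
        restr X U V \<in> ring_hom (sections X U) (sections X V)) \<and>
     (\<forall>U. openin (topo X) U \<longrightarrow> (\<forall>s\<in>carrier (sections X U). restr X U U s = s)) \<and>
     (\<forall>U V W. openin (topo X) U \<and> openin (topo X) V \<and> openin (topo X) W \<and> W \<subseteq> V \<and> V \<subseteq> U \<longrightarrow>
        (\<forall>s\<in>carrier (sections X U). restr X V W (restr X U V s) = restr X U W s))"

text \<open>The empty cover is allowed, so the empty set has exactly one section.\<close>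

definition is_ringed_space :: "('p, 'a) ringed_space \<Rightarrow> bool" where
  "is_ringed_space X \<longleftrightarrow> is_presheaf X \<and>
     (\<forall>\<U>. (\<forall>U\<in>\<U>. openin (topo X) U) \<longrightarrow>
        (\<forall>s\<in>carrier (sections X (\<Union>\<U>)). \<forall>t\<in>carrier (sections X (\<Union>\<U>)).
           (\<forall>U\<in>\<U>. restr X (\<Union>\<U>) U s = restr X (\<Union>\<U>) U t) \<longrightarrow> s = t) \<and>
        (\<forall>s. (\<forall>U\<in>\<U>. s U \<in> carrier (sections X U)) \<and>
             (\<forall>U\<in>\<U>. \<forall>V\<in>\<U>. restr X U (U \<inter> V) (s U) = restr X V (U \<inter> V) (s V)) \<longrightarrow>
             (\<exists>t\<in>carrier (sections X (\<Union>\<U>)). \<forall>U\<in>\<U>. restr X (\<Union>\<U>) U t = s U)))"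

definition germ :: "('p, 'a) ringed_space \<Rightarrow> 'p \<Rightarrow> 'p set \<Rightarrow> 'a \<Rightarrow> ('p set \<times> 'a) set" where
  "germ X x U s =
     {(V, t). openin (topo X) V \<and> x \<in> V \<and> t \<in> carrier (sections X V) \<and>
        (\<exists>W. openin (topo X) W \<and> x \<in> W \<and> W \<subseteq> U \<inter> V \<and> restr X U W s = restr X V W t)}"

definition stalk :: "('p, 'a) ringed_space \<Rightarrow> 'p \<Rightarrow> ('p set \<times> 'a) set ring" where
  "stalk X x =
     \<lparr> carrier = {germ X x U s | U s. openin (topo X) U \<and> x \<in> U \<and> s \<in> carrier (sections X U)},
       monoid.mult = (\<lambda>\<alpha> \<beta>. \<Union>(U, s)\<in>\<alpha>. \<Union>(V, t)\<in>\<beta>.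
         germ X x (U \<inter> V)
           (restr X U (U \<inter> V) s \<otimes>\<^bsub>sections X (U \<inter> V)\<^esub> restr X V (U \<inter> V) t)),
       one = germ X x (pts X) \<one>\<^bsub>sections X (pts X)\<^esub>,
       ring.zero = germ X x (pts X) \<zero>\<^bsub>sections X (pts X)\<^esub>,
       ring.add = (\<lambda>\<alpha> \<beta>. \<Union>(U, s)\<in>\<alpha>. \<Union>(V, t)\<in>\<beta>.
         germ X x (U \<inter> V)
           (restr X U (U \<inter> V) s \<oplus>\<^bsub>sections X (U \<inter> V)\<^esub> restr X V (U \<inter> V) t)) \<rparr>"

text \<open>For a point \<open>y\<close> that specialises to \<open>x\<close>, the canonical map from the stalk at \<open>x\<close>
  to the stalk at \<open>y\<close>.\<close>

definition cospecialization ::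
    "('p, 'a) ringed_space \<Rightarrow> 'p \<Rightarrow> ('p set \<times> 'a) set \<Rightarrow> ('p set \<times> 'a) set" where
  "cospecialization X y \<alpha> = (\<Union>(U, s)\<in>\<alpha>. germ X y U s)"

definition is_locally_ringed_space :: "('p, 'a) ringed_space \<Rightarrow> bool" where
  "is_locally_ringed_space X \<longleftrightarrow> is_ringed_space X \<and> (\<forall>x\<in>pts X. local_ring (stalk X x))"

definition open_subspace :: "('p, 'a) ringed_space \<Rightarrow> 'p set \<Rightarrow> ('p, 'a) ringed_space" where
  "open_subspace X U = X\<lparr>topo := subtopology (topo X) U\<rparr>"

definition ringed_space_isomorphic ::
    "('p, 'a) ringed_space \<Rightarrow> ('q, 'b) ringed_space \<Rightarrow> bool" where
  "ringed_space_isomorphic X Y \<longleftrightarrow>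
     (\<exists>f \<phi>. homeomorphic_map (topo X) (topo Y) f \<and>
        (\<forall>V. openin (topo Y) V \<longrightarrow>
           \<phi> V \<in> ring_iso (sections Y V) (sections X {x \<in> pts X. f x \<in> V})) \<and>
        (\<forall>V W. openin (topo Y) V \<and> openin (topo Y) W \<and> W \<subseteq> V \<longrightarrow>
           (\<forall>s\<in>carrier (sections Y V).
              restr X {x \<in> pts X. f x \<in> V} {x \<in> pts X. f x \<in> W} (\<phi> V s) =
              \<phi> W (restr Y V W s))))"


section \<open>Schemes\<close>

definition primes_of :: "'a ring \<Rightarrow> 'a set set" where
  "primes_of A = {p. primeideal p A}"

definition zariski_topology :: "'a ring \<Rightarrow> 'a set topology" where
  "zariski_topology A = topology_generated_by {{p \<in> primes_of A. f \<notin> p} | f. f \<in> carrier A}"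

abbreviation local_at :: "'a ring \<Rightarrow> 'a set \<Rightarrow> ('a \<times> 'a) set ring" where
  "local_at A p \<equiv> localization A (carrier A - p)"

definition regular_functions ::
    "'a ring \<Rightarrow> 'a set set \<Rightarrow> ('a set \<Rightarrow> ('a \<times> 'a) set) set" where
  "regular_functions A U =
     {s \<in> (\<Pi>\<^sub>E p\<in>U. carrier (local_at A p)).
        \<forall>p\<in>U. \<exists>V a f. openin (zariski_topology A) V \<and> p \<in> V \<and> V \<subseteq> U \<and>
          a \<in> carrier A \<and> f \<in> carrier A \<and>
          (\<forall>q\<in>V. f \<notin> q \<and> s q = fraction A (carrier A - q) a f)}"

definition Spec :: "'a ring \<Rightarrow> ('a set, 'a set \<Rightarrow> ('a \<times> 'a) set) ringed_space" where
  "Spec A =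
     \<lparr> topo = zariski_topology A,
       sections = (\<lambda>U.
         \<lparr> carrier = regular_functions A U,
           monoid.mult = (\<lambda>s t. \<lambda>p\<in>U. s p \<otimes>\<^bsub>local_at A p\<^esub> t p),
           one = (\<lambda>p\<in>U. \<one>\<^bsub>local_at A p\<^esub>),
           ring.zero = (\<lambda>p\<in>U. \<zero>\<^bsub>local_at A p\<^esub>),
           ring.add = (\<lambda>s t. \<lambda>p\<in>U. s p \<oplus>\<^bsub>local_at A p\<^esub> t p) \<rparr>),
       restr = (\<lambda>U V s. restrict s V) \<rparr>"

text \<open>The coordinate ring is isomorphic to the ring of sections over \<open>U\<close>, so it may be taken
  over the same type.\<close>

definition affine_open :: "('p, 'a) ringed_space \<Rightarrow> 'p set \<Rightarrow> bool" where
  "affine_open X U \<longleftrightarrow> openin (topo X) U \<and>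
     (\<exists>A :: 'a ring. cring A \<and> ringed_space_isomorphic (open_subspace X U) (Spec A))"

definition is_scheme :: "('p, 'a) ringed_space \<Rightarrow> bool" where
  "is_scheme X \<longleftrightarrow> is_locally_ringed_space X \<and> (\<forall>x\<in>pts X. \<exists>U. x \<in> U \<and> affine_open X U)"

definition integral_scheme :: "('p, 'a) ringed_space \<Rightarrow> bool" where
  "integral_scheme X \<longleftrightarrow> is_scheme X \<and> pts X \<noteq> {} \<and>
     (\<forall>U. openin (topo X) U \<and> U \<noteq> {} \<longrightarrow> domain (sections X U))"

text \<open>A morphism from \<open>X\<close> to the spectrum of \<open>k\<close> is the same thing as a ring homomorphism
  \<open>\<iota>\<close> from \<open>k\<close> to the global sections.\<close>

definition scheme_over ::
    "('k, 'm) ring_scheme \<Rightarrow> ('p, 'a) ringed_space \<Rightarrow> ('k \<Rightarrow> 'a) \<Rightarrow> bool" where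
  "scheme_over k X \<iota> \<longleftrightarrow> is_scheme X \<and> \<iota> \<in> ring_hom k (sections X (pts X))"

definition finite_type_over ::
    "('k, 'm) ring_scheme \<Rightarrow> ('p, 'a) ringed_space \<Rightarrow> ('k \<Rightarrow> 'a) \<Rightarrow> bool" where
  "finite_type_over k X \<iota> \<longleftrightarrow> scheme_over k X \<iota> \<and>
     (\<exists>\<U>. finite \<U> \<and> \<Union>\<U> = pts X \<and>
        (\<forall>U\<in>\<U>. affine_open X U \<and>
           (\<exists>S \<subseteq> carrier (sections X U). finite S \<and>
              generate_ring (sections X U) ((restr X (pts X) U \<circ> \<iota>) ` carrier k \<union> S) =
              carrier (sections X U))))"

text \<open>The diagonal of \<open>X\<close> over \<open>k\<close> is a closed immersion. Let \<open>\<U>\<close> be an affine open cover of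
  \<open>X\<close>. The self-product of \<open>X\<close> over \<open>k\<close> is covered by the affine open sets \<open>U \<times>\<^sub>k V\<close>, which are the
  spectra of the tensor products over \<open>k\<close> of the rings of sections over \<open>U\<close> and \<open>V\<close>, and
  the preimage of \<open>U \<times>\<^sub>k V\<close> under the diagonal is \<open>U \<inter> V\<close>. A morphism to an affine scheme is a
  closed immersion iff its source is affine and the map of rings is surjective. Here the map is
  from the tensor product to the sections over \<open>U \<inter> V\<close>, and its image is the subring
  generated by the restrictions of sections over \<open>U\<close> and over \<open>V\<close>.\<close>

definition separated_over ::
    "('k, 'm) ring_scheme \<Rightarrow> ('p, 'a) ringed_space \<Rightarrow> ('k \<Rightarrow> 'a) \<Rightarrow> bool" where
  "separated_over k X \<iota> \<longleftrightarrow> scheme_over k X \<iota> \<and>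
     (\<exists>\<U>. \<Union>\<U> = pts X \<and> (\<forall>U\<in>\<U>. affine_open X U) \<and>
        (\<forall>U\<in>\<U>. \<forall>V\<in>\<U>. affine_open X (U \<inter> V) \<and>
           generate_ring (sections X (U \<inter> V))
             (restr X U (U \<inter> V) ` carrier (sections X U) \<union>
              restr X V (U \<inter> V) ` carrier (sections X V)) =
           carrier (sections X (U \<inter> V))))"

definition generic_point :: "('p, 'a) ringed_space \<Rightarrow> 'p \<Rightarrow> bool" where
  "generic_point X \<eta> \<longleftrightarrow> \<eta> \<in> pts X \<and> topo X closure_of {\<eta>} = pts X"

text \<open>\<open>\<phi>\<close> is an isomorphism of extensions of \<open>k\<close> from the function field of \<open>X\<close> to \<open>F\<close>;
  here \<open>k\<close> is a subring of \<open>F\<close>.\<close>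

definition function_field_iso ::
    "'f ring \<Rightarrow> 'f set \<Rightarrow> ('p, 'a) ringed_space \<Rightarrow> ('f \<Rightarrow> 'a) \<Rightarrow> 'p \<Rightarrow>
     (('p set \<times> 'a) set \<Rightarrow> 'f) \<Rightarrow> bool" where
  "function_field_iso F K X \<iota> \<eta> \<phi> \<longleftrightarrow> generic_point X \<eta> \<and> \<phi> \<in> ring_iso (stalk X \<eta>) F \<and>
     (\<forall>c\<in>K. \<phi> (germ X \<eta> (pts X) (\<iota> c)) = c)"


section \<open>Function fields and places\<close>

definition perfect_field :: "('a, 'm) ring_scheme \<Rightarrow> bool" where
  "perfect_field k \<longleftrightarrow> field k \<and>
     (\<forall>p::nat. normalization_semidom_class.prime p \<and> [p] \<cdot>\<^bsub>k\<^esub> \<one>\<^bsub>k\<^esub> = \<zero>\<^bsub>k\<^esub> \<longrightarrow>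
        (\<forall>a\<in>carrier k. \<exists>b\<in>carrier k. b [^]\<^bsub>k\<^esub> p = a))"

definition algebraic_function_field :: "'a ring \<Rightarrow> 'a set \<Rightarrow> bool" where
  "algebraic_function_field F K \<longleftrightarrow> field F \<and> subfield K F \<and>
     (\<exists>S \<subseteq> carrier F. finite S \<and> generate_field F (K \<union> S) = carrier F)"

text \<open>The value \<open>None\<close> of \<open>residue\<close> is the value \<open>\<infinity>\<close> of a place.\<close>

record ('a, 'b) place =
  residue_field :: "'b ring"
  residue :: "'a \<Rightarrow> 'b option"

definition valuation_ring :: "'a ring \<Rightarrow> ('a, 'b) place \<Rightarrow> 'a set" where
  "valuation_ring F P = {a \<in> carrier F. residue P a \<noteq> None}"

definition valuation_ideal :: "'a ring \<Rightarrow> ('a, 'b) place \<Rightarrow> 'a set" where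
  "valuation_ideal F P = {a \<in> carrier F. residue P a = Some \<zero>\<^bsub>residue_field P\<^esub>}"

definition is_place :: "'a ring \<Rightarrow> ('a, 'b) place \<Rightarrow> bool" where
  "is_place F P \<longleftrightarrow> field (residue_field P) \<and>
     subring (valuation_ring F P) F \<and>
     (\<lambda>a. the (residue P a)) \<in> ring_hom (F\<lparr>carrier := valuation_ring F P\<rparr>) (residue_field P) \<and>
     (\<lambda>a. the (residue P a)) ` valuation_ring F P = carrier (residue_field P) \<and>
     (\<forall>a\<in>carrier F - valuation_ring F P. inv\<^bsub>F\<^esub> a \<in> valuation_ideal F P)"

definition trivial_on :: "'a ring \<Rightarrow> 'a set \<Rightarrow> ('a, 'b) place \<Rightarrow> bool" where
  "trivial_on F K P \<longleftrightarrow> K \<subseteq> valuation_ring F P \<and> inj_on (residue P) K"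

text \<open>Residue fields live on the type \<open>'a set\<close>, which has room for the residue classes modulo
  the valuation ideal, so every equivalence class of places is represented.
  Equivalent places belong to the same patches, so keeping all representatives does not affect
  density.\<close>

definition zariski_space :: "'a ring \<Rightarrow> 'a set \<Rightarrow> ('a, 'a set) place set" where
  "zariski_space F K = {P. is_place F P \<and> trivial_on F K P}"

definition patch :: "'a ring \<Rightarrow> 'a set \<Rightarrow> 'a set \<Rightarrow> 'a set \<Rightarrow> ('a, 'a set) place set" where
  "patch F K A B =
     {P \<in> zariski_space F K.
        (\<forall>a\<in>A. residue P a \<noteq> Some \<zero>\<^bsub>residue_field P\<^esub>) \<and>
        (\<forall>b\<in>B. residue P b = Some \<zero>\<^bsub>residue_field P\<^esub>)}"

definition patch_topology :: "'a ring \<Rightarrow> 'a set \<Rightarrow> ('a, 'a set) place topology" where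
  "patch_topology F K = topology_generated_by
     {patch F K A B | A B. finite A \<and> finite B \<and>
        A \<subseteq> carrier F - {\<zero>\<^bsub>F\<^esub>} \<and> B \<subseteq> carrier F - {\<zero>\<^bsub>F\<^esub>}}"

lemma topspace_patch_topology: "topspace (patch_topology F K) = zariski_space F K"
proof -
  have "patch F K {} {} = zariski_space F K"
    by (auto simp: patch_def)
  moreover have "patch F K A B \<subseteq> zariski_space F K" for A B
    by (auto simp: patch_def)
  ultimately show ?thesis
    unfolding patch_topology_def topology_generated_by_topspace by blast
qed

text \<open>The valuation ring of \<open>P\<close> dominates the local ring at \<open>x\<close>, which is mapped to \<open>F\<close> through
  the function field: it contains the image, and its maximal ideal meets the image in the image of
  the maximal ideal.\<close>

definition centered_at ::
    "'f ring \<Rightarrow> ('f, 'b) place \<Rightarrow> ('p, 'a) ringed_space \<Rightarrow> 'p \<Rightarrow>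
     (('p set \<times> 'a) set \<Rightarrow> 'f) \<Rightarrow> 'p \<Rightarrow> bool" where
  "centered_at F P X \<eta> \<phi> x \<longleftrightarrow> x \<in> pts X \<and>
     (\<forall>\<alpha>\<in>carrier (stalk X x).
        \<phi> (cospecialization X \<eta> \<alpha>) \<in> valuation_ring F P \<and>
        (\<phi> (cospecialization X \<eta> \<alpha>) \<in> valuation_ideal F P \<longleftrightarrow> \<alpha> \<in> max_ideal (stalk X x)))"

text \<open>An integral separated scheme with function field \<open>F\<close> has, up to isomorphism, sections in
  \<open>F\<close>, and a point of it is determined by its local ring as a subset of \<open>F\<close>. Hence the types
  chosen for \<open>X\<close> are no restriction.\<close>

definition uniformizable :: "'a ring \<Rightarrow> 'a set \<Rightarrow> ('a, 'b) place \<Rightarrow> bool" where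
  "uniformizable F K P \<longleftrightarrow>
     (\<exists>(X :: ('a set, 'a) ringed_space) \<iota> \<eta> \<phi> x.
        integral_scheme X \<and>
        separated_over (F\<lparr>carrier := K\<rparr>) X \<iota> \<and>
        finite_type_over (F\<lparr>carrier := K\<rparr>) X \<iota> \<and>
        function_field_iso F K X \<iota> \<eta> \<phi> \<and>
        centered_at F P X \<eta> \<phi> x \<and>
        regular_local_ring (stalk X x))"

end

theory Submission
  imports Defs "HOL-Algebra.Finite_Extensions"
begin

text \<open>
  Every nonempty basic patch contains a uniformizable place. Let \<open>P\<close> be a place in the patch given
  by \<open>a\<^sub>1, \<dots>, a\<^sub>k\<close> and \<open>b\<^sub>1, \<dots>, b\<^sub>l\<close>. If there are no \<open>b\<^sub>j\<close>, the trivial place belongs to the patch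
  and is centered in the generic point of any affine model.

  Otherwise let \<open>b\<close> be the \<open>b\<^sub>j\<close> of least value. Only the conditions that all \<open>1 / a\<^sub>i\<close> and
  \<open>b\<^sub>j / b\<close> lie in the valuation ring and that \<open>b\<close> is a nonunit there have to be preserved.
  Noether normalization inside the valuation ring of \<open>P\<close> gives elements over which these quotients, and
  generators of \<open>F\<close> or their inverses, are integral. The constant coefficient \<open>t\<close> of the minimal
  polynomial of \<open>b\<close> over the field they generate is not a unit, and by an exchange argument it may
  take the place of one of them, so that the elements are integral over \<open>k[t]\<close> for a purely
  transcendental extension \<open>k\<close> of \<open>K\<close> over which \<open>t\<close> is transcendental. A valuation ring that
  contains \<open>k[t]\<close> and has \<open>b\<close> as a nonunit exists, since otherwise \<open>1 / b\<close>, and with it \<open>1 / t\<close>, would be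
  integral over \<open>k[t]\<close>. The integral closure of \<open>k[t]\<close> is a finite \<open>k[t]\<close>-module, hence the valuation
  ring is discrete and is a localization of a finitely generated \<open>K\<close>-algebra. So the place is centered
  in a regular point of codimension one.
\<close>

text \<open>The given valuation may have any rank and any value group, so its center on a model need
  not be regular. The way out is to enlarge the field of constants from K to a field k over which F
  has transcendence degree one: a valuation ring between k and F is F or discrete, and a discrete
  valuation ring is regular without any resolution of singularities. The element b need not lie in
  the rational function field of the Noether generators, but the constant coefficient t does, and in
  every valuation ring containing these generators t is a nonunit if b is. Since b dictates t, the
  extension of k(t) by F may be inseparable, and the trace form does not yield finiteness of the
  integral closure. A count of poles at t = infinity takes its place: functions of bounded pole
  order form finite-dimensional spaces over k. The return from k to K costs only denominators in
  K[xs], where xs are the Noether generators that remain, and these denominators are units at the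
  new place.\<close>

lemmas (in cring) rsimp = a_minus_def l_distr r_distr l_minus r_minus minus_add minus_minus
  a_ac m_ac r_neg l_neg r_neg1 r_neg2 l_null r_null l_zero r_zero

section \<open>Polynomial expressions and integrality\<close>

context field
begin

text \<open>Coefficients are listed with the constant term first.\<close>

primrec horner :: "'a list \<Rightarrow> 'a \<Rightarrow> 'a" where
  "horner [] z = \<zero>"
| "horner (a # l) z = a \<oplus> z \<otimes> horner l z"

text \<open>The values at \<open>z\<close> of polynomials given by \<open>n\<close> coefficients
  from \<open>A\<close>. As \<open>A\<close> may be any set, an ideal can supply the coefficients,
  and \<open>z [^] n \<in> poly_span A z n\<close> expresses a monic equation of degree
  \<open>n\<close> for \<open>z\<close> over \<open>A\<close>.\<close>

primrec poly_span :: "'a set \<Rightarrow> 'a \<Rightarrow> nat \<Rightarrow> 'a set" where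
  "poly_span A z 0 = {\<zero>}"
| "poly_span A z (Suc n) = {a \<oplus> z \<otimes> u | a u. a \<in> A \<and> u \<in> poly_span A z n}"

text \<open>Negation is left out, so that subrings, sets of multiples, sets of nonunits and spaces
  of functions with bounded poles can be treated alike with little to check.\<close>

definition add_closed :: "'a set \<Rightarrow> bool" where
  "add_closed A \<longleftrightarrow> A \<subseteq> carrier R \<and> \<zero> \<in> A \<and> (\<forall>a\<in>A. \<forall>b\<in>A. a \<oplus> b \<in> A)"

lemma add_closedD:
  assumes "add_closed A"
  shows "a \<in> A \<Longrightarrow> a \<in> carrier R" "\<zero> \<in> A" "a \<in> A \<Longrightarrow> b \<in> A \<Longrightarrow> a \<oplus> b \<in> A"
  using assms by (auto simp: add_closed_def)

lemma subring_add_closed: "subring A R \<Longrightarrow> add_closed A"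
  by (simp add: add_closed_def subringE)

lemma subring_minus: "subring A R \<Longrightarrow> a \<in> A \<Longrightarrow> b \<in> A \<Longrightarrow> a \<ominus> b \<in> A"
  by (simp add: a_minus_def subringE)

lemma subring_pow: "subring A R \<Longrightarrow> a \<in> A \<Longrightarrow> a [^] (n::nat) \<in> A"
  by (induction n) (auto simp: subringE)

lemma inv_carrier [simp]: "a \<in> carrier R \<Longrightarrow> a \<noteq> \<zero> \<Longrightarrow> inv a \<in> carrier R"
  by (simp add: field_Units)

lemma inv_mult [simp]: "a \<in> carrier R \<Longrightarrow> a \<noteq> \<zero> \<Longrightarrow> a \<otimes> inv a = \<one>"
  "a \<in> carrier R \<Longrightarrow> a \<noteq> \<zero> \<Longrightarrow> inv a \<otimes> a = \<one>"
  by (simp_all add: field_Units)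

lemma inv_nonzero [simp]: "a \<in> carrier R \<Longrightarrow> a \<noteq> \<zero> \<Longrightarrow> inv a \<noteq> \<zero>"
  by (metis inv_mult(1) one_not_zero r_null)

lemma inv_eqI: "a \<in> carrier R \<Longrightarrow> b \<in> carrier R \<Longrightarrow> a \<otimes> b = \<one> \<Longrightarrow> inv a = b"
  by (rule comm_inv_char)

lemma inv_inv_field [simp]: "a \<in> carrier R \<Longrightarrow> a \<noteq> \<zero> \<Longrightarrow> inv (inv a) = a"
  by (rule inv_eqI) simp_all

lemma inv_prod: "a \<in> carrier R \<Longrightarrow> b \<in> carrier R \<Longrightarrow> a \<noteq> \<zero> \<Longrightarrow> b \<noteq> \<zero> \<Longrightarrow> inv (a \<otimes> b) = inv a \<otimes> inv b"
  by (rule inv_eqI) (auto simp: m_ac)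

lemma mult_inv_cancel [simp]:
  "a \<in> carrier R \<Longrightarrow> a \<noteq> \<zero> \<Longrightarrow> x \<in> carrier R \<Longrightarrow> a \<otimes> (inv a \<otimes> x) = x"
  "a \<in> carrier R \<Longrightarrow> a \<noteq> \<zero> \<Longrightarrow> x \<in> carrier R \<Longrightarrow> inv a \<otimes> (a \<otimes> x) = x"
  by (simp_all add: m_assoc[symmetric])

lemma pow_nonzero [simp]: "a \<in> carrier R \<Longrightarrow> a \<noteq> \<zero> \<Longrightarrow> a [^] (n::nat) \<noteq> \<zero>"
  by (induction n) (auto simp: integral_iff)

lemma pow_inv: "a \<in> carrier R \<Longrightarrow> a \<noteq> \<zero> \<Longrightarrow> inv a [^] (n::nat) = inv (a [^] n)"
  by (induction n) (simp_all add: inv_prod)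

lemma pow_mult_inv [simp]:
  "a \<in> carrier R \<Longrightarrow> a \<noteq> \<zero> \<Longrightarrow> a [^] n \<otimes> inv a [^] (n::nat) = \<one>"
  "a \<in> carrier R \<Longrightarrow> a \<noteq> \<zero> \<Longrightarrow> inv a [^] n \<otimes> a [^] (n::nat) = \<one>"
  by (simp_all add: pow_inv)

lemma horner_carrier [simp]: "set l \<subseteq> carrier R \<Longrightarrow> z \<in> carrier R \<Longrightarrow> horner l z \<in> carrier R"
  by (induction l) auto

lemma poly_span_SucI: "a \<in> A \<Longrightarrow> u \<in> poly_span A z n \<Longrightarrow> a \<oplus> z \<otimes> u \<in> poly_span A z (Suc n)"
  by auto

lemma poly_span_SucE:
  assumes "w \<in> poly_span A z (Suc n)"
  obtains a u where "a \<in> A" "u \<in> poly_span A z n" "w = a \<oplus> z \<otimes> u"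
  using assms by auto

declare poly_span.simps(2) [simp del]

lemma poly_span_eq_horner: "poly_span A z n = {horner l z | l. set l \<subseteq> A \<and> length l = n}"
proof (induction n)
  case (Suc n)
  have "u \<in> poly_span A z (Suc n) \<longleftrightarrow> (\<exists>a l. a \<in> A \<and> set l \<subseteq> A \<and> length l = n \<and> u = horner (a # l) z)" for u
    using Suc by (auto simp: poly_span.simps(2))
  moreover have "(\<exists>a l. a \<in> A \<and> set l \<subseteq> A \<and> length l = n \<and> u = horner (a # l) z) \<longleftrightarrow>
      (\<exists>l. u = horner l z \<and> set l \<subseteq> A \<and> length l = Suc n)" for u
    by (force simp: length_Suc_conv simp del: horner.simps)
  ultimately show ?case by blast
qed auto

lemma horner_in_poly_span: "set l \<subseteq> A \<Longrightarrow> horner l z \<in> poly_span A z (length l)"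
  by (auto simp: poly_span_eq_horner)

lemma horner_append:
  "set l \<subseteq> carrier R \<Longrightarrow> set m \<subseteq> carrier R \<Longrightarrow> z \<in> carrier R \<Longrightarrow>
   horner (l @ m) z = horner l z \<oplus> z [^] length l \<otimes> horner m z"
  by (induction l) (auto simp: rsimp)

lemma poly_span_carrier:
  "A \<subseteq> carrier R \<Longrightarrow> z \<in> carrier R \<Longrightarrow> u \<in> poly_span A z n \<Longrightarrow> u \<in> carrier R"
  by (auto simp: poly_span_eq_horner)

lemma poly_span_coeff_mono: "A \<subseteq> B \<Longrightarrow> poly_span A z n \<subseteq> poly_span B z n"
  by (auto simp: poly_span_eq_horner)

lemma poly_span_zero: "add_closed A \<Longrightarrow> z \<in> carrier R \<Longrightarrow> \<zero> \<in> poly_span A z n"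
proof (induction n)
  case (Suc n)
  then have "\<zero> = \<zero> \<oplus> z \<otimes> \<zero>" "\<zero> \<in> A" by (auto simp: add_closedD)
  then show ?case using poly_span_SucI[of \<zero> A \<zero> z n] Suc by simp
qed simp

lemma poly_span_Suc_mono: "add_closed A \<Longrightarrow> z \<in> carrier R \<Longrightarrow> u \<in> poly_span A z n \<Longrightarrow> u \<in> poly_span A z (Suc n)"
proof (induction n arbitrary: u)
  case 0
  then show ?case using poly_span_zero[of A z "Suc 0"] by simp
next
  case (Suc n)
  then show ?case by (auto elim!: poly_span_SucE[of u A z n] intro!: poly_span_SucI)
qed

lemma poly_span_mono:
  assumes "add_closed A" "z \<in> carrier R" "n \<le> m" "u \<in> poly_span A z n"
  shows "u \<in> poly_span A z m"
  using assms(3,4) by (induction m rule: dec_induct) (auto intro: poly_span_Suc_mono assms)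

lemma poly_span_add:
  assumes A: "add_closed A" and z: "z \<in> carrier R"
  shows "u \<in> poly_span A z n \<Longrightarrow> v \<in> poly_span A z n \<Longrightarrow> u \<oplus> v \<in> poly_span A z n"
proof (induction n arbitrary: u v)
  case (Suc n)
  then obtain a u' b v' where *: "a \<in> A" "b \<in> A" "u' \<in> poly_span A z n" "v' \<in> poly_span A z n"
    "u = a \<oplus> z \<otimes> u'" "v = b \<oplus> z \<otimes> v'" by (auto elim!: poly_span_SucE)
  have c: "u' \<in> carrier R" "v' \<in> carrier R" "a \<in> carrier R" "b \<in> carrier R"
    using * A poly_span_carrier[OF _ z *(3)] poly_span_carrier[OF _ z *(4)] by (auto simp: add_closed_def)
  have "u \<oplus> v = (a \<oplus> b) \<oplus> z \<otimes> (u' \<oplus> v')"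
    using c z * by (simp add: rsimp)
  moreover have "a \<oplus> b \<in> A" using * A by (auto simp: add_closedD)
  ultimately show ?case using poly_span_SucI[OF _ Suc.IH[OF *(3,4)]] by simp
qed simp

lemma poly_span_smult:
  assumes "A \<subseteq> carrier R" "c \<in> carrier R" "z \<in> carrier R" "\<And>a. a \<in> A \<Longrightarrow> c \<otimes> a \<in> B"
  shows "u \<in> poly_span A z n \<Longrightarrow> c \<otimes> u \<in> poly_span B z n"
proof (induction n arbitrary: u)
  case 0
  then show ?case using assms by auto
next
  case (Suc n)
  then obtain a u' where *: "a \<in> A" "u' \<in> poly_span A z n" "u = a \<oplus> z \<otimes> u'" by (auto elim: poly_span_SucE)
  have c: "u' \<in> carrier R" "a \<in> carrier R"
    using * assms(1) poly_span_carrier[OF assms(1,3) *(2)] by auto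
  have "c \<otimes> u = c \<otimes> a \<oplus> z \<otimes> (c \<otimes> u')"
    using c assms * by (simp add: rsimp)
  then show ?case using poly_span_SucI[OF assms(4)[OF *(1)] Suc.IH[OF *(2)]] by simp
qed

lemma poly_span_shift:
  assumes "add_closed A" "z \<in> carrier R" "u \<in> poly_span A z n"
  shows "z [^] k \<otimes> u \<in> poly_span A z (n + k)"
proof (induction k)
  case 0
  then show ?case using assms poly_span_carrier[of A z u n] by (simp add: add_closed_def)
next
  case (Suc k)
  have u: "u \<in> carrier R" using assms poly_span_carrier[of A z u n] by (simp add: add_closed_def)
  have "z [^] Suc k \<otimes> u = \<zero> \<oplus> z \<otimes> (z [^] k \<otimes> u)"
    using u assms(2) by (simp add: rsimp)
  then show ?case using poly_span_SucI[OF _ Suc.IH, of \<zero>] assms(1) by (simp add: add_closedD)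
qed

lemma poly_span_const: "add_closed A \<Longrightarrow> z \<in> carrier R \<Longrightarrow> a \<in> A \<Longrightarrow> a \<in> poly_span A z (Suc n)"
proof -
  assume *: "add_closed A" "z \<in> carrier R" "a \<in> A"
  then have "a = a \<oplus> z \<otimes> \<zero>" by (auto simp: add_closedD)
  then show ?thesis using * poly_span_SucI[of a A \<zero> z n] poly_span_zero[of A z n] by simp
qed

lemma poly_span_monom:
  assumes "add_closed A" "z \<in> carrier R" "a \<in> A"
  shows "z [^] k \<otimes> a \<in> poly_span A z (Suc k)"
  using poly_span_shift[OF assms(1,2) poly_span_const[OF assms, of 0], of k] by simp

lemma poly_span_top:
  assumes A: "A \<subseteq> carrier R" and z: "z \<in> carrier R"
  shows "u \<in> poly_span A z (Suc n) \<Longrightarrow> \<exists>v\<in>poly_span A z n. \<exists>a\<in>A. u = v \<oplus> z [^] n \<otimes> a"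
proof (induction n arbitrary: u)
  case 0
  then obtain a where "a \<in> A" "u = a \<oplus> z \<otimes> \<zero>" by (auto elim: poly_span_SucE)
  then show ?case using A z by (intro bexI[of _ \<zero>] bexI[of _ a]) auto
next
  case (Suc n)
  from Suc.prems obtain a u' where *: "a \<in> A" "u' \<in> poly_span A z (Suc n)" "u = a \<oplus> z \<otimes> u'"
    by (meson poly_span_SucE)
  from Suc.IH[OF *(2)] obtain v b where vb: "v \<in> poly_span A z n" "b \<in> A" "u' = v \<oplus> z [^] n \<otimes> b" by blast
  have c: "a \<in> carrier R" "b \<in> carrier R" "v \<in> carrier R" using * vb A poly_span_carrier[OF A z vb(1)] by auto
  have "u = (a \<oplus> z \<otimes> v) \<oplus> z [^] Suc n \<otimes> b" using c z * vb by (simp add: rsimp)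
  moreover have "a \<oplus> z \<otimes> v \<in> poly_span A z (Suc n)" using * vb by (auto intro: poly_span_SucI)
  ultimately show ?case using vb by blast
qed

text \<open>The last argument of \<open>poly_span\<close> counts coefficients, not degrees: factors
  with \<open>n\<close> and \<open>m + 1\<close> coefficients have a product with
  \<open>n + m\<close> of them.\<close>

lemma poly_span_mult:
  assumes C: "add_closed C" and A: "A \<subseteq> carrier R" and B: "B \<subseteq> carrier R" and z: "z \<in> carrier R"
    and AB: "\<And>a b. a \<in> A \<Longrightarrow> b \<in> B \<Longrightarrow> a \<otimes> b \<in> C"
  shows "u \<in> poly_span A z n \<Longrightarrow> v \<in> poly_span B z (Suc m) \<Longrightarrow> u \<otimes> v \<in> poly_span C z (n + m)"
proof (induction n arbitrary: u)
  case 0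
  then show ?case using poly_span_carrier[OF B z 0(2)] poly_span_zero[OF C z] by simp
next
  case (Suc n)
  then obtain a u' where *: "a \<in> A" "u' \<in> poly_span A z n" "u = a \<oplus> z \<otimes> u'" by (auto elim: poly_span_SucE)
  have c: "a \<in> carrier R" "u' \<in> carrier R" "v \<in> carrier R"
    using * A poly_span_carrier[OF A z *(2)] poly_span_carrier[OF B z Suc.prems(2)] by auto
  have "a \<otimes> v \<in> poly_span C z (Suc m)"
    using poly_span_smult[OF B c(1) z _ Suc.prems(2)] AB * by blast
  then have 1: "a \<otimes> v \<in> poly_span C z (Suc n + m)"
    using poly_span_mono[OF C z, of "Suc m" "Suc n + m"] by simp
  have 2: "z [^] (1::nat) \<otimes> (u' \<otimes> v) \<in> poly_span C z (n + m + 1)"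
    by (rule poly_span_shift[OF C z Suc.IH[OF *(2) Suc.prems(2)]])
  have "u \<otimes> v = a \<otimes> v \<oplus> z [^] (1::nat) \<otimes> (u' \<otimes> v)" using c z * by (simp add: rsimp)
  then show ?case using poly_span_add[OF C z 1] 2 by simp
qed

text \<open>Multiplication by \<open>z [^] n\<close> reverses the coefficients of a polynomial in
  \<open>inv z\<close>. This is the passage between the cases \<open>z \<in> V\<close> and
  \<open>inv z \<in> V\<close> for a valuation ring \<open>V\<close>.\<close>

lemma poly_span_reverse:
  assumes A: "add_closed A" and z: "z \<in> carrier R" "z \<noteq> \<zero>"
  shows "u \<in> poly_span A (inv z) (Suc n) \<Longrightarrow> z [^] n \<otimes> u \<in> poly_span A z (Suc n)"
proof (induction n arbitrary: u)
  case 0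
  then obtain a where "a \<in> A" "u = a \<oplus> inv z \<otimes> \<zero>" by (auto elim: poly_span_SucE)
  then have "z [^] (0::nat) \<otimes> u = a" "a \<in> A" using A z by (auto simp: add_closedD)
  then show ?case using poly_span_const[OF A z(1)] by simp
next
  case (Suc n)
  from Suc.prems obtain a u' where *: "a \<in> A" "u' \<in> poly_span A (inv z) (Suc n)" "u = a \<oplus> inv z \<otimes> u'"
    by (meson poly_span_SucE)
  have c: "a \<in> carrier R" "u' \<in> carrier R"
    using * A poly_span_carrier[OF _ inv_carrier[OF z] *(2)] by (auto simp: add_closed_def)
  have "z [^] Suc n \<otimes> u = z [^] Suc n \<otimes> a \<oplus> z [^] Suc n \<otimes> (inv z \<otimes> u')"
    unfolding *(3) by (rule r_distr) (use c z in auto)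
  also have "z [^] Suc n \<otimes> (inv z \<otimes> u') = z [^] n \<otimes> (z \<otimes> (inv z \<otimes> u'))"
    using c z by (simp add: m_assoc del: mult_inv_cancel)
  also have "\<dots> = z [^] n \<otimes> u'" using c z by simp
  finally show ?case
    using poly_span_add[OF A z(1) poly_span_monom[OF A z(1) *(1), of "Suc n"]
        poly_span_Suc_mono[OF A z(1) Suc.IH[OF *(2)]]] by simp
qed

lemma poly_span_subset:
  assumes "subring B R" "A \<subseteq> B" "z \<in> B"
  shows "u \<in> poly_span A z n \<Longrightarrow> u \<in> B"
  by (induction n arbitrary: u) (use assms subringE[OF assms(1)] in \<open>auto elim!: poly_span_SucE\<close>)

lemma poly_span_subring_minus:
  assumes "subring A R" "z \<in> carrier R" "u \<in> poly_span A z n"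
  shows "\<ominus> u \<in> poly_span A z n"
proof -
  have c: "u \<in> carrier R" "\<ominus> \<one> \<in> A" "A \<subseteq> carrier R"
    using assms poly_span_carrier[of A z u n] subringE[OF assms(1)] by auto
  have "(\<ominus> \<one>) \<otimes> u \<in> poly_span A z n"
    by (rule poly_span_smult[OF c(3) _ assms(2) _ assms(3)]) (use c subringE[OF assms(1)] in auto)
  then show ?thesis using c by (simp add: l_minus)
qed

lemma simple_extension_iff_poly_span:
  assumes "subring A R" "z \<in> carrier R"
  shows "u \<in> simple_extension A z \<longleftrightarrow> (\<exists>n. u \<in> poly_span A z n)"
proof
  assume "u \<in> simple_extension A z"
  then show "\<exists>n. u \<in> poly_span A z n"
  proof induction
    case zero
    show ?case by (auto intro: exI[of _ 0])
  next
    case (lin k1 k2)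
    then obtain n where n: "k1 \<in> poly_span A z n" by blast
    have c: "k1 \<in> carrier R" "k2 \<in> carrier R"
      using n lin assms poly_span_carrier subringE(1) by blast+
    have "k1 \<otimes> z \<oplus> k2 = k2 \<oplus> z \<otimes> k1" using c assms by (simp add: a_ac m_ac)
    then have "k1 \<otimes> z \<oplus> k2 \<in> poly_span A z (Suc n)" using n lin by (auto intro: poly_span_SucI)
    then show ?case by blast
  qed
next
  assume "\<exists>n. u \<in> poly_span A z n"
  then obtain n where "u \<in> poly_span A z n" by blast
  then show "u \<in> simple_extension A z"
  proof (induction n arbitrary: u)
    case (Suc n)
    then obtain a u' where *: "a \<in> A" "u' \<in> poly_span A z n" "u = a \<oplus> z \<otimes> u'" by (auto elim: poly_span_SucE)
    have c: "u' \<in> carrier R" "a \<in> carrier R" using * assms poly_span_carrier subringE(1) by blast+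
    have "u = u' \<otimes> z \<oplus> a" using c assms * by (simp add: a_ac m_ac)
    then show ?case using simple_extension.lin[OF Suc.IH[OF *(2)] *(1)] by simp
  qed (simp add: simple_extension.zero)
qed

section \<open>Valuation subrings\<close>

definition valuation_subring :: "'a set \<Rightarrow> bool" where
  "valuation_subring V \<longleftrightarrow> subring V R \<and> (\<forall>z\<in>carrier R. z \<notin> V \<longrightarrow> inv z \<in> V)"

text \<open>Zero is listed separately because \<open>inv \<zero>\<close> has no specified
  value.\<close>

definition nonunits :: "'a set \<Rightarrow> 'a set" where
  "nonunits V = {z \<in> V. z = \<zero> \<or> inv z \<notin> V}"

text \<open>The integral closure of \<open>A\<close> in the field, described by valuation rings
  instead of monic equations. In this form it is visibly a subring and a closure operator; the
  agreement with monic equations is \<open>int_closure_iff_monic\<close>.\<close>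

definition int_closure :: "'a set \<Rightarrow> 'a set" where
  "int_closure A = {z \<in> carrier R. \<forall>V. valuation_subring V \<and> A \<subseteq> V \<longrightarrow> z \<in> V}"

lemma valuation_subring_subring: "valuation_subring V \<Longrightarrow> subring V R"
  by (simp add: valuation_subring_def)

lemma valuation_subringD: "valuation_subring V \<Longrightarrow> z \<in> carrier R \<Longrightarrow> z \<notin> V \<Longrightarrow> inv z \<in> nonunits V \<and> z \<noteq> \<zero>"
  unfolding valuation_subring_def nonunits_def
  using subringE(2) by (metis (mono_tags, lifting) inv_inv_field mem_Collect_eq)

lemma nonunits_subset: "nonunits V \<subseteq> V"
  by (auto simp: nonunits_def)

lemma nonunits_smult:
  assumes "subring V R" "a \<in> V" "x \<in> nonunits V"
  shows "a \<otimes> x \<in> nonunits V"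
proof -
  note V = subringE[OF assms(1)]
  have xV: "x \<in> V" "x = \<zero> \<or> inv x \<notin> V" using assms(3) by (auto simp: nonunits_def)
  have c: "a \<in> carrier R" "x \<in> carrier R" using assms(2) xV V(1) by auto
  have "inv (a \<otimes> x) \<notin> V" if "a \<otimes> x \<noteq> \<zero>"
  proof
    assume "inv (a \<otimes> x) \<in> V"
    moreover have n: "a \<noteq> \<zero>" "x \<noteq> \<zero>" using that c by auto
    ultimately have "inv a \<otimes> inv x \<in> V" using c by (simp add: inv_prod)
    from V(6)[OF assms(2) this] have "inv x \<in> V" using n c by simp
    then show False using xV n by simp
  qed
  then show ?thesis using V(6)[OF assms(2) xV(1)] by (auto simp: nonunits_def)
qed

text \<open>One of the two quotients lies in \<open>V\<close>, say \<open>x / y\<close>, and then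
  \<open>x + y = (x / y + 1) y\<close>.\<close>

lemma nonunits_add:
  assumes V: "valuation_subring V" and x: "x \<in> nonunits V" and y: "y \<in> nonunits V"
  shows "x \<oplus> y \<in> nonunits V"
proof -
  have S: "subring V R" using V by (rule valuation_subring_subring)
  note S' = subringE[OF S]
  have c: "u \<in> carrier R" if "u \<in> nonunits V" for u
    using that S'(1) by (auto simp: nonunits_def)
  have main: "u \<oplus> w \<in> nonunits V"
    if "u \<in> nonunits V" "w \<in> nonunits V" "w \<noteq> \<zero>" "u \<otimes> inv w \<in> V" for u w
  proof -
    have "u \<oplus> w = (u \<otimes> inv w \<oplus> \<one>) \<otimes> w"
      using c[OF that(1)] c[OF that(2)] that(3) by (simp add: l_distr m_assoc)
    moreover have "u \<otimes> inv w \<oplus> \<one> \<in> V" using S'(7)[OF that(4) S'(3)] .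
    ultimately show ?thesis using nonunits_smult[OF S _ that(2)] by simp
  qed
  note c = c[OF x] c[OF y]
  consider "x = \<zero>" | "y = \<zero>" | "x \<noteq> \<zero>" "y \<noteq> \<zero>" "x \<otimes> inv y \<in> V"
    | "x \<noteq> \<zero>" "y \<noteq> \<zero>" "x \<otimes> inv y \<notin> V" by blast
  then show ?thesis
  proof cases
    case 4
    then have "inv (x \<otimes> inv y) \<in> V" using V c by (auto simp: valuation_subring_def)
    moreover have "inv (x \<otimes> inv y) = y \<otimes> inv x" using c 4 by (simp add: inv_prod m_comm)
    ultimately show ?thesis using main[OF y x 4(1)] c by (simp add: a_comm)
  qed (use x y c main[OF x y] in auto)
qed

lemma nonunits_zero: "subring V R \<Longrightarrow> \<zero> \<in> nonunits V"
  by (simp add: nonunits_def subringE)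

lemma nonunits_add_closed: "valuation_subring V \<Longrightarrow> add_closed (nonunits V)"
  unfolding add_closed_def
  using nonunits_zero nonunits_add nonunits_subset subringE(1)[OF valuation_subring_subring] valuation_subring_subring by blast

lemma one_not_nonunit: "\<one> \<notin> nonunits V"
  by (auto simp: nonunits_def)

lemma unit_diff_nonunit:
  assumes "valuation_subring V" "a \<in> V" "a \<notin> nonunits V" "x \<in> nonunits V"
  shows "a \<oplus> x \<in> V" "a \<oplus> x \<notin> nonunits V"
proof -
  note S = valuation_subring_subring[OF assms(1)]
  note S' = subringE[OF S]
  have xV: "x \<in> V" using assms(4) by (simp add: nonunits_def)
  have c: "a \<in> carrier R" "x \<in> carrier R" using assms(2) xV S'(1) by auto
  show "a \<oplus> x \<in> V" by (rule S'(7)[OF assms(2) xV])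
  show "a \<oplus> x \<notin> nonunits V"
  proof
    assume "a \<oplus> x \<in> nonunits V"
    moreover have "(\<ominus> \<one>) \<otimes> x \<in> nonunits V" by (rule nonunits_smult[OF S S'(5)[OF S'(3)] assms(4)])
    ultimately have "(a \<oplus> x) \<oplus> ((\<ominus> \<one>) \<otimes> x) \<in> nonunits V" by (rule nonunits_add[OF assms(1)])
    then show False using c assms(3) by (simp add: l_minus a_assoc r_neg)
  qed
qed

lemma nonunit_prime:
  assumes V: "valuation_subring V" and ab: "a \<in> V" "b \<in> V" "a \<otimes> b \<in> nonunits V"
  shows "a \<in> nonunits V \<or> b \<in> nonunits V"
proof (rule ccontr)
  assume *: "\<not> ?thesis"
  note S' = subringE[OF valuation_subring_subring[OF V]]
  have c: "a \<in> carrier R" "b \<in> carrier R" using ab S'(1) by auto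
  have n: "a \<noteq> \<zero>" "b \<noteq> \<zero>" "inv a \<in> V" "inv b \<in> V"
    using * ab by (auto simp: nonunits_def)
  have "inv (a \<otimes> b) \<in> V" using S'(6)[OF n(3,4)] c n by (simp add: inv_prod)
  then show False using ab(3) c n by (auto simp: nonunits_def integral_iff)
qed

lemma subring_Union_chain:
  assumes ne: "C \<noteq> {}" and ch: "\<And>A B. A \<in> C \<Longrightarrow> B \<in> C \<Longrightarrow> A \<subseteq> B \<or> B \<subseteq> A"
    and sub: "\<And>A. A \<in> C \<Longrightarrow> subring A R"
  shows "subring (\<Union>C) R"
proof (rule subringI)
  show "\<Union>C \<subseteq> carrier R" using subringE(1)[OF sub] by blast
  show "\<one> \<in> \<Union>C" using ne subringE(3)[OF sub] by blast
  show "\<ominus> h \<in> \<Union>C" if "h \<in> \<Union>C" for h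
  proof -
    from that obtain A where A: "A \<in> C" "h \<in> A" by blast
    then show ?thesis using subringE(5)[OF sub[OF A(1)] A(2)] by blast
  qed
  have both: "\<exists>A\<in>C. h1 \<in> A \<and> h2 \<in> A" if h: "h1 \<in> \<Union>C" "h2 \<in> \<Union>C" for h1 h2
  proof -
    obtain A B where "A \<in> C" "B \<in> C" "h1 \<in> A" "h2 \<in> B" using h by blast
    then show ?thesis using ch[of A B] by auto
  qed
  show "h1 \<otimes> h2 \<in> \<Union>C" if h: "h1 \<in> \<Union>C" "h2 \<in> \<Union>C" for h1 h2
  proof -
    from both[OF h] obtain A where A: "A \<in> C" "h1 \<in> A" "h2 \<in> A" by blast
    then show ?thesis using subringE(6)[OF sub[OF A(1)] A(2,3)] by blast
  qed
  show "h1 \<oplus> h2 \<in> \<Union>C" if h: "h1 \<in> \<Union>C" "h2 \<in> \<Union>C" for h1 h2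
  proof -
    from both[OF h] obtain A where A: "A \<in> C" "h1 \<in> A" "h2 \<in> A" by blast
    then show ?thesis using subringE(7)[OF sub[OF A(1)] A(2,3)] by blast
  qed
qed

text \<open>For \<open>z\<close> outside \<open>V\<close> the ring \<open>V[z]\<close> contains
  \<open>inv b\<close> by maximality, so \<open>1\<close> is a polynomial in \<open>z\<close> with
  coefficients in the ideal \<open>b V\<close>. If neither \<open>z\<close> nor \<open>inv z\<close>
  were in \<open>V\<close>, there would be shortest such expressions for both, and the shorter of
  the two would serve to shorten the other.\<close>

lemma maximal_subring_valuation:
  assumes V: "subring V R" and b: "b \<in> V" "b \<noteq> \<zero>" "inv b \<notin> V"
    and max: "\<And>W. subring W R \<Longrightarrow> V \<subseteq> W \<Longrightarrow> inv b \<notin> W \<Longrightarrow> W = V"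
  shows "valuation_subring V"
proof -
  note V' = subringE[OF V]
  have bc: "b \<in> carrier R" using b V' by auto
  \<comment> \<open>\<open>I\<close> is the ideal generated by \<open>b\<close>; it is proper
    because \<open>inv b\<close> is not in \<open>V\<close>.\<close>
  define I where "I = (\<lambda>v. b \<otimes> v) ` V"
  have "v \<in> V \<Longrightarrow> \<one> \<noteq> b \<otimes> v" for v
    using inv_eqI[OF bc, of v] V'(1) b(3) by auto
  moreover have "I \<subseteq> V" using V'(6)[OF b(1)] by (auto simp: I_def)
  ultimately have I: "I \<subseteq> V" "I \<subseteq> carrier R" "\<one> \<notin> I"
    using V'(1) by (auto simp: I_def)
  have Iadd: "add_closed I"
  proof -
    have "x \<oplus> y \<in> I" if "x \<in> I" "y \<in> I" for x y
    proof -
      obtain v w where vw: "v \<in> V" "w \<in> V" "x = b \<otimes> v" "y = b \<otimes> w" using \<open>x \<in> I\<close> \<open>y \<in> I\<close> by (auto simp: I_def)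
      then have "x \<oplus> y = b \<otimes> (v \<oplus> w)" using V'(1) bc by (simp add: r_distr subset_iff)
      then show ?thesis using V'(7)[OF vw(1,2)] by (auto simp: I_def)
    qed
    moreover have "b \<otimes> \<zero> \<in> I" using V'(2) by (auto simp: I_def)
    ultimately show ?thesis unfolding add_closed_def using I(2) bc by simp
  qed
  have Imult: "c \<otimes> x \<in> I" if cx: "c \<in> V" "x \<in> I" for c x
  proof -
    obtain v where v: "v \<in> V" "x = b \<otimes> v" using cx(2) by (auto simp: I_def)
    have "c \<otimes> x = b \<otimes> (c \<otimes> v)" using v cx V'(1) bc by (simp add: m_lcomm subset_iff)
    then show ?thesis using V'(6)[OF cx(1) v(1)] by (auto simp: I_def)
  qed
  have ext: "z \<in> V" if z: "z \<in> carrier R" "inv b \<notin> simple_extension V z" for z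
  proof -
    have "V \<subseteq> simple_extension V z" by (rule simple_extension_incl[OF V'(1) z(1)])
    then have "simple_extension V z = V" using max[OF simple_extension_is_subring[OF V z(1)]] z by blast
    then show ?thesis using simple_extension_mem[OF V z(1)] by simp
  qed
  have one_rep: "\<exists>n. \<one> \<in> poly_span I z n" if z: "z \<in> carrier R" "z \<notin> V" for z
  proof -
    have "inv b \<in> simple_extension V z" using ext[OF z(1)] z(2) by blast
    then obtain n where "inv b \<in> poly_span V z n" using simple_extension_iff_poly_span[OF V z(1)] by blast
    then have "b \<otimes> inv b \<in> poly_span I z n"
      by (rule poly_span_smult[OF V'(1) bc z(1), rotated]) (auto simp: I_def)
    then show ?thesis using inv_mult(1)[OF bc b(2)] by auto
  qed
  \<comment> \<open>The elements of \<open>1 + I\<close> are units: were \<open>u = 1 - x\<close>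
    not invertible in \<open>V\<close>, the expression of \<open>1\<close> in \<open>inv u\<close>
    would put a power of \<open>u\<close> into \<open>I\<close>, while every power of
    \<open>u\<close> is congruent to \<open>1\<close> modulo \<open>I\<close>.\<close>
  have inv1: "inv (\<one> \<ominus> x) \<in> V \<and> \<one> \<ominus> x \<noteq> \<zero>" if x: "x \<in> I" for x
  proof -
    have xc: "x \<in> carrier R" using x I by auto
    define u where "u = \<one> \<ominus> x"
    have "u \<noteq> \<zero>"
    proof
      assume "u = \<zero>"
      then have "\<one> = x" using xc by (simp add: u_def)
      then show False using x I(3) by simp
    qed
    moreover have "u \<in> V" unfolding u_def using subring_minus[OF V V'(3)] x I(1) by blast
    ultimately have u: "u \<in> V" "u \<noteq> \<zero>" "u \<in> carrier R" using V'(1) by auto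
    have "inv u \<in> V"
    proof (rule ccontr)
      assume n: "inv u \<notin> V"
      then obtain n where n: "\<one> \<in> poly_span I (inv u) n" using one_rep[of "inv u"] u by auto
      then obtain m where m: "\<one> \<in> poly_span I (inv u) (Suc m)" by (cases n) auto
      have "u [^] m \<otimes> \<one> \<in> poly_span I u (Suc m)" by (rule poly_span_reverse[OF Iadd u(3,2) m])
      then have "u [^] m \<in> poly_span I u (Suc m)" using u by simp
      moreover have Isub: "w \<in> I" if "w \<in> poly_span I u k" for w k
        using that
        by (induction k arbitrary: w) (auto elim!: poly_span_SucE simp: add_closedD[OF Iadd] Imult u)
      ultimately have um: "u [^] m \<in> I" by blast
      have "\<one> \<ominus> u [^] k \<in> I" for k :: nat
      proof (induction k)
        case 0 then show ?case using Iadd by (simp add: add_closedD r_neg a_minus_def)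
      next
        case (Suc k)
        have e: "\<one> \<ominus> u [^] Suc k = (\<one> \<ominus> u [^] k) \<oplus> u [^] k \<otimes> x"
          using xc by (simp add: u_def rsimp)
        have "u [^] k \<otimes> x \<in> I" using Imult x subring_pow[OF V u(1)] by blast
        then show ?case using Suc Iadd e by (simp add: add_closedD)
      qed
      then have "(\<one> \<ominus> u [^] m) \<oplus> u [^] m \<in> I" using um Iadd by (auto simp: add_closedD)
      then show False using I u by (simp add: rsimp)
    qed
    then show ?thesis using u by (simp add: u_def)
  qed
  \<comment> \<open>As \<open>1 - d\<close> is a unit, the relation for \<open>inv z\<close> turns
    into an expression of \<open>z [^] m'\<close>, where \<open>m' = m - 1\<close>, by lower powers
    of \<open>z\<close> over \<open>I\<close>. This removes the top term of the relation for
    \<open>z\<close>, whose length was minimal.\<close>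
  have key: False
    if z: "z \<in> carrier R" "z \<noteq> \<zero>" and n: "\<one> \<in> poly_span I z n" and m: "\<one> \<in> poly_span I (inv z) m"
      and minn: "\<And>k. k < n \<Longrightarrow> \<one> \<notin> poly_span I z k" and le: "m \<le> n" for z n m
  proof -
    obtain m' where m': "m = Suc m'" using m by (cases m) auto
    obtain n' where n': "n = Suc n'" using n by (cases n) auto
    obtain d v where dv: "d \<in> I" "v \<in> poly_span I (inv z) m'" "\<one> = d \<oplus> inv z \<otimes> v"
      using m m' by (auto elim: poly_span_SucE)
    have c: "d \<in> carrier R" "v \<in> carrier R" using dv I z poly_span_carrier[OF I(2) _ dv(2)] by auto
    define e where "e = inv (\<one> \<ominus> d)"
    have e: "e \<in> V" "\<one> \<ominus> d \<noteq> \<zero>" "e \<in> carrier R" "\<one> \<ominus> d \<in> carrier R"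
      using inv1[OF dv(1)] c by (auto simp: e_def)
    have "\<one> \<ominus> d = inv z \<otimes> v"
    proof -
      have "\<one> \<ominus> d = (d \<oplus> inv z \<otimes> v) \<ominus> d" using dv(3) by simp
      also have "\<dots> = inv z \<otimes> v" using c z by (simp add: rsimp)
      finally show ?thesis .
    qed
    then have ze: "z \<otimes> \<one> = e \<otimes> v"
    proof -
      assume *: "\<one> \<ominus> d = inv z \<otimes> v"
      have "e \<otimes> v = e \<otimes> (z \<otimes> (inv z \<otimes> v))" using c z by simp
      also have "\<dots> = z \<otimes> (e \<otimes> (\<one> \<ominus> d))" using c z e by (simp only: *[symmetric] m_lcomm)
      also have "\<dots> = z \<otimes> \<one>" using e by (simp add: e_def)
      finally show ?thesis by simp
    qed
    have ev: "e \<otimes> v \<in> poly_span I (inv z) m'"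
      by (rule poly_span_smult[OF I(2) e(3) _ _ dv(2)]) (use z Imult e in auto)
    have m'0: "m' \<noteq> 0"
    proof
      assume "m' = 0"
      then have "\<one> = d" using dv(2,3) c z by simp
      then show False using dv(1) I(3) by simp
    qed
    then obtain k where k: "m' = Suc k" by (cases m') auto
    have "z [^] k \<otimes> (e \<otimes> v) \<in> poly_span I z (Suc k)"
      by (rule poly_span_reverse[OF Iadd z]) (use ev k in simp)
    then have zm: "z [^] Suc k \<in> poly_span I z (Suc k)" using ze z by simp
    have kn: "Suc k \<le> n'" using le m' n' k by simp
    have zn: "z [^] n' \<in> poly_span I z n'"
    proof -
      have "z [^] (n' - Suc k) \<otimes> z [^] Suc k \<in> poly_span I z (Suc k + (n' - Suc k))"
        by (rule poly_span_shift[OF Iadd z(1) zm])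
      moreover have "z [^] (n' - Suc k) \<otimes> z [^] Suc k = z [^] n'"
        using kn nat_pow_mult[OF z(1), of "n' - Suc k" "Suc k"] by simp
      ultimately show ?thesis using kn by simp
    qed
    obtain w a where wa: "w \<in> poly_span I z n'" "a \<in> I" "\<one> = w \<oplus> z [^] n' \<otimes> a"
      using poly_span_top[OF I(2) z(1), of \<one> n'] n n' by blast
    have ac: "a \<in> carrier R" "a \<in> V" using wa I by auto
    have "a \<otimes> z [^] n' \<in> poly_span I z n'"
      by (rule poly_span_smult[OF I(2) ac(1) z(1) _ zn]) (use Imult ac in auto)
    then have "w \<oplus> a \<otimes> z [^] n' \<in> poly_span I z n'" using poly_span_add[OF Iadd z(1) wa(1)] by simp
    then have "\<one> \<in> poly_span I z n'" using wa(3) ac z by (simp add: m_comm)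
    then show False using minn n' by simp
  qed
  show ?thesis unfolding valuation_subring_def
  proof (intro conjI V ballI impI)
    fix z assume z: "z \<in> carrier R" "z \<notin> V"
    show "inv z \<in> V"
    proof (rule ccontr)
      assume iz: "inv z \<notin> V"
      have z0: "z \<noteq> \<zero>" using z V' by auto
      obtain n where n: "\<one> \<in> poly_span I z n" "\<And>k. k < n \<Longrightarrow> \<one> \<notin> poly_span I z k"
        using one_rep[OF z] exists_least_iff[of "\<lambda>n. \<one> \<in> poly_span I z n"] by metis
      have iz': "inv z \<in> carrier R" "inv z \<noteq> \<zero>" using z z0 by simp_all
      obtain m where m: "\<one> \<in> poly_span I (inv z) m" "\<And>k. k < m \<Longrightarrow> \<one> \<notin> poly_span I (inv z) k"
        using one_rep[OF iz'(1) iz] exists_least_iff[of "\<lambda>n. \<one> \<in> poly_span I (inv z) n"] by metis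
      show False
      proof (cases "m \<le> n")
        case True
        then show False using key[OF z(1) z0 n(1) m(1) n(2)] by blast
      next
        case False
        have "inv (inv z) = z" using z z0 by simp
        then show False using key[OF iz' m(1) _ m(2), of n] n(1) False by simp
      qed
    qed
  qed
qed

text \<open>A subring maximal among those that contain \<open>A\<close> and omit
  \<open>inv b\<close> exists by Zorn's lemma and is a valuation ring.\<close>

lemma exists_valuation_subring:
  assumes A: "subring A R" and b: "b \<in> A" "b \<noteq> \<zero>" "inv b \<notin> A"
  shows "\<exists>V. valuation_subring V \<and> A \<subseteq> V \<and> b \<in> nonunits V"
proof -
  define S where "S = {W. subring W R \<and> A \<subseteq> W \<and> inv b \<notin> W}"
  have "\<exists>M\<in>S. \<forall>W\<in>S. M \<subseteq> W \<longrightarrow> W = M"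
  proof (rule subset_Zorn_nonempty)
    show "S \<noteq> {}" using A b by (auto simp: S_def)
    fix C assume C: "C \<noteq> {}" "subset.chain S C"
    then have "subring (\<Union>C) R"
      by (intro subring_Union_chain) (auto simp: subset.chain_def S_def)
    then show "\<Union>C \<in> S" using C by (auto simp: subset.chain_def S_def)
  qed
  then obtain V where V: "subring V R" "A \<subseteq> V" "inv b \<notin> V"
    "\<And>W. subring W R \<Longrightarrow> A \<subseteq> W \<Longrightarrow> inv b \<notin> W \<Longrightarrow> V \<subseteq> W \<Longrightarrow> W = V"
    by (auto simp: S_def)
  have "valuation_subring V"
    using V(2,4) b(1) by (intro maximal_subring_valuation[OF V(1) _ b(2) V(3)]) blast+
  then show ?thesis using V b by (auto simp: nonunits_def)
qed

end

section \<open>Integral closure and minimal equations\<close>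

context field
begin

lemma pow_mult_inv_cancel [simp]:
  assumes "a \<in> carrier R" "a \<noteq> \<zero>" "x \<in> carrier R"
  shows "a [^] n \<otimes> (inv a [^] (n::nat) \<otimes> x) = x" "inv a [^] n \<otimes> (a [^] (n::nat) \<otimes> x) = x"
  using assms by (simp_all add: m_assoc[symmetric])

lemma carrier_valuation_subring: "valuation_subring (carrier R)"
  by (simp add: valuation_subring_def carrier_is_subring)

lemma int_closure_carrier: "int_closure A \<subseteq> carrier R"
  by (auto simp: int_closure_def)

lemma int_closureD: "z \<in> int_closure A \<Longrightarrow> valuation_subring V \<Longrightarrow> A \<subseteq> V \<Longrightarrow> z \<in> V"
  by (auto simp: int_closure_def)

lemma int_closure_superset: "A \<subseteq> carrier R \<Longrightarrow> A \<subseteq> int_closure A"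
  by (auto simp: int_closure_def)

lemma int_closure_subset: "A \<subseteq> int_closure B \<Longrightarrow> int_closure A \<subseteq> int_closure B"
  unfolding int_closure_def by (simp add: subset_iff)

lemma int_closure_subring: "subring (int_closure A) R"
proof (rule subringI)
  note V = subringE[OF valuation_subring_subring]
  show "int_closure A \<subseteq> carrier R" by (rule int_closure_carrier)
  show "\<one> \<in> int_closure A" using V(3) by (simp add: int_closure_def)
  show "\<ominus> h \<in> int_closure A" if "h \<in> int_closure A" for h
    using that V(5) by (simp add: int_closure_def)
  show "h1 \<otimes> h2 \<in> int_closure A" if "h1 \<in> int_closure A" "h2 \<in> int_closure A" for h1 h2
    using that V(6) by (simp add: int_closure_def)
  show "h1 \<oplus> h2 \<in> int_closure A" if "h1 \<in> int_closure A" "h2 \<in> int_closure A" for h1 h2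
    using that V(7) by (simp add: int_closure_def)
qed

text \<open>If \<open>z\<close> were outside \<open>V\<close>, then \<open>inv z\<close> would be in
  \<open>V\<close>, and division of the equation by \<open>z [^] (n - 1)\<close> would write
  \<open>z\<close> as a polynomial in \<open>inv z\<close>.\<close>

lemma monic_in_valuation:
  assumes V: "valuation_subring V" and A: "add_closed A" "A \<subseteq> V" and z: "z \<in> carrier R"
    and n: "z [^] n \<in> poly_span A z n"
  shows "z \<in> V"
proof (rule ccontr)
  assume zV: "z \<notin> V"
  have z0: "z \<noteq> \<zero>" "inv z \<in> V" using valuation_subringD[OF V z zV] nonunits_subset by auto
  obtain m where m: "n = Suc m" using n by (cases n) auto
  have "inv z [^] m \<otimes> z [^] Suc m \<in> poly_span A (inv z) (Suc m)"
    by (rule poly_span_reverse[OF A(1)]) (use z z0 n m in simp_all)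
  moreover have "inv z [^] m \<otimes> z [^] Suc m = z" using z z0 by simp
  ultimately have "z \<in> poly_span A (inv z) (Suc m)" by simp
  then show False using poly_span_subset[OF valuation_subring_subring[OF V] A(2) z0(2)] zV by blast
qed

text \<open>From left to right, put \<open>w = inv z\<close>. Unless \<open>z\<close> lies in
  \<open>A[w]\<close>, some valuation ring contains \<open>A[w]\<close> and has \<open>w\<close> as
  a nonunit, hence omits \<open>z\<close>. An expression of \<open>z\<close> as a polynomial in
  \<open>inv z\<close> becomes a monic equation after multiplication by a power of
  \<open>z\<close>.\<close>

theorem int_closure_iff_monic:
  assumes A: "subring A R"
  shows "z \<in> int_closure A \<longleftrightarrow> z \<in> carrier R \<and> (\<exists>n. z [^] (n::nat) \<in> poly_span A z n)"
proof
  assume z: "z \<in> carrier R \<and> (\<exists>n. z [^] (n::nat) \<in> poly_span A z n)"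
  then show "z \<in> int_closure A"
    using monic_in_valuation[OF _ subring_add_closed[OF A]] by (auto simp: int_closure_def)
next
  assume z: "z \<in> int_closure A"
  then have zc: "z \<in> carrier R" using int_closure_carrier by blast
  note A' = subring_add_closed[OF A]
  have "\<exists>n. z [^] (n::nat) \<in> poly_span A z n"
  proof (cases "z = \<zero>")
    case True
    have "\<zero> [^] (1::nat) \<in> poly_span A \<zero> 1" using poly_span_zero[OF A', of \<zero> 1] by simp
    then show ?thesis using True by blast
  next
    case z0: False
    define w where "w = inv z"
    have w: "w \<in> carrier R" "w \<noteq> \<zero>" "inv w = z" using zc z0 by (simp_all add: w_def)
    have "z \<in> simple_extension A w"
    proof (rule ccontr)
      assume "z \<notin> simple_extension A w"
      moreover have "w \<in> simple_extension A w" by (rule simple_extension_mem[OF A w(1)])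
      ultimately obtain V where V: "valuation_subring V" "simple_extension A w \<subseteq> V" "w \<in> nonunits V"
        using exists_valuation_subring[OF simple_extension_is_subring[OF A w(1)], of w] w by auto
      have "A \<subseteq> V" using V(2) simple_extension_incl[OF subringE(1)[OF A] w(1)] by blast
      then have "z \<in> V" by (rule int_closureD[OF z V(1)])
      then show False using V(3) w by (simp add: nonunits_def)
    qed
    then obtain n where n: "z \<in> poly_span A w n" using simple_extension_iff_poly_span[OF A w(1)] by blast
    then have "z \<in> poly_span A (inv z) (Suc n)" using poly_span_Suc_mono[OF A' w(1) n] by (simp add: w_def)
    then have "z [^] n \<otimes> z \<in> poly_span A z (Suc n)" by (rule poly_span_reverse[OF A' zc z0])
    then have "z [^] Suc n \<in> poly_span A z (Suc n)" by simp
    then show ?thesis by blast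
  qed
  then show "z \<in> carrier R \<and> (\<exists>n. z [^] (n::nat) \<in> poly_span A z n)" using zc by blast
qed

lemma horner_map_mult:
  "set l \<subseteq> carrier R \<Longrightarrow> z \<in> carrier R \<Longrightarrow> e \<in> carrier R \<Longrightarrow> horner (map ((\<otimes>) e) l) z = e \<otimes> horner l z"
proof (induction l)
  case (Cons a l)
  then show ?case by (simp add: r_distr m_lcomm)
qed simp

lemma horner_zeros: "set l \<subseteq> {\<zero>} \<Longrightarrow> z \<in> carrier R \<Longrightarrow> horner l z = \<zero>"
  by (induction l) auto

text \<open>The last nonzero coefficient is inverted in \<open>E\<close>, and \<open>k\<close> is
  its position; trailing zeros may keep \<open>k\<close> well below the length of
  \<open>l\<close>.\<close>

lemma horner_relation:
  assumes E: "subfield E R" and l: "set l \<subseteq> E" and z: "z \<in> carrier R"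
    and rel: "horner l z = \<zero>" and nz: "\<exists>x\<in>set l. x \<noteq> \<zero>"
  shows "\<exists>k<length l. z [^] k \<in> poly_span E z k"
proof -
  note E' = subringE[OF subfieldE(1)[OF E]]
  obtain ys x zs where s: "l = ys @ x # zs" "x \<noteq> \<zero>" "\<forall>y\<in>set zs. \<not> y \<noteq> \<zero>"
    using split_list_last_prop[OF nz] by blast
  have c: "set ys \<subseteq> E" "x \<in> E" "set ys \<subseteq> carrier R" "x \<in> carrier R" "set zs \<subseteq> carrier R" "set zs \<subseteq> {\<zero>}"
    using s l E'(1) by auto
  define y where "y = horner ys z"
  have y: "y \<in> carrier R" "y \<in> poly_span E z (length ys)"
    using c z by (auto simp: y_def horner_in_poly_span)
  have "horner l z = y \<oplus> z [^] length ys \<otimes> (x \<oplus> z \<otimes> horner zs z)"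
    using c z unfolding s y_def by (subst horner_append) auto
  then have e: "y \<oplus> z [^] length ys \<otimes> x = \<zero>" using rel z c horner_zeros[OF c(6) z] by simp
  have ix: "inv x \<in> E" "inv x \<in> carrier R" using subfield_m_inv[OF E, of x] c s E'(1) by auto
  have "z [^] length ys \<otimes> x = \<ominus> y" using e z y c
    by (metis a_comm m_closed minus_equality nat_pow_closed)
  then have "inv x \<otimes> (x \<otimes> z [^] length ys) = inv x \<otimes> \<ominus> y" using z c by (simp add: m_comm)
  then have "z [^] length ys = inv x \<otimes> \<ominus> y" using z c s by simp
  moreover have "inv x \<otimes> \<ominus> y \<in> poly_span E z (length ys)"
    by (rule poly_span_smult[OF E'(1) ix(2) z E'(6)[OF ix(1)] poly_span_subring_minus[OF subfieldE(1)[OF E] z y(2)]])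
  ultimately have "z [^] length ys \<in> poly_span E z (length ys)" by simp
  moreover have "length ys < length l" using s by simp
  ultimately show ?thesis by blast
qed

lemma algebraic_if_relation:
  assumes E: "subfield E R" and l: "set l \<subseteq> E" and z: "z \<in> carrier R"
    and rel: "horner l z = \<zero>" and nz: "\<exists>x\<in>set l. x \<noteq> \<zero>"
  shows "z \<in> int_closure E"
  using horner_relation[OF assms] z int_closure_iff_monic[OF subfieldE(1)[OF E]] by blast

text \<open>For a field \<open>E\<close>, the minimal polynomial of \<open>b\<close> has degree
  \<open>m + 1\<close> and constant coefficient \<open>-s\<close>: the lower terms stand on the
  right of the equation, and those divisible by \<open>b\<close> are gathered in
  \<open>b \<otimes> u\<close>. With \<open>s \<noteq> \<zero>\<close> the equation can also be read
  as one for \<open>inv b\<close>.\<close>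

definition min_relation :: "'a set \<Rightarrow> 'a \<Rightarrow> nat \<Rightarrow> 'a \<Rightarrow> bool" where
  "min_relation E b m s \<longleftrightarrow> s \<in> E \<and> s \<noteq> \<zero> \<and>
     (\<exists>u\<in>poly_span E b m. b [^] Suc m = s \<oplus> b \<otimes> u) \<and> (\<forall>k\<le>m. b [^] k \<notin> poly_span E b k)"

lemma exists_min_relation:
  assumes E: "subfield E R" and b: "b \<in> int_closure E" "b \<noteq> \<zero>"
  shows "\<exists>m s. min_relation E b m s"
proof -
  note E' = subringE[OF subfieldE(1)[OF E]]
  have bc: "b \<in> carrier R" using b int_closure_carrier by blast
  obtain n where n: "b [^] (n::nat) \<in> poly_span E b n" "\<And>k. k < n \<Longrightarrow> b [^] k \<notin> poly_span E b k"
    using b int_closure_iff_monic[OF subfieldE(1)[OF E]]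
      exists_least_iff[of "\<lambda>n. b [^] (n::nat) \<in> poly_span E b n"] by blast
  obtain m where m: "n = Suc m" using n(1) by (cases n) auto
  obtain s u where su: "s \<in> E" "u \<in> poly_span E b m" "b [^] Suc m = s \<oplus> b \<otimes> u"
    using n(1) unfolding m by (rule poly_span_SucE)
  have u: "u \<in> carrier R" by (rule poly_span_carrier[OF E'(1) bc su(2)])
  have "s \<noteq> \<zero>"
  proof
    assume "s = \<zero>"
    then have "b \<otimes> b [^] m = b \<otimes> u" using su(3) u bc by (simp add: m_comm)
    then have "b [^] m = u" using bc u b(2) by (simp add: m_lcancel)
    then show False using n(2)[of m] m su(2) by simp
  qed
  then have "min_relation E b m s" using su n(2) m unfolding min_relation_def by auto
  then show ?thesis by blast
qed

text \<open>By its minimal equation \<open>z\<close> divides a nonzero element \<open>s\<close> of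
  \<open>K\<close> in every valuation ring that contains \<open>K\<close>, and nonzero elements of
  \<open>K\<close> are units there.\<close>

lemma int_closure_field_inv:
  assumes K: "subfield K R" and z: "z \<in> int_closure K" "z \<noteq> \<zero>"
  shows "inv z \<in> int_closure K"
proof -
  note K' = subringE[OF subfieldE(1)[OF K]]
  have zc: "z \<in> carrier R" using z int_closure_carrier by blast
  obtain m s u where r: "s \<in> K" "s \<noteq> \<zero>" "u \<in> poly_span K z m" "z [^] Suc m = s \<oplus> z \<otimes> u"
    using exists_min_relation[OF K z] by (auto simp: min_relation_def)
  have u: "u \<in> carrier R" "s \<in> carrier R" using poly_span_carrier[OF K'(1) zc r(3)] r K'(1) by auto
  have sK: "inv s \<in> K" using subfield_m_inv[OF K, of s] r by auto
  show ?thesis unfolding int_closure_def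
  proof (intro CollectI conjI allI impI)
    show "inv z \<in> carrier R" using zc z by simp
    fix V assume V: "valuation_subring V \<and> K \<subseteq> V"
    have S: "subring V R" using V valuation_subring_subring by blast
    have zV: "z \<in> V" using int_closureD[OF z(1)] V by blast
    show "inv z \<in> V"
    proof (rule ccontr)
      assume "inv z \<notin> V"
      then have zm: "z \<in> nonunits V" using zV by (simp add: nonunits_def)
      have uV: "u \<in> V" using poly_span_subset[OF S _ zV r(3)] V by blast
      have "s = (z [^] m \<ominus> u) \<otimes> z" using r(4) zc u by (simp add: rsimp)
      moreover have "z [^] m \<ominus> u \<in> V" by (rule subring_minus[OF S subring_pow[OF S zV] uV])
      ultimately have "s \<in> nonunits V" using nonunits_smult[OF S _ zm] by simp
      then show False using sK V r(2) by (auto simp: nonunits_def)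
    qed
  qed
qed

lemma int_closure_subfield:
  assumes "subfield K R"
  shows "subfield (int_closure K) R"
  by (rule subfieldI'[OF int_closure_subring]) (use int_closure_field_inv[OF assms] in auto)

text \<open>Division by a monic equation with coefficients in \<open>A\<close> never leaves
  \<open>I\<close>, which absorbs multiplication by \<open>A\<close>; the remainder has
  \<open>M\<close> coefficients, again in \<open>I\<close>.\<close>

lemma poly_span_reduce:
  assumes A: "subring A R" and I: "add_closed I" "\<And>a x. a \<in> A \<Longrightarrow> x \<in> I \<Longrightarrow> x \<otimes> a \<in> I"
    and b: "b \<in> carrier R" and M: "b [^] M \<in> poly_span A b M" "M \<noteq> 0"
  shows "u \<in> poly_span I b n \<Longrightarrow> u \<in> poly_span I b M"
proof (induction n arbitrary: u)
  case 0
  then show ?case using poly_span_zero[OF I(1) b] by simp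
next
  case (Suc n)
  have Ic: "I \<subseteq> carrier R" using I(1) by (auto simp: add_closed_def)
  obtain a u' where u: "a \<in> I" "u' \<in> poly_span I b n" "u = a \<oplus> b \<otimes> u'"
    using Suc.prems by (rule poly_span_SucE)
  have "u \<in> poly_span I b (Suc M)" unfolding u(3) by (rule poly_span_SucI[OF u(1) Suc.IH[OF u(2)]])
  then obtain v x where v: "v \<in> poly_span I b M" "x \<in> I" "u = v \<oplus> b [^] M \<otimes> x"
    using poly_span_top[OF Ic b] by blast
  have xc: "x \<in> carrier R" using v Ic by auto
  have "x \<otimes> b [^] M \<in> poly_span I b M"
    by (rule poly_span_smult[OF subringE(1)[OF A] xc b _ M(1)]) (rule I(2)[OF _ v(2)])
  then have "b [^] M \<otimes> x \<in> poly_span I b M" using xc b by (simp add: m_comm)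
  then show ?case unfolding v(3) by (rule poly_span_add[OF I(1) b v(1)])
qed

text \<open>Division by a coefficient of least value makes a polynomial primitive. The least value
  is found by testing quotients for membership in \<open>V\<close>, without a value group.\<close>

lemma exists_scaling:
  assumes V: "valuation_subring V" and E: "subfield E R"
  shows "set l \<subseteq> E \<Longrightarrow> \<exists>x\<in>set l. x \<noteq> \<zero> \<Longrightarrow>
    \<exists>e\<in>E. e \<noteq> \<zero> \<and> (\<forall>x\<in>set l. e \<otimes> x \<in> V) \<and> (\<exists>x\<in>set l. e \<otimes> x = \<one>)"
proof (induction l)
  case (Cons a l)
  note E' = subringE[OF subfieldE(1)[OF E]]
  note V' = subringE[OF valuation_subring_subring[OF V]]
  have a: "a \<in> E" "a \<in> carrier R" using Cons.prems(1) E'(1) by auto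
  have lc: "x \<in> carrier R" if "x \<in> set l" for x using that Cons.prems(1) E'(1) by auto
  show ?case
  proof (cases "\<exists>x\<in>set l. x \<noteq> \<zero>")
    case False
    then have z: "\<forall>x\<in>set l. x = \<zero>" by blast
    have a0: "a \<noteq> \<zero>" using Cons.prems(2) z by auto
    have ia: "inv a \<in> E" "inv a \<noteq> \<zero>" using subfield_m_inv[OF E, of a] a a0 by auto
    show ?thesis
      by (intro bexI[OF _ ia(1)]) (use ia a a0 z V'(2,3) in auto)
  next
    case True
    then obtain e where e: "e \<in> E" "e \<noteq> \<zero>" "\<forall>x\<in>set l. e \<otimes> x \<in> V" "\<exists>x\<in>set l. e \<otimes> x = \<one>"
      using Cons.IH Cons.prems(1) by auto
    have ec: "e \<in> carrier R" using e E'(1) by auto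
    show ?thesis
    proof (cases "e \<otimes> a \<in> V")
      case True
      then show ?thesis using e by (intro bexI[OF _ e(1)]) auto
    next
      case False
      have n: "inv (e \<otimes> a) \<in> V" "e \<otimes> a \<noteq> \<zero>"
        using valuation_subringD[OF V _ False] ec a nonunits_subset by auto
      have a0: "a \<noteq> \<zero>" using n ec by auto
      have ia: "inv a \<in> E" "inv a \<noteq> \<zero>" "inv a \<in> carrier R" using subfield_m_inv[OF E, of a] a a0 by auto
      have "inv a \<otimes> x \<in> V" if x: "x \<in> set l" for x
      proof -
        have "inv (e \<otimes> a) \<otimes> (e \<otimes> x) = inv a \<otimes> (inv e \<otimes> (e \<otimes> x))"
          using ec a a0 e(2) lc[OF x] by (simp add: inv_prod m_ac del: mult_inv_cancel)
        then have "inv (e \<otimes> a) \<otimes> (e \<otimes> x) = inv a \<otimes> x" using ec e(2) lc[OF x] by simp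
        moreover have "inv (e \<otimes> a) \<otimes> (e \<otimes> x) \<in> V" using V'(6)[OF n(1)] e(3) x by blast
        ultimately show ?thesis by simp
      qed
      moreover have "inv a \<otimes> a = \<one>" using a a0 by simp
      ultimately show ?thesis using ia V'(3) by (intro bexI[OF _ ia(1)]) auto
    qed
  qed
qed simp

text \<open>A relation over \<open>E\<close> of smaller degree, scaled so that some coefficient is a unit, lowers the
  degree of any longer monic relation over \<open>V \<inter> E\<close>.\<close>

lemma min_relation_integral:
  assumes V: "valuation_subring V" and E: "subfield E R" and b: "b \<in> int_closure (V \<inter> E)"
    and rel: "b [^] Suc m \<in> poly_span E b (Suc m)" and min: "\<And>k. k \<le> m \<Longrightarrow> b [^] k \<notin> poly_span E b k"
  shows "b [^] Suc m \<in> poly_span (V \<inter> E) b (Suc m)"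
proof -
  have SV: "subring V R" and SE: "subring E R" using V E valuation_subring_subring subfieldE(1) by auto
  define A where "A = V \<inter> E"
  define N where "N = nonunits V \<inter> E"
  have A: "subring A R" unfolding A_def by (rule subring_inter[OF SV SE])
  have bc: "b \<in> carrier R" using b int_closure_carrier by blast
  have N: "add_closed N"
    using nonunits_add_closed[OF V] subring_add_closed[OF SE] unfolding N_def add_closed_def by blast
  have NA: "x \<otimes> a \<in> N" if ax: "a \<in> A" "x \<in> N" for a x
  proof -
    have c: "a \<in> carrier R" "x \<in> carrier R" using ax subringE(1)[OF A] N by (auto simp: add_closed_def)
    have "a \<otimes> x \<in> nonunits V" by (rule nonunits_smult[OF SV]) (use ax in \<open>auto simp: A_def N_def\<close>)
    moreover have "a \<otimes> x \<in> E" by (rule subringE(6)[OF SE]) (use ax in \<open>auto simp: A_def N_def\<close>)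
    ultimately show ?thesis using c by (simp add: N_def m_comm)
  qed
  have NsubA: "N \<subseteq> A" using nonunits_subset by (auto simp: N_def A_def)
  note A' = subringE[OF A] note AC = subring_add_closed[OF A]
  obtain l where l: "set l \<subseteq> E" "length l = Suc m" "b [^] Suc m = horner l b"
    using rel by (auto simp: poly_span_eq_horner)
  define l' where "l' = l @ [\<ominus> \<one>]"
  have lc: "set l \<subseteq> carrier R" using l subringE(1)[OF SE] by auto
  have l': "set l' \<subseteq> E" "length l' = m + 2" "\<exists>x\<in>set l'. x \<noteq> \<zero>" "set l' \<subseteq> carrier R"
    using l lc subringE(3,5)[OF SE] by (auto simp: l'_def add.inv_eq_1_iff)
  have hl': "horner l' b = \<zero>"
    unfolding l'_def using lc bc l by (subst horner_append) (auto simp: rsimp simp del: nat_pow_Suc)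
  obtain e where e: "e \<in> E" "e \<noteq> \<zero>" "\<forall>x\<in>set l'. e \<otimes> x \<in> V" "\<exists>x\<in>set l'. e \<otimes> x = \<one>"
    using exists_scaling[OF V E l'(1,3)] by blast
  have ec: "e \<in> carrier R" using e subringE(1)[OF SE] by auto
  define q where "q = map ((\<otimes>) e) l'"
  have q: "set q \<subseteq> A" "length q = m + 2" "horner q b = \<zero>"
    using e l' subringE(6)[OF SE e(1)] bc hl' ec by (auto simp: q_def A_def horner_map_mult)
  have "\<exists>x\<in>set q. x \<notin> nonunits V" using e(4) one_not_nonunit[of V] by (force simp: q_def)
  \<comment> \<open>\<open>x\<close> is the last unit among the scaled coefficients; all those
    behind it are nonunits.\<close>
  from split_list_last_prop[OF this] obtain ys x zs
    where s: "q = ys @ x # zs" "x \<notin> nonunits V" "\<forall>z\<in>set zs. \<not> z \<notin> nonunits V" by blast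
  have sc: "set ys \<subseteq> A" "x \<in> A" "set zs \<subseteq> N" using s q(1) by (auto simp: A_def N_def)
  have sc': "set ys \<subseteq> carrier R" "x \<in> carrier R" "set zs \<subseteq> carrier R"
    using sc A'(1) NsubA by auto
  have len: "length ys \<le> Suc m" using s q(2) by auto
  define y where "y = horner ys b"
  define z where "z = horner zs b"
  have yz: "y \<in> carrier R" "z \<in> carrier R" "y \<in> poly_span A b (length ys)" "z \<in> poly_span N b (length zs)"
    using sc sc' bc by (auto simp: y_def z_def horner_in_poly_span)
  have rel0: "y \<oplus> b [^] length ys \<otimes> (x \<oplus> b \<otimes> z) = \<zero>"
    using q(3) sc' bc unfolding s y_def z_def by (subst (asm) horner_append) auto
  obtain M where M: "b [^] (M::nat) \<in> poly_span A b M" "\<And>k. k < M \<Longrightarrow> b [^] k \<notin> poly_span A b k"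
    using b int_closure_iff_monic[OF A] exists_least_iff[of "\<lambda>n. b [^] (n::nat) \<in> poly_span A b n"]
    unfolding A_def by blast
  have "\<not> M \<le> m"
    using min[of M] M(1) poly_span_coeff_mono[of A E b M] by (auto simp: A_def)
  \<comment> \<open>A shortest monic relation over \<open>A\<close> longer than \<open>Suc m\<close>
    could be shortened: a shift by \<open>b [^] d\<close> brings the unit \<open>x\<close> to the
    exponent \<open>M' = M - 1\<close>, and the part beyond, having nonunit coefficients, is reduced
    modulo the equation of degree \<open>M\<close>. This changes \<open>x\<close> by a nonunit
    \<open>w\<close> only, so the coefficient remains invertible in \<open>A\<close>.\<close>
  moreover have "\<not> Suc m < M"
  proof
    assume "Suc m < M"
    then obtain M' where M': "M = Suc M'" "Suc m \<le> M'" by (cases M) auto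
    have le: "length ys \<le> M'" using len M' by simp
    define d where "d = M' - length ys"
    have d: "length ys + d = M'" "d + length ys = M'" using le by (auto simp: d_def)
    have y1: "b [^] d \<otimes> y \<in> poly_span A b M'"
      using poly_span_shift[OF AC bc yz(3), of d] d by simp
    have "b [^] M \<otimes> z \<in> poly_span N b M"
      by (rule poly_span_reduce[OF A N _ bc M(1) _ poly_span_shift[OF N bc yz(4)]]) (use NA M' in auto)
    then obtain v w where vw: "v \<in> poly_span N b M'" "w \<in> N" "b [^] M \<otimes> z = v \<oplus> b [^] M' \<otimes> w"
      using poly_span_top[of N b "b [^] M \<otimes> z" M'] N bc M'(1)
      by (auto simp: add_closed_def simp del: nat_pow_Suc)
    have vA: "v \<in> poly_span A b M'" using vw(1) poly_span_coeff_mono[OF NsubA] by blast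
    have vwc: "v \<in> carrier R" "w \<in> carrier R" using poly_span_carrier[OF A'(1) bc vA] vw(2) NsubA A'(1) by auto
    have "b [^] d \<otimes> (y \<oplus> b [^] length ys \<otimes> (x \<oplus> b \<otimes> z)) = \<zero>" using rel0 bc by simp
    then have "b [^] d \<otimes> y \<oplus> (b [^] d \<otimes> b [^] length ys) \<otimes> (x \<oplus> b \<otimes> z) = \<zero>"
      using bc yz sc' by (simp add: r_distr m_assoc)
    then have "b [^] d \<otimes> y \<oplus> b [^] M' \<otimes> (x \<oplus> b \<otimes> z) = \<zero>"
      using bc d by (simp add: nat_pow_mult)
    then have "b [^] d \<otimes> y \<oplus> (b [^] M' \<otimes> x \<oplus> b [^] M \<otimes> z) = \<zero>"
      using bc yz sc' M' by (simp add: r_distr m_assoc)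
    then have r2: "b [^] d \<otimes> y \<oplus> (b [^] M' \<otimes> x \<oplus> (v \<oplus> b [^] M' \<otimes> w)) = \<zero>" using vw(3) by simp
    define h where "h = b [^] d \<otimes> y \<oplus> v"
    have h: "h \<in> poly_span A b M'" "h \<in> carrier R"
      using poly_span_add[OF AC bc y1 vA] bc yz vwc by (auto simp: h_def)
    have "h \<oplus> b [^] M' \<otimes> (x \<oplus> w) = \<zero>"
      using r2 bc yz vwc sc' by (simp add: h_def r_distr a_ac)
    then have e1: "b [^] M' \<otimes> (x \<oplus> w) = \<ominus> h"
      using h bc sc' vwc by (metis a_closed a_comm m_closed minus_equality nat_pow_closed)
    define t where "t = x \<oplus> w"
    have t: "t \<in> V" "t \<notin> nonunits V" "t \<in> E" "t \<in> carrier R"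
      using unit_diff_nonunit[OF V _ s(2), of w] sc vw(2) subringE(7)[OF SE, of x w] sc' vwc
      by (auto simp: t_def A_def N_def)
    have t0: "t \<noteq> \<zero>" "inv t \<in> V" using t nonunits_zero[OF SV] by (auto simp: nonunits_def)
    have it: "inv t \<in> A" "inv t \<in> carrier R" using t0 t subfield_m_inv[OF E, of t] by (auto simp: A_def)
    have "inv t \<otimes> (t \<otimes> b [^] M') = inv t \<otimes> \<ominus> h" using e1 t bc by (simp add: t_def m_comm)
    then have "b [^] M' = inv t \<otimes> \<ominus> h" using t t0 bc by simp
    moreover have "inv t \<otimes> \<ominus> h \<in> poly_span A b M'"
      by (rule poly_span_smult[OF A'(1) it(2) bc A'(6)[OF it(1)] poly_span_subring_minus[OF A bc h(1)]])
    ultimately show False using M(2)[of M'] M' by simp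
  qed
  ultimately have "M = Suc m" by simp
  then show ?thesis using M(1) by (simp add: A_def)
qed

end

section \<open>Constant coefficients of minimal equations; fields of fractions\<close>

context field
begin

text \<open>Over the integrally closed ring \<open>V \<inter> E\<close> the minimal equation of an
  integral element has its coefficients in that ring. Its constant term agrees with
  \<open>s\<close>, since two different equations of minimal degree could be subtracted to give a
  shorter one. If \<open>b\<close> is a nonunit, the equation exhibits \<open>s\<close> as a
  multiple of \<open>b\<close> in \<open>V\<close>.\<close>

lemma min_relation_const:
  assumes V: "valuation_subring V" and E: "subfield E R" and r: "min_relation E b m s"
    and b: "b \<in> int_closure (V \<inter> E)"
  shows "s \<in> V" "b \<in> nonunits V \<Longrightarrow> s \<in> nonunits V"
proof -
  have SV: "subring V R" and SE: "subring E R" using V E valuation_subring_subring subfieldE(1) by auto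
  have EC: "E \<subseteq> carrier R" by (rule subringE(1)[OF SE])
  have bc: "b \<in> carrier R" using b int_closure_carrier by blast
  obtain u where u: "s \<in> E" "u \<in> poly_span E b m" "b [^] Suc m = s \<oplus> b \<otimes> u"
    and min: "\<And>k. k \<le> m \<Longrightarrow> b [^] k \<notin> poly_span E b k"
    using r unfolding min_relation_def by blast
  have "b [^] Suc m \<in> poly_span E b (Suc m)" unfolding u(3) by (rule poly_span_SucI[OF u(1,2)])
  then have "b [^] Suc m \<in> poly_span (V \<inter> E) b (Suc m)" by (rule min_relation_integral[OF V E b _ min])
  then obtain s' u' where u': "s' \<in> V \<inter> E" "u' \<in> poly_span (V \<inter> E) b m" "b [^] Suc m = s' \<oplus> b \<otimes> u'"
    by (rule poly_span_SucE)
  have u'E: "u' \<in> poly_span E b m" using u'(2) poly_span_coeff_mono[of "V \<inter> E" E b m] by blast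
  have c: "s \<in> carrier R" "s' \<in> carrier R" "u \<in> carrier R" "u' \<in> carrier R"
    using u(1) u'(1) EC poly_span_carrier[OF EC bc u(2)] poly_span_carrier[OF EC bc u'E] by auto
  have "u \<oplus> \<ominus> u' \<in> poly_span E b m"
    by (rule poly_span_add[OF subring_add_closed[OF SE] bc u(2) poly_span_subring_minus[OF SE bc u'E]])
  then obtain l where l: "set l \<subseteq> E" "length l = m" "u \<oplus> \<ominus> u' = horner l b"
    by (auto simp: poly_span_eq_horner)
  have "s = s'"
  proof (rule ccontr)
    assume ne: "s \<noteq> s'"
    have "s \<ominus> s' \<noteq> \<zero>" using ne c by simp
    moreover have "horner ((s \<ominus> s') # l) b = (s \<oplus> b \<otimes> u) \<ominus> (s' \<oplus> b \<otimes> u')"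
      using c bc by (simp add: l(3)[symmetric] rsimp)
    then have "horner ((s \<ominus> s') # l) b = \<zero>" using u(3) u'(3) c bc by (simp add: a_minus_def r_neg)
    moreover have "set ((s \<ominus> s') # l) \<subseteq> E" using l(1) subring_minus[OF SE u(1)] u'(1) by auto
    ultimately obtain k where "k < Suc m" "b [^] k \<in> poly_span E b k"
      using horner_relation[OF E _ bc, of "(s \<ominus> s') # l"] l(2) by auto
    then show False using min by auto
  qed
  then show "s \<in> V" using u'(1) by simp
  assume bm: "b \<in> nonunits V"
  have bV: "b \<in> V" using bm nonunits_subset by blast
  have "u' \<in> V" by (rule poly_span_subset[OF SV _ bV u'(2)]) auto
  then have "b [^] m \<ominus> u' \<in> V" by (rule subring_minus[OF SV subring_pow[OF SV bV]])
  moreover have "s = (b [^] m \<ominus> u') \<otimes> b" using u'(3) \<open>s = s'\<close> c bc by (simp add: rsimp)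
  ultimately show "s \<in> nonunits V" using nonunits_smult[OF SV _ bm] by simp
qed

text \<open>The reversed polynomial, made monic, is the minimal polynomial of the inverse. Together
  with \<open>min_relation_const\<close> it turns integrality of \<open>inv b\<close> into
  membership of \<open>inv s\<close> in a valuation ring.\<close>

lemma min_relation_inv:
  assumes E: "subfield E R" and b: "b \<in> carrier R" "b \<noteq> \<zero>" and r: "min_relation E b m s"
  shows "min_relation E (inv b) m (inv s)"
proof -
  have SE: "subring E R" using E subfieldE(1) by auto
  have EC: "E \<subseteq> carrier R" by (rule subringE(1)[OF SE])
  note EA = subring_add_closed[OF SE]
  obtain u where u: "s \<in> E" "s \<noteq> \<zero>" "u \<in> poly_span E b m" "b [^] Suc m = s \<oplus> b \<otimes> u"
    and min: "\<And>k. k \<le> m \<Longrightarrow> b [^] k \<notin> poly_span E b k"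
    using r unfolding min_relation_def by blast
  define c where "c = inv b"
  have c: "c \<in> carrier R" "c \<noteq> \<zero>" "inv c = b" "b \<otimes> c = \<one>" using b by (simp_all add: c_def)
  have car: "s \<in> carrier R" "u \<in> carrier R" using u(1) EC poly_span_carrier[OF EC b(1) u(3)] by auto
  have iS: "inv s \<in> E" "inv s \<noteq> \<zero>" "inv s \<in> carrier R" using subfield_m_inv[OF E, of s] u EC by auto
  \<comment> \<open>For \<open>m = 0\<close> the element \<open>u\<close> is zero and no factor
    \<open>c\<close> can be split off; otherwise \<open>t\<close> is \<open>u\<close> with reversed
    coefficients, a polynomial in \<open>c\<close>.\<close>
  define t where "t = (if m = 0 then \<zero> else c [^] (m - 1) \<otimes> u)"
  have t: "t \<in> poly_span E c m" "c [^] m \<otimes> u = c \<otimes> t"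
  proof -
    have "t \<in> poly_span E c m \<and> c [^] m \<otimes> u = c \<otimes> t"
    proof (cases m)
      case 0
      then show ?thesis using u(3) c by (simp add: t_def)
    next
      case (Suc m')
      have "c [^] m' \<otimes> u \<in> poly_span E c (Suc m')"
        by (rule poly_span_reverse[OF EA c(1,2)]) (use u(3) Suc c in simp)
      then show ?thesis using Suc c car by (simp add: t_def m_ac)
    qed
    then show "t \<in> poly_span E c m" "c [^] m \<otimes> u = c \<otimes> t" by auto
  qed
  have tc: "t \<in> carrier R" by (rule poly_span_carrier[OF EC c(1) t(1)])
  have "c [^] Suc m \<otimes> b [^] Suc m = c [^] Suc m \<otimes> s \<oplus> (c [^] m \<otimes> (c \<otimes> (b \<otimes> u)))"
    unfolding u(4) using car c b by (simp add: r_distr m_assoc)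
  moreover have "c [^] Suc m \<otimes> b [^] Suc m = \<one>"
    unfolding c_def by (rule pow_mult_inv(2)[OF b])
  moreover have "c \<otimes> (b \<otimes> u) = u" using b car by (simp add: c_def)
  ultimately have e: "\<one> = c [^] Suc m \<otimes> s \<oplus> c \<otimes> t" using t(2) by simp
  have "inv s = inv s \<otimes> (c [^] Suc m \<otimes> s \<oplus> c \<otimes> t)" unfolding e[symmetric] using iS by simp
  also have "\<dots> = c [^] Suc m \<otimes> (s \<otimes> inv s) \<oplus> c \<otimes> (inv s \<otimes> t)"
    using iS tc c car by (simp add: r_distr m_ac del: inv_mult mult_inv_cancel)
  also have "\<dots> = c [^] Suc m \<oplus> c \<otimes> (inv s \<otimes> t)" using u car c by simp
  finally have f: "inv s = c [^] Suc m \<oplus> c \<otimes> (inv s \<otimes> t)" .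
  have "c [^] Suc m \<oplus> c \<otimes> (inv s \<otimes> t) \<oplus> c \<otimes> (\<ominus> (inv s \<otimes> t)) = c [^] Suc m"
    using c tc iS by (simp add: r_minus a_assoc r_neg)
  then have "c [^] Suc m = inv s \<oplus> c \<otimes> (\<ominus> (inv s \<otimes> t))" by (simp only: f[symmetric])
  moreover have "\<ominus> (inv s \<otimes> t) \<in> poly_span E c m"
    by (rule poly_span_subring_minus[OF SE c(1) poly_span_smult[OF EC iS(3) c(1) subringE(6)[OF SE iS(1)] t(1)]])
  moreover have "c [^] k \<notin> poly_span E c k" if k: "k \<le> m" for k
  proof
    assume *: "c [^] k \<in> poly_span E c k"
    then obtain j where j: "k = Suc j" by (cases k) auto
    have "b [^] j \<otimes> c [^] k \<in> poly_span E b (Suc j)"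
      by (rule poly_span_reverse[OF EA b]) (use * j c_def in simp)
    moreover have "b [^] j \<otimes> c [^] k = c" unfolding j using b by (simp add: c_def)
    ultimately obtain l where l: "set l \<subseteq> E" "length l = k" "c = horner l b"
      using j by (auto simp: poly_span_eq_horner)
    have "horner (\<ominus> \<one> # l) b = \<zero>" using l(3) c by (simp add: l_neg)
    moreover have "\<ominus> \<one> \<noteq> \<zero>" by (metis add.inv_eq_1_iff one_closed one_not_zero)
    moreover have "set (\<ominus> \<one> # l) \<subseteq> E" using l(1) subringE(5)[OF SE subringE(3)[OF SE]] by auto
    ultimately obtain i where "i < Suc k" "b [^] i \<in> poly_span E b i"
      using horner_relation[OF E _ b(1), of "\<ominus> \<one> # l"] l(2) by auto
    then show False using min k by auto
  qed
  ultimately show ?thesis unfolding min_relation_def c_def[symmetric] using iS by blast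
qed

definition fractions :: "'a set \<Rightarrow> 'a set" where
  "fractions A = {a \<otimes> inv s | a s. a \<in> A \<and> s \<in> A \<and> s \<noteq> \<zero>}"

lemma fractionsI: "a \<in> A \<Longrightarrow> s \<in> A \<Longrightarrow> s \<noteq> \<zero> \<Longrightarrow> a \<otimes> inv s \<in> fractions A"
  by (auto simp: fractions_def)

lemma fractionsE:
  assumes "f \<in> fractions A"
  obtains a s where "a \<in> A" "s \<in> A" "s \<noteq> \<zero>" "f = a \<otimes> inv s"
  using assms by (auto simp: fractions_def)

lemma subset_fractions:
  assumes "subring A R"
  shows "A \<subseteq> fractions A"
proof
  fix a assume a: "a \<in> A"
  have "a \<otimes> inv \<one> \<in> fractions A" by (rule fractionsI[OF a subringE(3)[OF assms] one_not_zero])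
  then show "a \<in> fractions A" using a subringE(1)[OF assms] by auto
qed

lemma fractions_subfield:
  assumes A: "subring A R"
  shows "subfield (fractions A) R"
proof (rule subfieldI'[OF subringI])
  note A' = subringE[OF A]
  have c: "a \<in> carrier R" if "a \<in> A" for a using that A'(1) by auto
  show "fractions A \<subseteq> carrier R" using c by (auto simp: fractions_def)
  show "\<one> \<in> fractions A" using subset_fractions[OF A] A'(3) by blast
  show "\<ominus> h \<in> fractions A" if h: "h \<in> fractions A" for h
  proof -
    obtain a s where as: "a \<in> A" "s \<in> A" "s \<noteq> \<zero>" "h = a \<otimes> inv s" using h by (rule fractionsE)
    have "\<ominus> h = (\<ominus> a) \<otimes> inv s" using as c by (simp add: l_minus)
    then show ?thesis using fractionsI[OF A'(5)[OF as(1)] as(2,3)] by simp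
  qed
  show "h1 \<otimes> h2 \<in> fractions A" "h1 \<oplus> h2 \<in> fractions A" if h: "h1 \<in> fractions A" "h2 \<in> fractions A" for h1 h2
  proof -
    obtain a s where as: "a \<in> A" "s \<in> A" "s \<noteq> \<zero>" "h1 = a \<otimes> inv s" using h(1) by (rule fractionsE)
    obtain b t where bt: "b \<in> A" "t \<in> A" "t \<noteq> \<zero>" "h2 = b \<otimes> inv t" using h(2) by (rule fractionsE)
    note cc = c[OF as(1)] c[OF as(2)] c[OF bt(1)] c[OF bt(2)]
    have st: "s \<otimes> t \<in> A" "s \<otimes> t \<noteq> \<zero>" using A'(6) as bt cc by (auto simp: integral_iff)
    have "h1 \<otimes> h2 = (a \<otimes> b) \<otimes> inv (s \<otimes> t)"
      using as bt cc by (simp add: inv_prod m_ac)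
    then show "h1 \<otimes> h2 \<in> fractions A" using fractionsI[OF A'(6)[OF as(1) bt(1)] st] by simp
    have "(a \<otimes> t \<oplus> b \<otimes> s) \<otimes> inv (s \<otimes> t) = a \<otimes> inv s \<otimes> (t \<otimes> inv t) \<oplus> b \<otimes> inv t \<otimes> (s \<otimes> inv s)"
      using as bt cc by (simp add: inv_prod l_distr r_distr m_ac del: inv_mult mult_inv_cancel)
    then have "h1 \<oplus> h2 = (a \<otimes> t \<oplus> b \<otimes> s) \<otimes> inv (s \<otimes> t)" using as bt cc by simp
    then show "h1 \<oplus> h2 \<in> fractions A"
      using fractionsI[OF A'(7)[OF A'(6)[OF as(1) bt(2)] A'(6)[OF bt(1) as(2)]] st] by simp
  qed
  show "inv k \<in> fractions A" if k: "k \<in> fractions A - {\<zero>}" for k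
  proof -
    obtain a s where as: "a \<in> A" "s \<in> A" "s \<noteq> \<zero>" "k = a \<otimes> inv s" using k by (auto elim: fractionsE)
    have a: "a \<noteq> \<zero>" using k as c by auto
    have "inv k = s \<otimes> inv a" using as a c by (simp add: inv_prod m_comm)
    then show ?thesis using fractionsI[OF as(2,1) a] by simp
  qed
qed

lemma fractions_least:
  assumes "subfield K R" "A \<subseteq> K"
  shows "fractions A \<subseteq> K"
proof
  fix f assume "f \<in> fractions A"
  then obtain a s where as: "a \<in> A" "s \<in> A" "s \<noteq> \<zero>" "f = a \<otimes> inv s" by (rule fractionsE)
  then show "f \<in> K"
    using subringE(6)[OF subfieldE(1)[OF assms(1)], of a "inv s"] subfield_m_inv(1)[OF assms(1), of s] assms(2) by auto
qed

lemma clear_denominators: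
  assumes A: "subring A R" and z: "z \<in> carrier R"
  shows "u \<in> poly_span (fractions A) z n \<Longrightarrow> \<exists>s\<in>A. s \<noteq> \<zero> \<and> s \<otimes> u \<in> poly_span A z n"
proof (induction n arbitrary: u)
  case 0
  then show ?case using subringE(3)[OF A] by (auto intro!: bexI[of _ \<one>])
next
  case (Suc n)
  note A' = subringE[OF A]
  have c: "a \<in> carrier R" if "a \<in> A" for a using that A'(1) by auto
  obtain f u' where u: "f \<in> fractions A" "u' \<in> poly_span (fractions A) z n" "u = f \<oplus> z \<otimes> u'"
    using Suc.prems by (rule poly_span_SucE)
  obtain a t where at: "a \<in> A" "t \<in> A" "t \<noteq> \<zero>" "f = a \<otimes> inv t" using u(1) by (rule fractionsE)
  obtain s where s: "s \<in> A" "s \<noteq> \<zero>" "s \<otimes> u' \<in> poly_span A z n" using Suc.IH[OF u(2)] by blast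
  have u'c: "u' \<in> carrier R"
    using poly_span_carrier[OF _ z u(2)] subringE(1)[OF subfieldE(1)[OF fractions_subfield[OF A]]] by blast
  have "(t \<otimes> s) \<otimes> u = s \<otimes> (t \<otimes> (inv t \<otimes> a)) \<oplus> z \<otimes> (t \<otimes> (s \<otimes> u'))"
    using at s c u'c z u(3) by (simp add: r_distr m_ac del: mult_inv_cancel)
  then have "(t \<otimes> s) \<otimes> u = s \<otimes> a \<oplus> z \<otimes> (t \<otimes> (s \<otimes> u'))" using at c by simp
  moreover have "t \<otimes> (s \<otimes> u') \<in> poly_span A z n"
    by (rule poly_span_smult[OF A'(1) c[OF at(2)] z A'(6)[OF at(2)] s(3)])
  ultimately have "(t \<otimes> s) \<otimes> u \<in> poly_span A z (Suc n)"
    using poly_span_SucI[OF A'(6)[OF s(1) at(1)]] by simp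
  moreover have "t \<otimes> s \<in> A" "t \<otimes> s \<noteq> \<zero>" using A'(6) at s c by (auto simp: integral_iff)
  ultimately show ?case by blast
qed

text \<open>Clearing the denominators of a monic equation leaves a leading coefficient that is
  nonzero but in general no longer \<open>1\<close>.\<close>

lemma algebraic_relation:
  assumes A: "subring A R" and z: "z \<in> int_closure (fractions A)"
  shows "\<exists>l a. set l \<subseteq> A \<and> a \<in> A \<and> a \<noteq> \<zero> \<and> horner (l @ [a]) z = \<zero>"
proof -
  note A' = subringE[OF A]
  have zc: "z \<in> carrier R" using z int_closure_carrier by blast
  obtain n where n: "z [^] (n::nat) \<in> poly_span (fractions A) z n"
    using z int_closure_iff_monic[OF subfieldE(1)[OF fractions_subfield[OF A]]] by blast
  obtain s where s: "s \<in> A" "s \<noteq> \<zero>" "s \<otimes> z [^] n \<in> poly_span A z n"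
    using clear_denominators[OF A zc n] by blast
  obtain l where l: "set l \<subseteq> A" "length l = n" "s \<otimes> z [^] n = horner l z"
    using s(3) by (auto simp: poly_span_eq_horner)
  have sc: "s \<in> carrier R" using s A'(1) by auto
  have lc: "set l \<subseteq> carrier R" using l A'(1) by auto
  have "horner (l @ [\<ominus> s]) z = horner l z \<oplus> z [^] n \<otimes> \<ominus> s"
    using lc sc zc l(2) by (subst horner_append) auto
  also have "\<dots> = \<zero>" using l(3)[symmetric] sc zc by (simp add: l_minus r_minus m_comm r_neg)
  finally show ?thesis
    using l(1) A'(5)[OF s(1)] s(2) sc by (intro exI[of _ l] exI[of _ "\<ominus> s"]) (simp add: add.inv_eq_1_iff)
qed

lemma generate_ring_insert:
  assumes H: "H \<subseteq> carrier R" and y: "y \<in> carrier R"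
  shows "generate_ring R (insert y H) = simple_extension (generate_ring R H) y"
proof
  have G: "subring (generate_ring R H) R" by (rule generate_ring_is_subring[OF H])
  have S: "subring (simple_extension (generate_ring R H) y) R" by (rule simple_extension_is_subring[OF G y])
  have "H \<subseteq> generate_ring R H" by (auto intro: generate_ring.incl)
  then have 1: "H \<subseteq> simple_extension (generate_ring R H) y"
    using simple_extension_incl[OF subringE(1)[OF G] y] by blast
  show "generate_ring R (insert y H) \<subseteq> simple_extension (generate_ring R H) y"
    by (rule generate_ring_min_subring1) (use H y S 1 simple_extension_mem[OF G y] in auto)
  have Y: "subring (generate_ring R (insert y H)) R" by (rule generate_ring_is_subring) (use H y in auto)
  have 2: "generate_ring R H \<subseteq> generate_ring R (insert y H)"
    by (rule mono_generate_ring) (use H y in auto)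
  have 3: "y \<in> generate_ring R (insert y H)" by (rule generate_ring.incl) simp
  show "simple_extension (generate_ring R H) y \<subseteq> generate_ring R (insert y H)"
    using simple_extension_iff_poly_span[OF G y] poly_span_subset[OF Y 2 3] by blast
qed

lemma generate_ring_subring_eq: "subring A R \<Longrightarrow> generate_ring R A = A"
  using generate_ringI[of A A] subringE(1)[of A R] by auto

text \<open>Since \<open>z\<close> may satisfy relations over \<open>A\<close>, degree and leading
  coefficient belong to the chosen expression of \<open>p\<close> and not to \<open>p\<close>
  itself.\<close>

lemma leading_term:
  assumes A: "subring A R" and z: "z \<in> carrier R" and p: "p \<in> simple_extension A z" "p \<noteq> \<zero>"
  shows "\<exists>e c r. c \<in> A \<and> c \<noteq> \<zero> \<and> r \<in> poly_span A z e \<and> p = r \<oplus> z [^] (e::nat) \<otimes> c"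
proof -
  obtain n where "p \<in> poly_span A z n" using simple_extension_iff_poly_span[OF A z] p(1) by blast
  then obtain l where l: "set l \<subseteq> A" "p = horner l z" by (auto simp: poly_span_eq_horner)
  have "\<exists>x\<in>set l. x \<noteq> \<zero>" using horner_zeros[of l z] z l p(2) by blast
  from split_list_last_prop[OF this] obtain ys x zs
    where s: "l = ys @ x # zs" "x \<noteq> \<zero>" "\<forall>y\<in>set zs. \<not> y \<noteq> \<zero>" by blast
  have c: "set ys \<subseteq> carrier R" "x \<in> carrier R" "set zs \<subseteq> carrier R" "set zs \<subseteq> {\<zero>}"
    using s l(1) subringE(1)[OF A] by auto
  have "p = horner ys z \<oplus> z [^] length ys \<otimes> (x \<oplus> z \<otimes> horner zs z)"
    using c z unfolding l(2) s(1) by (subst horner_append) auto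
  then have "p = horner ys z \<oplus> z [^] length ys \<otimes> x" using c z horner_zeros[OF c(4) z] by simp
  moreover have "horner ys z \<in> poly_span A z (length ys)" "x \<in> A"
    using s l(1) by (auto intro: horner_in_poly_span)
  ultimately show ?thesis using s(2) by blast
qed

end

section \<open>Nagata's substitution\<close>

context field
begin

text \<open>The leading coefficient is taken from \<open>K\<close> itself, so for a field
  \<open>K\<close> it can be divided out to leave a monic expression. As \<open>x\<close> may
  satisfy relations over \<open>A\<close>, one element can have several degrees; even zero can have
  one, and then \<open>x\<close> is integral over \<open>A\<close>.\<close>

definition has_degree :: "'a set \<Rightarrow> 'a set \<Rightarrow> 'a \<Rightarrow> nat \<Rightarrow> 'a \<Rightarrow> bool" where
  "has_degree K A x W u \<longleftrightarrow> (\<exists>c\<in>K. \<exists>v\<in>poly_span A x W. c \<noteq> \<zero> \<and> u = v \<oplus> x [^] W \<otimes> c)"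

text \<open>The substitution of Nagata: the weight of the variable at position \<open>i\<close> is \<open>d ^ i\<close>, so
  distinct monomials of degree less than \<open>d\<close> in each variable have distinct weights.\<close>

primrec nagata :: "'a \<Rightarrow> nat \<Rightarrow> 'a list \<Rightarrow> 'a list" where
  "nagata x d [] = []"
| "nagata x d (y # ys) = (y \<ominus> x [^] (d ^ Suc (length ys))) # nagata x d ys"

lemma length_nagata [simp]: "length (nagata x d ys) = length ys"
  by (induction ys) auto

text \<open>With \<open>y = x [^] e + q\<close> and \<open>q\<close> in \<open>A\<close>, the
  summand \<open>y [^] length l \<otimes> a\<close> has degree \<open>e * length l + W\<close> in
  \<open>x\<close>. Every other summand stays below degree \<open>e * length l\<close>, because its
  power of \<open>y\<close> is lower by at least one and its coefficient has degree below
  \<open>e\<close>.\<close>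

lemma horner_degree:
  assumes K: "subring K R" "K \<subseteq> A" and A: "subring A R" and x: "x \<in> carrier R" and y: "y \<ominus> x [^] e \<in> A" "y \<in> carrier R"
    and l: "\<And>b. b \<in> set l \<Longrightarrow> b = \<zero> \<or> (\<exists>W<e. has_degree K A x W b)" and a: "has_degree K A x W a" "W < e"
  shows "has_degree K A x (e * length l + W) (horner (l @ [a]) y)"
proof -
  note AC = subring_add_closed[OF A] and Ac = subringE(1)[OF A]
  have "y = (y \<ominus> x [^] e) \<oplus> x [^] e \<otimes> \<one>" using x y(2) by (simp add: rsimp)
  moreover have "(y \<ominus> x [^] e) \<oplus> x [^] e \<otimes> \<one> \<in> poly_span A x (Suc e)"
    by (rule poly_span_add[OF AC x poly_span_const[OF AC x y(1)] poly_span_monom[OF AC x subringE(3)[OF A]]])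
  ultimately have y1: "y \<in> poly_span A x (Suc e)" by simp
  have small: "b \<in> poly_span A x (Suc W)" if b: "has_degree K A x W b" for b W
  proof -
    obtain c v where cv: "c \<in> K" "v \<in> poly_span A x W" "b = v \<oplus> x [^] W \<otimes> c"
      using b unfolding has_degree_def by blast
    show ?thesis unfolding cv(3)
      by (rule poly_span_add[OF AC x poly_span_Suc_mono[OF AC x cv(2)] poly_span_monom[OF AC x]]) (use cv K in auto)
  qed
  have coeff: "b \<in> poly_span A x e" if b: "b \<in> set l" for b
  proof (cases "b = \<zero>")
    case True
    then show ?thesis using poly_span_zero[OF AC x] by simp
  next
    case False
    then obtain V where V: "V < e" "has_degree K A x V b" using l[OF b] by blast
    show ?thesis by (rule poly_span_mono[OF AC x _ small[OF V(2)]]) (use V in simp)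
  qed
  have low: "horner m y \<in> poly_span A x (e * length m)" if "set m \<subseteq> set l" for m
    using that
  proof (induction m)
    case Nil
    then show ?case by simp
  next
    case (Cons b m)
    have h: "horner m y \<in> poly_span A x (e * length m)" using Cons by simp
    have "horner m y \<otimes> y \<in> poly_span A x (e * length m + e)"
      by (rule poly_span_mult[OF AC Ac Ac x subringE(6)[OF A] h y1])
    then have "y \<otimes> horner m y \<in> poly_span A x (e * length m + e)"
      using poly_span_carrier[OF Ac x h] y(2) by (simp add: m_comm)
    moreover have "b \<in> poly_span A x (e * length m + e)"
      by (rule poly_span_mono[OF AC x _ coeff]) (use Cons.prems in auto)
    ultimately show ?case using poly_span_add[OF AC x, of b _ "y \<otimes> horner m y"] by (simp add: add.commute)
  qed
  \<comment> \<open>The leading term of a power of \<open>y\<close> is a power of \<open>x\<close>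
    with coefficient \<open>1\<close>. Here \<open>e\<close> is positive since it exceeds
    \<open>W\<close>.\<close>
  have yn: "\<exists>v\<in>poly_span A x (e * n). y [^] n = v \<oplus> x [^] (e * n)" for n :: nat
  proof (induction n)
    case 0
    show ?case by simp
  next
    case (Suc n)
    then obtain v where v: "v \<in> poly_span A x (e * n)" "y [^] n = v \<oplus> x [^] (e * n)" by blast
    define q where "q = y \<ominus> x [^] e"
    have q: "q \<in> A" "q \<in> carrier R" "y = q \<oplus> x [^] e" using y x Ac by (auto simp: q_def rsimp)
    have vc: "v \<in> carrier R" by (rule poly_span_carrier[OF Ac x v(1)])
    have 0: "e \<noteq> 0" using a by simp
    have "y [^] Suc n = (v \<oplus> x [^] (e * n)) \<otimes> y" using v(2) by simp
    also have "\<dots> = (v \<otimes> y \<oplus> x [^] (e * n) \<otimes> q) \<oplus> x [^] (e * n) \<otimes> x [^] e"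
      unfolding q(3) using vc q(2) x by (simp add: l_distr r_distr a_ac)
    also have "x [^] (e * n) \<otimes> x [^] e = x [^] (e * Suc n)" using x by (simp add: nat_pow_mult add.commute)
    finally have fin: "y [^] Suc n = (v \<otimes> y \<oplus> x [^] (e * n) \<otimes> q) \<oplus> x [^] (e * Suc n)" .
    have "v \<otimes> y \<in> poly_span A x (e * n + e)"
      by (rule poly_span_mult[OF AC Ac Ac x subringE(6)[OF A] v(1) y1])
    moreover have "x [^] (e * n) \<otimes> q \<in> poly_span A x (e * n + e)"
      by (rule poly_span_mono[OF AC x _ poly_span_monom[OF AC x q(1)]]) (use 0 in simp)
    ultimately have "v \<otimes> y \<oplus> x [^] (e * n) \<otimes> q \<in> poly_span A x (e * Suc n)"
      using poly_span_add[OF AC x, of "v \<otimes> y" "e * n + e"] by (simp add: add.commute)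
    then show ?case using fin by blast
  qed
  define n where "n = length l"
  obtain v where v: "v \<in> poly_span A x (e * n)" "y [^] n = v \<oplus> x [^] (e * n)" using yn by blast
  obtain c w where cw: "c \<in> K" "c \<noteq> \<zero>" "w \<in> poly_span A x W" "a = w \<oplus> x [^] W \<otimes> c"
    using a(1) unfolding has_degree_def by blast
  have car: "v \<in> carrier R" "w \<in> carrier R" "c \<in> carrier R"
    using poly_span_carrier[OF Ac x v(1)] poly_span_carrier[OF Ac x cw(3)] cw(1) K(2) Ac by auto
  have lc: "set l \<subseteq> carrier R" using coeff poly_span_carrier[OF Ac x] by blast
  have ac: "a \<in> carrier R" using car x cw(4) by simp
  have 1: "horner l y \<in> poly_span A x (e * n + W)"
    by (rule poly_span_mono[OF AC x _ low[OF order_refl]]) (simp add: n_def)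
  have 2: "v \<otimes> a \<in> poly_span A x (e * n + W)"
    by (rule poly_span_mult[OF AC Ac Ac x subringE(6)[OF A] v(1) small[OF a(1)]])
  have 3: "x [^] (e * n) \<otimes> w \<in> poly_span A x (e * n + W)"
    using poly_span_shift[OF AC x cw(3), of "e * n"] by (simp add: add.commute)
  have "horner (l @ [a]) y = horner l y \<oplus> y [^] n \<otimes> a"
    using lc ac y(2) unfolding n_def by (subst horner_append) auto
  also have "y [^] n \<otimes> a = v \<otimes> a \<oplus> x [^] (e * n) \<otimes> a" unfolding v(2) using car ac x by (simp add: l_distr)
  also have "x [^] (e * n) \<otimes> a = x [^] (e * n) \<otimes> w \<oplus> (x [^] (e * n) \<otimes> x [^] W) \<otimes> c"
    unfolding cw(4) using car x by (simp add: r_distr m_assoc)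
  also have "x [^] (e * n) \<otimes> x [^] W = x [^] (e * n + W)" using x by (simp add: nat_pow_mult)
  finally have "horner (l @ [a]) y = (horner l y \<oplus> (v \<otimes> a \<oplus> x [^] (e * n) \<otimes> w)) \<oplus> x [^] (e * n + W) \<otimes> c"
    using car x ac lc y(2) by (simp add: a_assoc)
  moreover have "horner l y \<oplus> (v \<otimes> a \<oplus> x [^] (e * n) \<otimes> w) \<in> poly_span A x (e * n + W)"
    by (rule poly_span_add[OF AC x 1 poly_span_add[OF AC x 2 3]])
  ultimately show ?thesis unfolding has_degree_def n_def[symmetric] using cw by blast
qed

lemma leading_split:
  assumes A: "subring A R" and z: "z \<in> carrier R" and p: "p \<in> simple_extension A z" "p \<noteq> \<zero>"
  shows "\<exists>l a. set l \<subseteq> A \<and> a \<in> A \<and> a \<noteq> \<zero> \<and> p = horner (l @ [a]) z"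
proof -
  obtain e c r where r: "c \<in> A" "c \<noteq> \<zero>" "r \<in> poly_span A z e" "p = r \<oplus> z [^] (e::nat) \<otimes> c"
    using leading_term[OF assms] by blast
  then obtain l where l: "set l \<subseteq> A" "length l = e" "r = horner l z" by (auto simp: poly_span_eq_horner)
  have "horner (l @ [c]) z = p"
    using l r z subringE(1)[OF A] by (subst horner_append) auto
  then show ?thesis using l r by blast
qed

text \<open>All coefficients occurring in \<open>u\<close> have to be treated with the same
  \<open>d\<close>, hence the formulation for all sufficiently large \<open>d\<close>. The bound on
  \<open>W\<close> carries the induction: coefficients have degree below
  \<open>e = d ^ Suc (length ys)\<close>, and as the degree in \<open>y\<close> is less than
  \<open>d\<close>, the total stays below \<open>e * d\<close>.\<close>

lemma nagata_degree:
  assumes K: "subfield K R" and x: "x \<in> carrier R"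
  shows "set ys \<subseteq> carrier R \<Longrightarrow> u \<in> generate_ring R (K \<union> {x} \<union> set ys) \<Longrightarrow> u \<noteq> \<zero> \<Longrightarrow>
    eventually (\<lambda>d. \<forall>A. subring A R \<and> K \<subseteq> A \<and> set (nagata x d ys) \<subseteq> A \<longrightarrow>
      (\<exists>W<d ^ Suc (length ys). has_degree K A x W u)) sequentially"
proof (induction ys arbitrary: u)
  case Nil
  have SK: "subring K R" using K subfieldE(1) by blast
  have "generate_ring R (K \<union> {x}) = simple_extension K x"
    using generate_ring_insert[OF subringE(1)[OF SK] x] generate_ring_subring_eq[OF SK] by simp
  then obtain W c r where r: "c \<in> K" "c \<noteq> \<zero>" "r \<in> poly_span K x W" "u = r \<oplus> x [^] (W::nat) \<otimes> c"
    using leading_term[OF SK x, of u] Nil by auto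
  have "has_degree K A x W u" if "K \<subseteq> A" for A
    using r poly_span_coeff_mono[OF that] unfolding has_degree_def by blast
  then show ?case
    by (intro eventually_mono[OF eventually_gt_at_top[of W]]) auto
next
  case (Cons y ys)
  have SK: "subring K R" using K subfieldE(1) by blast
  define B where "B = generate_ring R (K \<union> {x} \<union> set ys)"
  have X: "K \<union> {x} \<union> set ys \<subseteq> carrier R" using subringE(1)[OF SK] x Cons.prems(1) by auto
  have B: "subring B R" unfolding B_def by (rule generate_ring_is_subring[OF X])
  have y: "y \<in> carrier R" using Cons.prems(1) by simp
  have "K \<union> {x} \<union> set (y # ys) = insert y (K \<union> {x} \<union> set ys)" by auto
  then have "u \<in> simple_extension B y"
    using Cons.prems(2) generate_ring_insert[OF X y] by (simp add: B_def)
  then obtain l a where l: "set l \<subseteq> B" "a \<in> B" "a \<noteq> \<zero>" "u = horner (l @ [a]) y"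
    using leading_split[OF B y _ Cons.prems(3)] by blast
  have ev: "eventually (\<lambda>d. \<forall>b\<in>set (l @ [a]). b \<noteq> \<zero> \<longrightarrow> (\<forall>A. subring A R \<and> K \<subseteq> A \<and> set (nagata x d ys) \<subseteq> A \<longrightarrow>
      (\<exists>W<d ^ Suc (length ys). has_degree K A x W b))) sequentially"
  proof (rule eventually_ball_finite, simp, intro ballI)
    fix b assume b: "b \<in> set (l @ [a])"
    show "eventually (\<lambda>d. b \<noteq> \<zero> \<longrightarrow> (\<forall>A. subring A R \<and> K \<subseteq> A \<and> set (nagata x d ys) \<subseteq> A \<longrightarrow>
      (\<exists>W<d ^ Suc (length ys). has_degree K A x W b))) sequentially"
    proof (cases "b = \<zero>")
      case False
      have "b \<in> B" using b l by auto
      then show ?thesis using Cons.IH[of b] Cons.prems(1) False by (simp add: B_def)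
    qed simp
  qed
  show ?case
  proof (rule eventually_mono[OF eventually_conj[OF ev eventually_gt_at_top[of "length l"]]], intro allI impI)
    fix d A
    assume d: "(\<forall>b\<in>set (l @ [a]). b \<noteq> \<zero> \<longrightarrow> (\<forall>A. subring A R \<and> K \<subseteq> A \<and> set (nagata x d ys) \<subseteq> A \<longrightarrow>
      (\<exists>W<d ^ Suc (length ys). has_degree K A x W b))) \<and> length l < d"
    assume A: "subring A R \<and> K \<subseteq> A \<and> set (nagata x d (y # ys)) \<subseteq> A"
    define e where "e = d ^ Suc (length ys)"
    have deg: "b = \<zero> \<or> (\<exists>W<e. has_degree K A x W b)" if "b \<in> set (l @ [a])" for b
      using d A that unfolding e_def by auto
    obtain W where W: "W < e" "has_degree K A x W a" using deg[of a] l(3) by auto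
    have ye: "y \<ominus> x [^] e \<in> A" using A by (simp add: e_def)
    have h: "has_degree K A x (e * length l + W) u"
      unfolding l(4) by (rule horner_degree[OF SK _ _ x ye y _ W(2,1)]) (use A deg in auto)
    have "e * length l + W < e * Suc (length l)" using W by simp
    also have "\<dots> \<le> e * d" using d by (intro mult_le_mono) auto
    also have "\<dots> = d ^ Suc (length (y # ys))" by (simp add: e_def)
    finally show "\<exists>W<d ^ Suc (length (y # ys)). has_degree K A x W u" using h by blast
  qed
qed

text \<open>Written in the new elements, the relation for \<open>y\<close> becomes an equation for
  \<open>x\<close> whose leading coefficient is a nonzero constant. So \<open>x\<close> is integral
  over them, and then each old element is as well. A family with an algebraic dependence is thereby
  replaced by one with a member fewer.\<close>

theorem nagata_integral:
  assumes K: "subfield K R" and x: "x \<in> carrier R" and ys: "set (y # ys) \<subseteq> carrier R"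
    and alg: "y \<in> int_closure (fractions (generate_ring R (K \<union> {x} \<union> set ys)))"
  shows "\<exists>d. insert x (set (y # ys)) \<subseteq> int_closure (generate_ring R (K \<union> set (nagata x d (y # ys))))"
proof -
  have SK: "subring K R" using K subfieldE(1) by blast
  define B where "B = generate_ring R (K \<union> {x} \<union> set ys)"
  have X: "K \<union> {x} \<union> set ys \<subseteq> carrier R" using subringE(1)[OF SK] x ys by auto
  have B: "subring B R" unfolding B_def by (rule generate_ring_is_subring[OF X])
  have y: "y \<in> carrier R" using ys by simp
  obtain l a where l: "set l \<subseteq> B" "a \<in> B" "a \<noteq> \<zero>" "horner (l @ [a]) y = \<zero>"
    using algebraic_relation[OF B alg[folded B_def]] by blast
  have ev: "eventually (\<lambda>d. \<forall>b\<in>set (l @ [a]). b \<noteq> \<zero> \<longrightarrow> (\<forall>A. subring A R \<and> K \<subseteq> A \<and> set (nagata x d ys) \<subseteq> A \<longrightarrow>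
      (\<exists>W<d ^ Suc (length ys). has_degree K A x W b))) sequentially"
  proof (rule eventually_ball_finite, simp, intro ballI)
    fix b assume b: "b \<in> set (l @ [a])"
    show "eventually (\<lambda>d. b \<noteq> \<zero> \<longrightarrow> (\<forall>A. subring A R \<and> K \<subseteq> A \<and> set (nagata x d ys) \<subseteq> A \<longrightarrow>
      (\<exists>W<d ^ Suc (length ys). has_degree K A x W b))) sequentially"
    proof (cases "b = \<zero>")
      case False
      have "b \<in> B" using b l by auto
      then show ?thesis using nagata_degree[OF K x, of ys b] ys False by (simp add: B_def)
    qed simp
  qed
  then obtain d where d: "\<forall>b\<in>set (l @ [a]). b \<noteq> \<zero> \<longrightarrow> (\<forall>A. subring A R \<and> K \<subseteq> A \<and> set (nagata x d ys) \<subseteq> A \<longrightarrow>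
      (\<exists>W<d ^ Suc (length ys). has_degree K A x W b))"
    using eventually_happens'[OF sequentially_bot ev] by blast
  define zs where "zs = nagata x d (y # ys)"
  define A where "A = generate_ring R (K \<union> set zs)"
  have nag: "set (nagata x d ws) \<subseteq> carrier R" if "set ws \<subseteq> carrier R" for ws
    using that x by (induction ws) auto
  have Z: "K \<union> set zs \<subseteq> carrier R" using nag[OF ys] subringE(1)[OF SK] by (auto simp: zs_def)
  have A: "subring A R" unfolding A_def by (rule generate_ring_is_subring[OF Z])
  have KA: "K \<subseteq> A" "set zs \<subseteq> A" unfolding A_def by (auto intro: generate_ring.incl)
  define e where "e = d ^ Suc (length ys)"
  have ysA: "set (nagata x d ys) \<subseteq> A" and ye: "y \<ominus> x [^] e \<in> A" using KA(2) by (auto simp: zs_def e_def)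
  have deg: "b = \<zero> \<or> (\<exists>W<e. has_degree K A x W b)" if "b \<in> set (l @ [a])" for b
    using d A KA(1) ysA that unfolding e_def by auto
  obtain W where W: "W < e" "has_degree K A x W a" using deg[of a] l(3) by auto
  \<comment> \<open>The relation has value zero, so its expression by powers of \<open>x\<close> is
    the desired equation for \<open>x\<close>.\<close>
  have "has_degree K A x (e * length l + W) \<zero>"
    unfolding l(4)[symmetric] by (rule horner_degree[OF SK KA(1) A x ye y _ W(2,1)]) (use deg in auto)
  then obtain n c v where v: "c \<in> K" "c \<noteq> \<zero>" "v \<in> poly_span A x n" "\<zero> = v \<oplus> x [^] (n::nat) \<otimes> c"
    unfolding has_degree_def by blast
  have car: "c \<in> carrier R" "v \<in> carrier R"
    using v(1) subringE(1)[OF SK] poly_span_carrier[OF subringE(1)[OF A] x v(3)] by auto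
  have "inv c \<in> K" using subfield_m_inv(1)[OF K, of c] v(1,2) by blast
  then have ic: "inv c \<in> A" "inv c \<in> carrier R" using KA(1) car v(2) by auto
  have "x [^] n \<otimes> c \<oplus> v = \<zero>" using v(4)[symmetric] car x by (simp add: a_comm)
  then have "\<ominus> v = x [^] n \<otimes> c" using car x by (intro minus_equality) simp_all
  then have "x [^] n \<otimes> c = \<ominus> v" by simp
  then have "inv c \<otimes> (c \<otimes> x [^] n) = inv c \<otimes> \<ominus> v" using x car by (simp only: m_comm[of c] nat_pow_closed)
  then have "x [^] n = inv c \<otimes> \<ominus> v" using x car v(2) by simp
  moreover have "inv c \<otimes> \<ominus> v \<in> poly_span A x n"
    by (rule poly_span_smult[OF subringE(1)[OF A] ic(2) x subringE(6)[OF A ic(1)] poly_span_subring_minus[OF A x v(3)]])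
  ultimately have xI: "x \<in> int_closure A" using int_closure_iff_monic[OF A, of x] x by metis
  note I = int_closure_subring[of A]
  have "set ws \<subseteq> int_closure A" if "set (nagata x d ws) \<subseteq> A" "set ws \<subseteq> carrier R" for ws
    using that
  proof (induction ws)
    case (Cons w ws)
    have w: "w \<ominus> x [^] (d ^ Suc (length ws)) \<in> int_closure A" "w \<in> carrier R"
      using Cons.prems int_closure_superset[OF subringE(1)[OF A]] by auto
    have "(w \<ominus> x [^] (d ^ Suc (length ws))) \<oplus> x [^] (d ^ Suc (length ws)) \<in> int_closure A"
      by (rule subringE(7)[OF I w(1) subring_pow[OF I xI]])
    then have "w \<in> int_closure A" using w(2) x by (simp add: rsimp)
    then show ?case using Cons by simp
  qed simp
  from this[of "y # ys"] have "insert x (set (y # ys)) \<subseteq> int_closure A"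
    using KA(2) ys xI by (simp add: zs_def)
  then show ?thesis unfolding A_def zs_def by blast
qed

end

section \<open>Degrees and the exchange of transcendental elements\<close>

context field
begin

text \<open>Where \<open>v\<close> is infinite, a polynomial in \<open>v\<close> of degree below
  \<open>e\<close> has a pole of smaller order than \<open>v [^] e\<close>.\<close>

lemma poly_in_valuation_top:
  assumes A: "subring A R" and v: "v \<in> carrier R" and W: "valuation_subring W" "A \<subseteq> W" "inv v \<in> nonunits W" "v \<noteq> \<zero>"
    and r: "r \<in> poly_span A v e"
  shows "inv v [^] e \<otimes> r \<in> nonunits W"
proof (cases e)
  case 0
  then show ?thesis using r v W nonunits_zero[OF valuation_subring_subring[OF W(1)]] by simp
next
  case (Suc n)
  note S = valuation_subring_subring[OF W(1)]
  have iv: "inv v \<in> W" "inv v \<in> carrier R" using W v nonunits_subset by auto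
  have rc: "r \<in> carrier R" by (rule poly_span_carrier[OF subringE(1)[OF A] v r])
  have "inv v [^] n \<otimes> r \<in> poly_span A (inv v) (Suc n)"
    by (rule poly_span_reverse[OF subring_add_closed[OF A]]) (use v W(4) r Suc in simp_all)
  then have "inv v [^] n \<otimes> r \<in> W" by (rule poly_span_subset[OF S W(2) iv(1)])
  then have "(inv v [^] n \<otimes> r) \<otimes> inv v \<in> nonunits W" by (rule nonunits_smult[OF S _ W(3)])
  moreover have "(inv v [^] n \<otimes> r) \<otimes> inv v = inv v [^] e \<otimes> r"
    unfolding Suc using rc iv by (simp add: m_ac)
  ultimately show ?thesis by simp
qed

text \<open>Where \<open>y\<close> is infinite the leading term decides, so \<open>p\<close> has the
  value of \<open>y [^] e\<close>. The exponent comes from an expression of \<open>p\<close> and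
  serves all valuation rings \<open>W\<close> at once.\<close>

lemma valuation_degree:
  assumes k: "subfield k R" and y: "y \<in> carrier R" and p: "p \<in> simple_extension k y" "p \<noteq> \<zero>"
  shows "\<exists>e::nat. \<forall>W. valuation_subring W \<and> k \<subseteq> W \<and> y \<notin> W \<longrightarrow>
    inv y [^] e \<otimes> p \<in> W \<and> inv y [^] e \<otimes> p \<notin> nonunits W"
proof -
  have SK: "subring k R" using k subfieldE(1) by blast
  obtain e c r where r: "c \<in> k" "c \<noteq> \<zero>" "r \<in> poly_span k y e" "p = r \<oplus> y [^] (e::nat) \<otimes> c"
    using leading_term[OF SK y p] by blast
  have car: "c \<in> carrier R" "r \<in> carrier R"
    using r(1) subringE(1)[OF SK] poly_span_carrier[OF subringE(1)[OF SK] y r(3)] by auto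
  have "inv y [^] e \<otimes> p \<in> W \<and> inv y [^] e \<otimes> p \<notin> nonunits W"
    if W: "valuation_subring W" "k \<subseteq> W" "y \<notin> W" for W
  proof -
    have iy: "inv y \<in> nonunits W" "y \<noteq> \<zero>" using valuation_subringD[OF W(1) y W(3)] by auto
    have n: "inv y [^] e \<otimes> r \<in> nonunits W" by (rule poly_in_valuation_top[OF SK y W(1,2) iy r(3)])
    have "inv c \<in> k" using subfield_m_inv(1)[OF k, of c] r by blast
    then have "c \<in> W" "c \<notin> nonunits W" using W(2) r(1,2) by (auto simp: nonunits_def)
    moreover have "inv y [^] e \<otimes> p = c \<oplus> inv y [^] e \<otimes> r"
      unfolding r(4) using y iy(2) car by (simp add: r_distr a_comm)
    ultimately show ?thesis using unit_diff_nonunit[OF W(1) _ _ n, of c] by simp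
  qed
  then show ?thesis by blast
qed

text \<open>The element \<open>s\<close> is finite wherever \<open>y\<close> is. It must have a pole
  wherever \<open>y\<close> is infinite, for otherwise it would lie in all valuation rings over
  \<open>k\<close> and be algebraic over \<open>k\<close>. So \<open>y\<close> is finite wherever
  \<open>s\<close> is, which is integrality over \<open>k[s]\<close>.\<close>

lemma integral_over_fraction:
  assumes k: "subfield k R" and y: "y \<in> carrier R" and s: "s \<in> fractions (simple_extension k y)"
    "s \<in> int_closure (simple_extension k y)" "s \<notin> int_closure k"
  shows "y \<in> int_closure (simple_extension k s)"
proof -
  have SK: "subring k R" using k subfieldE(1) by blast
  have kC: "k \<subseteq> carrier R" by (rule subringE(1)[OF SK])
  obtain p q where pq: "p \<in> simple_extension k y" "q \<in> simple_extension k y" "q \<noteq> \<zero>" "s = p \<otimes> inv q"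
    using s(1) by (rule fractionsE)
  have c: "p \<in> carrier R" "q \<in> carrier R"
    using pq subringE(1)[OF simple_extension_is_subring[OF SK y]] by auto
  have sc: "s \<in> carrier R" using s(2) int_closure_carrier by blast
  have p0: "p \<noteq> \<zero>"
  proof
    assume "p = \<zero>"
    then have "s = \<zero>" using pq c by simp
    then show False using s(3) subringE(2)[OF int_closure_subring] by blast
  qed
  obtain e where e: "\<And>W. valuation_subring W \<Longrightarrow> k \<subseteq> W \<Longrightarrow> y \<notin> W \<Longrightarrow>
      inv y [^] (e::nat) \<otimes> p \<in> W \<and> inv y [^] e \<otimes> p \<notin> nonunits W"
    using valuation_degree[OF k y pq(1) p0] by blast
  obtain f where f: "\<And>W. valuation_subring W \<Longrightarrow> k \<subseteq> W \<Longrightarrow> y \<notin> W \<Longrightarrow>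
      inv y [^] (f::nat) \<otimes> q \<in> W \<and> inv y [^] f \<otimes> q \<notin> nonunits W"
    using valuation_degree[OF k y pq(2,3)] by blast
  have spq: "p = s \<otimes> q" using pq c by (simp add: m_assoc)
  show ?thesis
  \<comment> \<open>\<open>e\<close> and \<open>f\<close> are the degrees of numerator and
    denominator; for \<open>e \<le> f\<close> the quotient is finite where \<open>y\<close> is
    infinite.\<close>
  proof (cases "e \<le> f")
    case True
    have "s \<in> W" if W: "valuation_subring W" "k \<subseteq> W" for W
    proof (cases "y \<in> W")
      case True
      have "simple_extension k y \<subseteq> W"
        by (rule simple_extension_subring_incl[OF valuation_subring_subring[OF W(1)] W(2) True])
      then show ?thesis using int_closureD[OF s(2) W(1)] by blast
    next
      case False
      note SW = subringE[OF valuation_subring_subring[OF W(1)]]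
      have iy: "inv y \<in> W" "y \<noteq> \<zero>" using valuation_subringD[OF W(1) y False] nonunits_subset by auto
      define g where "g = inv y [^] f \<otimes> q"
      have g: "g \<in> W" "g \<notin> nonunits W" using f[OF W False] by (auto simp: g_def)
      have g0: "g \<noteq> \<zero>" "inv g \<in> W" "g \<in> carrier R" using g SW(1) nonunits_zero[OF valuation_subring_subring[OF W(1)]]
        by (auto simp: nonunits_def)
      have "inv y [^] (f - e) \<otimes> (inv y [^] e \<otimes> p) \<in> W"
        using SW(6)[OF subring_pow[OF valuation_subring_subring[OF W(1)] iy(1)]] e[OF W False] by blast
      moreover have "inv y [^] (f - e) \<otimes> (inv y [^] e \<otimes> p) = inv y [^] f \<otimes> p"
        using y iy c True by (simp add: m_assoc[symmetric] nat_pow_mult)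
      moreover have "inv y [^] f \<otimes> p = s \<otimes> g"
        unfolding spq g_def using sc c y iy by (simp add: m_lcomm)
      ultimately have "(s \<otimes> g) \<otimes> inv g \<in> W" using SW(6) g0 by simp
      then show ?thesis using sc g0 by (simp add: m_assoc)
    qed
    then have "s \<in> int_closure k" using sc by (simp add: int_closure_def)
    then show ?thesis using s(3) by simp
  next
    case False
    have "y \<in> W" if W: "valuation_subring W" "simple_extension k s \<subseteq> W" for W
    proof (rule ccontr)
      assume yW: "y \<notin> W"
      note S = valuation_subring_subring[OF W(1)]
      have kW: "k \<subseteq> W" using simple_extension_incl[OF kC sc] W(2) by blast
      have sW: "s \<in> W" using simple_extension_mem[OF SK sc] W(2) by blast
      have iy: "inv y \<in> W" "inv y \<in> nonunits W" "y \<noteq> \<zero>" using valuation_subringD[OF W(1) y yW] nonunits_subset by auto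
      obtain h where h: "e - f = Suc h" using False by (cases "e - f") auto
      have "(inv y [^] h \<otimes> (s \<otimes> (inv y [^] f \<otimes> q))) \<otimes> inv y \<in> nonunits W"
        by (rule nonunits_smult[OF S _ iy(2)])
          (use subringE(6)[OF S] subring_pow[OF S iy(1)] sW f[OF W(1) kW yW] in blast)
      moreover have "(inv y [^] h \<otimes> (s \<otimes> (inv y [^] f \<otimes> q))) \<otimes> inv y = (inv y [^] Suc h \<otimes> inv y [^] f) \<otimes> (s \<otimes> q)"
        using y iy sc c by (simp add: m_ac)
      moreover have "inv y [^] Suc h \<otimes> inv y [^] f = inv y [^] e"
      proof -
        have "Suc h + f = e" using h False by simp
        then show ?thesis using y iy nat_pow_mult[of "inv y" "Suc h" f] by (simp del: nat_pow_Suc)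
      qed
      ultimately have "inv y [^] e \<otimes> p \<in> nonunits W" using spq by simp
      then show False using e[OF W(1) kW yW] by blast
    qed
    then show ?thesis using y by (simp add: int_closure_def)
  qed
qed

text \<open>The relation for \<open>u\<close> over \<open>k(v)\<close> is read as a polynomial in
  \<open>v\<close> with coefficients in \<open>k[u]\<close>. Its leading coefficient is a nontrivial
  polynomial expression in \<open>u\<close> over \<open>k\<close> and does not vanish because
  \<open>u\<close> is not algebraic over \<open>k\<close>.\<close>

lemma exchange:
  assumes k: "subfield k R" and u: "u \<in> int_closure (fractions (simple_extension k v))" "u \<notin> int_closure k"
    and v: "v \<in> carrier R"
  shows "v \<in> int_closure (fractions (simple_extension k u))"
proof -
  have SK: "subring k R" using k subfieldE(1) by blast
  have kC: "k \<subseteq> carrier R" by (rule subringE(1)[OF SK])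
  have uc: "u \<in> carrier R" using u(1) int_closure_carrier by blast
  define B where "B = simple_extension k u"
  have B: "subring B R" unfolding B_def by (rule simple_extension_is_subring[OF SK uc])
  note BC = subring_add_closed[OF B] and Bc = subringE(1)[OF B]
  have kB: "k \<subseteq> B" "u \<in> B" unfolding B_def using simple_extension_incl[OF kC uc] simple_extension_mem[OF SK uc] by auto
  have SV: "subring (simple_extension k v) R" by (rule simple_extension_is_subring[OF SK v])
  have hB: "horner cs u \<in> B" if "set cs \<subseteq> k" for cs
    using that
  proof (induction cs)
    case (Cons a cs)
    then show ?case using subringE(7)[OF B, of a] subringE(6)[OF B kB(2), of "horner cs u"] kB(1) by auto
  qed (simp add: subringE(2)[OF B])
  \<comment> \<open>\<open>D\<close> is the highest exponent of \<open>v\<close> in the relation,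
    and \<open>cs\<close> collects the coefficients of \<open>v [^] D\<close> ordered by powers of
    \<open>u\<close>. Here only the list \<open>cs\<close> is known to be nontrivial; that its value
    at \<open>u\<close> is nonzero follows afterwards from the transcendence of
    \<open>u\<close>.\<close>
  have main: "(\<forall>p\<in>set l. p = \<zero>) \<or> (\<exists>D cs rest. set cs \<subseteq> k \<and> (\<exists>c\<in>set cs. c \<noteq> \<zero>) \<and> rest \<in> poly_span B v D \<and>
      horner l u = rest \<oplus> v [^] (D::nat) \<otimes> horner cs u)" (is "?Z l \<or> ?P l")
    if "set l \<subseteq> simple_extension k v" for l
    using that
  proof (induction l)
    case (Cons p l)
    have lc: "set l \<subseteq> carrier R" "p \<in> carrier R" using Cons.prems subringE(1)[OF SV] by auto
    have pl: "horner (p # l) u = p \<oplus> u \<otimes> horner l u" by simp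
    have ub: "u \<otimes> w \<in> poly_span B v n" if "w \<in> poly_span B v n" for w n
      by (rule poly_span_smult[OF Bc uc v subringE(6)[OF B kB(2)] that])
    from Cons consider "?Z l" | D cs rest where "set cs \<subseteq> k" "\<exists>c\<in>set cs. c \<noteq> \<zero>" "rest \<in> poly_span B v D"
      "horner l u = rest \<oplus> v [^] (D::nat) \<otimes> horner cs u" by auto
    then show ?case
    proof cases
      case 1
      show ?thesis
      proof (cases "p = \<zero>")
        case False
        then obtain e c r where r: "c \<in> k" "c \<noteq> \<zero>" "r \<in> poly_span k v e" "p = r \<oplus> v [^] (e::nat) \<otimes> c"
          using leading_term[OF SK v, of p] Cons.prems by auto
        have cc: "c \<in> carrier R" using r kC by auto
        have "horner l u = \<zero>" by (rule horner_zeros) (use 1 uc in auto)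
        then have "horner (p # l) u = r \<oplus> v [^] e \<otimes> horner [c] u" using lc uc cc r(4) by simp
        moreover have "r \<in> poly_span B v e" using r(3) poly_span_coeff_mono[OF kB(1)] by blast
        ultimately have "set [c] \<subseteq> k \<and> (\<exists>c\<in>set [c]. c \<noteq> \<zero>) \<and> r \<in> poly_span B v e \<and> horner (p # l) u = r \<oplus> v [^] e \<otimes> horner [c] u"
          using r by auto
        then show ?thesis by blast
      qed (use 1 in auto)
    next
      case (2 D cs rest)
      define h where "h = horner cs u"
      have csc: "set cs \<subseteq> carrier R" using 2(1) kC by auto
      have h: "h \<in> B" "h \<in> carrier R" using hB[OF 2(1)] Bc by (auto simp: h_def)
      have restc: "rest \<in> carrier R" by (rule poly_span_carrier[OF Bc v 2(3)])
      have lh: "horner l u = rest \<oplus> v [^] D \<otimes> h" using 2(4) by (simp add: h_def)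
      have z: "\<zero> \<in> k" by (rule subringE(2)[OF SK])
      \<comment> \<open>A new constant term without \<open>v [^] D\<close> only shifts
        \<open>cs\<close> by one power of \<open>u\<close>.\<close>
      have low: ?thesis if p: "p \<in> poly_span B v D"
      proof -
        have "horner (p # l) u = (p \<oplus> u \<otimes> rest) \<oplus> v [^] D \<otimes> horner (\<zero> # cs) u"
          unfolding pl lh using lc uc v restc h by (simp add: h_def[symmetric] r_distr m_lcomm a_assoc)
        moreover have "p \<oplus> u \<otimes> rest \<in> poly_span B v D" by (rule poly_span_add[OF BC v p ub[OF 2(3)]])
        moreover have "set (\<zero> # cs) \<subseteq> k" "\<exists>c\<in>set (\<zero> # cs). c \<noteq> \<zero>" using 2 z by auto
        ultimately show ?thesis by blast
      qed
      show ?thesis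
      proof (cases "p = \<zero>")
        case True
        then show ?thesis using low poly_span_zero[OF BC v] by simp
      next
        case False
        then obtain e c r where r: "c \<in> k" "c \<noteq> \<zero>" "r \<in> poly_span k v e" "p = r \<oplus> v [^] (e::nat) \<otimes> c"
          using leading_term[OF SK v, of p] Cons.prems by auto
        have cc: "c \<in> carrier R" "r \<in> carrier R" using r kC poly_span_carrier[OF kC v r(3)] by auto
        have rB: "r \<in> poly_span B v e" using r(3) poly_span_coeff_mono[OF kB(1)] by blast
        \<comment> \<open>If the new term has degree above \<open>D\<close> in \<open>v\<close>, all
          earlier terms become remainder and the leading coefficient starts afresh as
          \<open>[c]\<close>.\<close>
        consider "e < D" | "e = D" | "D < e" by linarith
        then show ?thesis
        proof cases
          case 1
          have "p \<in> poly_span B v (Suc e)" unfolding r(4)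
            by (rule poly_span_add[OF BC v poly_span_Suc_mono[OF BC v rB] poly_span_monom[OF BC v]]) (use r(1) kB in auto)
          then have "p \<in> poly_span B v D" by (rule poly_span_mono[OF BC v, rotated]) (use 1 in simp)
          then show ?thesis by (rule low)
        next
          case 2
          have "horner (p # l) u = (r \<oplus> u \<otimes> rest) \<oplus> v [^] D \<otimes> horner (c # cs) u"
            unfolding pl lh using r(4) 2 lc uc v restc h cc by (simp add: h_def[symmetric] r_distr m_lcomm a_ac)
          moreover have "r \<oplus> u \<otimes> rest \<in> poly_span B v D"
            by (rule poly_span_add[OF BC v _ ub]) (use rB 2 \<open>rest \<in> poly_span B v D\<close> in auto)
          moreover have "set (c # cs) \<subseteq> k" "\<exists>c\<in>set (c # cs). c \<noteq> \<zero>" using \<open>set cs \<subseteq> k\<close> r by auto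
          ultimately show ?thesis by blast
        next
          case 3
          have "horner l u \<in> poly_span B v (Suc D)" unfolding lh
            by (rule poly_span_add[OF BC v poly_span_Suc_mono[OF BC v \<open>rest \<in> poly_span B v D\<close>] poly_span_monom[OF BC v h(1)]])
          then have "horner l u \<in> poly_span B v e" by (rule poly_span_mono[OF BC v, rotated]) (use 3 in simp)
          then have re: "r \<oplus> u \<otimes> horner l u \<in> poly_span B v e" using poly_span_add[OF BC v rB ub] by blast
          have "horner (p # l) u = (r \<oplus> u \<otimes> horner l u) \<oplus> v [^] e \<otimes> horner [c] u"
            unfolding pl using r(4) lc uc v cc by (simp add: a_ac)
          moreover have "set [c] \<subseteq> k" "\<exists>c\<in>set [c]. c \<noteq> \<zero>" using r by auto
          ultimately show ?thesis using re by blast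
        qed
      qed
    qed
  qed simp
  obtain l a where l: "set l \<subseteq> simple_extension k v" "a \<in> simple_extension k v" "a \<noteq> \<zero>" "horner (l @ [a]) u = \<zero>"
    using algebraic_relation[OF SV u(1)] by blast
  have la: "set (l @ [a]) \<subseteq> simple_extension k v" "\<not> (\<forall>p\<in>set (l @ [a]). p = \<zero>)" using l by auto
  obtain D cs rest where r: "set cs \<subseteq> k" "\<exists>c\<in>set cs. c \<noteq> \<zero>" "rest \<in> poly_span B v D"
    "\<zero> = rest \<oplus> v [^] (D::nat) \<otimes> horner cs u"
    using main[OF la(1)] la(2) unfolding l(4) by blast
  define h where "h = horner cs u"
  have h0: "h \<noteq> \<zero>" using algebraic_if_relation[OF k r(1) uc _ r(2)] u(2) by (auto simp: h_def)
  have h: "h \<in> B" "h \<in> carrier R" using hB[OF r(1)] Bc by (auto simp: h_def)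
  define L where "L = fractions B"
  have L: "subfield L R" and BL: "B \<subseteq> L" unfolding L_def by (rule fractions_subfield[OF B], rule subset_fractions[OF B])
  obtain q where q: "set q \<subseteq> B" "length q = D" "rest = horner q v" using r(3) by (auto simp: poly_span_eq_horner)
  have "horner (q @ [h]) v = \<zero>"
    using q(1) Bc v h q(2,3) r(4)[symmetric] by (subst horner_append) (auto simp: h_def)
  then have "v \<in> int_closure L"
    by (rule algebraic_if_relation[OF L _ v, rotated]) (use q BL h h0 in auto)
  then show ?thesis by (simp add: L_def B_def)
qed

text \<open>An expression of \<open>inv s\<close> in \<open>k[s]\<close>, multiplied by
  \<open>s\<close>, is a polynomial relation for \<open>s\<close> with nonzero constant
  term.\<close>

lemma inv_transcendental:
  assumes k: "subfield k R" and s: "s \<in> carrier R" "s \<notin> int_closure k"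
  shows "inv s \<notin> simple_extension k s"
proof
  have SK: "subring k R" using k subfieldE(1) by blast
  have s0: "s \<noteq> \<zero>" using s subringE(2)[OF int_closure_subring] by blast
  assume "inv s \<in> simple_extension k s"
  then obtain n where "inv s \<in> poly_span k s n" using simple_extension_iff_poly_span[OF SK s(1)] by blast
  then obtain l where l: "set l \<subseteq> k" "inv s = horner l s" by (auto simp: poly_span_eq_horner)
  have "horner (\<ominus> \<one> # l) s = \<zero>" using l(2)[symmetric] s(1) s0 by (simp add: l_neg)
  moreover have "\<ominus> \<one> \<noteq> \<zero>" by (metis add.inv_eq_1_iff one_closed one_not_zero)
  moreover have "set (\<ominus> \<one> # l) \<subseteq> k" using l(1) subringE(5)[OF SK subringE(3)[OF SK]] by auto
  ultimately have "s \<in> int_closure k" using algebraic_if_relation[OF k _ s(1), of "\<ominus> \<one> # l"] by auto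
  then show False using s by simp
qed

end

section \<open>Noether normalization and the choice of the new place\<close>

context field
begin

lemma generate_ring_carrier_subring:
  assumes "K \<subseteq> carrier R" "set xs \<subseteq> carrier R"
  shows "subring (generate_ring R (K \<union> set xs)) R"
  by (rule generate_ring_is_subring) (use assms in auto)

lemma fractions_mono: "A \<subseteq> B \<Longrightarrow> fractions A \<subseteq> fractions B"
  by (auto simp: fractions_def)

text \<open>A shortest list over which everything is integral
  consists of algebraically independent elements.\<close>

lemma noether_normalization:
  assumes K: "subfield K R" and P: "valuation_subring P" "K \<subseteq> P" and S: "finite S" "S \<subseteq> P"
  shows "\<exists>zs. set zs \<subseteq> P \<and> S \<subseteq> int_closure (generate_ring R (K \<union> set zs)) \<and>
    (\<forall>us y vs. zs = us @ y # vs \<longrightarrow> y \<notin> int_closure (fractions (generate_ring R (K \<union> set (us @ vs)))))"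
proof -
  have SK: "subring K R" using K subfieldE(1) by blast
  note SP = valuation_subring_subring[OF P(1)]
  have PC: "P \<subseteq> carrier R" by (rule subringE(1)[OF SP])
  have KC: "K \<subseteq> carrier R" by (rule subringE(1)[OF SK])
  define good where "good zs \<longleftrightarrow> set zs \<subseteq> P \<and> S \<subseteq> int_closure (generate_ring R (K \<union> set zs))" for zs
  obtain rs where rs: "set rs = S" using finite_list[OF S(1)] by blast
  have "S \<subseteq> generate_ring R (K \<union> set rs)" using rs by (auto intro: generate_ring.incl)
  also have "\<dots> \<subseteq> int_closure (generate_ring R (K \<union> set rs))"
    by (rule int_closure_superset, rule generate_ring_incl) (use KC PC S rs in auto)
  finally have "good rs" using rs S by (simp add: good_def)
  then obtain zs where zs: "good zs" "\<And>ws. good ws \<Longrightarrow> length zs \<le> length ws"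
    using ex_has_least_nat[of good rs length] by blast
  have "y \<notin> int_closure (fractions (generate_ring R (K \<union> set (us @ vs))))" if d: "zs = us @ y # vs" for us y vs
  proof
    assume y: "y \<in> int_closure (fractions (generate_ring R (K \<union> set (us @ vs))))"
    have zP: "set us \<subseteq> P" "set vs \<subseteq> P" "y \<in> P" using zs(1) d by (auto simp: good_def)
    have shorter: False if w: "set ws \<subseteq> P" "set zs \<subseteq> int_closure (generate_ring R (K \<union> set ws))" "length ws < length zs" for ws
    proof -
      define G where "G = generate_ring R (K \<union> set ws)"
      have "K \<subseteq> G" unfolding G_def by (auto intro: generate_ring.incl)
      moreover have "G \<subseteq> carrier R" unfolding G_def by (rule generate_ring_incl) (use KC PC w in auto)
      ultimately have "K \<subseteq> int_closure G" using int_closure_superset by blast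
      moreover have "set zs \<subseteq> carrier R" using zs(1) PC by (auto simp: good_def)
      ultimately have "generate_ring R (K \<union> set zs) \<subseteq> int_closure G"
        using w(2) KC generate_ring_min_subring1[OF _ int_closure_subring, of "K \<union> set zs" G]
        by (simp add: G_def)
      then have "int_closure (generate_ring R (K \<union> set zs)) \<subseteq> int_closure G" by (rule int_closure_subset)
      then have "good ws" using zs(1) w(1) unfolding good_def G_def by blast
      then show False using zs(2)[of ws] w(3) by simp
    qed
    show False
    \<comment> \<open>If \<open>y\<close> is the only element of \<open>zs\<close>, it is algebraic
      over \<open>K\<close> and the empty list is good. Otherwise a second element \<open>x\<close>
      is available for the substitution, which does not leave \<open>P\<close>.\<close>
    proof (cases "us @ vs")
      case Nil
      have "generate_ring R K = K" "fractions K = K"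
        using generate_ring_subring_eq[OF SK] fractions_least[OF K order_refl] subset_fractions[OF SK] by auto
      then have "y \<in> int_closure K" using y Nil by simp
      then show False using shorter[of "[]"] d Nil \<open>generate_ring R K = K\<close> by simp
    next
      case (Cons x ys)
      have xy: "x \<in> carrier R" "set (y # ys) \<subseteq> carrier R" "x \<in> P" "set (y # ys) \<subseteq> P"
        using zP PC arg_cong[OF Cons, of set] by auto
      have "K \<union> set (us @ vs) = K \<union> {x} \<union> set ys" unfolding Cons by auto
      then obtain e where e: "insert x (set (y # ys)) \<subseteq> int_closure (generate_ring R (K \<union> set (nagata x e (y # ys))))"
        using nagata_integral[OF K xy(1,2)] y by auto
      have "set (nagata x e ws) \<subseteq> P" if "set ws \<subseteq> P" for ws
        using that by (induction ws) (auto intro!: subring_minus[OF SP] subring_pow[OF SP xy(3)])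
      from this[OF xy(4)] have nP: "set (nagata x e (y # ys)) \<subseteq> P" .
      have "set zs = insert x (set (y # ys))" using d arg_cong[OF Cons, of set] by auto
      moreover have "length zs = Suc (Suc (length ys))" using d arg_cong[OF Cons, of length] by simp
      ultimately show False using shorter[OF nP] e by simp
    qed
  qed
  then show ?thesis using zs(1) unfolding good_def by blast
qed

text \<open>The place \<open>Q\<close> is sought with \<open>b\<close> as a nonunit, because only
  the implication from \<open>b\<close> to the constant coefficient \<open>t\<close> is at hand. The
  constants of the new place are generated by all Noether elements except the one that
  \<open>t\<close> replaces.\<close>

theorem exists_divisorial_center:
  assumes K: "subfield K R" and P: "valuation_subring P" "K \<subseteq> P" and S: "finite S" "S \<subseteq> P"
    and b: "b \<in> nonunits P" "b \<noteq> \<zero>"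
  shows "\<exists>xs t Q. set xs \<subseteq> carrier R \<and> valuation_subring Q \<and> fractions (generate_ring R (K \<union> set xs)) \<subseteq> Q \<and>
    t \<in> nonunits Q \<and> t \<noteq> \<zero> \<and> b \<in> nonunits Q \<and>
    S \<subseteq> int_closure (simple_extension (fractions (generate_ring R (K \<union> set xs))) t)"
proof -
  have SK: "subring K R" using K subfieldE(1) by blast
  note SP = valuation_subring_subring[OF P(1)]
  have PC: "P \<subseteq> carrier R" by (rule subringE(1)[OF SP])
  have KC: "K \<subseteq> carrier R" by (rule subringE(1)[OF SK])
  have bP: "b \<in> P" "b \<in> carrier R" using b nonunits_subset PC by auto
  obtain zs where zs: "set zs \<subseteq> P" "insert b S \<subseteq> int_closure (generate_ring R (K \<union> set zs))"
    and indep: "\<And>us y vs. zs = us @ y # vs \<Longrightarrow> y \<notin> int_closure (fractions (generate_ring R (K \<union> set (us @ vs))))"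
    using noether_normalization[OF K P, of "insert b S"] S bP by blast
  define G where "G = generate_ring R (K \<union> set zs)"
  define E where "E = fractions G"
  have zC: "set zs \<subseteq> carrier R" using zs PC by blast
  have G: "subring G R" unfolding G_def by (rule generate_ring_carrier_subring[OF KC zC])
  have E: "subfield E R" "G \<subseteq> E" unfolding E_def by (rule fractions_subfield[OF G], rule subset_fractions[OF G])
  have GP: "G \<subseteq> P" unfolding G_def by (rule generate_ring_min_subring1[OF _ SP]) (use KC zC zs P in auto)
  have bG: "b \<in> int_closure G" using zs(2) by (simp add: G_def)
  have "b \<in> int_closure E" using bG int_closure_subset[of G E] int_closure_superset[of E] E subringE(1)[OF subfieldE(1)[OF E(1)]] by blast
  then obtain m s where r: "min_relation E b m s" using exists_min_relation[OF E(1) _ b(2)] by blast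
  have s: "s \<in> E" "s \<noteq> \<zero>" using r by (auto simp: min_relation_def)
  \<comment> \<open>This supplies the integrality hypothesis of \<open>min_relation_const\<close>
    for every valuation ring that contains the Noether elements: for \<open>P\<close>, for
    \<open>Q\<close>, and for the rings that test integrality of \<open>s\<close>.\<close>
  have bW: "b \<in> int_closure (W \<inter> E)" if W: "valuation_subring W" "G \<subseteq> W" for W
  proof -
    have "W \<inter> E \<subseteq> carrier R" using subringE(1)[OF subfieldE(1)[OF E(1)]] by blast
    then have "G \<subseteq> int_closure (W \<inter> E)" using W(2) E(2) int_closure_superset[of "W \<inter> E"] by blast
    then show ?thesis using bG int_closure_subset by blast
  qed
  have sP: "s \<in> nonunits P" by (rule min_relation_const(2)[OF P(1) E(1) r bW[OF P(1) GP] b(1)])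
  have sc: "s \<in> carrier R" using sP nonunits_subset PC by blast
  \<comment> \<open>\<open>s\<close> is a nonzero nonunit of \<open>P\<close>, whereas nonzero
    elements algebraic over \<open>K\<close> are units there.\<close>
  have sK: "s \<notin> int_closure K"
  proof
    assume "s \<in> int_closure K"
    then have "inv s \<in> P" using int_closureD[OF int_closure_field_inv[OF K _ s(2)] P] by blast
    then show False using sP s(2) by (simp add: nonunits_def)
  qed
  \<comment> \<open>Along the fields generated by initial segments of \<open>zs\<close>, the element
    \<open>s\<close> becomes algebraic at a first step \<open>i\<close>; the element
    \<open>y\<close> added in that step is the one to be exchanged for \<open>s\<close>.\<close>
  define k where "k i = fractions (generate_ring R (K \<union> set (take i zs)))" for i
  have take_sub: "subring (generate_ring R (K \<union> set (take i zs))) R" for i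
    by (rule generate_ring_carrier_subring[OF KC]) (use zC set_take_subset[of i zs] in blast)
  have kf: "subfield (k i) R" for i unfolding k_def by (rule fractions_subfield[OF take_sub])
  have "k (length zs) = E" by (simp add: k_def E_def G_def)
  then have "s \<in> int_closure (k (length zs))"
    using s int_closure_superset[OF subringE(1)[OF subfieldE(1)[OF E(1)]]] by auto
  then obtain i where i: "i \<le> length zs" "s \<in> int_closure (k i)" "\<And>j. j < i \<Longrightarrow> s \<notin> int_closure (k j)"
    using exists_least_iff[of "\<lambda>i. s \<in> int_closure (k i)"] by (metis not_le_imp_less)
  have "k 0 = K" using fractions_least[OF K order_refl] subset_fractions[OF SK] generate_ring_subring_eq[OF SK]
    by (auto simp: k_def)
  then obtain j where j: "i = Suc j" using sK i(2) by (cases i) auto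
  define us y vs where "us = take j zs" and "y = zs ! j" and "vs = drop (Suc j) zs"
  have d: "zs = us @ y # vs" using i(1) j by (simp add: us_def y_def vs_def id_take_nth_drop)
  have yc: "y \<in> carrier R" using zC d by auto
  define xs where "xs = us @ vs"
  define k0 where "k0 = fractions (generate_ring R (K \<union> set xs))"
  have xsC: "set xs \<subseteq> carrier R" using zC d by (auto simp: xs_def)
  have G0: "subring (generate_ring R (K \<union> set xs)) R" by (rule generate_ring_carrier_subring[OF KC xsC])
  have k0: "subfield k0 R" unfolding k0_def by (rule fractions_subfield[OF G0])
  have Sk0: "subring k0 R" using k0 subfieldE(1) by blast
  have k0C: "k0 \<subseteq> carrier R" by (rule subringE(1)[OF Sk0])
  have Hk0: "K \<union> set xs \<subseteq> k0" unfolding k0_def using subset_fractions[OF G0] generate_ring.incl[of _ "K \<union> set xs" R] by blast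
  have yk0: "y \<notin> int_closure k0" using indep[OF d] by (simp add: k0_def xs_def)
  have kjk0: "k j \<subseteq> k0" unfolding k_def k0_def
    by (rule fractions_mono, rule mono_generate_ring) (use KC xsC in \<open>auto simp: xs_def us_def\<close>)
  have ki: "k i \<subseteq> fractions (simple_extension (k j) y)"
  proof -
    have "K \<union> set (take i zs) = insert y (K \<union> set us)"
      using i(1) by (auto simp: j us_def y_def take_Suc_conv_app_nth)
    moreover have "K \<union> set us \<subseteq> carrier R" using KC zC d by auto
    ultimately have "generate_ring R (K \<union> set (take i zs)) = simple_extension (generate_ring R (K \<union> set us)) y"
      using generate_ring_insert[OF _ yc] by simp
    also have "\<dots> \<subseteq> simple_extension (k j) y"
      by (rule mono_simple_extension) (use subset_fractions[OF take_sub[of j]] in \<open>simp add: k_def us_def\<close>)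
    finally show ?thesis unfolding k_def[of i] by (rule fractions_mono)
  qed
  \<comment> \<open>Were \<open>s\<close> algebraic over \<open>k0\<close>, the exchange of
    \<open>y\<close> and \<open>s\<close> over \<open>k j\<close> would make \<open>y\<close>
    algebraic over the other elements of \<open>zs\<close>.\<close>
  have s0: "s \<notin> int_closure k0"
  proof
    assume a: "s \<in> int_closure k0"
    have "s \<in> int_closure (fractions (simple_extension (k j) y))"
      using i(2) int_closure_subset[of "k i"] ki int_closure_superset[of "fractions (simple_extension (k j) y)"]
        subringE(1)[OF subfieldE(1)[OF fractions_subfield[OF simple_extension_is_subring[OF subfieldE(1)[OF kf[of j]] yc]]]] by blast
    then have "y \<in> int_closure (fractions (simple_extension (k j) s))"
      by (rule exchange[OF kf _ i(3) yc]) (simp add: j)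
    moreover have "fractions (simple_extension (k j) s) \<subseteq> int_closure k0"
    proof (rule fractions_least[OF int_closure_subfield[OF k0]], rule simple_extension_subring_incl[OF int_closure_subring _ a])
      show "k j \<subseteq> int_closure k0" using kjk0 int_closure_superset[OF k0C] by blast
    qed
    ultimately show False using yk0 int_closure_subset by blast
  qed
  have SY: "subring (simple_extension k0 y) R" by (rule simple_extension_is_subring[OF Sk0 yc])
  have GY: "G \<subseteq> simple_extension k0 y" unfolding G_def
  proof (rule generate_ring_min_subring1[OF _ SY])
    show "K \<union> set zs \<subseteq> carrier R" using KC zC by blast
    show "K \<union> set zs \<subseteq> simple_extension k0 y"
      using simple_extension_incl[OF k0C yc] simple_extension_mem[OF Sk0 yc] Hk0 d by (auto simp: xs_def)
  qed
  \<comment> \<open>\<open>s\<close> lies in every valuation ring containing \<open>k0[y]\<close>,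
    so it is integral over \<open>k0[y]\<close>; by the comparison of degrees \<open>y\<close> is
    then integral over \<open>k0[s]\<close>.\<close>
  have y_int: "y \<in> int_closure (simple_extension k0 s)"
  proof (rule integral_over_fraction[OF k0 yc _ _ s0])
    show "s \<in> fractions (simple_extension k0 y)" using s(1) fractions_mono[OF GY] by (auto simp: E_def)
    have "s \<in> W" if W: "valuation_subring W" "simple_extension k0 y \<subseteq> W" for W
      by (rule min_relation_const(1)[OF W(1) E(1) r bW[OF W(1)]]) (use GY W in blast)
    then show "s \<in> int_closure (simple_extension k0 y)" using sc by (simp add: int_closure_def)
  qed
  define T where "T = simple_extension k0 s"
  have T: "subring T R" unfolding T_def by (rule simple_extension_is_subring[OF Sk0 sc])
  have kT: "k0 \<subseteq> T" "s \<in> T" unfolding T_def using simple_extension_incl[OF k0C sc] simple_extension_mem[OF Sk0 sc] by auto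
  have "K \<union> set zs \<subseteq> int_closure T"
    using Hk0 kT int_closure_superset[OF subringE(1)[OF T]] y_int d by (auto simp: xs_def T_def)
  then have GT: "G \<subseteq> int_closure T" unfolding G_def
    by (rule generate_ring_min_subring1[OF _ int_closure_subring, rotated]) (use KC zC in auto)
  have ST: "insert b S \<subseteq> int_closure T" using zs(2) int_closure_subset[OF GT] by (auto simp: G_def)
  \<comment> \<open>If there is no such \<open>Q\<close>, then \<open>inv b\<close> is integral over
    \<open>T\<close>. Its minimal equation, whose constant coefficient comes from
    \<open>inv s\<close>, then puts \<open>inv s\<close> into a valuation ring \<open>W\<close> in
    which \<open>s\<close> was chosen to be a nonunit.\<close>
  have "\<exists>Q. valuation_subring Q \<and> T \<subseteq> Q \<and> b \<in> nonunits Q"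
  proof (rule ccontr)
    assume no: "\<not> ?thesis"
    have "inv b \<in> W" if W: "valuation_subring W" "T \<subseteq> W" for W
    proof -
      have "b \<in> W" using int_closureD[OF _ W] ST by blast
      then show ?thesis using no W by (auto simp: nonunits_def)
    qed
    then have ib: "inv b \<in> int_closure T" using bP b by (simp add: int_closure_def)
    obtain W where W: "valuation_subring W" "T \<subseteq> W" "s \<in> nonunits W"
      using exists_valuation_subring[OF T kT(2) s(2)] inv_transcendental[OF k0 sc s0] by (auto simp: T_def)
    have "k0 \<subseteq> E" unfolding k0_def E_def G_def
      by (rule fractions_mono, rule mono_generate_ring) (use KC zC d in \<open>auto simp: xs_def\<close>)
    then have "T \<subseteq> E" unfolding T_def
      by (rule simple_extension_subring_incl[OF subfieldE(1)[OF E(1)] _ s(1)])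
    then have "T \<subseteq> int_closure (W \<inter> E)"
      using W(2) int_closure_superset[of "W \<inter> E"] subringE(1)[OF subfieldE(1)[OF E(1)]] by blast
    then have "inv b \<in> int_closure (W \<inter> E)" using ib int_closure_subset by blast
    then have "inv s \<in> W" by (rule min_relation_const(1)[OF W(1) E(1) min_relation_inv[OF E(1) bP(2) b(2) r]])
    then show False using W(3) s(2) by (simp add: nonunits_def)
  qed
  then obtain Q where Q: "valuation_subring Q" "T \<subseteq> Q" "b \<in> nonunits Q" by blast
  have "G \<subseteq> Q" using GT int_closureD[OF _ Q(1,2)] by blast
  then have "s \<in> nonunits Q" by (rule min_relation_const(2)[OF Q(1) E(1) r bW[OF Q(1)] Q(3)])
  moreover have "k0 \<subseteq> Q" using kT Q by blast
  ultimately show ?thesis using Q xsC s(2) ST unfolding k0_def T_def by blast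
qed

end

context field
begin

section \<open>Finite generation of integral closures in one variable\<close>

lemma combine_map_mult:
  assumes "x \<in> carrier R"
  shows "set Ks \<subseteq> carrier R \<Longrightarrow> set Us \<subseteq> carrier R \<Longrightarrow> combine (map ((\<otimes>) x) Ks) Us = x \<otimes> combine Ks Us"
proof (induction Ks Us rule: combine.induct)
  case (1 a Ks u Us)
  then show ?case using assms by (simp add: r_distr m_assoc)
qed (use assms in auto)

lemma combine_map_vectors:
  assumes "x \<in> carrier R"
  shows "set Ks \<subseteq> carrier R \<Longrightarrow> set Us \<subseteq> carrier R \<Longrightarrow> combine Ks (map ((\<otimes>) x) Us) = x \<otimes> combine Ks Us"
proof (induction Ks Us rule: combine.induct)
  case (1 a Ks u Us)
  then show ?case using assms by (simp add: r_distr m_lcomm)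
qed (use assms in auto)

lemma combine_in_subring:
  assumes "subring A R"
  shows "set Ks \<subseteq> A \<Longrightarrow> set Us \<subseteq> A \<Longrightarrow> combine Ks Us \<in> A"
  by (induction Ks Us rule: combine.induct) (auto simp: subringE[OF assms])

lemma combine_split:
  assumes "z \<in> carrier R" "\<And>g. g \<in> set gs \<Longrightarrow> f g \<in> carrier R \<and> q g \<in> carrier R \<and> g = f g \<oplus> z \<otimes> q g"
  shows "set Us \<subseteq> carrier R \<Longrightarrow> combine gs Us = combine (map f gs) Us \<oplus> z \<otimes> combine (map q gs) Us"
  using assms(2)
proof (induction gs Us rule: combine.induct)
  case (1 g gs u Us)
  have g: "f g \<in> carrier R" "q g \<in> carrier R" "g = f g \<oplus> z \<otimes> q g" using 1(3)[of g] by auto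
  have c: "set (map f gs) \<subseteq> carrier R" "set (map q gs) \<subseteq> carrier R" "u \<in> carrier R" "set Us \<subseteq> carrier R"
    using 1(2,3) by auto
  have cc: "combine (map f gs) Us \<in> carrier R" "combine (map q gs) Us \<in> carrier R" using c combine_in_carrier by auto
  have IH: "combine gs Us = combine (map f gs) Us \<oplus> z \<otimes> combine (map q gs) Us" using 1 by auto
  have "combine (g # gs) (u # Us) = (f g \<oplus> z \<otimes> q g) \<otimes> u \<oplus> (combine (map f gs) Us \<oplus> z \<otimes> combine (map q gs) Us)"
    using IH g(3) by simp
  also have "\<dots> = (f g \<otimes> u \<oplus> combine (map f gs) Us) \<oplus> z \<otimes> (q g \<otimes> u \<oplus> combine (map q gs) Us)"
    using g(1,2) c cc assms(1) by (simp add: l_distr r_distr m_assoc a_ac)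
  finally show ?case by simp
qed (use assms(1) in auto)

text \<open>The minimal equation of \<open>z\<close> writes \<open>s\<close> as a multiple of
  \<open>z\<close> within \<open>B\<close>, and \<open>s\<close> is invertible in
  \<open>E\<close>.\<close>

lemma integral_subring_inv:
  assumes E: "subfield E R" and B: "subring B R" "E \<subseteq> B" "B \<subseteq> int_closure E" and z: "z \<in> B" "z \<noteq> \<zero>"
  shows "inv z \<in> B"
proof -
  have zc: "z \<in> carrier R" using z subringE(1)[OF B(1)] by blast
  obtain m s u where r: "s \<in> E" "s \<noteq> \<zero>" "u \<in> poly_span E z m" "z [^] Suc m = s \<oplus> z \<otimes> u"
    using exists_min_relation[OF E _ z(2)] z(1) B(3) unfolding min_relation_def by blast
  have uB: "u \<in> B" by (rule poly_span_subset[OF B(1,2) z(1) r(3)])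
  have c: "u \<in> carrier R" "s \<in> carrier R" using uB r(1) subringE(1)[OF B(1)] B(2) by auto
  have sE: "inv s \<in> B" using subfield_m_inv(1)[OF E, of s] r(1,2) B(2) by blast
  have "s = z \<otimes> (z [^] m \<ominus> u)" using r(4) zc c by (simp add: rsimp)
  then have "z \<otimes> ((z [^] m \<ominus> u) \<otimes> inv s) = \<one>" using zc c r(2) by (simp add: m_assoc[symmetric])
  then have "inv z = (z [^] m \<ominus> u) \<otimes> inv s" by (rule inv_eqI[OF zc, rotated]) (use zc c r(2) in simp)
  moreover have "(z [^] m \<ominus> u) \<otimes> inv s \<in> B"
    by (rule subringE(6)[OF B(1) subring_minus[OF B(1) subring_pow[OF B(1) z(1)] uB] sE])
  ultimately show ?thesis by simp
qed

lemma eval_rev: "set l \<subseteq> carrier R \<Longrightarrow> z \<in> carrier R \<Longrightarrow> eval (rev l) z = horner l z"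
proof (induction l rule: rev_induct)
  case (snoc a l)
  then show ?case by (subst horner_append) (auto simp: a_comm m_comm)
qed simp

lemma algebraic_if_integral:
  assumes E: "subfield E R" and z: "z \<in> int_closure E"
  shows "(algebraic over E) z"
proof -
  have SE: "subring E R" using E subfieldE(1) by blast
  have zc: "z \<in> carrier R" using z int_closure_carrier by blast
  have "fractions E = E" using fractions_least[OF E order_refl] subset_fractions[OF SE] by blast
  then obtain l a where l: "set l \<subseteq> E" "a \<in> E" "a \<noteq> \<zero>" "horner (l @ [a]) z = \<zero>"
    using algebraic_relation[OF SE, of z] z by auto
  have "set (l @ [a]) \<subseteq> carrier R" using l subringE(1)[OF SE] by auto
  then have "eval (rev (l @ [a])) z = \<zero>" using eval_rev[OF _ zc] l(4) by metis
  moreover have "rev (l @ [a]) \<in> carrier (E[X])"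
    using l unfolding univ_poly_carrier[symmetric] polynomial_def by auto
  ultimately show ?thesis by (intro algebraicI[of "rev (l @ [a])"]) auto
qed

text \<open>\<open>N\<close> is the degree of the field over \<open>E\<close>: the finitely many
  elements of \<open>H\<close> are algebraic, so the ring they generate over \<open>E\<close> is
  already a field. Only the dependence of long lists is stated, the form in which it enters the
  bounds on dimensions and on ramification.\<close>

lemma dependency_bound:
  assumes E: "subfield E R" and H: "finite H" "H \<subseteq> int_closure E" "generate_field R (K \<union> H) = carrier R" "K \<subseteq> E"
  shows "\<exists>N. \<forall>Us. set Us \<subseteq> carrier R \<and> length Us > N \<longrightarrow>
    (\<exists>Ks. set Ks \<subseteq> E \<and> length Ks = length Us \<and> (\<exists>x\<in>set Ks. x \<noteq> \<zero>) \<and> combine Ks Us = \<zero>)"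
proof -
  have SE: "subring E R" using E subfieldE(1) by blast
  obtain xs where xs: "set xs = H" using finite_list[OF H(1)] by blast
  have xc: "set xs \<subseteq> carrier R" using H(2) int_closure_carrier xs by blast
  define B where "B = finite_extension E xs"
  have B: "subring B R" unfolding B_def by (rule finite_extension_is_subring[OF SE xc])
  have EB: "E \<subseteq> B" "H \<subseteq> B"
    unfolding B_def using finite_extension_incl[OF subringE(1)[OF SE] xc] finite_extension_mem[OF SE xc] xs by auto
  have "B \<subseteq> int_closure E" unfolding B_def
    by (rule finite_extension_subring_incl[OF int_closure_subring int_closure_superset[OF subringE(1)[OF SE]]])
      (use xs H(2) in auto)
  then have "subfield B R"
    using integral_subring_inv[OF E B EB(1)] by (intro subfieldI'[OF B]) auto
  then have "generate_field R (K \<union> H) \<subseteq> B"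
    by (rule generate_field_min_subfield1[rotated]) (use EB H subringE(1)[OF B] in auto)
  then have BR: "B = carrier R" using H(3) subringE(1)[OF B] by blast
  have "finite_dimension E B" unfolding B_def
    by (rule finite_extension_finite_dimension(1)[OF E xc]) (use algebraic_if_integral[OF E] xs H(2) in blast)
  then obtain N where N: "dimension N E (carrier R)" unfolding BR by blast
  have "\<exists>Ks. set Ks \<subseteq> E \<and> length Ks = length Us \<and> (\<exists>x\<in>set Ks. x \<noteq> \<zero>) \<and> combine Ks Us = \<zero>"
    if Us: "set Us \<subseteq> carrier R" "length Us > N" for Us
  proof -
    have "dependent E Us" using independent_length_le_dimension[OF E N _ Us(1)] Us(2) by auto
    then obtain Ks where Ks: "length Ks = length Us" "combine Ks Us = \<zero>" "set Ks \<subseteq> E" "set Ks \<noteq> {\<zero>}"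
      using dependent_imp_non_trivial_combine[OF E Us(1)] by blast
    have "Ks \<noteq> []" using Ks(1) Us(2) by auto
    then have "\<exists>x\<in>set Ks. x \<noteq> \<zero>" using Ks(4) by (cases Ks) auto
    then show ?thesis using Ks by blast
  qed
  then show ?thesis by blast
qed

lemma constant_term:
  assumes k: "subring k R" and z: "z \<in> carrier R" and h: "h \<in> simple_extension k z"
  shows "\<exists>c\<in>k. \<exists>q\<in>simple_extension k z. h = c \<oplus> z \<otimes> q"
proof -
  obtain n where "h \<in> poly_span k z n" using simple_extension_iff_poly_span[OF k z] h by blast
  then have "h \<in> poly_span k z (Suc n)" by (rule poly_span_Suc_mono[OF subring_add_closed[OF k] z])
  then obtain c q where "c \<in> k" "q \<in> poly_span k z n" "h = c \<oplus> z \<otimes> q" by (rule poly_span_SucE)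
  then show ?thesis using simple_extension_iff_poly_span[OF k z] by blast
qed

text \<open>The exponent \<open>e\<close> is the order of vanishing at \<open>0\<close> of a
  polynomial that represents \<open>h\<close>.\<close>

lemma lowest_term:
  assumes k: "subring k R" and z: "z \<in> carrier R" and h: "h \<in> simple_extension k z" "h \<noteq> \<zero>"
  shows "\<exists>e::nat. \<exists>c\<in>k. \<exists>q\<in>simple_extension k z. c \<noteq> \<zero> \<and> h = z [^] e \<otimes> (c \<oplus> z \<otimes> q)"
proof -
  have ext: "q \<in> simple_extension k z" if "q \<in> poly_span k z n" for q n
    using simple_extension_iff_poly_span[OF k z] that by blast
  have sc: "simple_extension k z \<subseteq> carrier R" by (rule subringE(1)[OF simple_extension_is_subring[OF k z]])
  have "\<exists>e::nat. \<exists>c\<in>k. \<exists>q\<in>simple_extension k z. c \<noteq> \<zero> \<and> h = z [^] e \<otimes> (c \<oplus> z \<otimes> q)"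
    if "h \<in> poly_span k z n" "h \<noteq> \<zero>" for n h
    using that
  proof (induction n arbitrary: h)
    case (Suc n)
    obtain c q where cq: "c \<in> k" "q \<in> poly_span k z n" "h = c \<oplus> z \<otimes> q"
      using Suc.prems(1) by (rule poly_span_SucE)
    have c: "c \<in> carrier R" "q \<in> carrier R" using cq subringE(1)[OF k] ext sc by auto
    show ?case
    proof (cases "c = \<zero>")
      case False
      have "h = z [^] (0::nat) \<otimes> (c \<oplus> z \<otimes> q)" using cq c z by simp
      then show ?thesis using False cq ext by blast
    next
      case True
      then have "q \<noteq> \<zero>" using Suc.prems(2) cq z by auto
      then obtain e c' q' where e: "c' \<in> k" "q' \<in> simple_extension k z" "c' \<noteq> \<zero>" "q = z [^] (e::nat) \<otimes> (c' \<oplus> z \<otimes> q')"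
        using Suc.IH[OF cq(2)] by blast
      have "c' \<in> carrier R" "q' \<in> carrier R" using e subringE(1)[OF k] sc by auto
      then have "h = z [^] Suc e \<otimes> (c' \<oplus> z \<otimes> q')" using cq(3) True e(4) z by (simp add: m_ac)
      then show ?thesis using e by blast
    qed
  qed simp
  then show ?thesis using simple_extension_iff_poly_span[OF k z] h by blast
qed

text \<open>The least of the orders of vanishing is divided out, so that some quotient has a nonzero
  constant term and a relation remains nontrivial when reduced modulo \<open>z\<close>.\<close>

lemma divide_common_power:
  assumes k: "subring k R" and z: "z \<in> carrier R"
    and hs: "set hs \<subseteq> simple_extension k z" "\<exists>h\<in>set hs. h \<noteq> \<zero>"
  shows "\<exists>(e::nat) gs. set gs \<subseteq> simple_extension k z \<and> hs = map ((\<otimes>) (z [^] e)) gs \<and>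
    (\<exists>g\<in>set gs. \<exists>c\<in>k. \<exists>q\<in>simple_extension k z. c \<noteq> \<zero> \<and> g = c \<oplus> z \<otimes> q)"
proof -
  define B where "B = simple_extension k z"
  have B: "subring B R" unfolding B_def by (rule simple_extension_is_subring[OF k z])
  have zB: "z \<in> B" "k \<subseteq> B" unfolding B_def using simple_extension_mem[OF k z] simple_extension_incl[OF subringE(1)[OF k] z] by auto
  define low where "low e h \<longleftrightarrow> (\<exists>c\<in>k. \<exists>q\<in>B. c \<noteq> \<zero> \<and> h = z [^] (e::nat) \<otimes> (c \<oplus> z \<otimes> q))" for e h
  have ex: "\<exists>e. low e h" if "h \<in> set hs" "h \<noteq> \<zero>" for h
    using lowest_term[OF k z _ that(2)] that(1) hs(1) unfolding low_def B_def by blast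
  then have "\<exists>e. \<exists>h\<in>set hs. low e h" using hs(2) by blast
  then obtain e h0 where e: "h0 \<in> set hs" "low e h0" "\<And>d. d < e \<Longrightarrow> \<not> (\<exists>h\<in>set hs. low d h)"
    using exists_least_iff[of "\<lambda>e. \<exists>h\<in>set hs. low e h"] by blast
  have "\<exists>g\<in>B. h = z [^] e \<otimes> g" if h: "h \<in> set hs" for h
  proof (cases "h = \<zero>")
    case True
    then show ?thesis using subringE(2)[OF B] z by (intro bexI[of _ \<zero>]) auto
  next
    case False
    obtain d where d: "low d h" using ex[OF h False] by blast
    then obtain c q where cq: "c \<in> k" "q \<in> B" "h = z [^] d \<otimes> (c \<oplus> z \<otimes> q)" unfolding low_def by blast
    have "e \<le> d" using e(3)[of d] d h by (meson not_le_imp_less)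
    then have "z [^] d = z [^] e \<otimes> z [^] (d - e)" using z by (simp add: nat_pow_mult)
    moreover have m: "c \<oplus> z \<otimes> q \<in> B" using subringE(6,7)[OF B] zB cq by blast
    ultimately have "h = z [^] e \<otimes> (z [^] (d - e) \<otimes> (c \<oplus> z \<otimes> q))"
      using cq(3) z subringE(1)[OF B] by (simp add: m_assoc subset_iff)
    then show ?thesis using subringE(6)[OF B subring_pow[OF B zB(1)] m] by blast
  qed
  then obtain f where f: "\<And>h. h \<in> set hs \<Longrightarrow> f h \<in> B \<and> h = z [^] e \<otimes> f h" by metis
  obtain c q where cq: "c \<in> k" "q \<in> B" "c \<noteq> \<zero>" "h0 = z [^] e \<otimes> (c \<oplus> z \<otimes> q)" using e(2) unfolding low_def by blast
  \<comment> \<open>The quotient at \<open>h0\<close> is prescribed, since the chosen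
    \<open>f\<close> is not known to return the one with nonzero constant term.\<close>
  define f' where "f' = f(h0 := c \<oplus> z \<otimes> q)"
  have m: "c \<oplus> z \<otimes> q \<in> B" using subringE(6,7)[OF B] zB cq by blast
  have f': "f' h \<in> B \<and> h = z [^] e \<otimes> f' h" if "h \<in> set hs" for h
    using f[OF that] m cq(4) by (auto simp: f'_def)
  then have "hs = map ((\<otimes>) (z [^] e)) (map f' hs)" by (simp add: map_idI o_def)
  moreover have "set (map f' hs) \<subseteq> B" using f' by auto
  moreover have "f' h0 \<in> set (map f' hs)" "f' h0 = c \<oplus> z \<otimes> q" using e(1) by (auto simp: f'_def)
  ultimately show ?thesis using cq unfolding B_def by blast
qed

lemma clear_list_denominators:
  assumes B: "subring B R"
  shows "set hs \<subseteq> fractions B \<Longrightarrow> \<exists>s\<in>B. s \<noteq> \<zero> \<and> (\<forall>h\<in>set hs. s \<otimes> h \<in> B)"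
proof (induction hs)
  case Nil
  then show ?case using subringE(3)[OF B] by (intro bexI[of _ \<one>]) auto
next
  case (Cons h hs)
  then obtain s where s: "s \<in> B" "s \<noteq> \<zero>" "\<forall>h\<in>set hs. s \<otimes> h \<in> B" by auto
  obtain a d where ad: "a \<in> B" "d \<in> B" "d \<noteq> \<zero>" "h = a \<otimes> inv d" using Cons.prems by (auto elim: fractionsE)
  have c: "x \<in> carrier R" if "x \<in> B" for x using that subringE(1)[OF B] by auto
  have hsC: "h' \<in> carrier R" if "h' \<in> set hs" for h'
    using that Cons.prems subringE(1)[OF subfieldE(1)[OF fractions_subfield[OF B]]] by auto
  have "(s \<otimes> d) \<otimes> h = s \<otimes> (a \<otimes> (d \<otimes> inv d))" using s ad c by (simp add: m_ac del: inv_mult mult_inv_cancel)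
  then have "(s \<otimes> d) \<otimes> h \<in> B" using s ad c subringE(6)[OF B] by simp
  moreover have "(s \<otimes> d) \<otimes> h' \<in> B" if h': "h' \<in> set hs" for h'
  proof -
    have "(s \<otimes> d) \<otimes> h' = d \<otimes> (s \<otimes> h')" using s ad c hsC[OF h'] by (simp add: m_ac)
    then show ?thesis using subringE(6)[OF B ad(2)] s(3) h' by simp
  qed
  moreover have "s \<otimes> d \<in> B" "s \<otimes> d \<noteq> \<zero>" using subringE(6)[OF B] s ad c by (auto simp: integral_iff)
  ultimately show ?case by auto
qed

text \<open>A dependence over \<open>k(z)\<close> is made polynomial and primitive in
  \<open>z\<close>. Its constant terms then form a nontrivial combination over \<open>k\<close> that
  is a multiple of \<open>z\<close>.\<close>

lemma relation_mod:
  assumes k: "subring k R" and z: "z \<in> carrier R" "z \<noteq> \<zero>" and Us: "set Us \<subseteq> carrier R"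
    and Ks: "set Ks \<subseteq> fractions (simple_extension k z)" "length Ks = length Us" "\<exists>x\<in>set Ks. x \<noteq> \<zero>" "combine Ks Us = \<zero>"
  shows "\<exists>cs qs. set cs \<subseteq> k \<and> set qs \<subseteq> simple_extension k z \<and> length cs = length Us \<and> (\<exists>c\<in>set cs. c \<noteq> \<zero>) \<and>
    combine cs Us \<oplus> z \<otimes> combine qs Us = \<zero>"
proof -
  define B where "B = simple_extension k z"
  have B: "subring B R" unfolding B_def by (rule simple_extension_is_subring[OF k z(1)])
  note Bc = subringE(1)[OF B]
  have KC: "set Ks \<subseteq> carrier R"
    using Ks(1) subringE(1)[OF subfieldE(1)[OF fractions_subfield[OF B]]] by (auto simp: B_def)
  obtain s where s: "s \<in> B" "s \<noteq> \<zero>" "\<forall>h\<in>set Ks. s \<otimes> h \<in> B"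
    using clear_list_denominators[OF B] Ks(1) unfolding B_def by blast
  have sc: "s \<in> carrier R" using s Bc by auto
  define hs where "hs = map ((\<otimes>) s) Ks"
  obtain x where x: "x \<in> set Ks" "x \<noteq> \<zero>" using Ks(3) by blast
  have "s \<otimes> x \<noteq> \<zero>" using x KC sc s(2) by (auto simp: integral_iff)
  then have hs: "set hs \<subseteq> B" "\<exists>h\<in>set hs. h \<noteq> \<zero>"
    using s(3) x(1) by (auto simp: hs_def)
  have hz: "combine hs Us = \<zero>" unfolding hs_def using combine_map_mult[OF sc KC Us] Ks(4) sc by simp
  obtain e gs where gs: "set gs \<subseteq> B" "hs = map ((\<otimes>) (z [^] (e::nat))) gs"
    "\<exists>g\<in>set gs. \<exists>c\<in>k. \<exists>q\<in>B. c \<noteq> \<zero> \<and> g = c \<oplus> z \<otimes> q"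
    using divide_common_power[OF k z(1)] hs unfolding B_def by blast
  have gsC: "set gs \<subseteq> carrier R" using gs(1) Bc by blast
  have "z [^] e \<otimes> combine gs Us = \<zero>" using hz unfolding gs(2) using combine_map_mult[OF _ gsC Us] z by simp
  then have gz: "combine gs Us = \<zero>" using integral_iff[of "z [^] e" "combine gs Us"] z combine_in_carrier[OF gsC Us] by simp
  obtain g0 c0 q0 where g0: "g0 \<in> set gs" "c0 \<in> k" "q0 \<in> B" "c0 \<noteq> \<zero>" "g0 = c0 \<oplus> z \<otimes> q0" using gs(3) by blast
  have "\<forall>g\<in>set gs. \<exists>c q. c \<in> k \<and> q \<in> B \<and> g = c \<oplus> z \<otimes> q"
    using constant_term[OF k z(1)] gs(1) unfolding B_def by blast
  then obtain f q where fq: "\<And>g. g \<in> set gs \<Longrightarrow> f g \<in> k \<and> q g \<in> B \<and> g = f g \<oplus> z \<otimes> q g" by metis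
  \<comment> \<open>Constant term and cofactor of \<open>z\<close> are chosen arbitrarily for each
    \<open>g\<close>, so at \<open>g0\<close> the choice with \<open>c0 \<noteq> \<zero>\<close> has
    to be enforced.\<close>
  define f' q' where "f' = f(g0 := c0)" and "q' = q(g0 := q0)"
  have fq': "f' g \<in> k" "q' g \<in> B" "g = f' g \<oplus> z \<otimes> q' g" if "g \<in> set gs" for g
    using fq[OF that] g0 by (auto simp: f'_def q'_def)
  have "combine gs Us = combine (map f' gs) Us \<oplus> z \<otimes> combine (map q' gs) Us"
    by (rule combine_split[OF z(1) _ Us]) (use fq' subringE(1)[OF k] Bc in blast)
  then have "combine (map f' gs) Us \<oplus> z \<otimes> combine (map q' gs) Us = \<zero>" using gz by simp
  moreover have "set (map f' gs) \<subseteq> k" "set (map q' gs) \<subseteq> B" using fq' by auto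
  moreover have "f' g0 \<in> set (map f' gs)" "f' g0 \<noteq> \<zero>" using g0 by (auto simp: f'_def)
  moreover have "length (map f' gs) = length Us" 
    using arg_cong[OF gs(2), of length] Ks(2) by (simp only: hs_def length_map)
  ultimately show ?thesis unfolding B_def by blast
qed

text \<open>By \<open>dep\<close> the dimension of \<open>W\<close> modulo \<open>M\<close> is at
  most \<open>N\<close>. A longest list that is independent modulo \<open>M\<close> therefore
  exists, and it spans \<open>W\<close> modulo \<open>M\<close>.\<close>

lemma spanning_list_mod:
  assumes k: "subfield k R" and W: "W \<subseteq> carrier R" and M: "add_closed M" "\<And>c x. c \<in> k \<Longrightarrow> x \<in> M \<Longrightarrow> c \<otimes> x \<in> M"
    and dep: "\<And>Us. set Us \<subseteq> W \<Longrightarrow> length Us > N \<Longrightarrow>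
      \<exists>cs. set cs \<subseteq> k \<and> length cs = length Us \<and> (\<exists>c\<in>set cs. c \<noteq> \<zero>) \<and> combine cs Us \<in> M"
  shows "\<exists>Us. set Us \<subseteq> W \<and> (\<forall>u\<in>W. \<exists>cs v. set cs \<subseteq> k \<and> v \<in> M \<and> u = v \<oplus> combine cs Us)"
proof -
  have Sk: "subring k R" using k subfieldE(1) by blast
  have kC: "k \<subseteq> carrier R" by (rule subringE(1)[OF Sk])
  define ind where "ind Us \<longleftrightarrow> set Us \<subseteq> W \<and> \<not> (\<exists>cs. set cs \<subseteq> k \<and> length cs = length Us \<and> (\<exists>c\<in>set cs. c \<noteq> \<zero>) \<and> combine cs Us \<in> M)" for Us
  have bound: "\<forall>Us. ind Us \<longrightarrow> length Us < Suc N"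
    using dep unfolding ind_def by (meson not_less_eq)
  have "ind []" by (simp add: ind_def)
  then obtain Us where Us: "ind Us" "\<And>Vs. ind Vs \<Longrightarrow> length Vs \<le> length Us"
    using ex_has_greatest_nat[OF _ bound] by blast
  have UW: "set Us \<subseteq> W" using Us(1) by (simp add: ind_def)
  have main: "\<exists>cs v. set cs \<subseteq> k \<and> v \<in> M \<and> u = v \<oplus> combine cs Us" if u: "u \<in> W" for u
  proof -
    have "\<not> ind (u # Us)" using Us(2)[of "u # Us"] by auto
    then obtain cs' where cs': "set cs' \<subseteq> k" "length cs' = Suc (length Us)" "\<exists>c\<in>set cs'. c \<noteq> \<zero>" "combine cs' (u # Us) \<in> M"
      using u UW unfolding ind_def by auto
    then obtain c cs where c: "cs' = c # cs" by (cases cs') auto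
    have uc: "u \<in> carrier R" "c \<in> carrier R" "set cs \<subseteq> carrier R" using u W cs'(1) kC unfolding c by auto
    have cc: "combine cs Us \<in> carrier R" by (rule combine_in_carrier[OF uc(3)]) (use UW W in blast)
    have "c \<noteq> \<zero>"
    proof
      assume c0: "c = \<zero>"
      then have "combine cs Us \<in> M" using cs'(4) uc cc by (simp add: c)
      moreover have "\<exists>c\<in>set cs. c \<noteq> \<zero>" using cs'(3) c0 by (auto simp: c)
      ultimately show False using Us(1) cs' c unfolding ind_def by auto
    qed
    then have ic: "inv c \<in> k" "inv c \<in> carrier R" using subfield_m_inv(1)[OF k, of c] cs'(1) c kC by auto
    define v where "v = inv c \<otimes> combine cs' (u # Us)"
    have v: "v \<in> M" unfolding v_def by (rule M(2)[OF ic(1) cs'(4)])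
    have nc: "\<ominus> (inv c) \<in> k" "\<ominus> (inv c) \<in> carrier R" using subringE(5)[OF Sk ic(1)] ic by auto
    have "v = inv c \<otimes> (c \<otimes> u) \<oplus> inv c \<otimes> combine cs Us"
      unfolding v_def c using uc cc ic by (simp add: r_distr del: mult_inv_cancel)
    then have "v = u \<oplus> inv c \<otimes> combine cs Us" using uc \<open>c \<noteq> \<zero>\<close> by simp
    then have "u = v \<oplus> (\<ominus> (inv c)) \<otimes> combine cs Us" using uc ic cc by (simp add: l_minus a_assoc r_neg)
    also have "(\<ominus> (inv c)) \<otimes> combine cs Us = combine (map ((\<otimes>) (\<ominus> (inv c))) cs) Us"
      using combine_map_mult[OF nc(2) uc(3), of Us] UW W by simp
    finally have ueq: "u = v \<oplus> combine (map ((\<otimes>) (\<ominus> (inv c))) cs) Us" .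
    have ks: "set (map ((\<otimes>) (\<ominus> (inv c))) cs) \<subseteq> k" using cs'(1) c subringE(6)[OF Sk nc(1)] by auto
    show ?thesis
      by (rule exI[of _ "map ((\<otimes>) (\<ominus> (inv c))) cs"], rule exI[of _ v], intro conjI ks v ueq)
  qed
  show ?thesis by (rule exI[of _ Us]) (intro conjI ballI UW main)
qed

end

section \<open>Poles at infinity and finiteness of the integral closure\<close>

context field
begin

lemma fractions_inverse_variable:
  assumes k: "subring k R" and z: "z \<in> carrier R" "z \<noteq> \<zero>"
  shows "fractions (simple_extension k z) = fractions (simple_extension k (inv z))"
proof -
  have main: "fractions (simple_extension k x) \<subseteq> fractions (simple_extension k (inv x))"
    if x: "x \<in> carrier R" "x \<noteq> \<zero>" for x
  proof -
    have ix: "inv x \<in> carrier R" "inv x \<noteq> \<zero>" using x by simp_all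
    have S: "subring (simple_extension k (inv x)) R" by (rule simple_extension_is_subring[OF k ix(1)])
    note F = fractions_subfield[OF S]
    have "inv x \<in> fractions (simple_extension k (inv x))"
      using simple_extension_mem[OF k ix(1)] subset_fractions[OF S] by blast
    then have "inv (inv x) \<in> fractions (simple_extension k (inv x))"
      using subfield_m_inv(1)[OF F, of "inv x"] ix(2) by blast
    moreover have "k \<subseteq> fractions (simple_extension k (inv x))"
      using simple_extension_incl[OF subringE(1)[OF k] ix(1)] subset_fractions[OF S] by blast
    ultimately have "simple_extension k x \<subseteq> fractions (simple_extension k (inv x))"
      using simple_extension_subring_incl[OF subfieldE(1)[OF F]] x by simp
    then show ?thesis by (rule fractions_least[OF F])
  qed
  show ?thesis using main[OF z] main[of "inv z"] z by simp
qed

text \<open>In the scaled expression each coefficient acquires a positive power of \<open>w\<close>,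
  and the first factor \<open>w\<close> already carries it into \<open>B\<close>.\<close>

lemma poly_span_scale:
  assumes B: "subring B R" and A: "A \<subseteq> carrier R" and w: "w \<in> B" and z: "z \<in> carrier R"
    and coeff: "\<And>a. a \<in> A' \<Longrightarrow> w \<otimes> a \<in> B" and A': "A' \<subseteq> A"
  shows "u \<in> poly_span A' z m \<Longrightarrow> w [^] m \<otimes> u \<in> poly_span B (w \<otimes> z) m"
proof (induction m arbitrary: u)
  case 0
  then show ?case using w subringE(1)[OF B] by auto
next
  case (Suc m)
  obtain a v where av: "a \<in> A'" "v \<in> poly_span A' z m" "u = a \<oplus> z \<otimes> v"
    using Suc.prems by (rule poly_span_SucE)
  have wc: "w \<in> carrier R" using w subringE(1)[OF B] by blast
  have c: "a \<in> carrier R" "v \<in> carrier R"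
    using av A A' poly_span_carrier[OF _ z av(2)] by auto
  have "w [^] Suc m \<otimes> u = w [^] m \<otimes> (w \<otimes> a) \<oplus> (w \<otimes> z) \<otimes> (w [^] m \<otimes> v)"
    unfolding av(3) using c wc z by (simp add: r_distr m_ac)
  moreover have "w [^] m \<otimes> (w \<otimes> a) \<in> B"
    by (rule subringE(6)[OF B subring_pow[OF B w] coeff[OF av(1)]])
  ultimately show ?case using poly_span_SucI[OF _ Suc.IH[OF av(2)]] by simp
qed

text \<open>Multiplication by a power of \<open>inv t\<close> large enough for all coefficients of
  an integral equation turns these into polynomials in \<open>inv t\<close>. Thus \<open>n\<close>
  bounds the pole order of \<open>z\<close> at infinity.\<close>

lemma integral_pole_order:
  assumes k: "subring k R" and t: "t \<in> carrier R" "t \<noteq> \<zero>" and z: "z \<in> int_closure (simple_extension k t)"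
  shows "\<exists>n::nat. inv t [^] n \<otimes> z \<in> int_closure (simple_extension k (inv t))"
proof -
  define B where "B = simple_extension k t"
  define B' where "B' = simple_extension k (inv t)"
  have it: "inv t \<in> carrier R" "inv t \<noteq> \<zero>" using t by simp_all
  have B: "subring B R" "subring B' R" unfolding B_def B'_def using simple_extension_is_subring[OF k] t it by auto
  have zc: "z \<in> carrier R" using z int_closure_carrier by blast
  have wB: "inv t \<in> B'" unfolding B'_def by (rule simple_extension_mem[OF k it(1)])
  have ev: "eventually (\<lambda>D. inv t [^] D \<otimes> a \<in> B') sequentially" if a: "a \<in> B" for a
  proof -
    obtain n where "a \<in> poly_span k t n" using simple_extension_iff_poly_span[OF k t(1)] a by (auto simp: B_def)
    then have n: "a \<in> poly_span k t (Suc n)" by (rule poly_span_Suc_mono[OF subring_add_closed[OF k] t(1)])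
    have ac: "a \<in> carrier R" using a subringE(1)[OF B(1)] by blast
    have "inv t [^] n \<otimes> a \<in> poly_span k (inv t) (Suc n)"
      by (rule poly_span_reverse[OF subring_add_closed[OF k] it]) (use n t in simp)
    then have m: "inv t [^] n \<otimes> a \<in> B'" using simple_extension_iff_poly_span[OF k it(1)] by (auto simp: B'_def)
    have "inv t [^] D \<otimes> a \<in> B'" if "n \<le> D" for D
    proof -
      have "inv t [^] D \<otimes> a = inv t [^] (D - n) \<otimes> (inv t [^] n \<otimes> a)"
        using it ac that by (simp add: m_assoc[symmetric] nat_pow_mult)
      then show ?thesis using subringE(6)[OF B(2) subring_pow[OF B(2) wB] m] by simp
    qed
    then show ?thesis unfolding eventually_sequentially by blast
  qed
  obtain m where m: "z [^] (m::nat) \<in> poly_span B z m"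
    using z int_closure_iff_monic[OF B(1)] unfolding B_def by blast
  then obtain l where l: "set l \<subseteq> B" "length l = m" "z [^] m = horner l z" by (auto simp: poly_span_eq_horner)
  have all: "eventually (\<lambda>D. \<forall>a\<in>set l. inv t [^] D \<otimes> a \<in> B') sequentially"
    by (rule eventually_ball_finite) (use ev l(1) in auto)
  obtain D :: nat where D: "\<forall>a\<in>set l. inv t [^] D \<otimes> a \<in> B'" using eventually_happens'[OF sequentially_bot all] by blast
  define w where "w = inv t [^] D"
  have w: "w \<in> B'" "w \<in> carrier R" unfolding w_def using subring_pow[OF B(2) wB] it by auto
  have lC: "set l \<subseteq> carrier R" using l(1) subringE(1)[OF B(1)] by blast
  have "horner l z \<in> poly_span (set l) z m" using horner_in_poly_span[OF order_refl, of l z] l(2) by simp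
  then have wl: "w [^] m \<otimes> horner l z \<in> poly_span B' (w \<otimes> z) m"
    using D by (intro poly_span_scale[OF B(2) lC w(1) zc _ order_refl]) (simp_all add: w_def)
  have "(w \<otimes> z) [^] m = w [^] m \<otimes> horner l z" using l(3)[symmetric] w zc by (simp add: nat_pow_distrib)
  then have "(w \<otimes> z) [^] m \<in> poly_span B' (w \<otimes> z) m" using wl by simp
  moreover have "w \<otimes> z \<in> carrier R" using w zc by simp
  ultimately have "w \<otimes> z \<in> int_closure B'" using int_closure_iff_monic[OF B(2), of "w \<otimes> z"] by blast
  then show ?thesis unfolding w_def B'_def by blast
qed

text \<open>Such a \<open>z\<close> has no poles and is therefore algebraic over \<open>k\<close>.
  If it were nonzero, its inverse would be algebraic over \<open>k\<close> too, and \<open>t\<close>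
  would be integral over \<open>k[inv t]\<close>, although \<open>inv t\<close> is a nonunit of some
  valuation ring containing this ring.\<close>

lemma integral_no_pole_zero:
  assumes k: "subfield k R" and t: "t \<in> carrier R" "t \<notin> int_closure k"
    and z: "z \<in> int_closure (simple_extension k t)" "t \<otimes> z \<in> int_closure (simple_extension k (inv t))"
  shows "z = \<zero>"
proof (rule ccontr)
  assume z0: "z \<noteq> \<zero>"
  have Sk: "subring k R" using k subfieldE(1) by blast
  have kC: "k \<subseteq> carrier R" by (rule subringE(1)[OF Sk])
  have t0: "t \<noteq> \<zero>" using t subringE(2)[OF int_closure_subring] by blast
  have it: "inv t \<in> carrier R" "inv t \<noteq> \<zero>" using t t0 by simp_all
  have zc: "z \<in> carrier R" using z(1) int_closure_carrier by blast
  have "z \<in> V" if V: "valuation_subring V" "k \<subseteq> V" for V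
  proof (cases "t \<in> V")
    case True
    then show ?thesis
      using int_closureD[OF z(1) V(1)] simple_extension_subring_incl[OF valuation_subring_subring[OF V(1)] V(2)] by blast
  next
    case False
    then have iV: "inv t \<in> V" using valuation_subringD[OF V(1) t(1)] nonunits_subset by blast
    then have "t \<otimes> z \<in> V"
      using int_closureD[OF z(2) V(1)] simple_extension_subring_incl[OF valuation_subring_subring[OF V(1)] V(2)] by blast
    then have "inv t \<otimes> (t \<otimes> z) \<in> V" by (rule subringE(6)[OF valuation_subring_subring[OF V(1)] iV])
    then show ?thesis using t t0 zc by simp
  qed
  then have "z \<in> int_closure k" using zc by (simp add: int_closure_def)
  then have iz: "inv z \<in> int_closure k" by (rule int_closure_field_inv[OF k _ z0])
  have "k \<subseteq> int_closure (simple_extension k (inv t))"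
    using simple_extension_incl[OF kC it(1)] int_closure_superset[OF subringE(1)[OF simple_extension_is_subring[OF Sk it(1)]]] by blast
  then have "inv z \<in> int_closure (simple_extension k (inv t))" using iz int_closure_subset by blast
  then have "(t \<otimes> z) \<otimes> inv z \<in> int_closure (simple_extension k (inv t))"
    by (rule subringE(6)[OF int_closure_subring z(2)])
  then have tI: "t \<in> int_closure (simple_extension k (inv t))" using t zc z0 by (simp add: m_assoc)
  have "inv t \<notin> int_closure k" using int_closure_field_inv[OF k, of "inv t"] it t t0 by auto
  then have "inv (inv t) \<notin> simple_extension k (inv t)" by (rule inv_transcendental[OF k it(1)])
  then obtain V where V: "valuation_subring V" "simple_extension k (inv t) \<subseteq> V" "inv t \<in> nonunits V"
    using exists_valuation_subring[OF simple_extension_is_subring[OF Sk it(1)] simple_extension_mem[OF Sk it(1)] it(2)] by blast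
  then have "t \<in> V" using int_closureD[OF tI] by blast
  then show False using V(3) t t0 it by (simp add: nonunits_def)
qed

text \<open>The integral closure is filtered by the pole order at infinity. Each step of the
  filtration, and also the closure modulo \<open>t\<close>, has dimension at most \<open>N\<close>
  over \<open>k\<close>, because a dependence over \<open>k(t)\<close> can be reduced modulo
  \<open>inv t\<close> and modulo \<open>t\<close>. From some pole order on, every element differs
  from a combination of fixed ones by \<open>t\<close> times an element of smaller pole order. The
  conclusion speaks of all subrings \<open>B\<close> so that it applies to rings larger than the
  generated one.\<close>

theorem integral_closure_finitely_generated:
  assumes k: "subfield k R" and t: "t \<in> carrier R" "t \<notin> int_closure k"
    and dep: "\<And>Us. set Us \<subseteq> carrier R \<Longrightarrow> length Us > N \<Longrightarrow>
      \<exists>Ks. set Ks \<subseteq> fractions (simple_extension k t) \<and> length Ks = length Us \<and> (\<exists>x\<in>set Ks. x \<noteq> \<zero>) \<and> combine Ks Us = \<zero>"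
  shows "\<exists>H. finite H \<and> H \<subseteq> int_closure (simple_extension k t) \<and>
    (\<forall>B. subring B R \<and> k \<subseteq> B \<and> t \<in> B \<and> H \<subseteq> B \<longrightarrow> int_closure (simple_extension k t) \<subseteq> B)"
proof -
  have Sk: "subring k R" using k subfieldE(1) by blast
  have kC: "k \<subseteq> carrier R" by (rule subringE(1)[OF Sk])
  have t0: "t \<noteq> \<zero>" using t subringE(2)[OF int_closure_subring] by blast
  define w where "w = inv t"
  have w: "w \<in> carrier R" "w \<noteq> \<zero>" "t \<otimes> w = \<one>" "w \<otimes> t = \<one>" using t t0 by (simp_all add: w_def)
  define C where "C = int_closure (simple_extension k t)"
  define C' where "C' = int_closure (simple_extension k w)"
  have C: "subring C R" "subring C' R" unfolding C_def C'_def by (rule int_closure_subring)+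
  note CC = subringE(1)[OF C(1)]
  have Bt: "simple_extension k t \<subseteq> C" "simple_extension k w \<subseteq> C'"
    unfolding C_def C'_def
    using int_closure_superset subringE(1)[OF simple_extension_is_subring[OF Sk t(1)]]
      subringE(1)[OF simple_extension_is_subring[OF Sk w(1)]] by auto
  have kCC: "k \<subseteq> C" "k \<subseteq> C'" "t \<in> C" "w \<in> C'"
    using Bt simple_extension_incl[OF kC t(1)] simple_extension_incl[OF kC w(1)]
      simple_extension_mem[OF Sk t(1)] simple_extension_mem[OF Sk w(1)] by auto
  \<comment> \<open>The factor \<open>t\<close> shifts the index by one: \<open>L n\<close> consists
    of the elements of \<open>C\<close> with pole order less than \<open>n\<close> at infinity, so
    that \<open>L 0\<close> is zero.\<close>
  define L where "L n = {z \<in> C. t \<otimes> (w [^] (n::nat) \<otimes> z) \<in> C'}" for n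
  have LC: "L n \<subseteq> C" for n by (auto simp: L_def)
  have L0: "L 0 = {\<zero>}"
  proof -
    have "z = \<zero>" if "z \<in> L 0" for z
    proof (rule integral_no_pole_zero[OF k t])
      show "z \<in> int_closure (simple_extension k t)" using that by (simp add: L_def C_def)
      then have "z \<in> carrier R" using int_closure_carrier by blast
      then show "t \<otimes> z \<in> int_closure (simple_extension k (inv t))" using that w by (simp add: L_def C'_def w_def)
    qed
    moreover have "\<zero> \<in> L 0" using t w subringE(2)[OF C(1)] subringE(2)[OF C(2)] by (simp add: L_def)
    ultimately show ?thesis by blast
  qed
  have Ladd: "x \<oplus> y \<in> L n" if "x \<in> L n" "y \<in> L n" for x y n
  proof -
    have xy: "x \<in> C" "y \<in> C" "t \<otimes> (w [^] n \<otimes> x) \<in> C'" "t \<otimes> (w [^] n \<otimes> y) \<in> C'" using that by (auto simp: L_def)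
    have c: "x \<in> carrier R" "y \<in> carrier R" using xy CC by auto
    have "t \<otimes> (w [^] n \<otimes> (x \<oplus> y)) = t \<otimes> (w [^] n \<otimes> x) \<oplus> t \<otimes> (w [^] n \<otimes> y)" using c t w by (simp add: r_distr)
    then show ?thesis using subringE(7)[OF C(2) xy(3,4)] subringE(7)[OF C(1) xy(1,2)] by (simp add: L_def)
  qed
  have Lsmult: "c \<otimes> x \<in> L n" if "c \<in> k" "x \<in> L n" for c x n
  proof -
    have x: "x \<in> C" "t \<otimes> (w [^] n \<otimes> x) \<in> C'" "c \<in> carrier R" "x \<in> carrier R" "c \<in> C" "c \<in> C'"
      using that CC kC kCC by (auto simp: L_def)
    have "t \<otimes> (w [^] n \<otimes> (c \<otimes> x)) = c \<otimes> (t \<otimes> (w [^] n \<otimes> x))" using x t w by (simp add: m_lcomm)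
    then show ?thesis using subringE(6)[OF C(2) x(6,2)] subringE(6)[OF C(1) x(5,1)] by (simp add: L_def)
  qed
  have Lzero: "\<zero> \<in> L n" for n using t w subringE(2)[OF C(1)] subringE(2)[OF C(2)] by (simp add: L_def)
  have Lclosed: "add_closed (L n)" for n unfolding add_closed_def using Ladd Lzero LC CC by blast
  have Lmono: "L n \<subseteq> L (n + d)" for n d
  proof
    fix x assume "x \<in> L n"
    then have x: "x \<in> C" "t \<otimes> (w [^] n \<otimes> x) \<in> C'" "x \<in> carrier R" using CC by (auto simp: L_def)
    have "t \<otimes> (w [^] (n + d) \<otimes> x) = w [^] d \<otimes> (t \<otimes> (w [^] n \<otimes> x))"
      using x t w by (simp add: nat_pow_mult[symmetric] m_ac)
    then show "x \<in> L (n + d)" using subringE(6)[OF C(2) subring_pow[OF C(2) kCC(4)] x(2)] x(1) by (simp add: L_def)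
  qed
  have Lex: "\<exists>n. x \<in> L n" if x: "x \<in> C" for x
  proof -
    obtain n where n: "w [^] (n::nat) \<otimes> x \<in> C'"
      using integral_pole_order[OF Sk t(1) t0, of x] x unfolding C_def C'_def w_def by blast
    have xc: "x \<in> carrier R" using x CC by blast
    have "t \<otimes> (w [^] Suc n \<otimes> x) = (t \<otimes> w) \<otimes> (w [^] n \<otimes> x)" using t w(1) xc by (simp add: m_ac)
    then have "t \<otimes> (w [^] Suc n \<otimes> x) \<in> C'" using n w xc by simp
    then show ?thesis using x unfolding L_def by blast
  qed
  have comb: "combine cs Us \<in> C" if "set cs \<subseteq> k" "set Us \<subseteq> C" for cs Us
    using combine_in_subring[OF C(1)] that kCC(1) by auto
  have combL: "combine cs Us \<in> L n" if "set cs \<subseteq> k" "set Us \<subseteq> L n" for cs Us n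
    using that by (induction cs Us rule: combine.induct) (auto simp: Ladd Lsmult Lzero)
  have step: "\<exists>Us. set Us \<subseteq> L (Suc n) \<and> (\<forall>u\<in>L (Suc n). \<exists>cs v. set cs \<subseteq> k \<and> v \<in> L n \<and> u = v \<oplus> combine cs Us)" for n
  proof (rule spanning_list_mod[OF k _ Lclosed Lsmult])
    show "L (Suc n) \<subseteq> carrier R" using LC CC by blast
    fix Us assume Us: "set Us \<subseteq> L (Suc n)" "N < length Us"
    have UC: "set Us \<subseteq> C" using Us(1) LC by blast
    have Uc: "set Us \<subseteq> carrier R" using UC CC by blast
    obtain Ks where Ks: "set Ks \<subseteq> fractions (simple_extension k w)" "length Ks = length Us" "\<exists>x\<in>set Ks. x \<noteq> \<zero>" "combine Ks Us = \<zero>"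
      using dep[OF Uc Us(2)] fractions_inverse_variable[OF Sk t(1) t0] unfolding w_def by auto
    obtain cs qs where cq: "set cs \<subseteq> k" "set qs \<subseteq> simple_extension k w" "length cs = length Us" "\<exists>c\<in>set cs. c \<noteq> \<zero>"
      "combine cs Us \<oplus> w \<otimes> combine qs Us = \<zero>"
      using relation_mod[OF Sk w(1,2) Uc Ks] by blast
    have qC: "set qs \<subseteq> carrier R" using cq(2) Bt(2) subringE(1)[OF C(2)] by blast
    define x where "x = combine cs Us"
    define y where "y = combine qs Us"
    have x: "x \<in> C" "x \<in> carrier R" using comb[OF cq(1) UC] CC by (auto simp: x_def)
    have y: "y \<in> carrier R" unfolding y_def by (rule combine_in_carrier[OF qC Uc])
    \<comment> \<open>Multiplication by \<open>s\<close> makes all entries of \<open>Us\<close>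
      regular at infinity, and the factor \<open>w\<close> in the relation modulo \<open>w\<close>
      lowers the pole order of the combination by one.\<close>
    define s where "s = t \<otimes> w [^] Suc n"
    have s: "s \<in> carrier R" using t w by (simp add: s_def)
    have "set (map ((\<otimes>) s) Us) \<subseteq> C'"
    proof -
      have "s \<otimes> u \<in> C'" if "u \<in> set Us" for u
      proof -
        have "t \<otimes> (w [^] Suc n \<otimes> u) \<in> C'" "u \<in> carrier R" using that Us(1) Uc by (auto simp: L_def)
        then show ?thesis using t w by (simp add: s_def m_assoc)
      qed
      then show ?thesis by auto
    qed
    then have "combine qs (map ((\<otimes>) s) Us) \<in> C'"
      by (rule combine_in_subring[OF C(2), rotated]) (use cq(2) Bt(2) in blast)
    then have sy: "s \<otimes> y \<in> C'" unfolding y_def using combine_map_vectors[OF s qC Uc] by simp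
    have "x \<oplus> w \<otimes> y = \<zero>" using cq(5) by (simp add: x_def y_def)
    then have "\<ominus> (w \<otimes> y) = x" using x y w by (intro minus_equality) simp_all
    then have "t \<otimes> (w [^] n \<otimes> x) = \<ominus> (s \<otimes> y)"
      unfolding s_def using t w y by (auto simp: r_minus m_ac)
    then have "t \<otimes> (w [^] n \<otimes> x) \<in> C'" using subringE(5)[OF C(2) sy] by simp
    then have "combine cs Us \<in> L n" using x(1) by (simp add: L_def x_def)
    then show "\<exists>cs. set cs \<subseteq> k \<and> length cs = length Us \<and> (\<exists>c\<in>set cs. c \<noteq> \<zero>) \<and> combine cs Us \<in> L n"
      using cq by blast
  qed
  \<comment> \<open>The same reduction at \<open>t = 0\<close> shows that \<open>C\<close> modulo
    \<open>t C\<close> is spanned by finitely many elements.\<close>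
  define M where "M = (\<lambda>x. t \<otimes> x) ` C"
  have "\<exists>Us. set Us \<subseteq> C \<and> (\<forall>u\<in>C. \<exists>cs v. set cs \<subseteq> k \<and> v \<in> M \<and> u = v \<oplus> combine cs Us)"
  proof (rule spanning_list_mod[OF k CC])
    have Madd: "x \<oplus> y \<in> M" if xy: "x \<in> M" "y \<in> M" for x y
    proof -
      obtain a b where ab: "a \<in> C" "b \<in> C" "x = t \<otimes> a" "y = t \<otimes> b" using xy by (auto simp: M_def)
      have "a \<in> carrier R" "b \<in> carrier R" using ab CC by auto
      then have "x \<oplus> y = t \<otimes> (a \<oplus> b)" using ab t by (simp add: r_distr)
      then show ?thesis using subringE(7)[OF C(1) ab(1,2)] by (auto simp: M_def)
    qed
    have "t \<otimes> \<zero> \<in> M" using subringE(2)[OF C(1)] by (auto simp: M_def)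
    then show "add_closed M" unfolding add_closed_def using Madd t CC by (auto simp: M_def)
    show "c \<otimes> x \<in> M" if cx: "c \<in> k" "x \<in> M" for c x
    proof -
      obtain a where a: "a \<in> C" "x = t \<otimes> a" using cx by (auto simp: M_def)
      have "a \<in> carrier R" "c \<in> carrier R" "c \<in> C" using a CC cx kC kCC by auto
      then have "c \<otimes> x = t \<otimes> (c \<otimes> a)" "c \<otimes> a \<in> C" using a t subringE(6)[OF C(1)] by (auto simp: m_lcomm)
      then show ?thesis by (auto simp: M_def)
    qed
    fix Us assume Us: "set Us \<subseteq> C" "N < length Us"
    have Uc: "set Us \<subseteq> carrier R" using Us CC by blast
    obtain Ks where Ks: "set Ks \<subseteq> fractions (simple_extension k t)" "length Ks = length Us" "\<exists>x\<in>set Ks. x \<noteq> \<zero>" "combine Ks Us = \<zero>"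
      using dep[OF Uc Us(2)] by auto
    obtain cs qs where cq: "set cs \<subseteq> k" "set qs \<subseteq> simple_extension k t" "length cs = length Us" "\<exists>c\<in>set cs. c \<noteq> \<zero>"
      "combine cs Us \<oplus> t \<otimes> combine qs Us = \<zero>"
      using relation_mod[OF Sk t(1) t0 Uc Ks] by blast
    have y: "combine qs Us \<in> C" by (rule combine_in_subring[OF C(1)]) (use cq(2) Bt(1) Us in auto)
    have c: "combine cs Us \<in> carrier R" "combine qs Us \<in> carrier R" using comb[OF cq(1) Us(1)] y CC by auto
    have "\<ominus> (t \<otimes> combine qs Us) = combine cs Us" using cq(5) c t by (intro minus_equality) simp_all
    then have "combine cs Us = t \<otimes> (\<ominus> combine qs Us)" using c t by (simp add: r_minus)
    then have "combine cs Us \<in> M" using subringE(5)[OF C(1) y] by (auto simp: M_def)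
    then show "\<exists>cs. set cs \<subseteq> k \<and> length cs = length Us \<and> (\<exists>c\<in>set cs. c \<noteq> \<zero>) \<and> combine cs Us \<in> M"
      using cq by blast
  qed
  then obtain Us where Us: "set Us \<subseteq> C" "\<And>u. u \<in> C \<Longrightarrow> \<exists>cs v. set cs \<subseteq> k \<and> v \<in> M \<and> u = v \<oplus> combine cs Us" by blast
  have all: "eventually (\<lambda>n. \<forall>u\<in>set Us. u \<in> L n) sequentially"
  proof (rule eventually_ball_finite, simp, intro ballI)
    fix u assume "u \<in> set Us"
    then obtain n where n: "u \<in> L n" using Lex Us(1) by blast
    have "u \<in> L m" if "n \<le> m" for m using Lmono[of n "m - n"] n that by auto
    then show "eventually (\<lambda>n. u \<in> L n) sequentially" unfolding eventually_sequentially by blast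
  qed
  obtain e where e: "set Us \<subseteq> L e" using eventually_happens'[OF sequentially_bot all] by blast
  \<comment> \<open>Finite spanning lists for the steps of the filtration are collected, starting
    from \<open>L 0 = {\<zero>}\<close>.\<close>
  have gen: "\<exists>H. finite H \<and> H \<subseteq> C \<and> (\<forall>B. subring B R \<and> k \<subseteq> B \<and> H \<subseteq> B \<longrightarrow> L n \<subseteq> B)" for n
  proof (induction n)
    case 0
    have "L 0 \<subseteq> B" if "subring B R" for B using subringE(2)[OF that] L0 by simp
    then show ?case by (intro exI[of _ "{}"]) simp
  next
    case (Suc n)
    then obtain H where H0: "finite H" "H \<subseteq> C" "\<forall>B. subring B R \<and> k \<subseteq> B \<and> H \<subseteq> B \<longrightarrow> L n \<subseteq> B"
      by (elim exE conjE)
    note H = H0(1,2) H0(3)[rule_format, OF conjI[OF _ conjI]]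
    obtain Vs where Vs: "set Vs \<subseteq> L (Suc n)" "\<And>u. u \<in> L (Suc n) \<Longrightarrow> \<exists>cs v. set cs \<subseteq> k \<and> v \<in> L n \<and> u = v \<oplus> combine cs Vs"
      using step[of n] by blast
    have "L (Suc n) \<subseteq> B" if B: "subring B R" "k \<subseteq> B" "H \<union> set Vs \<subseteq> B" for B
    proof
      fix u assume "u \<in> L (Suc n)"
      then obtain cs v where cv: "set cs \<subseteq> k" "v \<in> L n" "u = v \<oplus> combine cs Vs" using Vs(2) by blast
      have "combine cs Vs \<in> B" by (rule combine_in_subring[OF B(1)]) (use cv B in auto)
      moreover have "v \<in> B" using H(3)[OF B(1,2)] B(3) cv(2) by blast
      ultimately show "u \<in> B" unfolding cv(3) using subringE(7)[OF B(1)] by blast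
    qed
    moreover have "finite (H \<union> set Vs)" "H \<union> set Vs \<subseteq> C" using H(1,2) Vs(1) LC[of "Suc n"] by auto
    ultimately show ?case by (intro exI[of _ "H \<union> set Vs"]) simp
  qed
  from gen[of e] obtain H where H0: "finite H" "H \<subseteq> C" "\<forall>B. subring B R \<and> k \<subseteq> B \<and> H \<subseteq> B \<longrightarrow> L e \<subseteq> B"
    by (elim exE conjE)
  note H = H0(1,2) H0(3)[rule_format, OF conjI[OF _ conjI]]
  have "C \<subseteq> B" if B: "subring B R" "k \<subseteq> B" "t \<in> B" "H \<union> set Us \<subseteq> B" for B
  proof -
    \<comment> \<open>Subtracting a combination of \<open>Us\<close> from an element of
      \<open>L (e + Suc d)\<close> leaves \<open>t \<otimes> y\<close>. The combination lies in
      \<open>L e\<close>, so the difference still has bounded poles, and division by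
      \<open>t\<close> puts \<open>y\<close> into \<open>L (e + d)\<close>.\<close>
    have "L (e + d) \<subseteq> B" for d
    proof (induction d)
      case 0
      show ?case using H(3)[OF B(1,2)] B(4) by simp
    next
      case (Suc d)
      show ?case
      proof
        fix u assume u: "u \<in> L (e + Suc d)"
        obtain cs v where cv: "set cs \<subseteq> k" "v \<in> M" "u = v \<oplus> combine cs Us" using Us(2)[of u] u LC[of "e + Suc d"] by auto
        obtain y where y: "y \<in> C" "v = t \<otimes> y" using cv(2) by (auto simp: M_def)
        have co: "combine cs Us \<in> B" by (rule combine_in_subring[OF B(1)]) (use cv B in auto)
        have cL: "combine cs Us \<in> L (e + Suc d)" using combL[OF cv(1) e] Lmono by blast
        have c: "y \<in> carrier R" "combine cs Us \<in> carrier R" "u \<in> carrier R"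
          using y(1) cL u LC[of "e + Suc d"] CC by auto
        have "u \<oplus> (\<ominus> \<one>) \<otimes> combine cs Us \<in> L (e + Suc d)"
          by (rule Ladd[OF u Lsmult[OF subringE(5)[OF Sk subringE(3)[OF Sk]] cL]])
        moreover have "u \<oplus> (\<ominus> \<one>) \<otimes> combine cs Us = t \<otimes> y"
          using cv(3) y(2) c t by (simp add: l_minus a_assoc r_neg)
        ultimately have "t \<otimes> (w [^] Suc (e + d) \<otimes> (t \<otimes> y)) \<in> C'" by (simp add: L_def)
        moreover have "t \<otimes> (w [^] Suc (e + d) \<otimes> (t \<otimes> y)) = t \<otimes> (w [^] (e + d) \<otimes> ((w \<otimes> t) \<otimes> y))"
          using t w(1) c by (simp add: m_ac)
        ultimately have "y \<in> L (e + d)" using w(4) c y(1) by (simp add: L_def)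
        then have "y \<in> B" using Suc by blast
        then have "v \<in> B" using subringE(6)[OF B(1,3)] y(2) by simp
        then show "u \<in> B" unfolding cv(3) using subringE(7)[OF B(1) _ co] by blast
      qed
    qed
    moreover have "C \<subseteq> (\<Union>d. L (e + d))"
    proof
      fix x assume "x \<in> C"
      then obtain n where "x \<in> L n" using Lex by blast
      then have "x \<in> L (e + n)" using Lmono[of n e] by (auto simp: add.commute)
      then show "x \<in> (\<Union>d. L (e + d))" by blast
    qed
    ultimately show ?thesis by blast
  qed
  moreover have "finite (H \<union> set Us)" "H \<union> set Us \<subseteq> C" using H(1,2) Us(1) by auto
  ultimately show ?thesis unfolding C_def by (intro exI[of _ "H \<union> set Us"]) simp
qed

end

context field
begin

section \<open>Discreteness of the valuation\<close>

text \<open>In terms of the value v of \<open>Q\<close>, a list with 0 <= v(w1) < v(w2) < ... <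
  v(t). The inequalities are expressed by quotients, so that no value group appears.\<close>

primrec value_chain :: "'a set \<Rightarrow> 'a \<Rightarrow> 'a list \<Rightarrow> bool" where
  "value_chain Q t [] = True"
| "value_chain Q t (w # ws) \<longleftrightarrow> w \<in> Q \<and> w \<noteq> \<zero> \<and>
     (\<forall>y\<in>insert t (set ws). y \<otimes> inv w \<in> nonunits Q) \<and> value_chain Q t ws"

lemma value_chain_elem: "value_chain Q t ws \<Longrightarrow> w \<in> set ws \<Longrightarrow> w \<in> Q \<and> w \<noteq> \<zero> \<and> t \<otimes> inv w \<in> nonunits Q"
  by (induction ws) auto

lemma subfield_not_nonunit:
  assumes "subfield k R" "k \<subseteq> Q" "c \<in> k" "c \<noteq> \<zero>"
  shows "c \<notin> nonunits Q"
  using subfield_m_inv(1)[OF assms(1), of c] assms by (auto simp: nonunits_def)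

text \<open>Nonzero elements of \<open>k\<close> are units of \<open>Q\<close>, so the first entry
  with nonzero coefficient determines the value of the combination.\<close>

lemma value_chain_combine:
  assumes k: "subfield k R" "k \<subseteq> Q" and Q: "valuation_subring Q"
  shows "value_chain Q t ws \<Longrightarrow> set cs \<subseteq> k \<Longrightarrow> length cs = length ws \<Longrightarrow> \<exists>c\<in>set cs. c \<noteq> \<zero> \<Longrightarrow>
    \<exists>w\<in>set ws. combine cs ws \<otimes> inv w \<in> Q \<and> combine cs ws \<otimes> inv w \<notin> nonunits Q"
proof (induction ws arbitrary: cs)
  case (Cons w ws)
  note S = valuation_subring_subring[OF Q]
  obtain c ds where cs: "cs = c # ds" using Cons.prems(3) by (cases cs) auto
  have kC: "k \<subseteq> carrier R" by (rule subringE(1)[OF subfieldE(1)[OF k(1)]])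
  have wsC: "set ws \<subseteq> carrier R" "w \<in> carrier R" "w \<noteq> \<zero>"
    using Cons.prems(1) value_chain_elem[of Q t ws] subringE(1)[OF S] by auto
  have cC: "c \<in> k" "set ds \<subseteq> k" "c \<in> carrier R" "set ds \<subseteq> carrier R" using Cons.prems(2) kC cs by auto
  have dc: "combine ds ws \<in> carrier R" by (rule combine_in_carrier[OF cC(4) wsC(1)])
  show ?case
  proof (cases "c = \<zero>")
    case True
    have "combine cs (w # ws) = combine ds ws" using True dc wsC by (simp add: cs)
    moreover have "\<exists>c\<in>set ds. c \<noteq> \<zero>" using Cons.prems(4) True cs by auto
    ultimately show ?thesis using Cons.IH[of ds] Cons.prems cC cs by auto
  next
    case False
    have iw: "inv w \<in> carrier R" using wsC by simp
    have "combine ds (map ((\<otimes>) (inv w)) ws) = inv w \<otimes> combine ds ws"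
      by (rule combine_map_vectors[OF iw cC(4) wsC(1)])
    moreover have nn: "combine es (map ((\<otimes>) (inv w)) vs) \<in> nonunits Q" if "set es \<subseteq> k" "set vs \<subseteq> set ws" for es vs
      using that
    proof (induction es vs rule: combine.induct)
      case (1 e es v vs)
      have "v \<otimes> inv w \<in> nonunits Q" "v \<in> carrier R" using 1 Cons.prems(1) wsC(1) by auto
      then have "inv w \<otimes> v \<in> nonunits Q" using iw by (simp add: m_comm)
      then have "e \<otimes> (inv w \<otimes> v) \<in> nonunits Q" using nonunits_smult[OF S, of e] 1 k(2) by auto
      then show ?case using nonunits_add[OF Q] 1 by auto
    qed (auto simp: nonunits_zero[OF S])
    ultimately have n: "inv w \<otimes> combine ds ws \<in> nonunits Q"
      using nn[OF cC(2) order_refl] by simp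
    have "combine cs (w # ws) \<otimes> inv w = c \<otimes> (w \<otimes> inv w) \<oplus> inv w \<otimes> combine ds ws"
      using cC wsC dc iw by (simp add: cs l_distr r_distr m_ac del: inv_mult mult_inv_cancel)
    then have "combine cs (w # ws) \<otimes> inv w = c \<oplus> inv w \<otimes> combine ds ws" using wsC cC by simp
    moreover have "c \<in> Q" "c \<notin> nonunits Q" using subfield_not_nonunit[OF k cC(1) False] cC(1) k(2) by auto
    ultimately show ?thesis using unit_diff_nonunit[OF Q _ _ n, of c] by auto
  qed
qed simp

text \<open>A dependence of the entries over \<open>k(t)\<close>, reduced modulo \<open>t\<close>,
  gives a nontrivial combination over \<open>k\<close> that is divisible by \<open>t\<close>; but
  its value is that of an entry and hence below the value of \<open>t\<close>. This is the classical
  bound of the ramification index by the degree.\<close>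

lemma value_chain_bound:
  assumes k: "subfield k R" "k \<subseteq> Q" and Q: "valuation_subring Q" and t: "t \<in> nonunits Q" "t \<noteq> \<zero>"
    and dep: "\<And>Us. set Us \<subseteq> carrier R \<Longrightarrow> length Us > N \<Longrightarrow>
      \<exists>Ks. set Ks \<subseteq> fractions (simple_extension k t) \<and> length Ks = length Us \<and> (\<exists>x\<in>set Ks. x \<noteq> \<zero>) \<and> combine Ks Us = \<zero>"
    and ch: "value_chain Q t ws"
  shows "length ws \<le> N"
proof (rule ccontr)
  assume "\<not> length ws \<le> N"
  note S = valuation_subring_subring[OF Q]
  have Sk: "subring k R" using k subfieldE(1) by blast
  have tQ: "t \<in> Q" "t \<in> carrier R" using t nonunits_subset subringE(1)[OF S] by auto
  have wQ: "set ws \<subseteq> Q" using value_chain_elem[OF ch] by blast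
  have wC: "set ws \<subseteq> carrier R" using wQ subringE(1)[OF S] by blast
  obtain Ks where Ks: "set Ks \<subseteq> fractions (simple_extension k t)" "length Ks = length ws" "\<exists>x\<in>set Ks. x \<noteq> \<zero>" "combine Ks ws = \<zero>"
    using dep[OF wC] \<open>\<not> length ws \<le> N\<close> by auto
  obtain cs qs where cq: "set cs \<subseteq> k" "set qs \<subseteq> simple_extension k t" "length cs = length ws" "\<exists>c\<in>set cs. c \<noteq> \<zero>"
    "combine cs ws \<oplus> t \<otimes> combine qs ws = \<zero>"
    using relation_mod[OF Sk tQ(2) t(2) wC Ks] by blast
  have qQ: "set qs \<subseteq> Q" using cq(2) simple_extension_subring_incl[OF S k(2) tQ(1)] by blast
  obtain w where w: "w \<in> set ws" "combine cs ws \<otimes> inv w \<in> Q" "combine cs ws \<otimes> inv w \<notin> nonunits Q"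
    using value_chain_combine[OF k Q ch cq(1,3,4)] by blast
  have wc: "w \<in> carrier R" "w \<noteq> \<zero>" "t \<otimes> inv w \<in> nonunits Q" using value_chain_elem[OF ch w(1)] w(1) wC by auto
  define x where "x = combine cs ws"
  define y where "y = combine qs ws"
  have y: "y \<in> Q" "y \<in> carrier R" unfolding y_def using combine_in_subring[OF S qQ wQ] subringE(1)[OF S] by auto
  have x: "x \<in> carrier R" unfolding x_def by (rule combine_in_carrier) (use cq(1) k(2) subringE(1)[OF S] wC in auto)
  have "x \<oplus> t \<otimes> y = \<zero>" using cq(5) by (simp add: x_def y_def)
  then have "\<ominus> (t \<otimes> y) = x" using x y tQ by (intro minus_equality) simp_all
  then have "x \<otimes> inv w = (\<ominus> y) \<otimes> (t \<otimes> inv w)" using y tQ wc by (auto simp: l_minus r_minus m_ac)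
  moreover have "(\<ominus> y) \<otimes> (t \<otimes> inv w) \<in> nonunits Q" by (rule nonunits_smult[OF S subringE(5)[OF S y(1)] wc(3)])
  ultimately show False using w(3) by (simp add: x_def)
qed

text \<open>Without a nonunit of least value, chains could be prolonged at their lower end without
  limit.\<close>

lemma exists_uniformizer:
  assumes Q: "valuation_subring Q" and t: "t \<in> nonunits Q" "t \<noteq> \<zero>"
    and bound: "\<And>ws. value_chain Q t ws \<Longrightarrow> length ws \<le> N"
  shows "\<exists>p\<in>nonunits Q. p \<noteq> \<zero> \<and> (\<forall>x\<in>nonunits Q. x \<otimes> inv p \<in> Q)"
proof (rule ccontr)
  assume no: "\<not> ?thesis"
  note S = valuation_subring_subring[OF Q]
  have nc: "x \<in> carrier R" if "x \<in> nonunits Q" for x using that nonunits_subset subringE(1)[OF S] by blast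
  have smaller: "\<exists>x\<in>nonunits Q. x \<noteq> \<zero> \<and> p \<otimes> inv x \<in> nonunits Q" if p: "p \<in> nonunits Q" "p \<noteq> \<zero>" for p
  proof -
    obtain x where x: "x \<in> nonunits Q" "x \<otimes> inv p \<notin> Q" using no p by blast
    have c: "x \<in> carrier R" "p \<in> carrier R" using nc x p by auto
    have "inv (x \<otimes> inv p) \<in> nonunits Q" "x \<otimes> inv p \<noteq> \<zero>" using valuation_subringD[OF Q _ x(2)] c p by auto
    moreover have x0: "x \<noteq> \<zero>" using calculation c p by auto
    ultimately have "p \<otimes> inv x \<in> nonunits Q" using c p by (simp add: inv_prod m_comm)
    then show ?thesis using x x0 by blast
  qed
  \<comment> \<open>The nonunit \<open>h\<close> divides \<open>t\<close> and all entries, so any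
    nonunit of smaller value can be prepended. It starts as \<open>t\<close> itself and is the last
    added entry from then on.\<close>
  have "\<exists>ws. value_chain Q t ws \<and> length ws = n \<and>
    (\<exists>h\<in>nonunits Q. h \<noteq> \<zero> \<and> (\<forall>y\<in>insert t (set ws). y \<in> carrier R \<and> y \<otimes> inv h \<in> Q))" for n
  proof (induction n)
    case 0
    have "t \<otimes> inv t \<in> Q" using nc[OF t(1)] t(2) subringE(3)[OF S] by simp
    then show ?case using t nc by (intro exI[of _ "[]"]) auto
  next
    case (Suc n)
    then obtain ws h where w: "value_chain Q t ws" "length ws = n" "h \<in> nonunits Q" "h \<noteq> \<zero>"
      "\<And>y. y \<in> insert t (set ws) \<Longrightarrow> y \<in> carrier R \<and> y \<otimes> inv h \<in> Q" by blast
    obtain x where x: "x \<in> nonunits Q" "x \<noteq> \<zero>" "h \<otimes> inv x \<in> nonunits Q" using smaller[OF w(3,4)] by blast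
    have c: "x \<in> carrier R" "h \<in> carrier R" using nc x w by auto
    have y: "y \<otimes> inv x \<in> nonunits Q" if y: "y \<in> insert t (set ws)" for y
    proof -
      have "(y \<otimes> inv h) \<otimes> (h \<otimes> inv x) \<in> nonunits Q" by (rule nonunits_smult[OF S _ x(3)]) (use w(5)[OF y] in blast)
      moreover have "(y \<otimes> inv h) \<otimes> (h \<otimes> inv x) = y \<otimes> inv x" using w(5)[OF y] c w(4) x(2) by (simp add: m_assoc)
      ultimately show ?thesis by simp
    qed
    have "x \<in> Q" using x nonunits_subset by blast
    then have "value_chain Q t (x # ws)" using w(1) x(2) y by simp
    moreover have "z \<in> carrier R \<and> z \<otimes> inv x \<in> Q" if "z \<in> insert t (set (x # ws))" for z
    proof (cases "z = x")
      case True
      then show ?thesis using c x(2) subringE(3)[OF S] by simp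
    next
      case False
      then have z: "z \<in> insert t (set ws)" using that by auto
      show ?thesis using w(5)[OF z] y[OF z] nonunits_subset by blast
    qed
    moreover have "length (x # ws) = Suc n" using w(2) by simp
    ultimately show ?case using x(1,2) by blast
  qed
  from this[of "Suc N"] show False using bound by fastforce
qed

text \<open>The algebraic relation for \<open>inv u\<close> shows that \<open>u\<close> divides a
  nonzero element of \<open>k[t]\<close>, which is a power of \<open>t\<close> up to a unit of
  \<open>Q\<close>. If all powers of \<open>p\<close> divided \<open>u\<close>, they would also
  divide \<open>t\<close> and form chains of any length.\<close>

lemma uniformizer_separated:
  assumes k: "subfield k R" "k \<subseteq> Q" and Q: "valuation_subring Q" and t: "t \<in> nonunits Q" "t \<noteq> \<zero>"
    and bound: "\<And>ws. value_chain Q t ws \<Longrightarrow> length ws \<le> N"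
    and p: "p \<in> nonunits Q" "p \<noteq> \<zero>"
    and u: "u \<in> Q" "u \<noteq> \<zero>" "inv u \<in> int_closure (fractions (simple_extension k t))"
  shows "\<exists>n::nat. u \<otimes> inv (p [^] n) \<notin> Q"
proof (rule ccontr)
  assume all: "\<not> ?thesis"
  note S = valuation_subring_subring[OF Q]
  have Sk: "subring k R" using k subfieldE(1) by blast
  have c: "t \<in> carrier R" "p \<in> carrier R" "u \<in> carrier R" "t \<in> Q" "p \<in> Q"
    using t p u nonunits_subset subringE(1)[OF S] by auto
  define B where "B = simple_extension k t"
  have B: "subring B R" "B \<subseteq> Q" unfolding B_def
    using simple_extension_is_subring[OF Sk c(1)] simple_extension_subring_incl[OF S k(2) c(4)] by auto
  obtain l a where l: "set l \<subseteq> B" "a \<in> B" "a \<noteq> \<zero>" "horner (l @ [a]) (inv u) = \<zero>"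
    using algebraic_relation[OF B(1)] u(3) unfolding B_def by blast
  have lc: "set l \<subseteq> carrier R" "a \<in> carrier R" using l subringE(1)[OF B(1)] by auto
  define h where "h = horner l (inv u)"
  have iu: "inv u \<in> carrier R" "inv u \<noteq> \<zero>" using c u by simp_all
  have hc: "h \<in> carrier R" using lc iu by (simp add: h_def)
  have "h \<oplus> inv u [^] length l \<otimes> a = \<zero>" using l(4) lc iu by (simp add: horner_append h_def)
  then have e1: "\<ominus> (inv u [^] length l \<otimes> a) = h" using hc iu lc by (intro minus_equality) simp_all
  \<comment> \<open>Multiplied by \<open>u [^] length l\<close>, the relation writes
    \<open>a\<close> as a multiple of \<open>u\<close>.\<close>
  have "\<exists>q\<in>Q. a = u \<otimes> q"
  proof (cases l)
    case Nil
    then show ?thesis using l(4) l(3) lc iu by simp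
  next
    case (Cons b m)
    have "h \<in> poly_span B (inv u) (Suc (length m))" using horner_in_poly_span[OF l(1)] Cons by (simp add: h_def)
    then have "u [^] length m \<otimes> h \<in> poly_span B u (Suc (length m))"
      by (rule poly_span_reverse[OF subring_add_closed[OF B(1)] c(3) u(2)])
    then have q: "u [^] length m \<otimes> h \<in> Q" by (rule poly_span_subset[OF S B(2) u(1)])
    have "u \<otimes> (\<ominus> (u [^] length m \<otimes> h)) = u [^] length l \<otimes> (inv u [^] length l \<otimes> a)"
      unfolding e1[symmetric] using Cons c iu lc by (simp add: r_minus m_ac del: pow_mult_inv_cancel mult_inv_cancel)
    then have "a = u \<otimes> (\<ominus> (u [^] length m \<otimes> h))" using c u lc by simp
    then show ?thesis using subringE(5)[OF S q] by blast
  qed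
  then obtain q where q: "q \<in> Q" "a = u \<otimes> q" by blast
  obtain e d r where e: "d \<in> k" "r \<in> B" "d \<noteq> \<zero>" "a = t [^] (e::nat) \<otimes> (d \<oplus> t \<otimes> r)"
    using lowest_term[OF Sk c(1), of a] l unfolding B_def by blast
  define g where "g = d \<oplus> t \<otimes> r"
  have tr: "t \<otimes> r \<in> nonunits Q"
    using nonunits_smult[OF S _ t(1), of r] e(2) B(2) c subringE(1)[OF S] by (auto simp: m_comm subset_iff)
  have g: "g \<in> Q" "g \<notin> nonunits Q"
    unfolding g_def using unit_diff_nonunit[OF Q _ subfield_not_nonunit[OF k e(1,3)] tr] e(1) k(2) by auto
  have g0: "g \<noteq> \<zero>" "inv g \<in> Q" "g \<in> carrier R" using g nonunits_zero[OF S] subringE(1)[OF S] by (auto simp: nonunits_def)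
  have te: "t [^] e = u \<otimes> (q \<otimes> inv g)"
  proof -
    have "u \<otimes> (q \<otimes> inv g) = t [^] e \<otimes> (g \<otimes> inv g)"
      using q e(4) c g0 subringE(1)[OF S] by (simp add: g_def[symmetric] m_assoc[symmetric] subset_iff del: inv_mult)
    then show ?thesis using g0 c by simp
  qed
  have qg: "q \<otimes> inv g \<in> Q" "q \<otimes> inv g \<in> carrier R" using subringE(6)[OF S q(1) g0(2)] subringE(1)[OF S] by auto
  have div: "t [^] e \<otimes> inv (p [^] n) \<in> Q" for n :: nat
  proof -
    have "(u \<otimes> inv (p [^] n)) \<otimes> (q \<otimes> inv g) \<in> Q" by (rule subringE(6)[OF S _ qg(1)]) (use all in blast)
    moreover have "(u \<otimes> inv (p [^] n)) \<otimes> (q \<otimes> inv g) = (u \<otimes> (q \<otimes> inv g)) \<otimes> inv (p [^] n)"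
      using c qg p by (simp add: m_ac)
    ultimately show ?thesis using te by simp
  qed
  \<comment> \<open>Otherwise \<open>t\<close> divides \<open>p [^] n\<close>, so
    \<open>t [^] e\<close> divides \<open>p [^] (n * e)\<close>. As \<open>p [^] (n * e + 1)\<close>
    divides \<open>t [^] e\<close>, the element \<open>p\<close> would be a unit.\<close>
  have tdiv: "t \<otimes> inv (p [^] n) \<in> Q" for n :: nat
  proof (rule ccontr)
    assume no: "t \<otimes> inv (p [^] n) \<notin> Q"
    have pn: "p [^] n \<in> carrier R" "p [^] n \<noteq> \<zero>" using c p by simp_all
    have "inv (t \<otimes> inv (p [^] n)) \<in> Q"
      using valuation_subringD[OF Q _ no] c pn nonunits_subset by auto
    then have "p [^] n \<otimes> inv t \<in> Q" using c pn t by (simp add: inv_prod m_comm)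
    then have "(p [^] n \<otimes> inv t) [^] e \<in> Q" by (rule subring_pow[OF S])
    then have m: "(p [^] n \<otimes> inv t) [^] e \<otimes> (t [^] e \<otimes> inv (p [^] (n * e + 1))) \<in> Q" by (rule subringE(6)[OF S _ div])
    have "(p [^] n \<otimes> inv t) [^] e = p [^] (n * e) \<otimes> inv t [^] e" using c t by (simp add: nat_pow_distrib nat_pow_pow)
    moreover define r where "r = p [^] (n * e + 1)"
    then have r: "r \<in> carrier R" "r \<noteq> \<zero>" using c p by (auto simp: integral_iff)
    ultimately have "(p [^] n \<otimes> inv t) [^] e \<otimes> (t [^] e \<otimes> inv r) = p [^] (n * e) \<otimes> (inv t [^] e \<otimes> (t [^] e \<otimes> inv r))"
      using c t p by (simp add: m_assoc del: pow_mult_inv_cancel)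
    then have "(p [^] n \<otimes> inv t) [^] e \<otimes> (t [^] e \<otimes> inv (p [^] (n * e + 1))) = p [^] (n * e) \<otimes> inv (p [^] (n * e + 1))"
      using r c t unfolding r_def[symmetric] by simp
    also have "\<dots> = inv p" using c p by (simp add: inv_prod)
    finally show False using m p by (simp add: nonunits_def)
  qed
  have chain: "value_chain Q t (map (\<lambda>i. p [^] i) [j..<j + n])" for j n
  proof (induction n arbitrary: j)
    case (Suc n)
    have pj: "p [^] j \<in> carrier R" "p [^] j \<noteq> \<zero>" "p [^] j \<in> Q" using c p subring_pow[OF S c(5)] by simp_all
    have "[j..<j + Suc n] = j # [Suc j..<Suc j + n]" by (simp add: upt_rec)
    moreover have "p [^] i \<otimes> inv (p [^] j) \<in> nonunits Q" if i: "Suc j \<le> i" for i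
    proof -
      have "p [^] i = p [^] (i - Suc j) \<otimes> p \<otimes> p [^] j"
        using c i nat_pow_mult[OF c(2), of "Suc (i - Suc j)" j] by simp
      then have "p [^] i \<otimes> inv (p [^] j) = p [^] (i - Suc j) \<otimes> p" using c pj by (simp add: m_assoc)
      then show ?thesis using nonunits_smult[OF S subring_pow[OF S c(5)] p(1)] by simp
    qed
    moreover have "t \<otimes> inv (p [^] j) \<in> nonunits Q"
    proof -
      have "(t \<otimes> inv (p [^] Suc j)) \<otimes> p \<in> nonunits Q" by (rule nonunits_smult[OF S tdiv p(1)])
      moreover have "(t \<otimes> inv (p [^] Suc j)) \<otimes> p = t \<otimes> inv (p [^] j)" using c p by (simp add: inv_prod m_assoc)
      ultimately show ?thesis by simp
    qed
    ultimately show ?case using pj Suc[of "Suc j"] by auto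
  qed simp
  from bound[OF chain[of 0 "Suc N"]] show False by simp
qed

text \<open>The suffixes \<open>b\<close> of a relation for \<open>z\<close> are integral together with \<open>z \<otimes> b\<close>, as one sees
  from the beginning or the end of the relation, depending on whether \<open>z\<close> or its inverse lies in a
  valuation subring.\<close>

lemma quotient_of_integral:
  assumes k: "subfield k R" "k \<subseteq> Q" and Q: "valuation_subring Q" and t: "t \<in> nonunits Q" "t \<noteq> \<zero>"
    and z: "z \<in> Q" "z \<in> int_closure (fractions (simple_extension k t))"
  shows "\<exists>a\<in>int_closure (simple_extension k t). \<exists>c\<in>int_closure (simple_extension k t). c \<notin> nonunits Q \<and> z = a \<otimes> inv c"
proof -
  note S = valuation_subring_subring[OF Q]
  have Sk: "subring k R" using k subfieldE(1) by blast
  have c: "t \<in> carrier R" "t \<in> Q" "z \<in> carrier R" using t z nonunits_subset subringE(1)[OF S] by auto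
  define B where "B = simple_extension k t"
  have B: "subring B R" "B \<subseteq> Q" unfolding B_def
    using simple_extension_is_subring[OF Sk c(1)] simple_extension_subring_incl[OF S k(2) c(2)] by auto
  obtain l a where l: "set l \<subseteq> B" "a \<in> B" "a \<noteq> \<zero>" "horner (l @ [a]) z = \<zero>"
    using algebraic_relation[OF B(1)] z(2) unfolding B_def by blast
  have hs: "set (l @ [a]) \<subseteq> B" "\<exists>h\<in>set (l @ [a]). h \<noteq> \<zero>" using l by auto
  \<comment> \<open>Dividing the relation by a power of \<open>t\<close> leaves a coefficient with
    nonzero constant term, which is a unit of \<open>Q\<close>.\<close>
  obtain e gs where gs: "set gs \<subseteq> B" "l @ [a] = map ((\<otimes>) (t [^] (e::nat))) gs"
    "\<exists>g\<in>set gs. \<exists>c\<in>k. \<exists>q\<in>B. c \<noteq> \<zero> \<and> g = c \<oplus> t \<otimes> q"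
    using divide_common_power[OF Sk c(1) hs[unfolded B_def]] unfolding B_def[symmetric] by (elim exE conjE)
  have gC: "set gs \<subseteq> carrier R" using gs(1) subringE(1)[OF B(1)] by blast
  have "t [^] e \<otimes> horner gs z = \<zero>" using l(4) unfolding gs(2) using horner_map_mult[OF gC c(3), of "t [^] e"] c by simp
  then have hz: "horner gs z = \<zero>" using integral_iff[of "t [^] e" "horner gs z"] c t gC by simp
  define b where "b i = horner (drop i gs) z" for i
  have dC: "set (drop i gs) \<subseteq> carrier R" "set (take i gs) \<subseteq> carrier R" "set (drop i gs) \<subseteq> B" "set (take i gs) \<subseteq> B" for i
    using gC gs(1) by (auto dest: in_set_dropD in_set_takeD)
  have bc: "b i \<in> carrier R" for i unfolding b_def using dC c by simp
  have mem: "b i \<in> V \<and> z \<otimes> b i \<in> V" if V: "valuation_subring V" "B \<subseteq> V" for V i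
  proof -
    note SV = valuation_subring_subring[OF V(1)]
    show ?thesis
    proof (cases "z \<in> V")
      case True
      have "b i \<in> V" unfolding b_def
        by (rule poly_span_subset[OF SV V(2) True horner_in_poly_span[OF dC(3)]])
      then show ?thesis using subringE(6)[OF SV True] by blast
    next
      case False
      have iz: "inv z \<in> V" "z \<noteq> \<zero>" using valuation_subringD[OF V(1) c(3) False] nonunits_subset by auto
      show ?thesis
      proof (cases "take i gs")
        case Nil
        then have "b i = \<zero>" using hz by (cases "i = 0") (auto simp: b_def)
        then show ?thesis using subringE(2)[OF SV] c by simp
      next
        case (Cons g m)
        have len: "length (take i gs) = Suc (length m)" using Cons by simp
        define h where "h = horner (take i gs) z"
        have h: "h \<in> carrier R" "h \<in> poly_span B z (Suc (length m))"
          unfolding h_def using dC c horner_in_poly_span[OF dC(4)[of i], of z] len by auto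
        have "horner (take i gs @ drop i gs) z = h \<oplus> z [^] Suc (length m) \<otimes> b i"
          using dC c len by (subst horner_append) (auto simp: h_def b_def)
        then have "h \<oplus> z [^] Suc (length m) \<otimes> b i = \<zero>" using hz by simp
        then have "\<ominus> (z [^] Suc (length m) \<otimes> b i) = h" using h c bc by (intro minus_equality) simp_all
        then have e1: "\<ominus> (z [^] length m \<otimes> (z \<otimes> b i)) = h" using c bc by (simp add: m_assoc)
        have "inv z [^] length m \<otimes> h \<in> poly_span B (inv z) (Suc (length m))"
          by (rule poly_span_reverse[OF subring_add_closed[OF B(1)]]) (use c iz h in simp_all)
        then have iV: "inv z [^] length m \<otimes> h \<in> V" by (rule poly_span_subset[OF SV V(2) iz(1)])
        have "inv z [^] length m \<otimes> h = \<ominus> (z \<otimes> b i)" unfolding e1[symmetric] using c bc[of i] iz(2) by (simp add: r_minus)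
        then have "z \<otimes> b i = \<ominus> (inv z [^] length m \<otimes> h)" using c bc[of i] by simp
        then have zb: "z \<otimes> b i \<in> V" using subringE(5)[OF SV iV] by simp
        then have "inv z \<otimes> (z \<otimes> b i) \<in> V" by (rule subringE(6)[OF SV iz(1)])
        then show ?thesis using zb c bc[of i] iz(2) by simp
      qed
    qed
  qed
  have bI: "b i \<in> int_closure B" "z \<otimes> b i \<in> int_closure B" for i
    using mem[of _ i] bc[of i] c by (simp_all add: int_closure_def)
  \<comment> \<open>Each coefficient is \<open>b i\<close> minus
    \<open>z \<otimes> b (Suc i)\<close>. If all suffixes were nonunits, so would be all
    coefficients, among them the unit \<open>g\<close>.\<close>
  have "\<exists>i. b i \<notin> nonunits Q"
  proof (rule ccontr)
    assume "\<not> ?thesis"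
    then have bn: "b i \<in> nonunits Q" for i by blast
    obtain g d q where g: "g \<in> set gs" "d \<in> k" "q \<in> B" "d \<noteq> \<zero>" "g = d \<oplus> t \<otimes> q" using gs(3) by blast
    have tq: "t \<otimes> q \<in> nonunits Q"
      using nonunits_smult[OF S _ t(1), of q] g(3) B c subringE(1)[OF S] by (auto simp: m_comm subset_iff)
    have gn: "g \<notin> nonunits Q" unfolding g(5)
      using unit_diff_nonunit(2)[OF Q _ subfield_not_nonunit[OF k g(2,4)] tq] g(2) k(2) by auto
    obtain i where i: "i < length gs" "g = gs ! i" using g(1) by (auto simp: in_set_conv_nth)
    have gc: "g \<in> carrier R" using g(1) gC by blast
    have "b i = g \<oplus> z \<otimes> b (Suc i)" unfolding b_def i(2) by (subst Cons_nth_drop_Suc[OF i(1), symmetric]) simp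
    then have "b i \<oplus> (\<ominus> z) \<otimes> b (Suc i) = g" using gc c bc[of "Suc i"] by (simp add: l_minus a_assoc r_neg)
    moreover have "b i \<oplus> (\<ominus> z) \<otimes> b (Suc i) \<in> nonunits Q"
      by (rule nonunits_add[OF Q bn nonunits_smult[OF S subringE(5)[OF S z(1)] bn]])
    ultimately show False using gn by simp
  qed
  then obtain i where i: "b i \<notin> nonunits Q" by blast
  have "b i \<in> Q" using mem[OF Q B(2)] by blast
  then have "b i \<noteq> \<zero>" using i nonunits_zero[OF S] by auto
  then have "z = (z \<otimes> b i) \<otimes> inv (b i)" using c bc[of i] by (simp add: m_assoc)
  then show ?thesis using bI i unfolding B_def by blast
qed

end

section \<open>The discrete valuation ring as a localization of a finitely generated algebra\<close>

context field
begin

text \<open>\<open>H\<close> consists of the Noether elements kept as constants, the variable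
  \<open>t\<close>, and elements that together with \<open>k\<close> and \<open>t\<close> generate
  the integral closure of \<open>k[t]\<close>. The algebra \<open>K[H]\<close> need not contain the
  field \<open>k\<close>, but the missing denominators come from \<open>K[xs]\<close> and are units
  of \<open>Q\<close>, so \<open>Q\<close> is still a localization of \<open>K[H]\<close>.\<close>

lemma exists_divisorial_valuation:
  assumes K: "subfield K R" and E0: "finite E0" "E0 \<subseteq> carrier R" "generate_field R (K \<union> E0) = carrier R"
    and P: "valuation_subring P" "K \<subseteq> P" and S: "finite S" "S \<subseteq> P" and b: "b \<in> nonunits P" "b \<noteq> \<zero>"
  shows "\<exists>H Q p. finite H \<and> H \<subseteq> carrier R \<and> valuation_subring Q \<and> generate_ring R (K \<union> H) \<subseteq> Q \<and>
    (\<forall>z\<in>Q. \<exists>a\<in>generate_ring R (K \<union> H). \<exists>s\<in>generate_ring R (K \<union> H). s \<notin> nonunits Q \<and> z = a \<otimes> inv s) \<and>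
    S \<subseteq> Q \<and> b \<in> nonunits Q \<and> p \<in> nonunits Q \<and> p \<noteq> \<zero> \<and> (\<forall>x\<in>nonunits Q. x \<otimes> inv p \<in> Q) \<and>
    (\<forall>u\<in>Q. u \<noteq> \<zero> \<longrightarrow> (\<exists>n::nat. u \<otimes> inv (p [^] n) \<notin> Q))"
proof -
  have SK: "subring K R" using K subfieldE(1) by blast
  have KC: "K \<subseteq> carrier R" by (rule subringE(1)[OF SK])
  \<comment> \<open>A generator of \<open>F\<close> outside \<open>P\<close> is replaced by its
    inverse, which lies in \<open>P\<close> and generates the same field, so that it can be made
    integral along with \<open>S\<close>.\<close>
  define f where "f g = (if g \<in> P then g else inv g)" for g
  have fP: "f g \<in> P" if "g \<in> carrier R" for g
    using valuation_subringD[OF P(1) that] nonunits_subset by (auto simp: f_def)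
  have S': "finite (S \<union> f ` E0)" "S \<union> f ` E0 \<subseteq> P" using S E0 fP by auto
  obtain xs t Q where xs: "set xs \<subseteq> carrier R" and Q: "valuation_subring Q" "fractions (generate_ring R (K \<union> set xs)) \<subseteq> Q"
    and t: "t \<in> nonunits Q" "t \<noteq> \<zero>" and bQ: "b \<in> nonunits Q"
    and int: "S \<union> f ` E0 \<subseteq> int_closure (simple_extension (fractions (generate_ring R (K \<union> set xs))) t)"
    using exists_divisorial_center[OF K P S' b] by blast
  define A0 where "A0 = generate_ring R (K \<union> set xs)"
  define k where "k = fractions A0"
  define C where "C = int_closure (simple_extension k t)"
  define E where "E = fractions (simple_extension k t)"
  note SQ = valuation_subring_subring[OF Q(1)]
  have A0: "subring A0 R" unfolding A0_def by (rule generate_ring_carrier_subring[OF KC xs])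
  have k: "subfield k R" "k \<subseteq> Q" "A0 \<subseteq> k"
    using fractions_subfield[OF A0] Q(2) subset_fractions[OF A0] unfolding k_def A0_def by auto
  have Sk: "subring k R" using k(1) subfieldE(1) by blast
  have kC: "k \<subseteq> carrier R" by (rule subringE(1)[OF Sk])
  have tc: "t \<in> carrier R" "t \<in> Q" using t nonunits_subset subringE(1)[OF SQ] by auto
  have B: "subring (simple_extension k t) R" by (rule simple_extension_is_subring[OF Sk tc(1)])
  have E: "subfield E R" unfolding E_def by (rule fractions_subfield[OF B])
  have EC: "E \<subseteq> carrier R" by (rule subringE(1)[OF subfieldE(1)[OF E]])
  have BE: "simple_extension k t \<subseteq> E" unfolding E_def by (rule subset_fractions[OF B])
  have kB: "k \<subseteq> simple_extension k t" "t \<in> simple_extension k t"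
    using simple_extension_incl[OF kC tc(1)] simple_extension_mem[OF Sk tc(1)] by auto
  have CE: "C \<subseteq> int_closure E" unfolding C_def using BE int_closure_superset[OF EC] by (intro int_closure_subset) blast
  have CQ: "C \<subseteq> Q" unfolding C_def
    using int_closureD[OF _ Q(1) simple_extension_subring_incl[OF SQ k(2) tc(2)]] by blast
  have BC: "simple_extension k t \<subseteq> C" unfolding C_def by (rule int_closure_superset[OF subringE(1)[OF B]])
  have KA: "K \<subseteq> A0" "set xs \<subseteq> A0" unfolding A0_def by (auto intro: generate_ring.incl)
  have E0E: "E0 \<subseteq> int_closure E"
  proof
    fix g assume g: "g \<in> E0"
    then have gc: "g \<in> carrier R" using E0 by blast
    have fg: "f g \<in> int_closure E" using int g CE unfolding C_def k_def A0_def by blast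
    show "g \<in> int_closure E"
    proof (cases "g \<in> P")
      case True
      then show ?thesis using fg by (simp add: f_def)
    next
      case False
      then have "g \<noteq> \<zero>" "f g = inv g" using subringE(2)[OF valuation_subring_subring[OF P(1)]] by (auto simp: f_def)
      then show ?thesis using int_closure_field_inv[OF E fg] gc by simp
    qed
  qed
  have KE: "K \<subseteq> E" using KA(1) k(3) kB(1) BE by blast
  obtain N where N: "\<And>Us. set Us \<subseteq> carrier R \<Longrightarrow> length Us > N \<Longrightarrow>
      \<exists>Ks. set Ks \<subseteq> fractions (simple_extension k t) \<and> length Ks = length Us \<and> (\<exists>x\<in>set Ks. x \<noteq> \<zero>) \<and> combine Ks Us = \<zero>"
    using dependency_bound[OF E E0(1) E0E E0(3) KE] unfolding E_def by blast
  have all_alg: "carrier R = int_closure E"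
  proof -
    have "generate_field R (K \<union> E0) \<subseteq> int_closure E"
      by (rule generate_field_min_subfield1[OF _ int_closure_subfield[OF E]])
        (use KC E0 E0E KE int_closure_superset[OF EC] in auto)
    then show ?thesis using E0(3) int_closure_carrier by blast
  qed
  have tk: "t \<notin> int_closure k"
  proof
    assume "t \<in> int_closure k"
    then have "inv t \<in> Q" using int_closureD[OF int_closure_field_inv[OF k(1) _ t(2)] Q(1) k(2)] by blast
    then show False using t by (simp add: nonunits_def)
  qed
  have "\<exists>H. finite H \<and> H \<subseteq> C \<and> (\<forall>B. subring B R \<and> k \<subseteq> B \<and> t \<in> B \<and> H \<subseteq> B \<longrightarrow> C \<subseteq> B)"
    unfolding C_def by (rule integral_closure_finitely_generated[OF k(1) tc(1) tk]) (rule N)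
  then obtain H0 where H0': "finite H0" "H0 \<subseteq> C"
    "\<forall>B. subring B R \<and> k \<subseteq> B \<and> t \<in> B \<and> H0 \<subseteq> B \<longrightarrow> C \<subseteq> B"
    by (elim exE conjE)
  note H0 = H0'(1,2) H0'(3)[rule_format, OF conjI[OF _ conjI[OF _ conjI]]]
  have CC: "C \<subseteq> carrier R" unfolding C_def by (rule int_closure_carrier)
  define H where "H = set xs \<union> {t} \<union> H0"
  define D where "D = generate_ring R (K \<union> H)"
  have HC: "finite H" "H \<subseteq> carrier R" "K \<union> H \<subseteq> carrier R" using H0(1,2) CC xs tc KC by (auto simp: H_def)
  have D: "subring D R" unfolding D_def by (rule generate_ring_is_subring[OF HC(3)])
  have DH: "K \<union> H \<subseteq> D" unfolding D_def by (auto intro: generate_ring.incl)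
  have DQ: "D \<subseteq> Q" unfolding D_def
    by (rule generate_ring_min_subring1[OF HC(3) SQ]) (use KA k H0(2) CQ tc in \<open>auto simp: H_def\<close>)
  have A0D: "A0 \<subseteq> D" unfolding A0_def D_def by (rule mono_generate_ring) (use HC in \<open>auto simp: H_def\<close>)
  note D' = subringE[OF D]
  \<comment> \<open>These are the elements that some nonzero denominator from \<open>A0\<close>
    brings into \<open>D\<close>. As a ring containing \<open>k\<close>, \<open>t\<close> and
    \<open>H0\<close>, it contains \<open>C\<close>.\<close>
  define M where "M = {z \<in> carrier R. \<exists>s\<in>A0. s \<noteq> \<zero> \<and> s \<otimes> z \<in> D}"
  have A0c: "s \<in> carrier R" if "s \<in> A0" for s using that subringE(1)[OF A0] by blast
  have DM: "D \<subseteq> M"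
  proof
    fix x assume x: "x \<in> D"
    then have "\<one> \<otimes> x \<in> D" "x \<in> carrier R" using D'(1) by auto
    then show "x \<in> M" using subringE(3)[OF A0] one_not_zero unfolding M_def by blast
  qed
  have M: "subring M R"
  proof (rule subringI)
    show "M \<subseteq> carrier R" by (auto simp: M_def)
    show "\<one> \<in> M" using DM D'(3) by blast
    show "\<ominus> h \<in> M" if hM: "h \<in> M" for h
    proof -
      obtain s where s: "s \<in> A0" "s \<noteq> \<zero>" "s \<otimes> h \<in> D" "h \<in> carrier R" using hM by (auto simp: M_def)
      have "s \<otimes> \<ominus> h \<in> D" using D'(5)[OF s(3)] s A0c by (simp add: r_minus)
      then show ?thesis using s by (auto simp: M_def)
    qed
    fix h1 h2 assume h: "h1 \<in> M" "h2 \<in> M"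
    obtain s where s: "s \<in> A0" "s \<noteq> \<zero>" "s \<otimes> h1 \<in> D" "h1 \<in> carrier R" using h(1) by (auto simp: M_def)
    obtain r where r: "r \<in> A0" "r \<noteq> \<zero>" "r \<otimes> h2 \<in> D" "h2 \<in> carrier R" using h(2) by (auto simp: M_def)
    have sr: "s \<otimes> r \<in> A0" "s \<otimes> r \<noteq> \<zero>" using subringE(6)[OF A0 s(1) r(1)] s r A0c by (auto simp: integral_iff)
    have "(s \<otimes> r) \<otimes> (h1 \<otimes> h2) = (s \<otimes> h1) \<otimes> (r \<otimes> h2)" using s r A0c by (simp add: m_ac)
    then have "(s \<otimes> r) \<otimes> (h1 \<otimes> h2) \<in> D" using D'(6)[OF s(3) r(3)] by simp
    then show "h1 \<otimes> h2 \<in> M" using sr s r unfolding M_def by blast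
    have "(s \<otimes> r) \<otimes> (h1 \<oplus> h2) = r \<otimes> (s \<otimes> h1) \<oplus> s \<otimes> (r \<otimes> h2)" using s r A0c by (simp add: r_distr m_ac)
    moreover have "r \<otimes> (s \<otimes> h1) \<oplus> s \<otimes> (r \<otimes> h2) \<in> D"
      by (rule D'(7)[OF D'(6) D'(6)]) (use s r A0D in auto)
    ultimately have "(s \<otimes> r) \<otimes> (h1 \<oplus> h2) \<in> D" by simp
    then show "h1 \<oplus> h2 \<in> M" using sr s r unfolding M_def by blast
  qed
  have kM: "k \<subseteq> M"
  proof
    fix x assume x: "x \<in> k"
    then obtain a s where as: "a \<in> A0" "s \<in> A0" "s \<noteq> \<zero>" "x = a \<otimes> inv s" unfolding k_def by (rule fractionsE)
    have "s \<otimes> x = a" using as A0c by (simp add: m_lcomm)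
    then have "s \<otimes> x \<in> D" "x \<in> carrier R" using as(1) A0D x kC by auto
    then show "x \<in> M" using as(2,3) unfolding M_def by blast
  qed
  have CM: "C \<subseteq> M" by (rule H0(3)[OF M kM]) (use DM DH in \<open>auto simp: H_def\<close>)
  \<comment> \<open>A quotient of elements of \<open>C\<close> is expanded by denominators from
    \<open>A0\<close>. The new denominator is again a unit of \<open>Q\<close>, since a product in
    \<open>Q\<close> is a nonunit only if one of its factors is.\<close>
  have frac: "\<exists>a\<in>D. \<exists>s\<in>D. s \<notin> nonunits Q \<and> z = a \<otimes> inv s" if z: "z \<in> Q" for z
  proof -
    have zE: "z \<in> int_closure (fractions (simple_extension k t))"
      using z subringE(1)[OF SQ] all_alg unfolding E_def by blast
    obtain a c where ac: "a \<in> C" "c \<in> C" "c \<notin> nonunits Q" "z = a \<otimes> inv c"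
      using quotient_of_integral[OF k(1,2) Q(1) t z zE] unfolding C_def by blast
    obtain s where s: "s \<in> A0" "s \<noteq> \<zero>" "s \<otimes> a \<in> D" "a \<in> carrier R" using ac(1) CM by (auto simp: M_def)
    obtain r where r: "r \<in> A0" "r \<noteq> \<zero>" "r \<otimes> c \<in> D" "c \<in> carrier R" using ac(2) CM by (auto simp: M_def)
    have c0: "c \<noteq> \<zero>" using ac(3) nonunits_zero[OF SQ] by auto
    have num: "r \<otimes> (s \<otimes> a) \<in> D" "s \<otimes> (r \<otimes> c) \<in> D" using D'(6) s r A0D by auto
    have unit: "x \<in> Q" "x \<notin> nonunits Q" if "x \<in> A0" "x \<noteq> \<zero>" for x
      using that k subfield_not_nonunit[OF k(1,2)] by auto
    have "r \<otimes> c \<notin> nonunits Q" using nonunit_prime[OF Q(1) unit(1)[OF r(1,2)], of c] ac(2,3) unit(2)[OF r(1,2)] CQ by blast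
    then have "s \<otimes> (r \<otimes> c) \<notin> nonunits Q"
      using nonunit_prime[OF Q(1) unit(1)[OF s(1,2)], of "r \<otimes> c"] unit(2)[OF s(1,2)] r(3) DQ by blast
    moreover have "z = (r \<otimes> (s \<otimes> a)) \<otimes> inv (s \<otimes> (r \<otimes> c))"
    proof -
      have "(r \<otimes> (s \<otimes> a)) \<otimes> inv (s \<otimes> (r \<otimes> c)) = (a \<otimes> inv c) \<otimes> ((s \<otimes> inv s) \<otimes> (r \<otimes> inv r))"
        using s r c0 A0c by (simp add: inv_prod integral_iff m_ac del: inv_mult mult_inv_cancel)
      then show ?thesis using ac(4) s r c0 A0c by simp
    qed
    ultimately show ?thesis using num by blast
  qed
  have bound: "length ws \<le> N" if "value_chain Q t ws" for ws
    by (rule value_chain_bound[OF k(1,2) Q(1) t N that])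
  obtain p where p: "p \<in> nonunits Q" "p \<noteq> \<zero>" "\<forall>x\<in>nonunits Q. x \<otimes> inv p \<in> Q"
    using exists_uniformizer[OF Q(1) t bound] by blast
  have sep: "\<exists>n::nat. u \<otimes> inv (p [^] n) \<notin> Q" if u: "u \<in> Q" "u \<noteq> \<zero>" for u
  proof (rule uniformizer_separated[OF k(1,2) Q(1) t bound p(1,2) u])
    have "u \<in> carrier R" using u subringE(1)[OF SQ] by blast
    then have "inv u \<in> carrier R" using u by simp
    then show "inv u \<in> int_closure (fractions (simple_extension k t))" using all_alg unfolding E_def by blast
  qed
  have SQ': "S \<subseteq> Q" using int CQ unfolding C_def k_def A0_def by blast
  show ?thesis
    by (rule exI[of _ H], rule exI[of _ Q], rule exI[of _ p], intro conjI ballI impI HC(1,2) Q(1) DQ[unfolded D_def]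
        frac[unfolded D_def] SQ' bQ p(1,2) sep p(3)[rule_format])
qed

end

section \<open>Regular local rings of dimension at most one\<close>

lemma (in cring) units_ideal:
  assumes "ideal I R" "a \<in> I" "a \<in> Units R"
  shows "I = carrier R"
proof -
  interpret I: ideal I R by (rule assms(1))
  have "inv a \<otimes> a \<in> I" by (rule I.I_l_closed[OF assms(2)]) (use assms in simp)
  then have one: "\<one> \<in> I" using assms(3) by simp
  show ?thesis using I.I_l_closed[OF one] I.a_subset by fastforce
qed

text \<open>Every proper ideal consists of nonunits, so as soon as these are closed under addition
  they form the largest proper ideal. The equivalence provides both existence and uniqueness of the
  maximal ideal.\<close>

lemma (in cring) nonunits_maximalideal:
  assumes ne: "\<one> \<noteq> \<zero>" and add: "\<And>a b. a \<in> carrier R - Units R \<Longrightarrow> b \<in> carrier R - Units R \<Longrightarrow> a \<oplus> b \<notin> Units R"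
  shows "maximalideal I R \<longleftrightarrow> I = carrier R - Units R"
proof -
  define m where "m = carrier R - Units R"
  have mult: "x \<otimes> a \<in> m" if "a \<in> m" "x \<in> carrier R" for a x
  proof -
    have "x \<otimes> a \<notin> Units R"
    proof
      assume "x \<otimes> a \<in> Units R"
      then have "a \<otimes> x \<in> Units R" using that by (simp add: m_def m_comm)
      then have "a \<otimes> (x \<otimes> inv (a \<otimes> x)) = \<one>" using that by (simp add: m_def m_assoc[symmetric])
      moreover have "x \<otimes> inv (a \<otimes> x) \<in> carrier R" using that \<open>a \<otimes> x \<in> Units R\<close> by simp
      ultimately have "a \<in> Units R" using that m_comm[of a "x \<otimes> inv (a \<otimes> x)"] by (auto simp: Units_def m_def)
      then show False using that by (simp add: m_def)
    qed
    then show ?thesis using that by (simp add: m_def)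
  qed
  have z: "\<zero> \<in> m"
  proof -
    have "\<zero> \<notin> Units R" using ne by (auto simp: Units_def)
    then show ?thesis by (simp add: m_def)
  qed
  have mI: "ideal m R"
  proof (rule idealI)
    show "ring R" by (rule ring_axioms)
    show "subgroup m (add_monoid R)"
    proof (rule add.subgroupI)
      show "m \<subseteq> carrier R" "m \<noteq> {}" using z by (auto simp: m_def)
      show "\<ominus> a \<in> m" if "a \<in> m" for a
        using mult[OF that, of "\<ominus> \<one>"] that by (simp add: m_def l_minus)
      show "a \<oplus> b \<in> m" if "a \<in> m" "b \<in> m" for a b using add that by (simp add: m_def)
    qed
    show "x \<otimes> a \<in> m" if "a \<in> m" "x \<in> carrier R" for a x by (rule mult[OF that])
    show "a \<otimes> x \<in> m" if "a \<in> m" "x \<in> carrier R" for a x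
      using mult[OF that] that by (simp add: m_def m_comm)
  qed
  have proper: "J = carrier R \<or> J \<subseteq> m" if "ideal J R" for J
    using units_ideal[OF that] additive_subgroup.a_subset[OF ideal.axioms(1)[OF that]] by (auto simp: m_def)
  have mne: "m \<noteq> carrier R" using Units_one_closed by (auto simp: m_def)
  have max: "maximalideal m R"
    by (rule maximalidealI[OF mI]) (use mne proper in auto)
  show ?thesis
  proof
    assume I: "maximalideal I R"
    then have "ideal I R" "I \<noteq> carrier R" using maximalideal.axioms(1) maximalideal.I_notcarr by auto
    then have "I \<subseteq> m" using proper by blast
    then have "m = I" using maximalideal.I_maximal[OF I mI] mne by (auto simp: m_def)
    then show "I = carrier R - Units R" by (simp add: m_def)
  qed (use max in \<open>simp add: m_def\<close>)
qed

lemma local_ringI: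
  assumes "cring S" "\<one>\<^bsub>S\<^esub> \<noteq> \<zero>\<^bsub>S\<^esub>"
    and "\<And>a b. a \<in> carrier S - Units S \<Longrightarrow> b \<in> carrier S - Units S \<Longrightarrow> a \<oplus>\<^bsub>S\<^esub> b \<notin> Units S"
  shows "local_ring S" "max_ideal S = carrier S - Units S"
  using cring.nonunits_maximalideal[OF assms] assms(1) by (auto simp: local_ring_def max_ideal_def)

lemma (in field) genideal_empty: "genideal R {} = {\<zero>}"
  using genideal_minimal[OF zeroideal, of "{}"] additive_subgroup.zero_closed[OF ideal.axioms(1)[OF genideal_ideal[of "{}"]]] by auto

text \<open>The dimension is zero, matched by the empty set as generating set of the maximal
  ideal.\<close>

lemma field_regular_local_ring:
  assumes "field S"
  shows "regular_local_ring S" "max_ideal S = {\<zero>\<^bsub>S\<^esub>}"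
proof -
  interpret field S by (rule assms)
  have U: "carrier S - Units S = {\<zero>\<^bsub>S\<^esub>}" using field_Units by auto
  have add: "a \<oplus>\<^bsub>S\<^esub> b \<notin> Units S" if "a \<in> carrier S - Units S" "b \<in> carrier S - Units S" for a b
    using that unfolding U by (simp add: field_Units)
  have L: "local_ring S" "max_ideal S = {\<zero>\<^bsub>S\<^esub>}"
    using local_ringI[OF is_cring one_not_zero add] U by auto
  have prime: "P = {\<zero>\<^bsub>S\<^esub>}" if "primeideal P S" for P
  proof -
    have P: "ideal P S" "carrier S \<noteq> P" using that primeideal.axioms(1) primeideal.I_notcarr by auto
    then have "P \<subseteq> {\<zero>\<^bsub>S\<^esub>}"
      using units_ideal[OF P(1)] additive_subgroup.a_subset[OF ideal.axioms(1)[OF P(1)]] U by blast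
    then show ?thesis using additive_subgroup.zero_closed[OF ideal.axioms(1)[OF P(1)]] by blast
  qed
  have "prime_chain S 0 (\<lambda>_. {\<zero>\<^bsub>S\<^esub>})" using zeroprimeideal by (simp add: prime_chain_def)
  moreover have "\<not> prime_chain S (Suc 0) c" for c
    using prime[of "c 0"] prime[of "c (Suc 0)"] by (auto simp: prime_chain_def)
  ultimately have "has_krull_dim S 0" by (auto simp: has_krull_dim_def)
  then have "\<exists>H\<subseteq>carrier S. finite H \<and> genideal S H = max_ideal S \<and> has_krull_dim S (card H)"
    using genideal_empty L by (intro exI[of _ "{}"]) simp
  then show "regular_local_ring S" using L(1) noetherian_ring_axioms by (simp add: regular_local_ring_def)
  show "max_ideal S = {\<zero>\<^bsub>S\<^esub>}" by (rule L(2))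
qed

text \<open>A nonzero ideal is generated by the least power of \<open>p\<close> that it contains,
  and the only nonzero prime is the ideal of \<open>p\<close>. So the dimension is one, which is
  also the number of generators of the maximal ideal.\<close>

lemma discrete_valuation_regular_local_ring:
  assumes "domain S" and p: "p \<in> carrier S" "p \<noteq> \<zero>\<^bsub>S\<^esub>" "p \<notin> Units S"
    and rep: "\<And>a. a \<in> carrier S \<Longrightarrow> a \<noteq> \<zero>\<^bsub>S\<^esub> \<Longrightarrow> \<exists>u\<in>Units S. \<exists>n::nat. a = u \<otimes>\<^bsub>S\<^esub> p [^]\<^bsub>S\<^esub> n"
  shows "regular_local_ring S" "max_ideal S = carrier S - Units S"
proof -
  interpret domain S by (rule assms(1))
  have Pid: "ideal (PIdl\<^bsub>S\<^esub> p) S" by (rule cgenideal_ideal[OF p(1)])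
  have notin: "x \<otimes>\<^bsub>S\<^esub> p \<notin> Units S" if x: "x \<in> carrier S" for x
  proof
    assume "x \<otimes>\<^bsub>S\<^esub> p \<in> Units S"
    moreover have "x \<otimes>\<^bsub>S\<^esub> p \<in> PIdl\<^bsub>S\<^esub> p" using x by (auto simp: cgenideal_def)
    ultimately have "PIdl\<^bsub>S\<^esub> p = carrier S" using units_ideal[OF Pid] by blast
    then have "\<one>\<^bsub>S\<^esub> \<in> PIdl\<^bsub>S\<^esub> p" by simp
    then obtain y where y: "y \<in> carrier S" "\<one>\<^bsub>S\<^esub> = y \<otimes>\<^bsub>S\<^esub> p" unfolding cgenideal_def by blast
    have "y \<otimes>\<^bsub>S\<^esub> p = \<one>\<^bsub>S\<^esub>" "p \<otimes>\<^bsub>S\<^esub> y = \<one>\<^bsub>S\<^esub>" using y(2) m_comm[OF y(1) p(1)] by simp_all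
    then have "p \<in> Units S" using p(1) y(1) unfolding Units_def by blast
    then show False using p(3) by simp
  qed
  have nonunits: "carrier S - Units S = PIdl\<^bsub>S\<^esub> p"
  proof
    show "PIdl\<^bsub>S\<^esub> p \<subseteq> carrier S - Units S" using notin p(1) by (auto simp: cgenideal_def)
    show "carrier S - Units S \<subseteq> PIdl\<^bsub>S\<^esub> p"
    proof
      fix a assume a: "a \<in> carrier S - Units S"
      show "a \<in> PIdl\<^bsub>S\<^esub> p"
      proof (cases "a = \<zero>\<^bsub>S\<^esub>")
        case True
        then show ?thesis using additive_subgroup.zero_closed[OF ideal.axioms(1)[OF Pid]] by simp
      next
        case False
        then obtain u n where un: "u \<in> Units S" "a = u \<otimes>\<^bsub>S\<^esub> p [^]\<^bsub>S\<^esub> (n::nat)" using rep[of a] a by auto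
        then obtain m where "n = Suc m" using a by (cases n) auto
        then have "a = (u \<otimes>\<^bsub>S\<^esub> p [^]\<^bsub>S\<^esub> m) \<otimes>\<^bsub>S\<^esub> p" using un Units_closed[OF un(1)] p(1) by (simp add: m_assoc)
        then show ?thesis using Units_closed[OF un(1)] p(1) by (auto simp: cgenideal_def)
      qed
    qed
  qed
  have add: "a \<oplus>\<^bsub>S\<^esub> b \<notin> Units S" if "a \<in> carrier S - Units S" "b \<in> carrier S - Units S" for a b
  proof -
    have "a \<oplus>\<^bsub>S\<^esub> b \<in> PIdl\<^bsub>S\<^esub> p"
      using that unfolding nonunits by (intro additive_subgroup.a_closed[OF ideal.axioms(1)[OF Pid]])
    then show ?thesis using nonunits by blast
  qed
  have L: "local_ring S" "max_ideal S = carrier S - Units S"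
    using local_ringI[OF is_cring one_not_zero add] by auto
  have powers: "p [^]\<^bsub>S\<^esub> n \<in> I" if I: "ideal I S" and a: "u \<otimes>\<^bsub>S\<^esub> p [^]\<^bsub>S\<^esub> (n::nat) \<in> I" "u \<in> Units S" for I u n
  proof -
    have "inv\<^bsub>S\<^esub> u \<otimes>\<^bsub>S\<^esub> (u \<otimes>\<^bsub>S\<^esub> p [^]\<^bsub>S\<^esub> n) \<in> I" by (rule ideal.I_l_closed[OF I a(1)]) (use a in simp)
    then show ?thesis using a(2) Units_closed[OF a(2)] p(1) by (simp add: m_assoc[symmetric])
  qed
  have noeth: "noetherian_ring S"
  proof (rule noetherian_ring.intro[OF ring_axioms noetherian_ring_axioms.intro])
    fix I assume I: "ideal I S"
    interpret I: ideal I S by (rule I)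
    show "\<exists>A\<subseteq>carrier S. finite A \<and> I = Idl\<^bsub>S\<^esub> A"
    proof (cases "I = {\<zero>\<^bsub>S\<^esub>}")
      case True
      have "Idl\<^bsub>S\<^esub> {} = {\<zero>\<^bsub>S\<^esub>}"
        using genideal_minimal[OF zeroideal, of "{}"] additive_subgroup.zero_closed[OF ideal.axioms(1)[OF genideal_ideal[of "{}"]]] by auto
      then show ?thesis using True by (intro exI[of _ "{}"]) simp
    next
      case False
      then obtain a where a: "a \<in> I" "a \<noteq> \<zero>\<^bsub>S\<^esub>" using I.zero_closed by blast
      then obtain u k where "u \<in> Units S" "a = u \<otimes>\<^bsub>S\<^esub> p [^]\<^bsub>S\<^esub> (k::nat)"
        using rep[of a] a I.a_subset by auto
      then have "\<exists>n::nat. p [^]\<^bsub>S\<^esub> n \<in> I" using powers[OF I, of u k] a by auto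
      then obtain n where n: "p [^]\<^bsub>S\<^esub> (n::nat) \<in> I" "\<And>k::nat. k < n \<Longrightarrow> p [^]\<^bsub>S\<^esub> k \<notin> I"
        using exists_least_iff[of "\<lambda>n::nat. p [^]\<^bsub>S\<^esub> n \<in> I"] by blast
      have pc: "p [^]\<^bsub>S\<^esub> n \<in> carrier S" using p by simp
      have G: "ideal (Idl\<^bsub>S\<^esub> {p [^]\<^bsub>S\<^esub> n}) S" by (rule genideal_ideal) (use pc in simp)
      have gen: "p [^]\<^bsub>S\<^esub> n \<in> Idl\<^bsub>S\<^esub> {p [^]\<^bsub>S\<^esub> n}" by (rule genideal_self') (use pc in simp)
      have "I \<subseteq> Idl\<^bsub>S\<^esub> {p [^]\<^bsub>S\<^esub> n}"
      proof
        fix b assume b: "b \<in> I"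
        show "b \<in> Idl\<^bsub>S\<^esub> {p [^]\<^bsub>S\<^esub> n}"
        proof (cases "b = \<zero>\<^bsub>S\<^esub>")
          case True
          then show ?thesis using additive_subgroup.zero_closed[OF ideal.axioms(1)[OF G]] by simp
        next
          case False
          then obtain v m where vm: "v \<in> Units S" "b = v \<otimes>\<^bsub>S\<^esub> p [^]\<^bsub>S\<^esub> (m::nat)"
            using rep[of b] b I.a_subset by auto
          have vc: "v \<in> carrier S" using Units_closed[OF vm(1)] .
          have "n \<le> m" using n(2)[of m] powers[OF I, of v m] b vm not_le by auto
          then have "p [^]\<^bsub>S\<^esub> m = p [^]\<^bsub>S\<^esub> (m - n) \<otimes>\<^bsub>S\<^esub> p [^]\<^bsub>S\<^esub> n" using p by (simp add: nat_pow_mult)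
          then have "b = (v \<otimes>\<^bsub>S\<^esub> p [^]\<^bsub>S\<^esub> (m - n)) \<otimes>\<^bsub>S\<^esub> p [^]\<^bsub>S\<^esub> n" using vm vc p by (simp add: m_assoc)
          then show ?thesis using ideal.I_l_closed[OF G gen] vc p by simp
        qed
      qed
      moreover have "Idl\<^bsub>S\<^esub> {p [^]\<^bsub>S\<^esub> n} \<subseteq> I" by (rule genideal_minimal[OF I]) (use n in simp)
      ultimately show ?thesis using pc by (intro exI[of _ "{p [^]\<^bsub>S\<^esub> n}"]) auto
    qed
  qed
  have prime: "P = {\<zero>\<^bsub>S\<^esub>} \<or> P = PIdl\<^bsub>S\<^esub> p" if P: "primeideal P S" for P
  proof (cases "P = {\<zero>\<^bsub>S\<^esub>}")
    case False
    interpret P: primeideal P S by (rule P)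
    obtain a where a: "a \<in> P" "a \<noteq> \<zero>\<^bsub>S\<^esub>" using False P.zero_closed by blast
    then obtain u n where "u \<in> Units S" "a = u \<otimes>\<^bsub>S\<^esub> p [^]\<^bsub>S\<^esub> (n::nat)"
      using rep[of a] a P.a_subset by auto
    then have "p [^]\<^bsub>S\<^esub> n \<in> P" using powers[OF P.ideal_axioms, of u n] a by auto
    moreover have "p [^]\<^bsub>S\<^esub> k \<in> P \<Longrightarrow> p \<in> P" for k :: nat
    proof (induction k)
      case 0
      then show ?case using units_ideal[OF P.ideal_axioms, of "\<one>\<^bsub>S\<^esub>"] P.I_notcarr by simp
    next
      case (Suc k)
      then show ?case using P.I_prime[of "p [^]\<^bsub>S\<^esub> k" p] p by auto
    qed
    ultimately have "PIdl\<^bsub>S\<^esub> p \<subseteq> P" using cgenideal_minimal[OF P.ideal_axioms] by blast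
    moreover have "P \<subseteq> PIdl\<^bsub>S\<^esub> p"
      using units_ideal[OF P.ideal_axioms] P.I_notcarr P.a_subset unfolding nonunits[symmetric] by blast
    ultimately show ?thesis by blast
  qed simp
  have pP: "p \<in> PIdl\<^bsub>S\<^esub> p" by (rule cgenideal_self[OF p(1)])
  have mP: "primeideal (PIdl\<^bsub>S\<^esub> p) S"
    by (rule maximalideal_prime) (use nonunits_maximalideal[OF one_not_zero add] nonunits in simp)
  have "prime_chain S (Suc 0) (\<lambda>i. if i = 0 then {\<zero>\<^bsub>S\<^esub>} else PIdl\<^bsub>S\<^esub> p)"
    unfolding prime_chain_def using zeroprimeideal mP p(2) pP additive_subgroup.zero_closed[OF ideal.axioms(1)[OF Pid]] by auto
  moreover have "\<not> prime_chain S (Suc (Suc 0)) c" for c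
  proof
    assume c: "prime_chain S (Suc (Suc 0)) c"
    have "primeideal (c i) S" if "i \<le> 2" for i using c that by (auto simp: prime_chain_def)
    then have "primeideal (c 0) S" "primeideal (c (Suc 0)) S" "primeideal (c (Suc (Suc 0))) S" by auto
    moreover have "c 0 \<subset> c (Suc 0)" "c (Suc 0) \<subset> c (Suc (Suc 0))" using c unfolding prime_chain_def by blast+
    moreover have "\<zero>\<^bsub>S\<^esub> \<in> PIdl\<^bsub>S\<^esub> p" by (rule additive_subgroup.zero_closed[OF ideal.axioms(1)[OF Pid]])
    ultimately show False using prime[of "c 0"] prime[of "c (Suc 0)"] prime[of "c (Suc (Suc 0))"] by auto
  qed
  ultimately have "has_krull_dim S (Suc 0)" by (auto simp: has_krull_dim_def)
  moreover have "genideal S {p} = max_ideal S" using cgenideal_eq_genideal[OF p(1)] L(2) nonunits by simp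
  ultimately have "\<exists>H\<subseteq>carrier S. finite H \<and> genideal S H = max_ideal S \<and> has_krull_dim S (card H)"
    using p(1) by (intro exI[of _ "{p}"]) simp
  then show "regular_local_ring S" using L(1) noeth by (simp add: regular_local_ring_def)
  show "max_ideal S = carrier S - Units S" by (rule L(2))
qed

section \<open>Affine models of a field\<close>

text \<open>The scheme structure on the spectrum of a subring \<open>D\<close> of a field \<open>F\<close> whose sections over a
  nonempty open set are the elements of \<open>F\<close> that lie in all local rings of its points.\<close>

locale affine_model = field F for F :: "'a ring" (structure) +
  fixes D :: "'a set"
  assumes D: "subring D F"
begin

abbreviation A :: "'a ring" where "A \<equiv> F\<lparr>carrier := D\<rparr>"

definition loc :: "'a set \<Rightarrow> 'a set" where
  "loc p = {a \<otimes> inv s | a s. a \<in> D \<and> s \<in> D - p}"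

text \<open>Over the empty set the condition on local rings is void and would give all of
  \<open>F\<close>, whereas a sheaf has exactly one section there. Hence the separate clause, in
  which \<open>one\<close> is overwritten to obtain the zero ring.\<close>

definition section_ring :: "'a set set \<Rightarrow> 'a ring" where
  "section_ring U = (if U = {} then F\<lparr>carrier := {\<zero>}, one := \<zero>\<rparr> else F\<lparr>carrier := {x \<in> carrier F. \<forall>p\<in>U. x \<in> loc p}\<rparr>)"

definition model :: "('a set, 'a) ringed_space" where
  "model = \<lparr> topo = zariski_topology A, sections = section_ring,
     restr = (\<lambda>U V s. if V = {} then \<zero> else s) \<rparr>"

lemma A_domain: "domain A"
  by (rule subring_is_domain[OF D])

lemma D_carrier: "a \<in> D \<Longrightarrow> a \<in> carrier F"
  using subringE(1)[OF D] by blast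

lemma primeD:
  assumes "p \<in> primes_of A"
  shows "p \<subseteq> D" "\<zero> \<in> p" "\<one> \<notin> p" "a \<in> p \<Longrightarrow> b \<in> p \<Longrightarrow> a \<oplus> b \<in> p" "a \<in> p \<Longrightarrow> b \<in> D \<Longrightarrow> b \<otimes> a \<in> p"
    "a \<in> D \<Longrightarrow> b \<in> D \<Longrightarrow> a \<otimes> b \<in> p \<Longrightarrow> a \<in> p \<or> b \<in> p"
proof -
  interpret p: primeideal p A using assms by (simp add: primes_of_def)
  show "p \<subseteq> D" using p.a_subset by simp
  show "\<zero> \<in> p" using additive_subgroup.zero_closed[OF p.additive_subgroup_axioms] by simp
  show "\<one> \<notin> p" using p.one_imp_carrier p.I_notcarr by auto
  show "a \<in> p \<Longrightarrow> b \<in> p \<Longrightarrow> a \<oplus> b \<in> p" using additive_subgroup.a_closed[OF p.additive_subgroup_axioms, of a b] by simp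
  show "a \<in> p \<Longrightarrow> b \<in> D \<Longrightarrow> b \<otimes> a \<in> p" using p.I_l_closed[of a b] by simp
  show "a \<in> D \<Longrightarrow> b \<in> D \<Longrightarrow> a \<otimes> b \<in> p \<Longrightarrow> a \<in> p \<or> b \<in> p" using p.I_prime[of a b] by simp
qed

lemma zero_prime: "{\<zero>} \<in> primes_of A"
  using domain.zeroprimeideal[OF A_domain] by (simp add: primes_of_def)

text \<open>The generating sets form a base: by primality, the points where neither \<open>f\<close>
  nor \<open>g\<close> vanishes are those where \<open>f \<otimes> g\<close> does not
  vanish.\<close>

lemma openin_zariski:
  "openin (zariski_topology A) U \<longleftrightarrow> U \<subseteq> primes_of A \<and> (\<forall>p\<in>U. \<exists>f\<in>D. f \<notin> p \<and> {q \<in> primes_of A. f \<notin> q} \<subseteq> U)"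
proof
  assume "openin (zariski_topology A) U"
  then have "generate_topology_on {{p \<in> primes_of A. f \<notin> p} | f. f \<in> carrier A} U"
    by (simp add: zariski_topology_def openin_topology_generated_by_iff)
  then show "U \<subseteq> primes_of A \<and> (\<forall>p\<in>U. \<exists>f\<in>D. f \<notin> p \<and> {q \<in> primes_of A. f \<notin> q} \<subseteq> U)"
  proof induction
    case (Int U V)
    have "\<exists>f\<in>D. f \<notin> p \<and> {q \<in> primes_of A. f \<notin> q} \<subseteq> U \<inter> V" if p: "p \<in> U" "p \<in> V" for p
    proof -
      obtain f where f: "f \<in> D" "f \<notin> p" "{q \<in> primes_of A. f \<notin> q} \<subseteq> U" using Int p by blast
      obtain g where g: "g \<in> D" "g \<notin> p" "{q \<in> primes_of A. g \<notin> q} \<subseteq> V" using Int p by blast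
      have pp: "p \<in> primes_of A" using Int p by blast
      have "f \<notin> q \<and> g \<notin> q" if q: "q \<in> primes_of A" "f \<otimes> g \<notin> q" for q
      proof -
        have "f \<otimes> g = g \<otimes> f" by (rule m_comm[OF D_carrier[OF f(1)] D_carrier[OF g(1)]])
        then show ?thesis using primeD(5)[OF q(1) _ f(1), of g] primeD(5)[OF q(1) _ g(1), of f] q(2) by metis
      qed
      moreover have "f \<otimes> g \<notin> p" using primeD(6)[OF pp f(1) g(1)] f g by blast
      moreover have "f \<otimes> g \<in> D" by (rule subringE(6)[OF D f(1) g(1)])
      ultimately show ?thesis using f(3) g(3) by blast
    qed
    then show ?case using Int by blast
  next
    case (UN \<U>)
    then show ?case by (meson Sup_upper UnionE Union_least subset_trans)
  qed auto
next
  assume U: "U \<subseteq> primes_of A \<and> (\<forall>p\<in>U. \<exists>f\<in>D. f \<notin> p \<and> {q \<in> primes_of A. f \<notin> q} \<subseteq> U)"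
  show "openin (zariski_topology A) U"
  proof (subst openin_subopen, intro ballI)
    fix p assume p: "p \<in> U"
    then obtain f where f: "f \<in> D" "f \<notin> p" "{q \<in> primes_of A. f \<notin> q} \<subseteq> U" using U by blast
    have "openin (zariski_topology A) {q \<in> primes_of A. f \<notin> q}"
      unfolding zariski_topology_def by (rule topology_generated_by_Basis) (use f in auto)
    then show "\<exists>T. openin (zariski_topology A) T \<and> p \<in> T \<and> T \<subseteq> U" using f p U by blast
  qed
qed

lemma topspace_zariski: "topspace (zariski_topology A) = primes_of A"
proof
  show "topspace (zariski_topology A) \<subseteq> primes_of A" using openin_zariski[of "topspace (zariski_topology A)"] by simp
  have "openin (zariski_topology A) (primes_of A)"
    unfolding openin_zariski by (auto intro!: bexI[of _ \<one>] simp: subringE(3)[OF D] primeD(3))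
  then show "primes_of A \<subseteq> topspace (zariski_topology A)" by (rule openin_subset)
qed

text \<open>The zero ideal is the generic point. Any two nonempty open sets meet in it, so sections
  over them can be compared as elements of \<open>F\<close>.\<close>

lemma zero_in_open: "openin (zariski_topology A) U \<Longrightarrow> U \<noteq> {} \<Longrightarrow> {\<zero>} \<in> U"
proof -
  assume U: "openin (zariski_topology A) U" "U \<noteq> {}"
  then obtain p f where p: "p \<in> U" "f \<in> D" "f \<notin> p" "{q \<in> primes_of A. f \<notin> q} \<subseteq> U" using openin_zariski[of U] by blast
  have "p \<in> primes_of A" using U p(1) openin_zariski[of U] by blast
  then have "f \<noteq> \<zero>" using primeD(2)[of p] p(3) by blast
  then show "{\<zero>} \<in> U" using p zero_prime by blast
qed

lemma locI: "a \<in> D \<Longrightarrow> s \<in> D \<Longrightarrow> s \<notin> p \<Longrightarrow> a \<otimes> inv s \<in> loc p"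
  by (auto simp: loc_def)

lemma locE:
  assumes "x \<in> loc p" "p \<in> primes_of A"
  obtains a s where "a \<in> D" "s \<in> D" "s \<notin> p" "s \<noteq> \<zero>" "a \<in> carrier F" "s \<in> carrier F" "x = a \<otimes> inv s"
  using assms primeD(2)[OF assms(2)] D_carrier by (auto simp: loc_def)

lemma loc_subring:
  assumes p: "p \<in> primes_of A"
  shows "subring (loc p) F"
proof (rule subringI)
  note D' = subringE[OF D]
  show "loc p \<subseteq> carrier F"
  proof
    fix x assume "x \<in> loc p"
    then obtain a s where "s \<noteq> \<zero>" "a \<in> carrier F" "s \<in> carrier F" "x = a \<otimes> inv s"
      by (rule locE[OF _ p])
    then show "x \<in> carrier F" by simp
  qed
  have "\<one> \<otimes> inv \<one> \<in> loc p" by (rule locI[OF D'(3) D'(3) primeD(3)[OF p]])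
  then show "\<one> \<in> loc p" by simp
  fix x assume "x \<in> loc p"
  then obtain a s where as: "a \<in> D" "s \<in> D" "s \<notin> p" "s \<noteq> \<zero>" "a \<in> carrier F" "s \<in> carrier F" "x = a \<otimes> inv s"
    by (rule locE[OF _ p])
  have "\<ominus> x = (\<ominus> a) \<otimes> inv s" using as by (simp add: l_minus)
  then show "\<ominus> x \<in> loc p" using locI[OF D'(5)[OF as(1)] as(2,3)] by simp
  fix y assume "y \<in> loc p"
  then obtain b t where bt: "b \<in> D" "t \<in> D" "t \<notin> p" "t \<noteq> \<zero>" "b \<in> carrier F" "t \<in> carrier F" "y = b \<otimes> inv t"
    by (rule locE[OF _ p])
  have st: "s \<otimes> t \<in> D" "s \<otimes> t \<notin> p" using D'(6)[OF as(2) bt(2)] primeD(6)[OF p as(2) bt(2)] as bt by auto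
  have "x \<otimes> y = (a \<otimes> b) \<otimes> inv (s \<otimes> t)" using as bt by (simp add: inv_prod m_ac)
  then show "x \<otimes> y \<in> loc p" using locI[OF D'(6)[OF as(1) bt(1)] st] by simp
  have "(a \<otimes> t \<oplus> b \<otimes> s) \<otimes> inv (s \<otimes> t) = a \<otimes> inv s \<otimes> (t \<otimes> inv t) \<oplus> b \<otimes> inv t \<otimes> (s \<otimes> inv s)"
    using as bt by (simp add: inv_prod l_distr r_distr m_ac del: inv_mult mult_inv_cancel)
  then have "x \<oplus> y = (a \<otimes> t \<oplus> b \<otimes> s) \<otimes> inv (s \<otimes> t)" using as bt by simp
  then show "x \<oplus> y \<in> loc p" using locI[OF D'(7)[OF D'(6)[OF as(1) bt(2)] D'(6)[OF bt(1) as(2)]] st] by simp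
qed

lemma D_subset_loc:
  assumes "p \<in> primes_of A"
  shows "D \<subseteq> loc p"
proof
  fix a assume a: "a \<in> D"
  have "a \<otimes> inv \<one> \<in> loc p" by (rule locI[OF a subringE(3)[OF D] primeD(3)[OF assms]])
  then show "a \<in> loc p" using a D_carrier by simp
qed

text \<open>In a domain the pairs that represent a fraction are determined by its value in the
  field, which makes the classes in \<open>localization\<close> explicit.\<close>

definition frac_class :: "'a set \<Rightarrow> 'a \<Rightarrow> ('a \<times> 'a) set" where
  "frac_class p x = {(b, t). b \<in> D \<and> t \<in> D - p \<and> b = x \<otimes> t}"

lemma fraction_eq:
  assumes p: "p \<in> primes_of A" and a: "a \<in> D" and s: "s \<in> D" "s \<notin> p"
  shows "fraction A (carrier A - p) a s = frac_class p (a \<otimes> inv s)"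
proof -
  interpret A: domain A by (rule A_domain)
  have c: "a \<in> carrier F" "s \<in> carrier F" "s \<noteq> \<zero>" using a s primeD(2)[OF p] D_carrier by auto
  have "(\<exists>u\<in>D - p. u \<otimes> ((t \<otimes> a) \<ominus>\<^bsub>A\<^esub> (s \<otimes> b)) = \<zero>) \<longleftrightarrow> b = (a \<otimes> inv s) \<otimes> t"
    if bt: "b \<in> D" "t \<in> D - p" for b t
  proof -
    have bc: "b \<in> carrier F" "t \<in> carrier F" using bt D_carrier by auto
    have m: "t \<otimes> a \<in> D" "s \<otimes> b \<in> D" using subringE(6)[OF D] bt a s by auto
    have dm: "(t \<otimes> a) \<ominus>\<^bsub>A\<^esub> (s \<otimes> b) \<in> D" using A.minus_closed m by simp
    have "(\<exists>u\<in>D - p. u \<otimes> ((t \<otimes> a) \<ominus>\<^bsub>A\<^esub> (s \<otimes> b)) = \<zero>) \<longleftrightarrow> (t \<otimes> a) \<ominus>\<^bsub>A\<^esub> (s \<otimes> b) = \<zero>"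
    proof
      assume "\<exists>u\<in>D - p. u \<otimes> ((t \<otimes> a) \<ominus>\<^bsub>A\<^esub> (s \<otimes> b)) = \<zero>"
      then obtain u where u: "u \<in> D" "u \<notin> p" "u \<otimes> ((t \<otimes> a) \<ominus>\<^bsub>A\<^esub> (s \<otimes> b)) = \<zero>" by blast
      have "u \<noteq> \<zero>" using u(2) primeD(2)[OF p] by blast
      then show "(t \<otimes> a) \<ominus>\<^bsub>A\<^esub> (s \<otimes> b) = \<zero>" using integral[OF u(3)] u(1) dm D_carrier by blast
    next
      assume "(t \<otimes> a) \<ominus>\<^bsub>A\<^esub> (s \<otimes> b) = \<zero>"
      then show "\<exists>u\<in>D - p. u \<otimes> ((t \<otimes> a) \<ominus>\<^bsub>A\<^esub> (s \<otimes> b)) = \<zero>" using s c by (intro bexI[of _ s]) auto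
    qed
    also have "\<dots> \<longleftrightarrow> t \<otimes> a = s \<otimes> b" using A.r_right_minus_eq[of "t \<otimes> a" "s \<otimes> b"] m by simp
    also have "\<dots> \<longleftrightarrow> b = (a \<otimes> inv s) \<otimes> t"
    proof
      assume "t \<otimes> a = s \<otimes> b"
      then have "inv s \<otimes> (t \<otimes> a) = b" using c bc by simp
      then show "b = (a \<otimes> inv s) \<otimes> t" using c bc by (simp add: m_ac)
    next
      assume "b = (a \<otimes> inv s) \<otimes> t"
      then have "s \<otimes> b = s \<otimes> (inv s \<otimes> (t \<otimes> a))" using c bc by (simp add: m_ac del: mult_inv_cancel)
      then show "t \<otimes> a = s \<otimes> b" using c bc by simp
    qed
    finally show ?thesis .
  qed
  then show ?thesis unfolding fraction_def frac_class_def by auto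
qed

lemma frac_class_mem: "p \<in> primes_of A \<Longrightarrow> a \<in> D \<Longrightarrow> s \<in> D \<Longrightarrow> s \<notin> p \<Longrightarrow> (a, s) \<in> frac_class p (a \<otimes> inv s)"
proof -
  assume *: "p \<in> primes_of A" "a \<in> D" "s \<in> D" "s \<notin> p"
  then have "s \<noteq> \<zero>" using primeD(2)[of p] by blast
  then have "a \<otimes> inv s \<otimes> s = a" using * D_carrier by (simp add: m_assoc)
  then show ?thesis using * by (simp add: frac_class_def)
qed

lemma frac_class_memD:
  assumes "p \<in> primes_of A" "x \<in> carrier F" "(a, s) \<in> frac_class p x"
  shows "a \<in> D" "s \<in> D" "s \<notin> p" "x = a \<otimes> inv s"
proof -
  show as: "a \<in> D" "s \<in> D" "s \<notin> p" using assms(3) by (auto simp: frac_class_def)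
  then have "s \<in> carrier F" "s \<noteq> \<zero>" using D_carrier primeD(2)[OF assms(1)] by auto
  moreover have "a = x \<otimes> s" using assms(3) by (simp add: frac_class_def)
  ultimately show "x = a \<otimes> inv s" using assms(2) by (simp add: m_assoc)
qed

lemma loc_carrier: "p \<in> primes_of A \<Longrightarrow> x \<in> loc p \<Longrightarrow> x \<in> carrier F"
  using subringE(1)[OF loc_subring] by blast

lemma frac_class_nonempty: "p \<in> primes_of A \<Longrightarrow> x \<in> loc p \<Longrightarrow> \<exists>a s. (a, s) \<in> frac_class p x"
  by (erule locE, assumption) (auto intro: frac_class_mem)

lemma frac_class_inj:
  assumes p: "p \<in> primes_of A" and x: "x \<in> loc p" and y: "y \<in> loc p" and e: "frac_class p x = frac_class p y"
  shows "x = y"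
proof -
  obtain a s where "(a, s) \<in> frac_class p x" using frac_class_nonempty[OF p x] by blast
  then show ?thesis
    using frac_class_memD(4)[OF p loc_carrier[OF p x]] frac_class_memD(4)[OF p loc_carrier[OF p y]] e by metis
qed

lemma local_at_carrier:
  assumes "p \<in> primes_of A"
  shows "carrier (local_at A p) = frac_class p ` loc p"
proof -
  have "carrier (local_at A p) = {frac_class p (a \<otimes> inv s) | a s. a \<in> D \<and> s \<in> D - p}"
  proof -
    have "(\<exists>a s. y = fraction A (carrier A - p) a s \<and> a \<in> D \<and> s \<in> D - p) \<longleftrightarrow>
        (\<exists>a s. y = frac_class p (a \<otimes> inv s) \<and> a \<in> D \<and> s \<in> D - p)" for y
    proof -
      have "fraction A (carrier A - p) a s = frac_class p (a \<otimes> inv s)" if h: "a \<in> D" "s \<in> D - p" for a s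
        using fraction_eq[OF assms h(1), of s] h(2) by blast
      then show ?thesis by metis
    qed
    then show ?thesis by (simp add: localization_def)
  qed
  then show ?thesis unfolding loc_def by blast
qed

text \<open>The unions that define the operations run over nonempty classes, and every pair of
  representatives contributes the same class.\<close>

lemma local_at_ops:
  assumes p: "p \<in> primes_of A" and x: "x \<in> loc p" and y: "y \<in> loc p"
  shows "frac_class p x \<otimes>\<^bsub>local_at A p\<^esub> frac_class p y = frac_class p (x \<otimes> y)"
    and "frac_class p x \<oplus>\<^bsub>local_at A p\<^esub> frac_class p y = frac_class p (x \<oplus> y)"
proof -
  note D' = subringE[OF D]
  obtain a0 s0 where 0: "(a0, s0) \<in> frac_class p x" using frac_class_nonempty[OF p x] by blast
  obtain b0 t0 where 1: "(b0, t0) \<in> frac_class p y" using frac_class_nonempty[OF p y] by blast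
  have key: "fraction A (carrier A - p) (a \<otimes> b) (s \<otimes> t) = frac_class p (x \<otimes> y) \<and>
      fraction A (carrier A - p) ((a \<otimes> t) \<oplus> (b \<otimes> s)) (s \<otimes> t) = frac_class p (x \<oplus> y)"
    if as: "(a, s) \<in> frac_class p x" and bt: "(b, t) \<in> frac_class p y" for a s b t
  proof -
    note as' = frac_class_memD[OF p loc_carrier[OF p x] as] note bt' = frac_class_memD[OF p loc_carrier[OF p y] bt]
    have c: "a \<in> carrier F" "s \<in> carrier F" "b \<in> carrier F" "t \<in> carrier F" "s \<noteq> \<zero>" "t \<noteq> \<zero>"
      using as' bt' D_carrier primeD(2)[OF p] by auto
    have st: "s \<otimes> t \<in> D" "s \<otimes> t \<notin> p" using D'(6)[OF as'(2) bt'(2)] primeD(6)[OF p as'(2) bt'(2)] as' bt' by auto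
    have "(a \<otimes> b) \<otimes> inv (s \<otimes> t) = x \<otimes> y" using as'(4) bt'(4) c by (simp add: inv_prod m_ac)
    moreover have "(a \<otimes> t \<oplus> b \<otimes> s) \<otimes> inv (s \<otimes> t) = x \<oplus> y"
    proof -
      have "(a \<otimes> t \<oplus> b \<otimes> s) \<otimes> inv (s \<otimes> t) = a \<otimes> inv s \<otimes> (t \<otimes> inv t) \<oplus> b \<otimes> inv t \<otimes> (s \<otimes> inv s)"
        using c by (simp add: inv_prod l_distr r_distr m_ac del: inv_mult mult_inv_cancel)
      then show ?thesis using c as'(4) bt'(4) by simp
    qed
    ultimately show ?thesis
      using fraction_eq[OF p D'(6)[OF as'(1) bt'(1)] st]
        fraction_eq[OF p D'(7)[OF D'(6)[OF as'(1) bt'(2)] D'(6)[OF bt'(1) as'(2)]] st] by simp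
  qed
  have "(\<Union>(a, s)\<in>frac_class p x. \<Union>(b, t)\<in>frac_class p y. fraction A (carrier A - p) (a \<otimes> b) (s \<otimes> t)) = frac_class p (x \<otimes> y)" (is "?L = ?R")
  proof (rule equalityI)
    show "?L \<subseteq> ?R" using key by fast
    show "?R \<subseteq> ?L" using key[OF 0 1] 0 1 by fast
  qed
  then show "frac_class p x \<otimes>\<^bsub>local_at A p\<^esub> frac_class p y = frac_class p (x \<otimes> y)"
    by (simp add: localization_def)
  have "(\<Union>(a, s)\<in>frac_class p x. \<Union>(b, t)\<in>frac_class p y. fraction A (carrier A - p) ((a \<otimes> t) \<oplus> (b \<otimes> s)) (s \<otimes> t)) = frac_class p (x \<oplus> y)" (is "?L = ?R")
  proof (rule equalityI)
    show "?L \<subseteq> ?R" using key by fast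
    show "?R \<subseteq> ?L" using key[OF 0 1] 0 1 by fast
  qed
  then show "frac_class p x \<oplus>\<^bsub>local_at A p\<^esub> frac_class p y = frac_class p (x \<oplus> y)"
    by (simp add: localization_def)
qed

lemma local_at_one: "p \<in> primes_of A \<Longrightarrow> \<one>\<^bsub>local_at A p\<^esub> = frac_class p \<one>"
  using fraction_eq[of p \<one> \<one>] subringE(3)[OF D] primeD(3) by (simp add: localization_def)

end

section \<open>The structure sheaf of the model and its comparison with the spectrum\<close>

lemma ring_iso_Units:
  assumes R: "ring R" and h: "h \<in> ring_iso R S" and a: "a \<in> carrier R"
  shows "h a \<in> Units S \<longleftrightarrow> a \<in> Units R"
proof -
  interpret ring R by (rule R)
  note h' = ring_iso_memE[OF h]
  have inj: "h x = h y \<longleftrightarrow> x = y" if "x \<in> carrier R" "y \<in> carrier R" for x y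
    using bij_betw_imp_inj_on[OF h'(5)] that by (auto dest: inj_onD)
  have surj: "carrier S = h ` carrier R" using bij_betw_imp_surj_on[OF h'(5)] by simp
  have "h b \<otimes>\<^bsub>S\<^esub> h a = \<one>\<^bsub>S\<^esub> \<longleftrightarrow> b \<otimes>\<^bsub>R\<^esub> a = \<one>\<^bsub>R\<^esub>" "h a \<otimes>\<^bsub>S\<^esub> h b = \<one>\<^bsub>S\<^esub> \<longleftrightarrow> a \<otimes>\<^bsub>R\<^esub> b = \<one>\<^bsub>R\<^esub>"
    if b: "b \<in> carrier R" for b
    using h'(2)[OF a b] h'(2)[OF b a] h'(4) inj[OF m_closed[OF a b] one_closed] inj[OF m_closed[OF b a] one_closed] by auto
  then show ?thesis unfolding Units_def surj using a h'(1)[OF a] surj by auto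
qed

lemma zero_cring:
  assumes "ring R"
  shows "cring (R\<lparr>carrier := {\<zero>\<^bsub>R\<^esub>}, one := \<zero>\<^bsub>R\<^esub>\<rparr>)"
proof -
  interpret ring R by (rule assms)
  show ?thesis
    by (intro cringI abelian_groupI comm_monoidI) auto
qed

context affine_model
begin

lemma section_carrier: "U \<noteq> {} \<Longrightarrow> carrier (section_ring U) = {x \<in> carrier F. \<forall>p\<in>U. x \<in> loc p}"
  by (simp add: section_ring_def)

lemma section_carrier_empty: "carrier (section_ring {}) = {\<zero>}"
  by (simp add: section_ring_def)

lemma section_subring:
  assumes "U \<subseteq> primes_of A"
  shows "subring {x \<in> carrier F. \<forall>p\<in>U. x \<in> loc p} F"
proof -
  have "subring (\<Inter>(insert (carrier F) (loc ` U))) F"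
    by (rule subring_Inter) (use assms loc_subring carrier_is_subring in auto)
  moreover have "\<Inter>(insert (carrier F) (loc ` U)) = {x \<in> carrier F. \<forall>p\<in>U. x \<in> loc p}" by auto
  ultimately show ?thesis by simp
qed

lemma section_domain: "U \<subseteq> primes_of A \<Longrightarrow> U \<noteq> {} \<Longrightarrow> domain (section_ring U)"
  using subring_is_domain[OF section_subring] by (simp add: section_ring_def)

lemma section_cring: "U \<subseteq> primes_of A \<Longrightarrow> cring (section_ring U)"
proof (cases "U = {}")
  case True
  then show ?thesis using zero_cring[OF ring_axioms] by (simp add: section_ring_def)
next
  case False
  assume "U \<subseteq> primes_of A"
  then show ?thesis using domain.axioms(1)[OF section_domain[OF _ False]] by blast
qed

lemma section_ops [simp]:
  "monoid.mult (section_ring U) = monoid.mult F" "ring.add (section_ring U) = ring.add F" "ring.zero (section_ring U) = \<zero>"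
  "U \<noteq> {} \<Longrightarrow> monoid.one (section_ring U) = \<one>" "monoid.one (section_ring {}) = \<zero>"
  by (simp_all add: section_ring_def)

lemma open_subset_primes: "openin (zariski_topology A) U \<Longrightarrow> U \<subseteq> primes_of A"
  using openin_zariski by blast

lemma exists_section:
  assumes p: "p \<in> primes_of A" and x: "x \<in> loc p"
  shows "\<exists>U. openin (zariski_topology A) U \<and> p \<in> U \<and> x \<in> carrier (section_ring U)"
proof -
  obtain a s where as: "a \<in> D" "s \<in> D" "s \<notin> p" "s \<noteq> \<zero>" "a \<in> carrier F" "s \<in> carrier F" "x = a \<otimes> inv s"
    by (rule locE[OF x p])
  define U where "U = {q \<in> primes_of A. s \<notin> q}"
  have "openin (zariski_topology A) U" unfolding openin_zariski U_def using as(2) by blast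
  moreover have "p \<in> U" using p as by (simp add: U_def)
  moreover have "x \<in> carrier (section_ring U)"
  proof -
    have "x \<in> loc q" if "q \<in> U" for q using locI[OF as(1,2), of q] that as(7) by (simp add: U_def)
    moreover have "U \<noteq> {}" using \<open>p \<in> U\<close> by blast
    ultimately show ?thesis using as by (simp add: section_carrier)
  qed
  ultimately show ?thesis by blast
qed

definition to_spec :: "'a set set \<Rightarrow> 'a \<Rightarrow> 'a set \<Rightarrow> ('a \<times> 'a) set" where
  "to_spec U x = (\<lambda>p\<in>U. frac_class p x)"

lemma to_spec_regular:
  assumes U: "openin (zariski_topology A) U" and x: "x \<in> carrier (section_ring U)"
  shows "to_spec U x \<in> regular_functions A U"
proof (cases "U = {}")
  case True
  then show ?thesis by (simp add: to_spec_def regular_functions_def restrict_def)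
next
  case False
  have xl: "x \<in> loc p" if "p \<in> U" for p using x that False by (simp add: section_carrier)
  note UP = open_subset_primes[OF U]
  show ?thesis unfolding regular_functions_def
  proof (intro CollectI conjI ballI)
    show "to_spec U x \<in> (\<Pi>\<^sub>E p\<in>U. carrier (local_at A p))"
      using xl UP local_at_carrier unfolding to_spec_def by (intro restrict_PiE_iff[THEN iffD2]) blast
    fix p assume p: "p \<in> U"
    have pp: "p \<in> primes_of A" using p UP by blast
    obtain a s where as: "a \<in> D" "s \<in> D" "s \<notin> p" "s \<noteq> \<zero>" "a \<in> carrier F" "s \<in> carrier F" "x = a \<otimes> inv s"
      by (rule locE[OF xl[OF p] pp])
    define V where "V = U \<inter> {q \<in> primes_of A. s \<notin> q}"
    have "openin (zariski_topology A) {q \<in> primes_of A. s \<notin> q}" unfolding openin_zariski using as(2) by blast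
    then have "openin (zariski_topology A) V" unfolding V_def by (rule openin_Int[OF U])
    moreover have "s \<notin> q \<and> to_spec U x q = fraction A (carrier A - q) a s" if q: "q \<in> V" for q
      using fraction_eq[OF _ as(1,2), of q] q as(7) by (simp add: V_def to_spec_def)
    moreover have "p \<in> V" "V \<subseteq> U" using p pp as(3) by (auto simp: V_def)
    ultimately show "\<exists>V a f. openin (zariski_topology A) V \<and> p \<in> V \<and> V \<subseteq> U \<and> a \<in> carrier A \<and> f \<in> carrier A \<and>
      (\<forall>q\<in>V. f \<notin> q \<and> to_spec U x q = fraction A (carrier A - q) a f)"
      using as(1,2) by (intro exI[of _ V] exI[of _ a] exI[of _ s]) simp
  qed
qed

text \<open>The value at the generic point determines an element of \<open>F\<close>. Near any other
  point the section is a single fraction, and since every neighborhood contains the generic point,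
  this fraction is the same element.\<close>

lemma to_spec_surj:
  assumes U: "openin (zariski_topology A) U" and s: "s \<in> regular_functions A U"
  shows "s \<in> to_spec U ` carrier (section_ring U)"
proof (cases "U = {}")
  case True
  have "s = (\<lambda>_. undefined)" using s True by (simp add: regular_functions_def)
  then have "s = to_spec U \<zero>" using True by (simp add: to_spec_def restrict_def)
  then show ?thesis using True section_carrier_empty by simp
next
  case False
  note UP = open_subset_primes[OF U]
  have sP: "s \<in> (\<Pi>\<^sub>E p\<in>U. carrier (local_at A p))" using s by (simp add: regular_functions_def)
  have z: "{\<zero>} \<in> U" by (rule zero_in_open[OF U False])
  then have "s {\<zero>} \<in> frac_class {\<zero>} ` loc {\<zero>}" using PiE_mem[OF sP z] local_at_carrier[OF zero_prime] by simp
  then obtain x where x: "x \<in> loc {\<zero>}" "s {\<zero>} = frac_class {\<zero>} x" by blast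
  have all: "x \<in> loc p \<and> s p = frac_class p x" if p: "p \<in> U" for p
  proof -
    obtain V a f where V: "openin (zariski_topology A) V" "p \<in> V" "V \<subseteq> U" "a \<in> D" "f \<in> D"
      "\<And>q. q \<in> V \<Longrightarrow> f \<notin> q \<and> s q = fraction A (carrier A - q) a f"
      using s p unfolding regular_functions_def by auto
    have zV: "{\<zero>} \<in> V" using zero_in_open[OF V(1)] V(2) by blast
    have pp: "p \<in> primes_of A" using p UP by blast
    have "s {\<zero>} = frac_class {\<zero>} (a \<otimes> inv f)" using V(6)[OF zV] fraction_eq[OF zero_prime V(4,5)] by simp
    then have "x = a \<otimes> inv f"
      using frac_class_inj[OF zero_prime x(1) locI[OF V(4,5)]] x(2) V(6)[OF zV] by simp
    moreover have "s p = frac_class p (a \<otimes> inv f)" using V(6)[OF V(2)] fraction_eq[OF pp V(4,5)] by simp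
    moreover have "a \<otimes> inv f \<in> loc p" using locI[OF V(4,5)] V(6)[OF V(2)] by blast
    ultimately show ?thesis by simp
  qed
  have "s p = to_spec U x p" for p
    using all[of p] PiE_arb[OF sP, of p] by (cases "p \<in> U") (simp_all add: to_spec_def)
  then have "s = to_spec U x" by (rule ext)
  moreover have "x \<in> carrier (section_ring U)" using all False loc_carrier[OF zero_prime x(1)] by (simp add: section_carrier)
  ultimately show ?thesis by blast
qed

lemma to_spec_iso:
  assumes U: "openin (zariski_topology A) U"
  shows "to_spec U \<in> ring_iso (section_ring U) (sections (Spec A) U)"
proof (rule ring_iso_memI)
  note UP = open_subset_primes[OF U]
  show "to_spec U x \<in> carrier (sections (Spec A) U)" if "x \<in> carrier (section_ring U)" for x
    using to_spec_regular[OF U that] by (simp add: Spec_def)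
  have ops: "x \<in> loc p" if "x \<in> carrier (section_ring U)" "p \<in> U" for x p
  proof -
    have "U \<noteq> {}" using that by blast
    then show ?thesis using that by (simp add: section_carrier)
  qed
  show "to_spec U (x \<otimes>\<^bsub>section_ring U\<^esub> y) = to_spec U x \<otimes>\<^bsub>sections (Spec A) U\<^esub> to_spec U y"
    "to_spec U (x \<oplus>\<^bsub>section_ring U\<^esub> y) = to_spec U x \<oplus>\<^bsub>sections (Spec A) U\<^esub> to_spec U y"
    if xy: "x \<in> carrier (section_ring U)" "y \<in> carrier (section_ring U)" for x y
  proof -
    have "frac_class p x \<otimes>\<^bsub>local_at A p\<^esub> frac_class p y = frac_class p (x \<otimes> y)"
      "frac_class p x \<oplus>\<^bsub>local_at A p\<^esub> frac_class p y = frac_class p (x \<oplus> y)" if p: "p \<in> U" for p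
      using local_at_ops[of p x y] ops[OF xy(1) p] ops[OF xy(2) p] p UP by blast+
    then show "to_spec U (x \<otimes>\<^bsub>section_ring U\<^esub> y) = to_spec U x \<otimes>\<^bsub>sections (Spec A) U\<^esub> to_spec U y"
      "to_spec U (x \<oplus>\<^bsub>section_ring U\<^esub> y) = to_spec U x \<oplus>\<^bsub>sections (Spec A) U\<^esub> to_spec U y"
      unfolding to_spec_def Spec_def by (auto simp del: partial_object.simps intro!: restrict_ext)
  qed
  show "to_spec U \<one>\<^bsub>section_ring U\<^esub> = \<one>\<^bsub>sections (Spec A) U\<^esub>"
  proof (cases "U = {}")
    case True
    then show ?thesis by (simp add: to_spec_def Spec_def restrict_def)
  next
    case False
    have "frac_class p \<one> = \<one>\<^bsub>local_at A p\<^esub>" if "p \<in> U" for p using local_at_one[of p] that UP by auto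
    then show ?thesis using False unfolding to_spec_def Spec_def by (auto intro!: restrict_ext)
  qed
  have inj: "inj_on (to_spec U) (carrier (section_ring U))"
  proof (cases "U = {}")
    case True
    then show ?thesis by (simp add: section_carrier_empty)
  next
    case False
    show ?thesis
    proof (rule inj_onI)
      fix x y assume xy: "x \<in> carrier (section_ring U)" "y \<in> carrier (section_ring U)" "to_spec U x = to_spec U y"
      have z: "{\<zero>} \<in> U" by (rule zero_in_open[OF U False])
      have "frac_class {\<zero>} x = frac_class {\<zero>} y" using fun_cong[OF xy(3), of "{\<zero>}"] z by (simp add: to_spec_def)
      then show "x = y" by (rule frac_class_inj[OF zero_prime ops[OF xy(1) z] ops[OF xy(2) z]])
    qed
  qed
  have "to_spec U ` carrier (section_ring U) = regular_functions A U"
    using to_spec_regular[OF U] to_spec_surj[OF U] by blast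
  then show "bij_betw (to_spec U) (carrier (section_ring U)) (carrier (sections (Spec A) U))"
    using inj by (simp add: bij_betw_def Spec_def)
qed

lemma model_simps [simp]:
  "topo model = zariski_topology A" "sections model = section_ring" "restr model U V s = (if V = {} then \<zero> else s)"
  "topspace (zariski_topology A) = primes_of A"
  by (simp_all add: model_def topspace_zariski)

lemma restr_section:
  assumes V: "V \<subseteq> U" and s: "s \<in> carrier (section_ring U)"
  shows "restr model U V s \<in> carrier (section_ring V)"
proof (cases "V = {}")
  case False
  then have "U \<noteq> {}" using V by blast
  then show ?thesis using s V False by (auto simp: section_carrier)
qed (simp add: section_carrier_empty)

lemma zero_section_empty: "s \<in> carrier (section_ring {}) \<Longrightarrow> s = \<zero>"
  by (simp add: section_carrier_empty)

lemma model_iso_spec: "ringed_space_isomorphic model (Spec A)"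
proof -
  define \<phi> where "\<phi> V = inv_into (carrier (section_ring V)) (to_spec V)" for V
  have pre: "{x \<in> pts model. id x \<in> V} = V" if "openin (zariski_topology A) V" for V
    using open_subset_primes[OF that] by auto
  have iso: "\<phi> V \<in> ring_iso (sections (Spec A) V) (section_ring V)" if V: "openin (zariski_topology A) V" for V
    unfolding \<phi>_def
    by (rule ring_iso_set_sym[OF _ to_spec_iso[OF V]])
      (rule cring.axioms(1)[OF section_cring[OF open_subset_primes[OF V]]])
  have inv: "\<phi> V (to_spec V x) = x" if V: "openin (zariski_topology A) V" and x: "x \<in> carrier (section_ring V)" for V x
    unfolding \<phi>_def by (rule inv_into_f_f[OF bij_betw_imp_inj_on[OF ring_iso_memE(5)[OF to_spec_iso[OF V]]] x])
  have comm: "restr model V W (\<phi> V s) = \<phi> W (restr (Spec A) V W s)"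
    if V: "openin (zariski_topology A) V" and W: "openin (zariski_topology A) W" "W \<subseteq> V" and s: "s \<in> carrier (sections (Spec A) V)" for V W s
  proof -
    have "s \<in> regular_functions A V" using s by (simp add: Spec_def)
    then obtain x where x: "x \<in> carrier (section_ring V)" "s = to_spec V x" using to_spec_surj[OF V] by blast
    define y where "y = restr model V W x"
    have y: "y \<in> carrier (section_ring W)" unfolding y_def by (rule restr_section[OF W(2) x(1)])
    have "restr (Spec A) V W s = to_spec W y"
    proof (cases "W = {}")
      case False
      then have "y = x" by (simp add: y_def)
      then show ?thesis using W(2) unfolding x(2) to_spec_def Spec_def by (auto intro!: restrict_ext simp: Int_absorb1)
    qed (simp add: to_spec_def Spec_def restrict_def)
    then show ?thesis using inv[OF W(1) y] inv[OF V x(1)] x(2) y_def by simp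
  qed
  show ?thesis unfolding ringed_space_isomorphic_def
  proof (intro exI conjI allI impI)
    show "homeomorphic_map (topo model) (topo (Spec A)) id" by (simp add: Spec_def homeomorphic_map_id)
    show "\<phi> V \<in> ring_iso (sections (Spec A) V) (sections model {x \<in> pts model. id x \<in> V})"
      if "openin (topo (Spec A)) V" for V using iso[of V] pre[of V] that by (simp add: Spec_def)
    show "\<forall>s\<in>carrier (sections (Spec A) V). restr model {x \<in> pts model. id x \<in> V} {x \<in> pts model. id x \<in> W} (\<phi> V s) =
        \<phi> W (restr (Spec A) V W s)"
      if "openin (topo (Spec A)) V \<and> openin (topo (Spec A)) W \<and> W \<subseteq> V" for V W
    proof -
      have VW: "openin (zariski_topology A) V" "openin (zariski_topology A) W" "W \<subseteq> V" using that by (auto simp: Spec_def)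
      show ?thesis unfolding pre[OF VW(1)] pre[OF VW(2)] using comm[OF VW] by blast
    qed
  qed
qed

lemma affine_open_model: "affine_open model (primes_of A)"
proof -
  have "open_subspace model (primes_of A) = model"
    using subtopology_topspace[of "zariski_topology A"] by (simp add: open_subspace_def model_def topspace_zariski)
  moreover have "openin (zariski_topology A) (primes_of A)" using openin_topspace[of "zariski_topology A"] by simp
  ultimately show ?thesis unfolding affine_open_def using model_iso_spec domain.axioms(1)[OF A_domain] by auto
qed

text \<open>Restriction to a nonempty open set does not change an element of \<open>F\<close>, so
  the sheaf axioms come down to the irreducibility of the space and to the treatment of empty
  members of a cover.\<close>

lemma model_ringed_space: "is_ringed_space model"
  unfolding is_ringed_space_def
proof (intro conjI allI impI)
  show "is_presheaf model" unfolding is_presheaf_def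
  proof (intro conjI allI impI ballI)
    show "cring (sections model U)" if "openin (topo model) U" for U
      using section_cring[OF open_subset_primes] that by simp
    show "restr model U V \<in> ring_hom (sections model U) (sections model V)"
      if "openin (topo model) U \<and> openin (topo model) V \<and> V \<subseteq> U" for U V
    proof (rule ring_hom_memI)
      show "restr model U V x \<in> carrier (sections model V)" if "x \<in> carrier (sections model U)" for x
        using restr_section[of V U x] that \<open>openin (topo model) U \<and> openin (topo model) V \<and> V \<subseteq> U\<close> by simp
      show "restr model U V \<one>\<^bsub>sections model U\<^esub> = \<one>\<^bsub>sections model V\<^esub>" using that by (cases "V = {}"; cases "U = {}") auto
    qed auto
    show "restr model U U s = s" if "openin (topo model) U" "s \<in> carrier (sections model U)" for U s
      using that zero_section_empty by (cases "U = {}") auto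
    show "restr model V W (restr model U V s) = restr model U W s"
      if "openin (topo model) U \<and> openin (topo model) V \<and> openin (topo model) W \<and> W \<subseteq> V \<and> V \<subseteq> U" for U V W s
      using that by auto
  qed
  fix \<U> :: "'a set set set"
  assume O: "\<forall>U\<in>\<U>. openin (topo model) U"
  show "\<forall>s\<in>carrier (sections model (\<Union>\<U>)). \<forall>t\<in>carrier (sections model (\<Union>\<U>)).
           (\<forall>U\<in>\<U>. restr model (\<Union>\<U>) U s = restr model (\<Union>\<U>) U t) \<longrightarrow> s = t"
  proof (intro ballI impI)
    fix s t assume st: "s \<in> carrier (sections model (\<Union>\<U>))" "t \<in> carrier (sections model (\<Union>\<U>))"
      "\<forall>U\<in>\<U>. restr model (\<Union>\<U>) U s = restr model (\<Union>\<U>) U t"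
    show "s = t"
    proof (cases "\<Union>\<U> = {}")
      case True
      then show ?thesis using st(1,2) zero_section_empty[of s] zero_section_empty[of t] by (simp only: model_simps True)
    next
      case False
      obtain U where "U \<in> \<U>" "U \<noteq> {}" using False by blast
      have "restr model (\<Union>\<U>) U s = restr model (\<Union>\<U>) U t" using st(3) \<open>U \<in> \<U>\<close> by blast
      then show ?thesis using \<open>U \<noteq> {}\<close> by simp
    qed
  qed
  fix s assume s: "(\<forall>U\<in>\<U>. s U \<in> carrier (sections model U)) \<and>
             (\<forall>U\<in>\<U>. \<forall>V\<in>\<U>. restr model U (U \<inter> V) (s U) = restr model V (U \<inter> V) (s V))"
  show "\<exists>t\<in>carrier (sections model (\<Union>\<U>)). \<forall>U\<in>\<U>. restr model (\<Union>\<U>) U t = s U"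
  proof (cases "\<Union>\<U> = {}")
    case True
    have "s U = \<zero>" "U = {}" if "U \<in> \<U>" for U
    proof -
      show "U = {}" using True that by blast
      then show "s U = \<zero>" using s that zero_section_empty[of "s U"] by auto
    qed
    moreover have "\<zero> \<in> carrier (sections model (\<Union>\<U>))" unfolding True using section_carrier_empty by simp
    ultimately show ?thesis by (intro bexI[of _ \<zero>] ballI) simp_all
  next
    case False
    then obtain U0 where U0: "U0 \<in> \<U>" "U0 \<noteq> {}" by blast
    \<comment> \<open>Two nonempty members share the generic point, so compatibility on their
      intersection is equality in \<open>F\<close>.\<close>
    have eq: "s U = s U0" if U: "U \<in> \<U>" "U \<noteq> {}" for U
    proof -
      have "openin (zariski_topology A) U" "openin (zariski_topology A) U0" using O U(1) U0(1) by simp_all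
      then have "{\<zero>} \<in> U" "{\<zero>} \<in> U0" using zero_in_open U(2) U0(2) by simp_all
      then have "U \<inter> U0 \<noteq> {}" by blast
      moreover have "restr model U (U \<inter> U0) (s U) = restr model U0 (U \<inter> U0) (s U0)" using s U(1) U0(1) by blast
      ultimately show ?thesis by simp
    qed
    have sc: "s U \<in> carrier (section_ring U)" if h: "U \<in> \<U>" for U using s h by simp
    have "s U0 \<in> carrier F" using sc[OF U0(1)] section_carrier[OF U0(2)] by simp
    moreover have "s U0 \<in> loc p" if p: "p \<in> \<Union>\<U>" for p
    proof -
      obtain U where U: "U \<in> \<U>" "p \<in> U" using p by blast
      then have "U \<noteq> {}" by blast
      then have "s U \<in> loc p" using sc[OF U(1)] section_carrier[of U] U(2) by simp
      then show ?thesis using eq[OF U(1) \<open>U \<noteq> {}\<close>] by simp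
    qed
    ultimately have "s U0 \<in> carrier (section_ring (\<Union>\<U>))" unfolding section_carrier[OF False] by blast
    moreover have "restr model (\<Union>\<U>) U (s U0) = s U" if U: "U \<in> \<U>" for U
    proof (cases "U = {}")
      case True
      then show ?thesis using sc[OF U] zero_section_empty[of "s U"] by simp
    qed (use eq[OF U] in simp)
    ultimately show ?thesis by (intro bexI[of _ "s U0"]) simp_all
  qed
qed

end

section \<open>Global sections and stalks of the model\<close>

lemma (in cring) exists_maximalideal:
  assumes J: "ideal J R" "\<one> \<notin> J"
  shows "\<exists>M. maximalideal M R \<and> J \<subseteq> M"
proof -
  define S where "S = {I. ideal I R \<and> J \<subseteq> I \<and> \<one> \<notin> I}"
  have "\<exists>M\<in>S. \<forall>I\<in>S. M \<subseteq> I \<longrightarrow> I = M"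
  proof (rule subset_Zorn_nonempty)
    show "S \<noteq> {}" using J by (auto simp: S_def)
    fix C assume C: "C \<noteq> {}" "subset.chain S C"
    have "subset.chain {I. ideal I R} C" using C(2) unfolding pred_on.chain_def S_def by blast
    then have "ideal (\<Union>C) R" using chain_Union_is_ideal[of C] C(1) by simp
    moreover have "J \<subseteq> \<Union>C" "\<one> \<notin> \<Union>C" using C unfolding pred_on.chain_def S_def by blast+
    ultimately show "\<Union>C \<in> S" by (simp add: S_def)
  qed
  then obtain M where M: "M \<in> S" "\<And>I. I \<in> S \<Longrightarrow> M \<subseteq> I \<Longrightarrow> I = M" by blast
  have MI: "ideal M R" "J \<subseteq> M" "\<one> \<notin> M" using M(1) by (auto simp: S_def)
  have "maximalideal M R"
  proof (rule maximalidealI[OF MI(1)])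
    show "carrier R \<noteq> M" using MI(3) by auto
    fix I assume I: "ideal I R" "M \<subseteq> I" "I \<subseteq> carrier R"
    show "I = M \<or> I = carrier R"
    proof (cases "\<one> \<in> I")
      case True
      then show ?thesis using ideal.one_imp_carrier[OF I(1)] by simp
    next
      case False
      then show ?thesis using M(2)[of I] I MI by (auto simp: S_def)
    qed
  qed
  then show ?thesis using MI(2) by blast
qed

context affine_model
begin

text \<open>The denominators of \<open>x\<close> form an ideal of \<open>D\<close>. If
  \<open>x\<close> lies in the local ring of a prime, this ideal is not contained in that prime; if
  \<open>x\<close> lies in all local rings, the ideal is therefore not proper and \<open>1\<close>
  is a denominator.\<close>

lemma Inter_loc: "{x \<in> carrier F. \<forall>p\<in>primes_of A. x \<in> loc p} = D"
proof
  show "D \<subseteq> {x \<in> carrier F. \<forall>p\<in>primes_of A. x \<in> loc p}" using D_subset_loc D_carrier by blast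
  show "{x \<in> carrier F. \<forall>p\<in>primes_of A. x \<in> loc p} \<subseteq> D"
  proof
    fix x assume x: "x \<in> {x \<in> carrier F. \<forall>p\<in>primes_of A. x \<in> loc p}"
    then have xc: "x \<in> carrier F" by simp
    interpret A: domain A by (rule A_domain)
    note D' = subringE[OF D]
    define J where "J = {d \<in> D. d \<otimes> x \<in> D}"
    have JI: "ideal J A"
    proof (rule idealI)
      show "ring A" by (rule A.ring_axioms)
      have ml: "b \<otimes> a \<in> J" if h: "a \<in> J" "b \<in> D" for a b
      proof -
        have a: "a \<in> D" "a \<otimes> x \<in> D" using h by (auto simp: J_def)
        have "(b \<otimes> a) \<otimes> x = b \<otimes> (a \<otimes> x)" using m_assoc[OF D_carrier[OF h(2)] D_carrier[OF a(1)] xc] .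
        then show ?thesis using D'(6)[OF h(2) a(1)] D'(6)[OF h(2) a(2)] by (simp add: J_def)
      qed
      show "subgroup J (add_monoid A)"
      proof (rule A.add.subgroupI)
        show "J \<subseteq> carrier A" by (auto simp: J_def)
        have "\<zero> \<in> J" using D'(2) xc by (simp add: J_def)
        then show "J \<noteq> {}" by blast
        fix a assume a: "a \<in> J"
        have aD: "a \<in> D" using a by (simp add: J_def)
        have "(\<ominus>\<^bsub>A\<^esub> \<one>) \<otimes> a \<in> J" by (rule ml[OF a]) (use A.a_inv_closed A.one_closed in simp)
        moreover have "(\<ominus>\<^bsub>A\<^esub> \<one>) \<otimes> a = \<ominus>\<^bsub>A\<^esub> a" using A.l_minus[of \<one> a] aD D'(3) D_carrier by simp
        ultimately show "\<ominus>\<^bsub>A\<^esub> a \<in> J" by simp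
        fix b assume b: "b \<in> J"
        show "a \<oplus>\<^bsub>A\<^esub> b \<in> J" using a b D'(7) D_carrier xc by (simp add: J_def l_distr)
      qed
      show "b \<otimes>\<^bsub>A\<^esub> a \<in> J" if "a \<in> J" "b \<in> carrier A" for a b using ml that by simp
      show "a \<otimes>\<^bsub>A\<^esub> b \<in> J" if "a \<in> J" "b \<in> carrier A" for a b
        using ml[of a b] that A.m_comm[of a b] by (simp add: J_def)
    qed
    show "x \<in> D"
    proof (rule ccontr)
      assume "x \<notin> D"
      then have "\<one>\<^bsub>A\<^esub> \<notin> J" using xc by (simp add: J_def)
      then obtain M where M: "maximalideal M A" "J \<subseteq> M" using A.exists_maximalideal[OF JI] by blast
      have Mp: "M \<in> primes_of A" using A.maximalideal_prime[OF M(1)] by (simp add: primes_of_def)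
      then have "x \<in> loc M" using x by blast
      then obtain a s where as: "a \<in> D" "s \<in> D" "s \<notin> M" "s \<noteq> \<zero>" "a \<in> carrier F" "s \<in> carrier F" "x = a \<otimes> inv s"
        by (rule locE[OF _ Mp])
      have "s \<otimes> x = a" using as by (simp add: m_lcomm)
      then have "s \<in> J" using as by (simp add: J_def)
      then show False using M(2) as(3) by blast
    qed
  qed
qed

text \<open>As restrictions to nonempty sets are inclusions, a germ amounts to an element of
  \<open>F\<close> paired with each neighborhood over which it is a section.\<close>

definition germ_of :: "'a set \<Rightarrow> 'a \<Rightarrow> ('a set set \<times> 'a) set" where
  "germ_of p x = {(V, t). openin (zariski_topology A) V \<and> p \<in> V \<and> t \<in> carrier (section_ring V) \<and> t = x}"

lemma germ_model:
  assumes U: "openin (zariski_topology A) U" "p \<in> U"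
  shows "germ model p U x = germ_of p x"
proof -
  have "(\<exists>W. openin (topo model) W \<and> p \<in> W \<and> W \<subseteq> U \<inter> V \<and> restr model U W x = restr model V W t) \<longleftrightarrow> t = x"
    if V: "openin (zariski_topology A) V" "p \<in> V" for V t
  proof
    assume "\<exists>W. openin (topo model) W \<and> p \<in> W \<and> W \<subseteq> U \<inter> V \<and> restr model U W x = restr model V W t"
    then obtain W where W: "p \<in> W" "restr model U W x = restr model V W t" by blast
    from W(1) have "W \<noteq> {}" by blast
    then show "t = x" using W(2) by simp
  next
    assume "t = x"
    then show "\<exists>W. openin (topo model) W \<and> p \<in> W \<and> W \<subseteq> U \<inter> V \<and> restr model U W x = restr model V W t"
      using openin_Int[OF U(1) V(1)] U(2) V(2) by (intro exI[of _ "U \<inter> V"]) simp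
  qed
  then show ?thesis unfolding germ_def germ_of_def by (auto simp del: model_simps(3))
qed

lemma section_loc: "x \<in> carrier (section_ring U) \<Longrightarrow> p \<in> U \<Longrightarrow> x \<in> loc p"
  using section_carrier[of U] by (cases "U = {}") auto

lemma stalk_carrier:
  assumes p: "p \<in> primes_of A"
  shows "carrier (stalk model p) = germ_of p ` loc p"
proof
  show "carrier (stalk model p) \<subseteq> germ_of p ` loc p"
  proof
    fix \<alpha> assume "\<alpha> \<in> carrier (stalk model p)"
    then obtain U s where U: "\<alpha> = germ model p U s" "openin (zariski_topology A) U" "p \<in> U" "s \<in> carrier (section_ring U)"
      by (auto simp: stalk_def)
    then show "\<alpha> \<in> germ_of p ` loc p" using germ_model[OF U(2,3)] section_loc[OF U(4,3)] by simp
  qed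
  show "germ_of p ` loc p \<subseteq> carrier (stalk model p)"
  proof
    fix \<alpha> assume "\<alpha> \<in> germ_of p ` loc p"
    then obtain x where x: "x \<in> loc p" "\<alpha> = germ_of p x" by blast
    obtain U where U: "openin (zariski_topology A) U" "p \<in> U" "x \<in> carrier (section_ring U)" using exists_section[OF p x(1)] by blast
    have "\<alpha> = germ model p U x" using x(2) germ_model[OF U(1,2)] by simp
    then show "\<alpha> \<in> carrier (stalk model p)" unfolding stalk_def using U by (simp del: split_paired_Ex) blast
  qed
qed

lemma germ_of_nonempty: "p \<in> primes_of A \<Longrightarrow> x \<in> loc p \<Longrightarrow> \<exists>U. (U, x) \<in> germ_of p x"
  using exists_section[of p x] by (auto simp: germ_of_def)

lemma germ_of_memD: "(U, t) \<in> germ_of p x \<Longrightarrow> openin (zariski_topology A) U \<and> p \<in> U \<and> t = x"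
  by (auto simp: germ_of_def)

lemma germ_of_inj: "p \<in> primes_of A \<Longrightarrow> x \<in> loc p \<Longrightarrow> germ_of p x = germ_of p y \<Longrightarrow> x = y"
  using germ_of_nonempty[of p x] germ_of_memD[of _ x p y] by auto

lemma primes_open: "openin (zariski_topology A) (primes_of A)"
  using openin_topspace[of "zariski_topology A"] by simp

lemma stalk_iso:
  assumes p: "p \<in> primes_of A"
  shows "germ_of p \<in> ring_iso (F\<lparr>carrier := loc p\<rparr>) (stalk model p)"
    and "\<zero>\<^bsub>stalk model p\<^esub> = germ_of p \<zero>"
proof -
  have ne: "primes_of A \<noteq> {}" using p by blast
  have z: "\<zero>\<^bsub>section_ring (primes_of A)\<^esub> = \<zero>" "\<one>\<^bsub>section_ring (primes_of A)\<^esub> = \<one>" using ne by simp_all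
  show "\<zero>\<^bsub>stalk model p\<^esub> = germ_of p \<zero>"
    using germ_model[OF primes_open p] z(1) by (simp add: stalk_def)
  have ops: "germ_of p x \<otimes>\<^bsub>stalk model p\<^esub> germ_of p y = germ_of p (x \<otimes> y)"
    "germ_of p x \<oplus>\<^bsub>stalk model p\<^esub> germ_of p y = germ_of p (x \<oplus> y)"
    if x: "x \<in> loc p" and y: "y \<in> loc p" for x y
  proof -
    obtain U0 where U0: "(U0, x) \<in> germ_of p x" using germ_of_nonempty[OF p x] by blast
    obtain V0 where V0: "(V0, y) \<in> germ_of p y" using germ_of_nonempty[OF p y] by blast
    have m: "germ model p (U \<inter> V) (restr model U (U \<inter> V) s \<otimes>\<^bsub>sections model (U \<inter> V)\<^esub> restr model V (U \<inter> V) t) = germ_of p (x \<otimes> y)"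
        and a: "germ model p (U \<inter> V) (restr model U (U \<inter> V) s \<oplus>\<^bsub>sections model (U \<inter> V)\<^esub> restr model V (U \<inter> V) t) = germ_of p (x \<oplus> y)"
      if s: "(U, s) \<in> germ_of p x" and t: "(V, t) \<in> germ_of p y" for U s V t
    proof -
      have *: "openin (zariski_topology A) (U \<inter> V)" "p \<in> U \<inter> V" "s = x" "t = y"
        using germ_of_memD[OF s] germ_of_memD[OF t] by (simp_all add: openin_Int)
      then have "U \<inter> V \<noteq> {}" by blast
      then show "germ model p (U \<inter> V) (restr model U (U \<inter> V) s \<otimes>\<^bsub>sections model (U \<inter> V)\<^esub> restr model V (U \<inter> V) t) = germ_of p (x \<otimes> y)"
        "germ model p (U \<inter> V) (restr model U (U \<inter> V) s \<oplus>\<^bsub>sections model (U \<inter> V)\<^esub> restr model V (U \<inter> V) t) = germ_of p (x \<oplus> y)"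
        using germ_model[OF *(1,2)] *(3,4) by simp_all
    qed
    have "(\<Union>(U, s)\<in>germ_of p x. \<Union>(V, t)\<in>germ_of p y.
         germ model p (U \<inter> V) (restr model U (U \<inter> V) s \<otimes>\<^bsub>sections model (U \<inter> V)\<^esub> restr model V (U \<inter> V) t)) = germ_of p (x \<otimes> y)"
      (is "?L = ?R")
    proof
      show "?L \<subseteq> ?R" using m by fast
      show "?R \<subseteq> ?L" using m[OF U0 V0] U0 V0 by fast
    qed
    then show "germ_of p x \<otimes>\<^bsub>stalk model p\<^esub> germ_of p y = germ_of p (x \<otimes> y)"
      by (simp only: stalk_def monoid.simps)
    have "(\<Union>(U, s)\<in>germ_of p x. \<Union>(V, t)\<in>germ_of p y.
         germ model p (U \<inter> V) (restr model U (U \<inter> V) s \<oplus>\<^bsub>sections model (U \<inter> V)\<^esub> restr model V (U \<inter> V) t)) = germ_of p (x \<oplus> y)"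
      (is "?L = ?R")
    proof
      show "?L \<subseteq> ?R" using a by fast
      show "?R \<subseteq> ?L" using a[OF U0 V0] U0 V0 by fast
    qed
    then show "germ_of p x \<oplus>\<^bsub>stalk model p\<^esub> germ_of p y = germ_of p (x \<oplus> y)"
      by (simp only: stalk_def ring.simps)
  qed
  show "germ_of p \<in> ring_iso (F\<lparr>carrier := loc p\<rparr>) (stalk model p)"
  proof (rule ring_iso_memI)
    show "germ_of p \<one>\<^bsub>F\<lparr>carrier := loc p\<rparr>\<^esub> = \<one>\<^bsub>stalk model p\<^esub>"
      using germ_model[OF primes_open p] z(2) by (simp add: stalk_def)
    have "inj_on (germ_of p) (loc p)" by (rule inj_onI) (rule germ_of_inj[OF p])
    then show "bij_betw (germ_of p) (carrier (F\<lparr>carrier := loc p\<rparr>)) (carrier (stalk model p))"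
      using stalk_carrier[OF p] by (simp add: bij_betw_def)
  qed (use ops stalk_carrier[OF p] in auto)
qed

end

text \<open>Membership in \<open>ring_iso\<close> speaks of products, sums and one. The target is
  not yet known to be a ring, so its zero has to be matched separately.\<close>

lemma ring_iso_transfer:
  assumes "h \<in> ring_iso R S" and "\<zero>\<^bsub>S\<^esub> = h \<zero>\<^bsub>R\<^esub>"
  shows "cring R \<Longrightarrow> cring S" "domain R \<Longrightarrow> domain S" "field R \<Longrightarrow> field S"
proof -
  have S: "S\<lparr>zero := h \<zero>\<^bsub>R\<^esub>\<rparr> = S" using assms(2) by simp
  show "cring R \<Longrightarrow> cring S" using cring.ring_iso_imp_img_cring[OF _ assms(1)] S by simp
  show "domain R \<Longrightarrow> domain S" using domain.ring_iso_imp_img_domain[OF _ assms(1)] S by simp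
  show "field R \<Longrightarrow> field S" using field.ring_iso_imp_img_field[OF _ assms(1)] S by simp
qed

lemma ring_iso_local_ring:
  assumes R: "cring R" "\<one>\<^bsub>R\<^esub> \<noteq> \<zero>\<^bsub>R\<^esub>"
    and add: "\<And>a b. a \<in> carrier R - Units R \<Longrightarrow> b \<in> carrier R - Units R \<Longrightarrow> a \<oplus>\<^bsub>R\<^esub> b \<notin> Units R"
    and h: "h \<in> ring_iso R S" and z: "\<zero>\<^bsub>S\<^esub> = h \<zero>\<^bsub>R\<^esub>"
  shows "local_ring S" "max_ideal S = h ` (carrier R - Units R)"
proof -
  interpret cring R by (rule R(1))
  note h' = ring_iso_memE[OF h]
  have surj: "carrier S = h ` carrier R" using bij_betw_imp_surj_on[OF h'(5)] by simp
  have inj: "inj_on h (carrier R)" by (rule bij_betw_imp_inj_on[OF h'(5)])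
  have U: "carrier S - Units S = h ` (carrier R - Units R)"
    using ring_iso_Units[OF ring_axioms h] surj by auto
  have S: "cring S" by (rule ring_iso_transfer(1)[OF h z R(1)])
  have "h \<one>\<^bsub>R\<^esub> \<noteq> h \<zero>\<^bsub>R\<^esub>" using inj_onD[OF inj, of "\<one>\<^bsub>R\<^esub>" "\<zero>\<^bsub>R\<^esub>"] R(2) by auto
  then have one: "\<one>\<^bsub>S\<^esub> \<noteq> \<zero>\<^bsub>S\<^esub>" using h'(4) z by simp
  have add': "x \<oplus>\<^bsub>S\<^esub> y \<notin> Units S" if xy: "x \<in> carrier S - Units S" "y \<in> carrier S - Units S" for x y
  proof -
    obtain a b where ab: "a \<in> carrier R - Units R" "b \<in> carrier R - Units R" "x = h a" "y = h b"
      using xy unfolding U by blast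
    have c: "a \<in> carrier R" "b \<in> carrier R" using ab by auto
    show ?thesis
      using h'(3)[OF c] ring_iso_Units[OF ring_axioms h a_closed[OF c]] add[OF ab(1,2)] ab(3,4) by simp
  qed
  show "local_ring S" "max_ideal S = h ` (carrier R - Units R)"
    using local_ringI[OF S one add'] unfolding U by blast+
qed

lemma ring_iso_pow:
  assumes "ring R" "h \<in> ring_iso R S" "a \<in> carrier R"
  shows "h (a [^]\<^bsub>R\<^esub> (n::nat)) = h a [^]\<^bsub>S\<^esub> n"
proof (induction n)
  case 0
  then show ?case using ring_iso_memE(4)[OF assms(2)] by simp
next
  case (Suc n)
  interpret ring R by (rule assms(1))
  show ?case using Suc ring_iso_memE(2)[OF assms(2), of "a [^]\<^bsub>R\<^esub> n" a] assms(3) by simp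
qed

lemma ring_iso_discrete_valuation:
  assumes R: "domain R" and p: "p \<in> carrier R" "p \<noteq> \<zero>\<^bsub>R\<^esub>" "p \<notin> Units R"
    and rep: "\<And>a. a \<in> carrier R \<Longrightarrow> a \<noteq> \<zero>\<^bsub>R\<^esub> \<Longrightarrow> \<exists>u\<in>Units R. \<exists>n::nat. a = u \<otimes>\<^bsub>R\<^esub> p [^]\<^bsub>R\<^esub> n"
    and h: "h \<in> ring_iso R S" and z: "\<zero>\<^bsub>S\<^esub> = h \<zero>\<^bsub>R\<^esub>"
  shows "regular_local_ring S"
proof (rule discrete_valuation_regular_local_ring(1))
  interpret domain R by (rule R)
  note h' = ring_iso_memE[OF h]
  have surj: "carrier S = h ` carrier R" using bij_betw_imp_surj_on[OF h'(5)] by simp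
  have inj: "inj_on h (carrier R)" by (rule bij_betw_imp_inj_on[OF h'(5)])
  show "domain S" by (rule ring_iso_transfer(2)[OF h z R])
  show "h p \<in> carrier S" by (rule h'(1)[OF p(1)])
  show "h p \<noteq> \<zero>\<^bsub>S\<^esub>" using inj_onD[OF inj, of p "\<zero>\<^bsub>R\<^esub>"] p z by auto
  show "h p \<notin> Units S" using ring_iso_Units[OF ring_axioms h p(1)] p(3) by simp
  fix x assume x: "x \<in> carrier S" "x \<noteq> \<zero>\<^bsub>S\<^esub>"
  then obtain a where a: "a \<in> carrier R" "x = h a" using surj by blast
  have "a \<noteq> \<zero>\<^bsub>R\<^esub>" using x(2) a(2) z by auto
  then obtain u n where un: "u \<in> Units R" "a = u \<otimes>\<^bsub>R\<^esub> p [^]\<^bsub>R\<^esub> (n::nat)" using rep[OF a(1)] by blast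
  have uc: "u \<in> carrier R" by (rule Units_closed[OF un(1)])
  have "x = h u \<otimes>\<^bsub>S\<^esub> h p [^]\<^bsub>S\<^esub> n"
    using h'(2)[OF uc, of "p [^]\<^bsub>R\<^esub> n"] p(1) ring_iso_pow[OF ring_axioms h p(1)] a(2) un(2) by simp
  moreover have "h u \<in> Units S" using ring_iso_Units[OF ring_axioms h uc] un(1) by simp
  ultimately show "\<exists>u\<in>Units S. \<exists>n::nat. x = u \<otimes>\<^bsub>S\<^esub> h p [^]\<^bsub>S\<^esub> n" by blast
qed

lemma (in field) valuation_subring_Units:
  assumes "valuation_subring Q"
  shows "Units (R\<lparr>carrier := Q\<rparr>) = Q - nonunits Q"
proof -
  have Q: "Q \<subseteq> carrier R" using subringE(1)[OF valuation_subring_subring[OF assms]] .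
  show ?thesis
  proof
    show "Units (R\<lparr>carrier := Q\<rparr>) \<subseteq> Q - nonunits Q"
    proof
      fix u assume "u \<in> Units (R\<lparr>carrier := Q\<rparr>)"
      then obtain v where v: "u \<in> Q" "v \<in> Q" "u \<otimes> v = \<one>" unfolding Units_def by auto
      have c: "u \<in> carrier R" "v \<in> carrier R" using v Q by auto
      have "u \<noteq> \<zero>" using v(3) c by auto
      moreover have "inv u = v" by (rule inv_eqI[OF c v(3)])
      ultimately show "u \<in> Q - nonunits Q" using v by (simp add: nonunits_def)
    qed
    show "Q - nonunits Q \<subseteq> Units (R\<lparr>carrier := Q\<rparr>)"
    proof
      fix u assume u: "u \<in> Q - nonunits Q"
      then have "u \<in> Q" "inv u \<in> Q" "u \<noteq> \<zero>" "u \<in> carrier R" using Q by (auto simp: nonunits_def)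
      then show "u \<in> Units (R\<lparr>carrier := Q\<rparr>)"
        unfolding Units_def by (intro CollectI conjI bexI[of _ "inv u"]) simp_all
    qed
  qed
qed

section \<open>The model as an integral separated scheme of finite type with function field
  F\<close>

context affine_model
begin

lemma loc_Units:
  assumes p: "p \<in> primes_of A" and as: "a \<in> D" "s \<in> D" "s \<notin> p"
  shows "a \<otimes> inv s \<in> Units (F\<lparr>carrier := loc p\<rparr>) \<longleftrightarrow> a \<notin> p"
proof
  have c: "a \<in> carrier F" "s \<in> carrier F" "s \<noteq> \<zero>" using as D_carrier primeD(2)[OF p] by auto
  {
    assume "a \<otimes> inv s \<in> Units (F\<lparr>carrier := loc p\<rparr>)"
    then obtain y where y: "y \<in> loc p" "(a \<otimes> inv s) \<otimes> y = \<one>" unfolding Units_def by auto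
    obtain b t where bt: "b \<in> D" "t \<in> D" "t \<notin> p" "t \<noteq> \<zero>" "b \<in> carrier F" "t \<in> carrier F" "y = b \<otimes> inv t"
      by (rule locE[OF y(1) p])
    have "s \<otimes> t \<otimes> ((a \<otimes> inv s) \<otimes> y) = (b \<otimes> a) \<otimes> (s \<otimes> inv s) \<otimes> (t \<otimes> inv t)"
      using c bt by (simp add: m_ac del: inv_mult mult_inv_cancel)
    then have "b \<otimes> a = s \<otimes> t" using y(2) c bt by simp
    then have "b \<otimes> a \<notin> p" using primeD(6)[OF p as(2) bt(2)] as bt by auto
    then show "a \<notin> p" using primeD(5)[OF p _ bt(1)] by blast
  }
  assume a: "a \<notin> p"
  then have a0: "a \<noteq> \<zero>" using primeD(2)[OF p] by blast
  have 1: "a \<otimes> inv s \<in> loc p" "s \<otimes> inv a \<in> loc p" using locI[OF as] locI[OF as(2,1) a] by simp_all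
  have 2: "(a \<otimes> inv s) \<otimes> (s \<otimes> inv a) = \<one>" "(s \<otimes> inv a) \<otimes> (a \<otimes> inv s) = \<one>"
    using c a0 by (simp_all add: m_assoc)
  show "a \<otimes> inv s \<in> Units (F\<lparr>carrier := loc p\<rparr>)"
    unfolding Units_def using 1 by (intro CollectI conjI bexI[of _ "s \<otimes> inv a"]) (simp_all add: 2)
qed

lemma stalk_local:
  assumes p: "p \<in> primes_of A"
  shows "local_ring (stalk model p)"
    "max_ideal (stalk model p) = germ_of p ` (loc p - Units (F\<lparr>carrier := loc p\<rparr>))"
proof -
  have "domain (F\<lparr>carrier := loc p\<rparr>)" by (rule subring_is_domain[OF loc_subring[OF p]])
  then have cr: "cring (F\<lparr>carrier := loc p\<rparr>)" by (rule domain.axioms(1))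
  have one: "\<one>\<^bsub>F\<lparr>carrier := loc p\<rparr>\<^esub> \<noteq> \<zero>\<^bsub>F\<lparr>carrier := loc p\<rparr>\<^esub>" by simp
  have add: "x \<oplus>\<^bsub>F\<lparr>carrier := loc p\<rparr>\<^esub> y \<notin> Units (F\<lparr>carrier := loc p\<rparr>)"
    if x: "x \<in> carrier (F\<lparr>carrier := loc p\<rparr>) - Units (F\<lparr>carrier := loc p\<rparr>)"
      and y: "y \<in> carrier (F\<lparr>carrier := loc p\<rparr>) - Units (F\<lparr>carrier := loc p\<rparr>)" for x y
  proof -
    have xl: "x \<in> loc p" "y \<in> loc p" using x y by auto
    obtain a s where as: "a \<in> D" "s \<in> D" "s \<notin> p" "s \<noteq> \<zero>" "a \<in> carrier F" "s \<in> carrier F" "x = a \<otimes> inv s"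
      by (rule locE[OF xl(1) p])
    obtain b t where bt: "b \<in> D" "t \<in> D" "t \<notin> p" "t \<noteq> \<zero>" "b \<in> carrier F" "t \<in> carrier F" "y = b \<otimes> inv t"
      by (rule locE[OF xl(2) p])
    have ab: "a \<in> p" "b \<in> p"
      using x y loc_Units[OF p as(1-3)] loc_Units[OF p bt(1-3)] as(7) bt(7) by auto
    have num: "t \<otimes> a \<oplus> s \<otimes> b \<in> p" by (rule primeD(4)[OF p primeD(5)[OF p ab(1) bt(2)] primeD(5)[OF p ab(2) as(2)]])
    then have numD: "t \<otimes> a \<oplus> s \<otimes> b \<in> D" using primeD(1)[OF p] by blast
    have st: "s \<otimes> t \<in> D" "s \<otimes> t \<notin> p"
      using subringE(6)[OF D as(2) bt(2)] primeD(6)[OF p as(2) bt(2)] as bt by auto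
    have "(t \<otimes> a \<oplus> s \<otimes> b) \<otimes> inv (s \<otimes> t) = a \<otimes> inv s \<otimes> (t \<otimes> inv t) \<oplus> b \<otimes> inv t \<otimes> (s \<otimes> inv s)"
      using as bt by (simp add: inv_prod l_distr r_distr m_ac del: inv_mult mult_inv_cancel)
    then have "x \<oplus> y = (t \<otimes> a \<oplus> s \<otimes> b) \<otimes> inv (s \<otimes> t)" using as bt by simp
    then show ?thesis using loc_Units[OF p numD st] num by simp
  qed
  have z: "\<zero>\<^bsub>stalk model p\<^esub> = germ_of p \<zero>\<^bsub>F\<lparr>carrier := loc p\<rparr>\<^esub>" using stalk_iso(2)[OF p] by simp
  show "local_ring (stalk model p)"
    "max_ideal (stalk model p) = germ_of p ` (loc p - Units (F\<lparr>carrier := loc p\<rparr>))"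
    using ring_iso_local_ring[OF cr one add stalk_iso(1)[OF p] z] by simp_all
qed

lemma section_primes: "section_ring (primes_of A) = A"
  using zero_prime Inter_loc by (auto simp: section_ring_def)

lemma model_scheme: "is_scheme model"
  unfolding is_scheme_def is_locally_ringed_space_def
  using model_ringed_space stalk_local(1) affine_open_model by auto

lemma model_integral: "integral_scheme model"
  unfolding integral_scheme_def
  using model_scheme zero_prime section_domain[OF open_subset_primes] by auto

lemma model_over:
  assumes "K \<subseteq> D"
  shows "scheme_over (F\<lparr>carrier := K\<rparr>) model id"
  unfolding scheme_over_def using model_scheme assms by (auto simp: section_primes intro!: ring_hom_memI)

text \<open>The model is covered by one affine set, for which the condition on the diagonal says
  that \<open>D\<close> generates itself.\<close>

lemma model_separated:
  assumes "K \<subseteq> D"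
  shows "separated_over (F\<lparr>carrier := K\<rparr>) model id"
proof -
  interpret A: domain A by (rule A_domain)
  have ne: "primes_of A \<noteq> {}" using zero_prime by blast
  have "generate_ring A D = carrier A"
    using A.generate_ring_incl[of D] generate_ring.incl[of _ D A] by auto
  then show ?thesis unfolding separated_over_def
    using model_over[OF assms] affine_open_model ne
    by (intro conjI exI[of _ "{primes_of A}"]) (simp_all add: section_primes image_def)
qed

lemma model_finite_type:
  assumes "K \<subseteq> carrier F" "H \<subseteq> carrier F" "finite H" "D = generate_ring F (K \<union> H)"
  shows "finite_type_over (F\<lparr>carrier := K\<rparr>) model id"
proof -
  have ne: "primes_of A \<noteq> {}" using zero_prime by blast
  have KH: "K \<union> H \<subseteq> D" unfolding assms(4) using generate_ring.incl[of _ "K \<union> H" F] by (intro subsetI) simp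
  have "generate_ring A (K \<union> H) = D" using subring_gen_equality[OF D KH] assms(4) by simp
  moreover have "(restr model (primes_of A) (primes_of A) \<circ> id) ` K = K" using ne by (auto simp: image_def)
  ultimately have "generate_ring (sections model (primes_of A)) ((restr model (pts model) (primes_of A) \<circ> id) ` carrier (F\<lparr>carrier := K\<rparr>) \<union> H) =
      carrier (sections model (primes_of A))" "H \<subseteq> carrier (sections model (primes_of A))"
    using KH by (simp_all add: section_primes)
  then have "affine_open model (primes_of A) \<and> (\<exists>S\<subseteq>carrier (sections model (primes_of A)). finite S \<and>
      generate_ring (sections model (primes_of A)) ((restr model (pts model) (primes_of A) \<circ> id) ` carrier (F\<lparr>carrier := K\<rparr>) \<union> S) =
      carrier (sections model (primes_of A)))"
    using affine_open_model assms(3) by blast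
  moreover have "scheme_over (F\<lparr>carrier := K\<rparr>) model id" by (rule model_over) (use KH in blast)
  ultimately show ?thesis unfolding finite_type_over_def
    by (intro conjI exI[of _ "{primes_of A}"]) simp_all
qed

lemma model_generic_point: "generic_point model {\<zero>}"
  unfolding generic_point_def closure_of_def using zero_prime zero_in_open by auto

lemma model_function_field:
  assumes "loc {\<zero>} = carrier F" "K \<subseteq> carrier F"
  shows "function_field_iso F K model id {\<zero>} (inv_into (carrier F) (germ_of {\<zero>}))"
proof -
  have F: "F\<lparr>carrier := loc {\<zero>}\<rparr> = F" using assms(1) by simp
  have iso: "germ_of {\<zero>} \<in> ring_iso F (stalk model {\<zero>})" using stalk_iso(1)[OF zero_prime] F by simp
  have "inv_into (carrier F) (germ_of {\<zero>}) (germ model {\<zero>} (primes_of A) c) = c" if h: "c \<in> K" for c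
    using inv_into_f_f[OF bij_betw_imp_inj_on[OF ring_iso_memE(5)[OF iso]], of c] germ_model[OF primes_open zero_prime] h assms(2)
    by auto
  then show ?thesis unfolding function_field_iso_def
    using model_generic_point ring_iso_set_sym[OF ring_axioms iso] by simp
qed

text \<open>With stalks viewed as subrings of \<open>F\<close>, the passage to the generic point is
  the inclusion.\<close>

lemma cospecialization_model:
  assumes p: "p \<in> primes_of A" and x: "x \<in> loc p"
  shows "cospecialization model {\<zero>} (germ_of p x) = germ_of {\<zero>} x"
proof -
  obtain U0 where U0: "(U0, x) \<in> germ_of p x" using germ_of_nonempty[OF p x] by blast
  have g: "germ model {\<zero>} U s = germ_of {\<zero>} x" if h: "(U, s) \<in> germ_of p x" for U s
  proof -
    have U: "openin (zariski_topology A) U" "p \<in> U" "s = x" using germ_of_memD[OF h] by auto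
    then have "{\<zero>} \<in> U" using zero_in_open[OF U(1)] by blast
    then show ?thesis using germ_model[OF U(1)] U(3) by simp
  qed
  show ?thesis unfolding cospecialization_def
  proof
    show "(\<Union>(U, s)\<in>germ_of p x. germ model {\<zero>} U s) \<subseteq> germ_of {\<zero>} x" using g by fast
    show "germ_of {\<zero>} x \<subseteq> (\<Union>(U, s)\<in>germ_of p x. germ model {\<zero>} U s)" using g[OF U0] U0 by fast
  qed
qed

lemma model_centered:
  assumes frac: "loc {\<zero>} = carrier F" and p: "p \<in> primes_of A" "loc p = Q" and Q: "valuation_subring Q"
    and P: "valuation_ring F P = Q" "valuation_ideal F P = nonunits Q"
  shows "centered_at F P model {\<zero>} (inv_into (carrier F) (germ_of {\<zero>})) p"
proof -
  have "inv_into (carrier F) (germ_of {\<zero>}) (cospecialization model {\<zero>} (germ_of p x)) = x" if h: "x \<in> loc p" for x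
  proof -
    have "F\<lparr>carrier := loc {\<zero>}\<rparr> = F" using frac by simp
    then have iso: "germ_of {\<zero>} \<in> ring_iso F (stalk model {\<zero>})" using stalk_iso(1)[OF zero_prime] by simp
    show ?thesis unfolding cospecialization_model[OF p(1) h]
      by (rule inv_into_f_f[OF bij_betw_imp_inj_on[OF ring_iso_memE(5)[OF iso]] loc_carrier[OF p(1) h]])
  qed
  moreover have "germ_of p x \<in> max_ideal (stalk model p) \<longleftrightarrow> x \<in> nonunits Q" if h: "x \<in> loc p" for x
  proof -
    have "loc p - Units (F\<lparr>carrier := loc p\<rparr>) = nonunits Q"
      unfolding p(2) valuation_subring_Units[OF Q] using nonunits_subset by blast
    moreover have "germ_of p x \<in> germ_of p ` nonunits Q \<longleftrightarrow> x \<in> nonunits Q"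
      using germ_of_inj[OF p(1) h] by blast
    ultimately show ?thesis unfolding stalk_local(2)[OF p(1)] by simp
  qed
  ultimately show ?thesis unfolding centered_at_def using p P by (auto simp: stalk_carrier[OF p(1)])
qed

end

section \<open>Places and valuation rings\<close>

locale function_field = field F for F :: "'a ring" (structure) +
  fixes K :: "'a set"
  assumes K: "subfield K F"
    and finitely_generated: "\<exists>S\<subseteq>carrier F. finite S \<and> generate_field F (K \<union> S) = carrier F"
begin

text \<open>The residues are cosets of the nonunits, that is, sets of elements of \<open>F\<close>,
  in accordance with the type of residue fields in \<open>zariski_space\<close>.\<close>

definition place_of :: "'a set \<Rightarrow> ('a, 'a set) place" where
  "place_of Q = \<lparr> residue_field = (F\<lparr>carrier := Q\<rparr>) Quot nonunits Q,
     residue = (\<lambda>a. if a \<in> Q then Some (nonunits Q +>\<^bsub>F\<lparr>carrier := Q\<rparr>\<^esub> a) else None) \<rparr>"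

lemma nonunits_maximal:
  assumes "valuation_subring Q"
  shows "maximalideal (nonunits Q) (F\<lparr>carrier := Q\<rparr>)"
proof -
  interpret S: domain "F\<lparr>carrier := Q\<rparr>" by (rule subring_is_domain[OF valuation_subring_subring[OF assms]])
  have n: "carrier (F\<lparr>carrier := Q\<rparr>) - Units (F\<lparr>carrier := Q\<rparr>) = nonunits Q"
    unfolding valuation_subring_Units[OF assms] using nonunits_subset[of Q] by auto
  have "a \<oplus>\<^bsub>F\<lparr>carrier := Q\<rparr>\<^esub> b \<notin> Units (F\<lparr>carrier := Q\<rparr>)" if h: "a \<in> nonunits Q" "b \<in> nonunits Q" for a b
    using nonunits_add[OF assms h] by (simp add: valuation_subring_Units[OF assms])
  then show ?thesis using S.nonunits_maximalideal[OF S.one_not_zero, of "nonunits Q"] unfolding n by blast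
qed

lemma place_of:
  assumes Q: "valuation_subring Q"
  shows "is_place F (place_of Q)" "valuation_ring F (place_of Q) = Q" "valuation_ideal F (place_of Q) = nonunits Q"
proof -
  note S = valuation_subring_subring[OF Q]
  interpret S: domain "F\<lparr>carrier := Q\<rparr>" by (rule subring_is_domain[OF S])
  interpret I: maximalideal "nonunits Q" "F\<lparr>carrier := Q\<rparr>" by (rule nonunits_maximal[OF Q])
  have QC: "Q \<subseteq> carrier F" by (rule subringE(1)[OF S])
  show ring: "valuation_ring F (place_of Q) = Q" using QC by (auto simp: valuation_ring_def place_of_def)
  have zero: "nonunits Q +>\<^bsub>F\<lparr>carrier := Q\<rparr>\<^esub> a = nonunits Q \<longleftrightarrow> a \<in> nonunits Q" if h: "a \<in> Q" for a
    using I.a_rcos_self[of a] I.a_rcos_const[of a] h by auto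
  show ideal: "valuation_ideal F (place_of Q) = nonunits Q"
    using QC zero nonunits_subset[of Q] by (auto simp: valuation_ideal_def place_of_def FactRing_def)
  have res: "the (residue (place_of Q) a) = nonunits Q +>\<^bsub>F\<lparr>carrier := Q\<rparr>\<^esub> a" if "a \<in> Q" for a
    using that by (simp add: place_of_def)
  have rf: "residue_field (place_of Q) = (F\<lparr>carrier := Q\<rparr>) Quot nonunits Q" by (simp add: place_of_def)
  note hom = ring_hom_memE[OF I.rcos_ring_hom]
  show "is_place F (place_of Q)"
    unfolding is_place_def ring ideal rf
  proof (intro conjI ballI)
    show "field (F\<lparr>carrier := Q\<rparr> Quot nonunits Q)" by (rule I.quotient_is_field[OF S.is_cring])
    show "subring Q F" by (rule S)
    show "(\<lambda>a. the (residue (place_of Q) a)) \<in> ring_hom (F\<lparr>carrier := Q\<rparr>) (F\<lparr>carrier := Q\<rparr> Quot nonunits Q)"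
    proof (rule ring_hom_memI)
      fix x assume x: "x \<in> carrier (F\<lparr>carrier := Q\<rparr>)"
      then have xQ: "x \<in> Q" by simp
      show "the (residue (place_of Q) x) \<in> carrier (F\<lparr>carrier := Q\<rparr> Quot nonunits Q)"
        unfolding res[OF xQ] by (rule hom(1)[OF x])
      fix y assume y: "y \<in> carrier (F\<lparr>carrier := Q\<rparr>)"
      then have yQ: "y \<in> Q" by simp
      have xy: "x \<otimes>\<^bsub>F\<lparr>carrier := Q\<rparr>\<^esub> y \<in> Q" "x \<oplus>\<^bsub>F\<lparr>carrier := Q\<rparr>\<^esub> y \<in> Q"
        using S.m_closed[OF x y] S.a_closed[OF x y] by simp_all
      show "the (residue (place_of Q) (x \<otimes>\<^bsub>F\<lparr>carrier := Q\<rparr>\<^esub> y)) =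
          the (residue (place_of Q) x) \<otimes>\<^bsub>F\<lparr>carrier := Q\<rparr> Quot nonunits Q\<^esub> the (residue (place_of Q) y)"
        unfolding res[OF xQ] res[OF yQ] res[OF xy(1)] by (rule hom(2)[OF x y])
      show "the (residue (place_of Q) (x \<oplus>\<^bsub>F\<lparr>carrier := Q\<rparr>\<^esub> y)) =
          the (residue (place_of Q) x) \<oplus>\<^bsub>F\<lparr>carrier := Q\<rparr> Quot nonunits Q\<^esub> the (residue (place_of Q) y)"
        unfolding res[OF xQ] res[OF yQ] res[OF xy(2)] by (rule hom(3)[OF x y])
    next
      have "\<one>\<^bsub>F\<lparr>carrier := Q\<rparr>\<^esub> \<in> Q" using S.one_closed by simp
      then show "the (residue (place_of Q) \<one>\<^bsub>F\<lparr>carrier := Q\<rparr>\<^esub>) = \<one>\<^bsub>F\<lparr>carrier := Q\<rparr> Quot nonunits Q\<^esub>"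
        using res hom(4) by simp
    qed
    show "(\<lambda>a. the (residue (place_of Q) a)) ` Q = carrier (F\<lparr>carrier := Q\<rparr> Quot nonunits Q)"
      using res by (auto simp: FactRing_def A_RCOSETS_def' image_def)
    show "inv a \<in> nonunits Q" if "a \<in> carrier F - Q" for a
      using valuation_subringD[OF Q, of a] that by blast
  qed
qed

text \<open>Two elements of \<open>K\<close> with the same residue differ by a nonunit of
  \<open>Q\<close> that lies in \<open>K\<close>, and the only such element is zero.\<close>

lemma place_of_trivial:
  assumes Q: "valuation_subring Q" and KQ: "K \<subseteq> Q"
  shows "place_of Q \<in> zariski_space F K"
proof -
  interpret I: maximalideal "nonunits Q" "F\<lparr>carrier := Q\<rparr>" by (rule nonunits_maximal[OF Q])
  have KC: "K \<subseteq> carrier F" using subfieldE(3)[OF K] .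
  have "a = b" if h: "a \<in> K" "b \<in> K" "residue (place_of Q) a = residue (place_of Q) b" for a b
  proof (rule ccontr)
    assume ne: "a \<noteq> b"
    have ab: "a \<in> Q" "b \<in> Q" "a \<in> carrier F" "b \<in> carrier F" using h KQ KC by auto
    have "nonunits Q +>\<^bsub>F\<lparr>carrier := Q\<rparr>\<^esub> a = nonunits Q +>\<^bsub>F\<lparr>carrier := Q\<rparr>\<^esub> b"
      using h(3) ab by (simp add: place_of_def)
    then have "a \<in> nonunits Q +>\<^bsub>F\<lparr>carrier := Q\<rparr>\<^esub> b" using I.a_rcos_self[of a] ab by simp
    then obtain i where i: "i \<in> nonunits Q" "a = i \<oplus> b" by (auto simp: a_r_coset_def')
    have ic: "i \<in> carrier F" using i(1) nonunits_subset subringE(1)[OF valuation_subring_subring[OF Q]] by blast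
    have "a \<ominus> b = i" using ic ab i(2) by (simp add: a_minus_def a_assoc r_neg)
    then have "i \<in> K" using subring_minus[OF subfieldE(1)[OF K] h(1,2)] by simp
    moreover have "i \<noteq> \<zero>" using ne i(2) ab by auto
    ultimately show False using subfield_not_nonunit[OF K KQ] i(1) by blast
  qed
  then have "inj_on (residue (place_of Q)) K" by (auto intro: inj_onI)
  then show ?thesis using place_of[OF Q] KQ by (simp add: zariski_space_def trivial_on_def)
qed

text \<open>If a nonzero \<open>a\<close> has residue zero, its inverse cannot be finite, because
  the residue of the product is one. Conversely, if \<open>inv a\<close> is infinite, the last
  condition on places forces the residue of \<open>a\<close> to be zero.\<close>

lemma valuation_ring_subring:
  assumes P: "is_place F P"
  shows "valuation_subring (valuation_ring F P)" "valuation_ideal F P = nonunits (valuation_ring F P)"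
proof -
  define O' where "O' = valuation_ring F P"
  define v where "v = (\<lambda>a. the (residue P a))"
  have P': "field (residue_field P)" "subring O' F" "v \<in> ring_hom (F\<lparr>carrier := O'\<rparr>) (residue_field P)"
    "\<And>a. a \<in> carrier F \<Longrightarrow> a \<notin> O' \<Longrightarrow> inv a \<in> valuation_ideal F P"
    using P by (auto simp: is_place_def O'_def v_def)
  interpret k: field "residue_field P" by (rule P'(1))
  interpret S: domain "F\<lparr>carrier := O'\<rparr>" by (rule subring_is_domain[OF P'(2)])
  note O = subringE[OF P'(2)]
  have IO: "valuation_ideal F P \<subseteq> O'" by (auto simp: valuation_ideal_def valuation_ring_def O'_def)
  have I: "a \<in> valuation_ideal F P \<longleftrightarrow> v a = \<zero>\<^bsub>residue_field P\<^esub>" if h: "a \<in> O'" for a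
    using h by (auto simp: valuation_ideal_def valuation_ring_def O'_def v_def)
  have z: "v \<zero> = \<zero>\<^bsub>residue_field P\<^esub>" using ring_hom_zero[OF P'(3) S.ring_axioms k.ring_axioms] by simp
  have V: "valuation_subring O'" unfolding valuation_subring_def using P'(2,4) IO by blast
  have "a \<in> valuation_ideal F P \<longleftrightarrow> a \<in> nonunits O'" if a: "a \<in> O'" for a
  proof
    have ac: "a \<in> carrier F" using a O(1) by blast
    assume ai: "a \<in> valuation_ideal F P"
    have "inv a \<notin> O'" if a0: "a \<noteq> \<zero>"
    proof
      assume ia: "inv a \<in> O'"
      have "v (a \<otimes> inv a) = v a \<otimes>\<^bsub>residue_field P\<^esub> v (inv a)" using ring_hom_mult[OF P'(3), of a "inv a"] a ia by simp
      then have "v \<one> = \<zero>\<^bsub>residue_field P\<^esub>"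
        using ring_hom_closed[OF P'(3), of "inv a"] ia I[OF a] ai a0 ac by simp
      then show False using ring_hom_one[OF P'(3)] k.one_not_zero by simp
    qed
    then show "a \<in> nonunits O'" using a by (auto simp: nonunits_def)
  next
    have ac: "a \<in> carrier F" using a O(1) by blast
    assume "a \<in> nonunits O'"
    then have "a = \<zero> \<or> inv a \<notin> O'" by (simp add: nonunits_def)
    then show "a \<in> valuation_ideal F P"
    proof
      assume "a = \<zero>"
      then show ?thesis using I[OF a] z by simp
    next
      assume ia: "inv a \<notin> O'"
      show ?thesis
      proof (cases "a = \<zero>")
        case True
        then show ?thesis using I[OF a] z by simp
      next
        case False
        then show ?thesis using P'(4)[of "inv a"] ia ac by simp
      qed
    qed
  qed
  then have "valuation_ideal F P = nonunits O'" using IO nonunits_subset[of O'] by blast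
  then show "valuation_subring (valuation_ring F P)" "valuation_ideal F P = nonunits (valuation_ring F P)"
    using V by (simp_all add: O'_def)
qed

text \<open>Regularity is assumed for all rings isomorphic to \<open>Q\<close> over the type of
  stalks, since the stalk is an isomorphic copy of \<open>Q\<close> only. In this form the trivial
  valuation ring and the discrete ones are treated together.\<close>

lemma uniformizable_place_of:
  assumes H: "finite H" "H \<subseteq> carrier F" and Q: "valuation_subring Q"
    and D: "generate_ring F (K \<union> H) \<subseteq> Q"
    and frac: "\<And>z. z \<in> Q \<Longrightarrow> \<exists>a\<in>generate_ring F (K \<union> H). \<exists>s\<in>generate_ring F (K \<union> H). s \<notin> nonunits Q \<and> z = a \<otimes> inv s"
    and reg: "\<And>h S. h \<in> ring_iso (F\<lparr>carrier := Q\<rparr>) S \<Longrightarrow> \<zero>\<^bsub>S\<^esub> = h \<zero> \<Longrightarrow> regular_local_ring (S :: ('a set set \<times> 'a) set ring)"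
  shows "place_of Q \<in> zariski_space F K" "uniformizable F K (place_of Q)"
proof -
  define D' where "D' = generate_ring F (K \<union> H)"
  have KC: "K \<subseteq> carrier F" using subfieldE(3)[OF K] .
  have KD: "K \<subseteq> D'" unfolding D'_def using generate_ring.incl[of _ "K \<union> H" F] by (intro subsetI) simp
  have D'Q: "D' \<subseteq> Q" using D by (simp add: D'_def)
  have "subring D' F" unfolding D'_def by (rule generate_ring_is_subring) (use KC H(2) in simp)
  then interpret M: affine_model F D' by (intro affine_model.intro field_axioms affine_model_axioms.intro)
  note SQ = valuation_subring_subring[OF Q]
  interpret S: domain "F\<lparr>carrier := Q\<rparr>" by (rule subring_is_domain[OF SQ])
  have QC: "Q \<subseteq> carrier F" by (rule subringE(1)[OF SQ])
  have zn: "\<zero> \<in> nonunits Q" by (rule nonunits_zero[OF SQ])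
  have KQ: "K \<subseteq> Q" using KD D'Q by blast
  show zs: "place_of Q \<in> zariski_space F K" by (rule place_of_trivial[OF Q KQ])
  \<comment> \<open>The center of \<open>Q\<close> on the spectrum of the algebra; by
    \<open>frac\<close> its local ring is all of \<open>Q\<close>.\<close>
  define x where "x = nonunits Q \<inter> D'"
  interpret A: domain M.A by (rule M.A_domain)
  have "primeideal x M.A"
  proof (rule primeidealI)
    show "ideal x M.A"
    proof (rule idealI)
      show "ring M.A" by (rule A.ring_axioms)
      have sm: "b \<otimes> a \<in> x" if h: "a \<in> x" "b \<in> D'" for a b
        using nonunits_smult[OF SQ, of b a] subringE(6)[OF M.D, of b a] h D'Q by (auto simp: x_def)
      show "subgroup x (add_monoid M.A)"
      proof (rule A.add.subgroupI)
        show "x \<subseteq> carrier M.A" by (simp add: x_def)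
        have "\<zero> \<in> x" using zn subringE(2)[OF M.D] by (simp add: x_def)
        then show "x \<noteq> {}" by blast
        fix a assume a: "a \<in> x"
        have aD: "a \<in> D'" using a by (simp add: x_def)
        have "(\<ominus>\<^bsub>M.A\<^esub> \<one>) \<otimes> a \<in> x" by (rule sm[OF a]) (use A.a_inv_closed A.one_closed in simp)
        moreover have "(\<ominus>\<^bsub>M.A\<^esub> \<one>) \<otimes> a = \<ominus>\<^bsub>M.A\<^esub> a"
          using A.l_minus[of \<one> a] aD subringE(3)[OF M.D] M.D_carrier by simp
        ultimately show "\<ominus>\<^bsub>M.A\<^esub> a \<in> x" by simp
        fix b assume b: "b \<in> x"
        show "a \<oplus>\<^bsub>M.A\<^esub> b \<in> x" using a b nonunits_add[OF Q, of a b] subringE(7)[OF M.D, of a b] by (simp add: x_def)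
      qed
      show "b \<otimes>\<^bsub>M.A\<^esub> a \<in> x" if "a \<in> x" "b \<in> carrier M.A" for a b using sm that by simp
      show "a \<otimes>\<^bsub>M.A\<^esub> b \<in> x" if "a \<in> x" "b \<in> carrier M.A" for a b
        using sm[of a b] that A.m_comm[of a b] by (simp add: x_def)
    qed
    show "cring M.A" by (rule A.is_cring)
    have "\<one> \<notin> x" "\<one> \<in> carrier M.A" using one_not_nonunit subringE(3)[OF M.D] by (auto simp: x_def)
    then show "carrier M.A \<noteq> x" by blast
    show "a \<in> x \<or> b \<in> x" if h: "a \<in> carrier M.A" "b \<in> carrier M.A" "a \<otimes>\<^bsub>M.A\<^esub> b \<in> x" for a b
      using nonunit_prime[OF Q, of a b] h D'Q by (auto simp: x_def)
  qed
  then have xp: "x \<in> primes_of M.A" by (simp add: primes_of_def)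
  have loc: "M.loc x = Q"
  proof
    show "M.loc x \<subseteq> Q"
    proof
      fix z assume "z \<in> M.loc x"
      then obtain a s where as: "a \<in> D'" "s \<in> D'" "s \<notin> x" "z = a \<otimes> inv s" using M.locE[OF _ xp] by metis
      have "inv s \<in> Q" using as(2,3) D'Q by (auto simp: x_def nonunits_def)
      then show "z \<in> Q" using subringE(6)[OF SQ] as(1,4) D'Q by blast
    qed
    show "Q \<subseteq> M.loc x"
    proof
      fix z assume "z \<in> Q"
      then obtain a s where as: "a \<in> D'" "s \<in> D'" "s \<notin> nonunits Q" "z = a \<otimes> inv s" using frac[of z] unfolding D'_def by blast
      then have "s \<notin> x" by (simp add: x_def)
      then show "z \<in> M.loc x" using M.locI[OF as(1,2)] as(4) by simp
    qed
  qed
  \<comment> \<open>Every element of \<open>F\<close> or its inverse lies in \<open>Q\<close> and is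
    thus a fraction of elements of the algebra, so the function field of the model is
    \<open>F\<close>.\<close>
  have loc0: "M.loc {\<zero>} = carrier F"
  proof
    show "M.loc {\<zero>} \<subseteq> carrier F" using M.loc_carrier[OF M.zero_prime] by blast
    show "carrier F \<subseteq> M.loc {\<zero>}"
    proof
      fix z assume z: "z \<in> carrier F"
      have fr: "\<exists>a s. a \<in> D' \<and> s \<in> D' \<and> s \<noteq> \<zero> \<and> y = a \<otimes> inv s" if y: "y \<in> Q" for y
        using frac[OF y] zn unfolding D'_def by blast
      show "z \<in> M.loc {\<zero>}"
      proof (cases "z \<in> Q")
        case True
        then obtain a s where as: "a \<in> D'" "s \<in> D'" "s \<noteq> \<zero>" "z = a \<otimes> inv s" using fr by blast
        then show ?thesis using M.locI[OF as(1,2), of "{\<zero>}"] by simp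
      next
        case False
        then have iz: "inv z \<in> Q" "z \<noteq> \<zero>" using valuation_subringD[OF Q z] nonunits_subset by blast+
        obtain a s where as: "a \<in> D'" "s \<in> D'" "s \<noteq> \<zero>" "inv z = a \<otimes> inv s" using fr[OF iz(1)] by blast
        have c: "a \<in> carrier F" "s \<in> carrier F" using as M.D_carrier by auto
        have "a \<noteq> \<zero>" using as(4) c as(3) z iz(2) inv_nonzero[OF z iz(2)] by auto
        have "z = inv (a \<otimes> inv s)" using as(4) z iz(2) inv_inv_field by metis
        then have "z = s \<otimes> inv a" using c as(3) \<open>a \<noteq> \<zero>\<close> by (simp add: inv_prod m_comm)
        then show ?thesis using M.locI[OF as(2,1), of "{\<zero>}"] \<open>a \<noteq> \<zero>\<close> by simp
      qed
    qed
  qed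
  have "regular_local_ring (stalk M.model x)"
    using reg[of "M.germ_of x" "stalk M.model x"] M.stalk_iso[OF xp] unfolding loc by blast
  moreover have "centered_at F (place_of Q) M.model {\<zero>} (inv_into (carrier F) (M.germ_of {\<zero>})) x"
    by (rule M.model_centered[OF loc0 xp loc Q place_of(2,3)[OF Q]])
  moreover have "finite_type_over (F\<lparr>carrier := K\<rparr>) M.model id"
    by (rule M.model_finite_type[OF KC H(2,1) D'_def])
  ultimately show "uniformizable F K (place_of Q)"
    unfolding uniformizable_def
    using M.model_integral M.model_separated[OF KD] M.model_function_field[OF loc0 KC] by blast
qed

end

section \<open>Density in the patch topology\<close>

context function_field
begin

text \<open>Patches see a place only through its valuation ring, so it is enough to construct a ring
  \<open>Q\<close> and to take \<open>place_of Q\<close>.\<close>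

lemma patch_iff:
  assumes "B \<subseteq> carrier F" "C \<subseteq> carrier F"
  shows "P \<in> patch F K B C \<longleftrightarrow> P \<in> zariski_space F K \<and>
    (\<forall>a\<in>B. a \<notin> nonunits (valuation_ring F P)) \<and> (\<forall>b\<in>C. b \<in> nonunits (valuation_ring F P))"
proof (cases "P \<in> zariski_space F K")
  case True
  then have "valuation_ideal F P = nonunits (valuation_ring F P)"
    using valuation_ring_subring(2)[of P] by (simp add: zariski_space_def)
  then have "residue P a = Some \<zero>\<^bsub>residue_field P\<^esub> \<longleftrightarrow> a \<in> nonunits (valuation_ring F P)" if "a \<in> carrier F" for a
    using that by (auto simp: valuation_ideal_def)
  then show ?thesis using True assms unfolding patch_def by blast
qed (simp add: patch_def)

lemma exists_minimal_value:
  assumes V: "valuation_subring V" and B: "finite B" "B \<noteq> {}" "B \<subseteq> carrier F - {\<zero>}"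
  shows "\<exists>c\<in>B. \<forall>b\<in>B. b \<otimes> inv c \<in> V"
  using B
proof (induction rule: finite_ne_induct)
  case (singleton x)
  then show ?case using subringE(3)[OF valuation_subring_subring[OF V]] by simp
next
  case (insert x B)
  note S = subringE[OF valuation_subring_subring[OF V]]
  obtain c where c: "c \<in> B" "\<And>b. b \<in> B \<Longrightarrow> b \<otimes> inv c \<in> V" using insert by blast
  have xc: "x \<in> carrier F" "x \<noteq> \<zero>" "c \<in> carrier F" "c \<noteq> \<zero>" using insert c(1) by auto
  show ?case
  proof (cases "x \<otimes> inv c \<in> V")
    case True
    then show ?thesis using c by (intro bexI[of _ c]) auto
  next
    case False
    then have "inv (x \<otimes> inv c) \<in> V" using valuation_subringD[OF V, of "x \<otimes> inv c"] xc nonunits_subset[of V] by auto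
    then have cx: "c \<otimes> inv x \<in> V" using xc by (simp add: inv_prod m_comm)
    have "b \<otimes> inv x \<in> V" if b: "b \<in> insert x B" for b
    proof (cases "b = x")
      case True
      then show ?thesis using S(3) xc by simp
    next
      case False
      then have b': "b \<in> B" "b \<in> carrier F" using b insert by auto
      have "(b \<otimes> inv c) \<otimes> (c \<otimes> inv x) = b \<otimes> inv x" using xc b' by (simp add: m_assoc)
      then show ?thesis using S(6)[OF c(2)[OF b'(1)] cx] by simp
    qed
    then show ?thesis by blast
  qed
qed

lemma nonunits_carrier: "nonunits (carrier F) = {\<zero>}"
  unfolding nonunits_def using inv_carrier zero_closed by blast

lemma trivial_place_uniformizable:
  "place_of (carrier F) \<in> zariski_space F K \<and> uniformizable F K (place_of (carrier F))"
proof -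
  obtain H where H: "H \<subseteq> carrier F" "finite H" "generate_field F (K \<union> H) = carrier F"
    using finitely_generated by blast
  have KH: "K \<union> H \<subseteq> carrier F" using subfieldE(3)[OF K] H(1) by blast
  define D where "D = generate_ring F (K \<union> H)"
  have D: "subring D F" unfolding D_def by (rule generate_ring_is_subring[OF KH])
  have sf: "subfield (fractions D) F" by (rule fractions_subfield[OF D])
  have "K \<union> H \<subseteq> fractions D"
    using subset_fractions[OF D] generate_ring.incl[of _ "K \<union> H" F] unfolding D_def by blast
  then have "carrier F \<subseteq> fractions D"
    using generate_field_min_subfield1[OF KH sf] H(3) by simp
  then have frac: "\<exists>a\<in>D. \<exists>s\<in>D. s \<notin> nonunits (carrier F) \<and> z = a \<otimes> inv s" if z: "z \<in> carrier F" for z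
    using z unfolding nonunits_carrier fractions_def by blast
  have reg: "regular_local_ring S"
    if h: "h \<in> ring_iso (F\<lparr>carrier := carrier F\<rparr>) S" "\<zero>\<^bsub>S\<^esub> = h \<zero>"
    for h and S :: "('a set set \<times> 'a) set ring"
  proof -
    have "h \<in> ring_iso F S" using h(1) by simp
    from ring_iso_transfer(3)[OF this h(2) field_axioms] show ?thesis by (rule field_regular_local_ring(1))
  qed
  have DC: "generate_ring F (K \<union> H) \<subseteq> carrier F" by (rule generate_ring_incl[OF KH])
  show ?thesis
    using uniformizable_place_of[OF H(2,1) carrier_valuation_subring DC frac[unfolded D_def] reg] by (rule conjI)
qed

text \<open>The first exponent \<open>n\<close> for which division by \<open>p [^] n\<close> leaves
  \<open>Q\<close> exceeds the value of \<open>a\<close> by one: the quotient by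
  \<open>p [^] (n - 1)\<close> is in \<open>Q\<close> but no longer divisible by \<open>p\<close>,
  hence a unit.\<close>

lemma discrete_valuation_decomposition:
  assumes Q: "valuation_subring Q" and p: "p \<in> nonunits Q" "p \<noteq> \<zero>"
    and min: "\<forall>x\<in>nonunits Q. x \<otimes> inv p \<in> Q" and fin: "\<forall>u\<in>Q. u \<noteq> \<zero> \<longrightarrow> (\<exists>n::nat. u \<otimes> inv (p [^] n) \<notin> Q)"
    and a: "a \<in> Q" "a \<noteq> \<zero>"
  shows "\<exists>u\<in>Q - nonunits Q. \<exists>n::nat. a = u \<otimes> p [^] n"
proof -
  have QC: "Q \<subseteq> carrier F" by (rule subringE(1)[OF valuation_subring_subring[OF Q]])
  have c: "p \<in> carrier F" "a \<in> carrier F" using p(1) a(1) QC nonunits_subset by auto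
  have "\<exists>n::nat. a \<otimes> inv (p [^] n) \<notin> Q" using fin a by blast
  then obtain n where n: "a \<otimes> inv (p [^] (n::nat)) \<notin> Q" "\<And>m::nat. m < n \<Longrightarrow> a \<otimes> inv (p [^] m) \<in> Q"
    using exists_least_iff[of "\<lambda>n::nat. a \<otimes> inv (p [^] n) \<notin> Q"] by blast
  have "n \<noteq> 0"
  proof
    assume "n = 0"
    then show False using n(1) a(1) c by simp
  qed
  then obtain m where m: "n = Suc m" by (cases n) auto
  define u where "u = a \<otimes> inv (p [^] m)"
  have pm: "p [^] m \<in> carrier F" "p [^] m \<noteq> \<zero>" using c p(2) by simp_all
  have uQ: "u \<in> Q" unfolding u_def by (rule n(2)) (simp add: m)
  have "u \<otimes> inv p = a \<otimes> inv (p [^] n)" using c p(2) pm by (simp add: u_def m inv_prod m_assoc)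
  then have "u \<notin> nonunits Q" using min n(1) by auto
  moreover have "a = u \<otimes> p [^] m" using c pm by (simp add: u_def m_assoc)
  ultimately show ?thesis using uQ by blast
qed

lemma patch_uniformizable:
  assumes B: "finite B" "B \<subseteq> carrier F - {\<zero>}" and C: "finite C" "C \<subseteq> carrier F - {\<zero>}" and P: "P \<in> patch F K B C"
  shows "\<exists>P'\<in>patch F K B C. uniformizable F K P'"
proof (cases "C = {}")
  case True
  have BC: "B \<subseteq> carrier F" "C \<subseteq> carrier F" using B C by auto
  have "place_of (carrier F) \<in> patch F K B C"
    unfolding patch_iff[OF BC] place_of(2)[OF carrier_valuation_subring] nonunits_carrier
    using trivial_place_uniformizable True B(2) by blast
  then show ?thesis using trivial_place_uniformizable by blast
next
  case False
  have BC: "B \<subseteq> carrier F" "C \<subseteq> carrier F" using B C by auto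
  define V where "V = valuation_ring F P"
  have P': "P \<in> zariski_space F K" "\<And>a. a \<in> B \<Longrightarrow> a \<notin> nonunits V" "\<And>b. b \<in> C \<Longrightarrow> b \<in> nonunits V"
    using P unfolding patch_iff[OF BC] V_def by auto
  have V: "valuation_subring V" using valuation_ring_subring(1)[of P] P'(1) by (simp add: zariski_space_def V_def)
  have KV: "K \<subseteq> V" using P'(1) by (simp add: zariski_space_def trivial_on_def V_def)
  obtain c where c: "c \<in> C" "\<And>b. b \<in> C \<Longrightarrow> b \<otimes> inv c \<in> V" using exists_minimal_value[OF V C(1) False C(2)] by blast
  have cc: "c \<in> carrier F" "c \<noteq> \<zero>" using c(1) C(2) by auto
  \<comment> \<open>If \<open>inv a\<close> lies in \<open>Q\<close>, then \<open>a\<close> is not a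
    nonunit of \<open>Q\<close>, whether or not it belongs to \<open>Q\<close>. Each
    \<open>b\<close> is the product of \<open>b / c\<close> with the nonunit \<open>c\<close>, hence
    a nonunit as soon as the quotient lies in \<open>Q\<close>.\<close>
  define S where "S = (\<lambda>a. inv a) ` B \<union> (\<lambda>b. b \<otimes> inv c) ` C"
  have S: "finite S" "S \<subseteq> V"
  proof -
    show "finite S" using B C by (simp add: S_def)
    have "inv a \<in> V" if a: "a \<in> B" for a
    proof (cases "a \<in> V")
      case True
      then show ?thesis using P'(2)[OF a] by (auto simp: nonunits_def)
    next
      case False
      then show ?thesis using valuation_subringD[OF V, of a] a BC nonunits_subset[of V] by blast
    qed
    then show "S \<subseteq> V" using c(2) by (auto simp: S_def)
  qed
  obtain E0 where E0: "E0 \<subseteq> carrier F" "finite E0" "generate_field F (K \<union> E0) = carrier F"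
    using finitely_generated by blast
  obtain H Q p where Q: "finite H" "H \<subseteq> carrier F" "valuation_subring Q" "generate_ring F (K \<union> H) \<subseteq> Q"
    "\<forall>z\<in>Q. \<exists>a\<in>generate_ring F (K \<union> H). \<exists>s\<in>generate_ring F (K \<union> H). s \<notin> nonunits Q \<and> z = a \<otimes> inv s"
    "S \<subseteq> Q" "c \<in> nonunits Q" "p \<in> nonunits Q" "p \<noteq> \<zero>" "\<forall>x\<in>nonunits Q. x \<otimes> inv p \<in> Q"
    "\<forall>u\<in>Q. u \<noteq> \<zero> \<longrightarrow> (\<exists>n::nat. u \<otimes> inv (p [^] n) \<notin> Q)"
    using exists_divisorial_valuation[OF K E0(2,1,3) V KV S P'(3)[OF c(1)] cc(2)] by (elim exE conjE)
  note SQ = valuation_subring_subring[OF Q(3)]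
  have reg: "regular_local_ring S'"
    if h: "h \<in> ring_iso (F\<lparr>carrier := Q\<rparr>) S'" "\<zero>\<^bsub>S'\<^esub> = h \<zero>" for h and S' :: "('a set set \<times> 'a) set ring"
  proof (rule ring_iso_discrete_valuation[OF subring_is_domain[OF SQ] _ _ _ _ h(1)])
    show "p \<in> carrier (F\<lparr>carrier := Q\<rparr>)" using Q(8) nonunits_subset by auto
    show "p \<noteq> \<zero>\<^bsub>F\<lparr>carrier := Q\<rparr>\<^esub>" using Q(9) by simp
    show "p \<notin> Units (F\<lparr>carrier := Q\<rparr>)" using Q(8) by (simp add: valuation_subring_Units[OF Q(3)])
    show "\<zero>\<^bsub>S'\<^esub> = h \<zero>\<^bsub>F\<lparr>carrier := Q\<rparr>\<^esub>" using h(2) by simp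
    fix a assume "a \<in> carrier (F\<lparr>carrier := Q\<rparr>)" "a \<noteq> \<zero>\<^bsub>F\<lparr>carrier := Q\<rparr>\<^esub>"
    then have "\<exists>u\<in>Q - nonunits Q. \<exists>n::nat. a = u \<otimes> p [^] n"
      using discrete_valuation_decomposition[OF Q(3,8,9,10,11), of a] by simp
    then show "\<exists>u\<in>Units (F\<lparr>carrier := Q\<rparr>). \<exists>n::nat. a = u \<otimes>\<^bsub>F\<lparr>carrier := Q\<rparr>\<^esub> p [^]\<^bsub>F\<lparr>carrier := Q\<rparr>\<^esub> n"
      unfolding valuation_subring_Units[OF Q(3)] nat_pow_consistent[of p _ Q] by simp
  qed
  have frac: "\<exists>a\<in>generate_ring F (K \<union> H). \<exists>s\<in>generate_ring F (K \<union> H). s \<notin> nonunits Q \<and> z = a \<otimes> inv s" if "z \<in> Q" for z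
    using Q(5) that by blast
  have U: "place_of Q \<in> zariski_space F K \<and> uniformizable F K (place_of Q)"
    using uniformizable_place_of[OF Q(1-4) frac reg] by (rule conjI)
  have "a \<notin> nonunits Q" if a: "a \<in> B" for a
  proof -
    have "inv a \<in> Q" "a \<noteq> \<zero>" using Q(6) a B(2) by (auto simp: S_def)
    then show ?thesis by (simp add: nonunits_def)
  qed
  moreover have "b \<in> nonunits Q" if b: "b \<in> C" for b
  proof -
    have "b \<otimes> inv c \<in> Q" using Q(6) b by (auto simp: S_def)
    then have "b \<otimes> inv c \<otimes> c \<in> nonunits Q" by (rule nonunits_smult[OF SQ _ Q(7)])
    then show ?thesis using b BC(2) cc by (simp add: m_assoc subset_iff)
  qed
  ultimately have "place_of Q \<in> patch F K B C"
    unfolding patch_iff[OF BC] place_of(2)[OF Q(3)] using U by blast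
  then show ?thesis using U by blast
qed

text \<open>Uniting the conditions of two basic patches gives their intersection, so the generating
  family is a base of the topology.\<close>

lemma patch_topology_base:
  assumes "openin (patch_topology F K) T" "P \<in> T"
  shows "\<exists>B C. finite B \<and> finite C \<and> B \<subseteq> carrier F - {\<zero>} \<and> C \<subseteq> carrier F - {\<zero>} \<and> P \<in> patch F K B C \<and> patch F K B C \<subseteq> T"
proof -
  have "generate_topology_on {patch F K A B | A B. finite A \<and> finite B \<and> A \<subseteq> carrier F - {\<zero>} \<and> B \<subseteq> carrier F - {\<zero>}} T"
    using assms(1) by (simp add: patch_topology_def openin_topology_generated_by_iff)
  then show ?thesis using assms(2)
  proof induction
    case (Int T T')
    obtain B C where 1: "finite B" "finite C" "B \<subseteq> carrier F - {\<zero>}" "C \<subseteq> carrier F - {\<zero>}" "P \<in> patch F K B C" "patch F K B C \<subseteq> T"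
      using Int by blast
    obtain B' C' where 2: "finite B'" "finite C'" "B' \<subseteq> carrier F - {\<zero>}" "C' \<subseteq> carrier F - {\<zero>}" "P \<in> patch F K B' C'" "patch F K B' C' \<subseteq> T'"
      using Int by blast
    have eq: "patch F K (B \<union> B') (C \<union> C') = patch F K B C \<inter> patch F K B' C'" by (auto simp: patch_def)
    show ?case by (rule exI[of _ "B \<union> B'"], rule exI[of _ "C \<union> C'"]) (unfold eq, use 1 2 in blast)
  next
    case (UN \<U>)
    then obtain T where T: "T \<in> \<U>" "P \<in> T" by blast
    then have "\<exists>B C. finite B \<and> finite C \<and> B \<subseteq> carrier F - {\<zero>} \<and> C \<subseteq> carrier F - {\<zero>} \<and> P \<in> patch F K B C \<and> patch F K B C \<subseteq> T"
      by (rule UN.IH)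
    then show ?case using T(1) by (meson Union_upper subset_trans)
  next
    case (Basis s)
    then show ?case by blast
  qed simp
qed

lemma uniformizable_dense:
  "patch_topology F K closure_of {P \<in> zariski_space F K. uniformizable F K P} = zariski_space F K"
proof -
  have "\<exists>P'. P' \<in> {P \<in> zariski_space F K. uniformizable F K P} \<and> P' \<in> T"
    if T: "openin (patch_topology F K) T" "P \<in> T" for P T
  proof -
    obtain B C where BC: "finite B" "finite C" "B \<subseteq> carrier F - {\<zero>}" "C \<subseteq> carrier F - {\<zero>}" "P \<in> patch F K B C" "patch F K B C \<subseteq> T"
      using patch_topology_base[OF T] by (elim exE conjE)
    obtain P' where "P' \<in> patch F K B C" "uniformizable F K P'" using patch_uniformizable[OF BC(1,3,2,4,5)] by blast
    then show ?thesis using BC(6) by (auto simp: patch_def)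
  qed
  then show ?thesis unfolding closure_of_def topspace_patch_topology by blast
qed

end

theorem corollary1p3:
  fixes F :: "'a ring" and K :: "'a set"
  assumes "perfect_field (F\<lparr>carrier := K\<rparr>)"
    and "algebraic_function_field F K"
  shows "patch_topology F K closure_of {P \<in> zariski_space F K. uniformizable F K P} =
         zariski_space F K"
proof -
  interpret function_field F K
    using assms(2) unfolding algebraic_function_field_def
    by (intro function_field.intro function_field_axioms.intro) auto
  show ?thesis by (rule uniformizable_dense)
qed

end
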